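(* Let $n\geq3$ and let $\mathscr{F}$ be an $\mathscr{L}$-foliation (of codimension one) on $\mathbf{C}\mathbf{P}(n)$ having an isolated singular point. Then $\mathscr{F}$ has degree $1$, and there is an affine chart $\mathbf{C}^n\subset\mathbf{C}\mathbf{P}(n)$ such that $\mathscr{F}|_{\mathbf{C}^n}$ is associated with a quadratic form of maximal rank (i.e. it is defined by $dq$ with $q$ a quadratic form of rank $n$ on $\mathbf{C}^n$).
   Context: A codimension one foliation $\mathscr{F}$ of degree $\nu$ on $\mathbf{C}\mathbf{P}(n)$ is given in homogeneous coordinates by a $1$-form $\omega=\sum_{k=0}^nA_kdz_k$ on $\mathbf{C}^{n+1}$, with $A_k$ homogeneous polynomials of degree $\nu+1$, $\omega\wedge d\omega=0$, $\sum z_kA_k=0$, and $\{A_0=\dots=A_n=0\}$ of codimension $\geq2$; its singular set is the image in $\mathbf{C}\mathbf{P}(n)$ of $\{A_0=\dots=A_n=0\}\setminus\{0\}$. An isolated singular point is an isolated point of this singular set. Let $\chi(\mathbf{C}\mathbf{P}(n))$ be the Lie algebra of holomorphic vector fields on $\mathbf{C}\mathbf{P}(n)$. $\mathscr{F}$ is an $\mathscr{L}$-foliation if there is a Lie subalgebra $\mathscr{L}\subset\chi(\mathbf{C}\mathbf{P}(n))$ such that, for generic $z$, $\mathscr{L}(z)=\{X(z):X\in\mathscr{L}\}$ is the tangent space at $z$ to the leaf of $\mathscr{F}$ (so it has dimension $n-1$). *)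

theory Defs
  imports "HOL-Analysis.Analysis" "HOL-Library.Extended_Nat"
begin

section \<open>Polynomials and the Zariski topology on affine space\<close>

definition poly_fun :: "(complex ^ 'a::finite \<Rightarrow> complex) \<Rightarrow> bool" where
  "poly_fun p \<longleftrightarrow> (\<exists>S c. finite S \<and>
     p = (\<lambda>z. \<Sum>\<alpha>\<in>S. c (\<alpha> :: 'a \<Rightarrow> nat) * (\<Prod>i\<in>UNIV. z $ i ^ \<alpha> i)))"

definition homog_poly_fun :: "nat \<Rightarrow> (complex ^ 'a::finite \<Rightarrow> complex) \<Rightarrow> bool" where
  "homog_poly_fun d p \<longleftrightarrow> (\<exists>c.
     p = (\<lambda>z. \<Sum>\<alpha>\<in>{\<alpha> :: 'a \<Rightarrow> nat. (\<Sum>i\<in>UNIV. \<alpha> i) = d}. c \<alpha> * (\<Prod>i\<in>UNIV. z $ i ^ \<alpha> i)))"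

definition zariski_closed :: "(complex ^ 'a::finite) set \<Rightarrow> bool" where
  "zariski_closed Z \<longleftrightarrow> (\<exists>P. (\<forall>p\<in>P. poly_fun p) \<and> Z = {z. \<forall>p\<in>P. p z = 0})"

definition irreducible_closed :: "(complex ^ 'a::finite) set \<Rightarrow> bool" where
  "irreducible_closed Y \<longleftrightarrow> zariski_closed Y \<and> Y \<noteq> {} \<and>
     (\<forall>Y1 Y2. zariski_closed Y1 \<and> zariski_closed Y2 \<and> Y \<subseteq> Y1 \<union> Y2 \<longrightarrow> Y \<subseteq> Y1 \<or> Y \<subseteq> Y2)"

text \<open>Codimension in affine space: the infimum, over the irreducible closed subsets \<open>Y\<close> of \<open>Z\<close>,
  of the supremum of the lengths of chains of irreducible closed sets starting at \<open>Y\<close>.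
  The empty set has codimension \<open>\<infinity>\<close>.\<close>

definition codimension :: "(complex ^ 'a::finite) set \<Rightarrow> enat" where
  "codimension Z = (INF Y\<in>{Y. irreducible_closed Y \<and> Y \<subseteq> Z}.
     SUP k\<in>{k. \<exists>C. C 0 = Y \<and> (\<forall>i\<le>k. irreducible_closed (C i)) \<and> (\<forall>i<k. C i \<subset> C (Suc i))}. enat k)"

section \<open>Complex derivatives and holomorphy\<close>

definition dir_deriv :: "(complex ^ 'a::finite \<Rightarrow> complex) \<Rightarrow> complex ^ 'a \<Rightarrow> complex ^ 'a \<Rightarrow> complex" where
  "dir_deriv f z v = deriv (\<lambda>t. f (z + t *s v)) 0"

text \<open>Below, \<open>S\<close> is either an open set or the relatively open affine hyperplane \<open>{w. w $ i = 1}\<close>;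
  in the latter case only the restriction of \<open>D\<close> to the direction of the hyperplane is determined,
  and this is the complex derivative of \<open>f\<close> on the hyperplane.\<close>

definition holo_on :: "(complex ^ 'a::finite) set \<Rightarrow> (complex ^ 'a \<Rightarrow> complex) \<Rightarrow> bool" where
  "holo_on S f \<longleftrightarrow> (\<forall>w\<in>S. \<exists>D. (f has_derivative D) (at w within S) \<and> (\<forall>c v. D (c *s v) = c * D v))"

section \<open>Complex projective space\<close>

text \<open>Points are complex lines through the origin; the topology is the quotient topology.
  With index type \<open>'a\<close> the dimension is \<open>CARD('a) - 1\<close>.\<close>

definition hline :: "complex ^ 'a::finite \<Rightarrow> (complex ^ 'a) set" where
  "hline z = range (\<lambda>c. c *s z)"

definition CP :: "(complex ^ 'a::finite) set set" where
  "CP = hline ` (- {0})"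

definition CP_topology :: "(complex ^ 'a::finite) set topology" where
  "CP_topology = topology (\<lambda>U. U \<subseteq> CP \<and> open {z. z \<noteq> 0 \<and> hline z \<in> U})"

lemma openin_CP_topology:
  "openin CP_topology U \<longleftrightarrow> U \<subseteq> CP \<and> open {z. z \<noteq> 0 \<and> hline z \<in> U}"
proof -
  have "istopology (\<lambda>U. U \<subseteq> (CP :: (complex ^ 'a) set set) \<and> open {z. z \<noteq> 0 \<and> hline z \<in> U})"
    unfolding istopology_def
  proof (intro conjI allI impI)
    fix S T :: "(complex ^ 'a) set set"
    assume S: "S \<subseteq> CP \<and> open {z. z \<noteq> 0 \<and> hline z \<in> S}"
      and T: "T \<subseteq> CP \<and> open {z. z \<noteq> 0 \<and> hline z \<in> T}"
    show "S \<inter> T \<subseteq> CP" using S by blast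
    have "{z. z \<noteq> 0 \<and> hline z \<in> S \<inter> T} = {z. z \<noteq> 0 \<and> hline z \<in> S} \<inter> {z. z \<noteq> 0 \<and> hline z \<in> T}"
      by blast
    then show "open {z. z \<noteq> 0 \<and> hline z \<in> S \<inter> T}" using S T by (simp only: open_Int)
  next
    fix K :: "(complex ^ 'a) set set set"
    assume K: "\<forall>U\<in>K. U \<subseteq> CP \<and> open {z. z \<noteq> 0 \<and> hline z \<in> U}"
    show "\<Union>K \<subseteq> CP" using K by blast
    have "{z. z \<noteq> 0 \<and> hline z \<in> \<Union>K} = (\<Union>U\<in>K. {z. z \<noteq> 0 \<and> hline z \<in> U})" by blast
    then show "open {z. z \<noteq> 0 \<and> hline z \<in> \<Union>K}" using K by (simp only:) (rule open_UN, blast)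
  qed
  then show ?thesis by (simp add: CP_topology_def)
qed

definition CP_zariski_closed :: "(complex ^ 'a::finite) set set \<Rightarrow> bool" where
  "CP_zariski_closed S \<longleftrightarrow> (\<exists>P. (\<forall>p\<in>P. \<exists>d. homog_poly_fun d p) \<and>
     S = {l\<in>CP. \<forall>p\<in>P. \<forall>z\<in>l. p z = 0})"

text \<open>A property holds at the generic point if it holds off a proper Zariski closed subset.\<close>

definition generic_CP :: "((complex ^ 'a::finite) set \<Rightarrow> bool) \<Rightarrow> bool" where
  "generic_CP Q \<longleftrightarrow> (\<exists>S. CP_zariski_closed S \<and> S \<noteq> CP \<and> (\<forall>l\<in>CP - S. Q l))"

text \<open>The standard chart with number \<open>i\<close> identifies the set of lines not contained in
  \<open>{z. z $ i = 0}\<close> with the affine hyperplane \<open>slice i\<close>, by taking the homogeneous coordinates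
  \<open>w\<close> normalised by \<open>w $ i = 1\<close>.  Its tangent space at every point is \<open>{v. v $ i = 0}\<close>.\<close>

definition slice :: "'a::finite \<Rightarrow> (complex ^ 'a) set" where
  "slice i = {w. w $ i = 1}"

section \<open>Holomorphic vector fields on complex projective space\<close>

text \<open>A holomorphic vector field is given by its expressions \<open>V i\<close> in the standard charts.
  The last condition is compatibility under the coordinate change \<open>w \<mapsto> w / w $ j\<close> from
  \<open>slice i\<close> to \<open>slice j\<close>, whose differential is \<open>v \<mapsto> v / w $ j - (v $ j / (w $ j)\<^sup>2) w\<close>.
  Outside of \<open>slice i\<close> the function \<open>V i\<close> is normalised to \<open>0\<close>.\<close>

type_synonym 'a vfield = "'a \<Rightarrow> complex ^ 'a \<Rightarrow> complex ^ 'a"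

definition holo_vfield :: "'a::finite vfield \<Rightarrow> bool" where
  "holo_vfield V \<longleftrightarrow>
     (\<forall>i w. w \<notin> slice i \<longrightarrow> V i w = 0) \<and>
     (\<forall>i. \<forall>w\<in>slice i. V i w $ i = 0) \<and>
     (\<forall>i k. holo_on (slice i) (\<lambda>w. V i w $ k)) \<and>
     (\<forall>i j. \<forall>w\<in>slice i. w $ j \<noteq> 0 \<longrightarrow>
        V j (inverse (w $ j) *s w) = inverse (w $ j) *s V i w - (V i w $ j / (w $ j)\<^sup>2) *s w)"

definition vf_bracket :: "'a::finite vfield \<Rightarrow> 'a vfield \<Rightarrow> 'a vfield" where
  "vf_bracket X Y = (\<lambda>i w. if w \<in> slice i
     then (\<chi> k. dir_deriv (\<lambda>u. Y i u $ k) w (X i w) - dir_deriv (\<lambda>u. X i u $ k) w (Y i w))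
     else 0)"

definition lie_subalgebra :: "'a::finite vfield set \<Rightarrow> bool" where
  "lie_subalgebra L \<longleftrightarrow> L \<subseteq> {V. holo_vfield V} \<and>
     (\<lambda>i w. 0) \<in> L \<and>
     (\<forall>X\<in>L. \<forall>Y\<in>L. (\<lambda>i w. X i w + Y i w) \<in> L) \<and>
     (\<forall>c. \<forall>X\<in>L. (\<lambda>i w. c *s X i w) \<in> L) \<and>
     (\<forall>X\<in>L. \<forall>Y\<in>L. vf_bracket X Y \<in> L)"

section \<open>Codimension one foliations\<close>

text \<open>A function \<open>A\<close> stands for the 1-form \<open>\<omega> = \<Sum>k. A\<^sub>k dz\<^sub>k\<close>.\<close>

definition one_form :: "(complex ^ 'a::finite \<Rightarrow> complex ^ 'a) \<Rightarrow> complex ^ 'a \<Rightarrow> complex ^ 'a \<Rightarrow> complex" where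
  "one_form A z v = (\<Sum>k\<in>UNIV. A z $ k * v $ k)"

definition ext_deriv :: "(complex ^ 'a::finite \<Rightarrow> complex ^ 'a) \<Rightarrow>
    complex ^ 'a \<Rightarrow> complex ^ 'a \<Rightarrow> complex ^ 'a \<Rightarrow> complex" where
  "ext_deriv A z u v = dir_deriv (\<lambda>x. one_form A x v) z u - dir_deriv (\<lambda>x. one_form A x u) z v"

text \<open>The displayed expression is \<open>(\<omega> \<and> d\<omega>)(u, v, w)\<close>.\<close>

definition integrable_form :: "(complex ^ 'a::finite \<Rightarrow> complex ^ 'a) \<Rightarrow> bool" where
  "integrable_form A \<longleftrightarrow> (\<forall>z u v w.
     one_form A z u * ext_deriv A z v w + one_form A z v * ext_deriv A z w u
       + one_form A z w * ext_deriv A z u v = 0)"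

definition foliation :: "nat \<Rightarrow> (complex ^ 'a::finite \<Rightarrow> complex ^ 'a) \<Rightarrow> bool" where
  "foliation \<nu> A \<longleftrightarrow>
     (\<forall>k. homog_poly_fun (\<nu> + 1) (\<lambda>z. A z $ k)) \<and>
     integrable_form A \<and>
     (\<forall>z. (\<Sum>k\<in>UNIV. z $ k * A z $ k) = 0) \<and>
     codimension {z. A z = 0} \<ge> 2"

definition singular_set :: "(complex ^ 'a::finite \<Rightarrow> complex ^ 'a) \<Rightarrow> (complex ^ 'a) set set" where
  "singular_set A = hline ` ({z. A z = 0} - {0})"

definition isolated_singular_point ::
    "(complex ^ 'a::finite \<Rightarrow> complex ^ 'a) \<Rightarrow> (complex ^ 'a) set \<Rightarrow> bool" where
  "isolated_singular_point A p \<longleftrightarrow>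
     p \<in> singular_set A \<and> p \<notin> CP_topology derived_set_of singular_set A"

text \<open>At a regular point, the tangent space of the leaf is the kernel of \<open>\<omega>\<close>, here written in the
  chart \<open>slice i\<close>.\<close>

definition leaf_tangent :: "(complex ^ 'a::finite \<Rightarrow> complex ^ 'a) \<Rightarrow> 'a \<Rightarrow> complex ^ 'a \<Rightarrow> (complex ^ 'a) set" where
  "leaf_tangent A i w = {v. v $ i = 0 \<and> one_form A w v = 0}"

definition L_foliation :: "(complex ^ 'a::finite \<Rightarrow> complex ^ 'a) \<Rightarrow> bool" where
  "L_foliation A \<longleftrightarrow> (\<exists>L. lie_subalgebra L \<and>
     generic_CP (\<lambda>l. l \<notin> singular_set A \<and>
       (\<forall>i. \<forall>w\<in>l \<inter> slice i. (\<lambda>X. X i w) ` L = leaf_tangent A i w)))"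

section \<open>Affine charts and quadratic forms\<close>

text \<open>The homogeneous coordinates on projective \<open>n\<close>-space are indexed by \<open>'n option\<close> with
  \<open>CARD('n) = n\<close>.  An affine chart is \<open>x \<mapsto> [g (1, x)]\<close> with \<open>g\<close> an invertible matrix;
  \<open>hcons c x\<close> is the vector \<open>(c, x)\<close>.\<close>

definition hcons :: "complex \<Rightarrow> complex ^ 'n::finite \<Rightarrow> complex ^ ('n option)" where
  "hcons c x = (\<chi> j. case j of None \<Rightarrow> c | Some k \<Rightarrow> x $ k)"

text \<open>The pull-back of the form by \<open>x \<mapsto> g (1, x)\<close>, whose differential is \<open>u \<mapsto> g (0, u)\<close>.\<close>

definition chart_form :: "complex ^ ('n option) ^ ('n option) \<Rightarrow>
    (complex ^ ('n option) \<Rightarrow> complex ^ ('n option)) \<Rightarrow> complex ^ 'n::finite \<Rightarrow> complex ^ 'n \<Rightarrow> complex" where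
  "chart_form g A x u = one_form A (g *v hcons 1 x) (g *v hcons 0 u)"

definition quad_form :: "complex ^ 'n ^ 'n \<Rightarrow> complex ^ 'n::finite \<Rightarrow> complex" where
  "quad_form Q x = (\<Sum>i\<in>UNIV. \<Sum>j\<in>UNIV. Q $ i $ j * x $ i * x $ j)"

text \<open>A 1-form defines the same foliation as \<open>dq\<close> if it is the product of \<open>dq\<close> with a nowhere
  vanishing holomorphic function.\<close>

definition chart_defined_by_d :: "complex ^ ('n option) ^ ('n option) \<Rightarrow>
    (complex ^ ('n option) \<Rightarrow> complex ^ ('n option)) \<Rightarrow> (complex ^ 'n::finite \<Rightarrow> complex) \<Rightarrow> bool" where
  "chart_defined_by_d g A q \<longleftrightarrow> (\<exists>h. holo_on UNIV h \<and> (\<forall>x. h x \<noteq> 0) \<and>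
     (\<forall>x u. chart_form g A x u = h x * dir_deriv q x u))"

end

theory Submission
  imports Defs "HOL-Complex_Analysis.Conformal_Mappings" "HOL-Library.Function_Algebras"
begin

text \<open>Let \<open>p\<close> be the isolated singular point and move it to the origin of an affine chart, where the foliation is given
by a polynomial form \<open>a = \<Sum>k. a\<^sub>k dx\<^sub>k\<close> whose coefficients have an isolated common zero.  Everything
rests on one local fact (\<open>isolated_zero_syzygy\<close>): if a polynomial vector field \<open>X\<close> satisfies \<open>a \<cdot> X = 0\<close>,
then \<open>X\<close> vanishes at the origin and the kernel of the linear part of \<open>a\<close> is annihilated by the linear part of
\<open>X\<close>.  Algebraically this holds because \<open>n\<close> functions with an isolated common zero in dimension \<open>n\<close>
have only the trivial (Koszul) relations.  The proof below avoids commutative algebra by pairing with the Grothendieck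
residue, computed as a limit of averages over roots of unity; the non-emptiness of spectra in seminormed
algebras (\<open>spectrum_nonempty\<close>) supplies, on each face of a polydisc, a polynomial combination of the \<open>a\<^sub>k\<close> without
zeros.

Holomorphic vector fields on projective space are linear (\<open>chart_field.linear\<close>), so in the chart the fields of
the Lie algebra are \<open>S x - (l \<cdot> x) x\<close>: the constant term vanishes by the local fact.  Write \<open>H\<close> for the
linear part of \<open>a\<close>.  The local fact, applied to the field formed from the coefficients of the exterior
derivative, shows that \<open>H\<close> is symmetric; it also gives \<open>S v = 0\<close> for all \<open>v\<close> in the kernel of
\<open>H\<close>.  If this kernel were not trivial, the lowest order term \<open>\<beta>\<close> of \<open>a\<close> along a kernel line
would be annihilated by the transposes of all \<open>S\<close>, and a Lie algebra computation (\<open>structure_identity\<close>) would force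
\<open>a\<close> to be a multiple of \<open>\<beta>\<close> on the hyperplane \<open>\<beta> = 0\<close>; but one function on a space of
dimension at least two has no isolated zeros.  So \<open>H\<close> is invertible (\<open>H_injective\<close>).

Next, comparing terms of third order shows that all the \<open>l\<close> are of the form \<open>l = c S\<close> with one covector
\<open>c\<close> (\<open>common_centre\<close>).  Hence the hyperplane \<open>c \<cdot> x = 1\<close> is invariant, and taking it as the
hyperplane at infinity turns all fields into linear fields preserving the quadratic form of \<open>H\<close>.  Consequently the
homogeneous form is a polynomial multiple \<open>\<psi>\<close> of the one defined by that quadratic form.  The zeros of
\<open>\<psi>\<close> are singular, and since the singular set has codimension at least two while a hypersurface has codimension
one (\<open>codimension_hypersurface\<close>), \<open>\<psi>\<close> is a constant.  This gives the degree and the normal form.\<close>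

section \<open>Polynomial functions\<close>

definition cdot :: "complex ^ 'a::finite \<Rightarrow> complex ^ 'a \<Rightarrow> complex" where
  "cdot u v = (\<Sum>k\<in>UNIV. u $ k * v $ k)"

lemma cdot_add_left: "cdot (u + v) w = cdot u w + cdot v w"
  and cdot_add_right: "cdot u (v + w) = cdot u v + cdot u w"
  and cdot_diff_left: "cdot (u - v) w = cdot u w - cdot v w"
  and cdot_diff_right: "cdot u (v - w) = cdot u v - cdot u w"
  and cdot_scale_left: "cdot (c *s u) w = c * cdot u w"
  and cdot_scale_right: "cdot u (c *s w) = c * cdot u w"
  and cdot_zero_left [simp]: "cdot 0 w = 0"
  and cdot_zero_right [simp]: "cdot u 0 = 0"
  and cdot_minus_right: "cdot u (- w) = - cdot u w"
  by (simp_all add: cdot_def algebra_simps sum.distrib sum_subtractf sum_distrib_left sum_negf)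

lemma cdot_commute: "cdot u v = cdot v u"
  by (simp add: cdot_def mult.commute)

lemma cdot_axis_right [simp]: "cdot u (axis k c) = u $ k * c"
  by (simp add: cdot_def axis_def if_distrib cong: if_cong)

lemma cdot_axis_left [simp]: "cdot (axis k c) u = c * u $ k"
  by (simp add: cdot_def axis_def if_distrib if_distribR cong: if_cong)

lemma cdot_eqI: "(\<And>w. cdot u w = cdot v w) \<Longrightarrow> u = v"
  by (metis cdot_axis_right mult.right_neutral vec_eq_iff)

lemma cdot_matrix: "cdot u (M *v w) = cdot (transpose M *v u) w"
proof -
  have "cdot u (M *v w) = (\<Sum>i\<in>UNIV. \<Sum>j\<in>UNIV. u $ i * (M $ i $ j * w $ j))"
    by (simp add: cdot_def matrix_vector_mult_def sum_distrib_left)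
  also have "\<dots> = (\<Sum>j\<in>UNIV. \<Sum>i\<in>UNIV. u $ i * (M $ i $ j * w $ j))" by (rule sum.swap)
  also have "\<dots> = (\<Sum>j\<in>UNIV. (\<Sum>i\<in>UNIV. M $ i $ j * u $ i) * w $ j)"
  proof (rule sum.cong[OF refl])
    fix j
    have "u $ i * (M $ i $ j * w $ j) = M $ i $ j * u $ i * w $ j" for i by simp
    then show "(\<Sum>i\<in>UNIV. u $ i * (M $ i $ j * w $ j)) = (\<Sum>i\<in>UNIV. M $ i $ j * u $ i) * w $ j"
      by (simp only: sum_distrib_right)
  qed
  also have "\<dots> = cdot (transpose M *v u) w"
    by (simp add: cdot_def matrix_vector_mult_def transpose_def)
  finally show ?thesis .
qed

lemma one_form_eq_cdot: "one_form A z v = cdot (A z) v"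
  by (simp add: one_form_def cdot_def)

lemma poly_fun_sum_mono:
  assumes "finite S" shows "poly_fun (\<lambda>z. \<Sum>\<alpha>\<in>S. c (\<alpha> :: 'a::finite \<Rightarrow> nat) * (\<Prod>i\<in>UNIV. z $ i ^ \<alpha> i))"
  unfolding poly_fun_def using assms by blast

lemma poly_fun_const [simp, intro]: "poly_fun (\<lambda>z :: complex ^ 'a::finite. c)"
  using poly_fun_sum_mono[of "{\<lambda>_. 0}" "\<lambda>_. c"] by simp

lemma poly_fun_coord [simp, intro]: "poly_fun (\<lambda>z :: complex ^ 'a::finite. z $ k)"
proof -
  have "(\<Prod>i\<in>UNIV. z $ i ^ (if i = k then 1 else 0)) = z $ k" for z :: "complex ^ 'a"
  proof -
    have "(\<Prod>i\<in>UNIV. z $ i ^ (if i = k then 1 else 0)) = (\<Prod>i\<in>UNIV. if i = k then z $ i else 1)"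
      by (intro prod.cong) auto
    then show ?thesis by simp
  qed
  then show ?thesis using poly_fun_sum_mono[of "{\<lambda>i. if i = k then 1 else 0}" "\<lambda>_. 1"] by simp
qed

lemma poly_fun_add [simp, intro]:
  assumes "poly_fun p" "poly_fun q" shows "poly_fun (\<lambda>z. p z + q z)"
proof -
  from assms obtain S c T d where S: "finite S" "p = (\<lambda>z. \<Sum>\<alpha>\<in>S. c (\<alpha> :: 'a \<Rightarrow> nat) * (\<Prod>i\<in>UNIV. z $ i ^ \<alpha> i))"
    and T: "finite T" "q = (\<lambda>z. \<Sum>\<alpha>\<in>T. d (\<alpha> :: 'a \<Rightarrow> nat) * (\<Prod>i\<in>UNIV. z $ i ^ \<alpha> i))"
    unfolding poly_fun_def by blast
  have 1: "p z = (\<Sum>\<alpha>\<in>S\<union>T. (if \<alpha> \<in> S then c \<alpha> else 0) * (\<Prod>i\<in>UNIV. z $ i ^ \<alpha> i))" for z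
    unfolding S(2) using S T by (intro sum.mono_neutral_cong_left) auto
  have 2: "q z = (\<Sum>\<alpha>\<in>S\<union>T. (if \<alpha> \<in> T then d \<alpha> else 0) * (\<Prod>i\<in>UNIV. z $ i ^ \<alpha> i))" for z
    unfolding T(2) using S T by (intro sum.mono_neutral_cong_left) auto
  have "(\<lambda>z. p z + q z) = (\<lambda>z. \<Sum>\<alpha>\<in>S\<union>T. ((if \<alpha> \<in> S then c \<alpha> else 0) + (if \<alpha> \<in> T then d \<alpha> else 0)) * (\<Prod>i\<in>UNIV. z $ i ^ \<alpha> i))"
    by (rule ext) (simp only: 1 2 sum.distrib ring_distribs)
  then show ?thesis using poly_fun_sum_mono[of "S \<union> T"] S T by simp
qed

lemma poly_fun_sum [simp, intro]:
  "(\<And>i. i \<in> I \<Longrightarrow> poly_fun (p i)) \<Longrightarrow> poly_fun (\<lambda>z. \<Sum>i\<in>I. p i z)"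
  by (induction I rule: infinite_finite_induct) auto

lemma poly_fun_mono_mult:
  fixes \<alpha> :: "'a::finite \<Rightarrow> nat"
  assumes "poly_fun p" shows "poly_fun (\<lambda>z. c * (\<Prod>i\<in>UNIV. z $ i ^ \<alpha> i) * p z)"
proof -
  from assms obtain S d where S: "finite S" "p = (\<lambda>z. \<Sum>\<beta>\<in>S. d (\<beta> :: 'a \<Rightarrow> nat) * (\<Prod>i\<in>UNIV. z $ i ^ \<beta> i))"
    unfolding poly_fun_def by blast
  have "poly_fun (\<lambda>z. c * (\<Prod>i\<in>UNIV. z $ i ^ \<alpha> i) * (d \<beta> * (\<Prod>i\<in>UNIV. z $ i ^ \<beta> i)))" for \<beta>
  proof -
    have "(\<lambda>z. c * (\<Prod>i\<in>UNIV. z $ i ^ \<alpha> i) * (d \<beta> * (\<Prod>i\<in>UNIV. z $ i ^ \<beta> i)))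
        = (\<lambda>z. \<Sum>\<gamma>\<in>{\<lambda>i. \<alpha> i + \<beta> i}. (c * d \<beta>) * (\<Prod>i\<in>UNIV. z $ i ^ \<gamma> i))"
      by (simp add: power_add prod.distrib mult_ac)
    then show ?thesis using poly_fun_sum_mono[of "{\<lambda>i. \<alpha> i + \<beta> i}"] by simp
  qed
  then show ?thesis unfolding S(2) sum_distrib_left by (intro poly_fun_sum)
qed

lemma poly_fun_mult [simp, intro]:
  assumes "poly_fun p" "poly_fun q" shows "poly_fun (\<lambda>z. p z * q z)"
proof -
  from assms(1) obtain S c where S: "finite S" "p = (\<lambda>z. \<Sum>\<alpha>\<in>S. c (\<alpha> :: 'a \<Rightarrow> nat) * (\<Prod>i\<in>UNIV. z $ i ^ \<alpha> i))"
    unfolding poly_fun_def by blast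
  show ?thesis unfolding S(2) sum_distrib_right
    by (intro poly_fun_sum poly_fun_mono_mult assms)
qed

lemma poly_fun_uminus [simp, intro]: "poly_fun p \<Longrightarrow> poly_fun (\<lambda>z. - p z)"
  using poly_fun_mult[of "\<lambda>_. -1" p] by simp

lemma poly_fun_diff [simp, intro]: "poly_fun p \<Longrightarrow> poly_fun q \<Longrightarrow> poly_fun (\<lambda>z. p z - q z)"
  using poly_fun_add[of p "\<lambda>z. - q z"] by simp

lemma poly_fun_power [simp, intro]: "poly_fun p \<Longrightarrow> poly_fun (\<lambda>z. p z ^ k)"
  by (induction k) auto

lemma poly_fun_prod [simp, intro]:
  "(\<And>i. i \<in> I \<Longrightarrow> poly_fun (p i)) \<Longrightarrow> poly_fun (\<lambda>z. \<Prod>i\<in>I. p i z)"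
  by (induction I rule: infinite_finite_induct) auto

lemma poly_fun_cdot [simp, intro]:
  "(\<And>k. poly_fun (\<lambda>z. u z $ k)) \<Longrightarrow> (\<And>k. poly_fun (\<lambda>z. v z $ k)) \<Longrightarrow> poly_fun (\<lambda>z. cdot (u z) (v z))"
  unfolding cdot_def by auto

lemma poly_fun_matrix_vector [simp, intro]:
  "(\<And>i j. poly_fun (\<lambda>z. M z $ i $ j)) \<Longrightarrow> (\<And>k. poly_fun (\<lambda>z. v z $ k)) \<Longrightarrow> poly_fun (\<lambda>z. (M z *v v z) $ k)"
  unfolding matrix_vector_mult_def by auto

lemma poly_fun_det [simp, intro]:
  fixes M :: "complex ^ 'a::finite \<Rightarrow> complex ^ 'b::finite ^ 'b"
  shows "(\<And>i j. poly_fun (\<lambda>z. M z $ i $ j)) \<Longrightarrow> poly_fun (\<lambda>z. det (M z))"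
  unfolding det_def by auto

lemma poly_fun_induct [consumes 1, case_names const coord add mult]:
  assumes "poly_fun p" and const: "\<And>c. P (\<lambda>_. c)" and coord: "\<And>k. P (\<lambda>z. z $ k)"
    and add: "\<And>p q. poly_fun p \<Longrightarrow> poly_fun q \<Longrightarrow> P p \<Longrightarrow> P q \<Longrightarrow> P (\<lambda>z. p z + q z)"
    and mult: "\<And>p q. poly_fun p \<Longrightarrow> poly_fun q \<Longrightarrow> P p \<Longrightarrow> P q \<Longrightarrow> P (\<lambda>z. p z * q z)"
  shows "P p"
proof -
  from assms(1) obtain S c where S: "finite S" "p = (\<lambda>z. \<Sum>\<alpha>\<in>S. c (\<alpha> :: 'a \<Rightarrow> nat) * (\<Prod>i\<in>UNIV. z $ i ^ \<alpha> i))"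
    unfolding poly_fun_def by blast
  have pw: "P (\<lambda>z. z $ i ^ m)" for i m
    by (induction m) (use const[of 1] mult coord in auto)
  have pr: "P (\<lambda>z. \<Prod>i\<in>I. z $ i ^ \<alpha> i)" if "finite I" for I and \<alpha> :: "'a \<Rightarrow> nat"
    using that by (induction I) (use const[of 1] mult pw in auto)
  have "P (\<lambda>z. \<Sum>\<alpha>\<in>S. c \<alpha> * (\<Prod>i\<in>UNIV. z $ i ^ \<alpha> i))" using S(1)
    by (induction S) (use const[of 0] mult add pr const in auto)
  then show ?thesis using S(2) by simp
qed

lemma poly_fun_compose:
  fixes f :: "complex ^ 'b::finite \<Rightarrow> complex ^ 'a::finite"
  assumes "poly_fun p" "\<And>k. poly_fun (\<lambda>x. f x $ k)"
  shows "poly_fun (\<lambda>x. p (f x))"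
  using assms(1) by (induction rule: poly_fun_induct) (auto simp: assms)

lemma poly_fun_continuous [intro]: "poly_fun p \<Longrightarrow> continuous_on S p"
  by (induction rule: poly_fun_induct) (auto intro!: continuous_intros)

lemma poly_fun_line:
  assumes "poly_fun p" shows "\<exists>P. \<forall>t. p (x + t *s y) = poly P t"
  using assms
proof (induction rule: poly_fun_induct)
  case (const c)
  show ?case by (rule exI[of _ "[:c:]"]) simp
next
  case (coord k)
  show ?case by (rule exI[of _ "[:x $ k, y $ k:]"]) (simp add: mult.commute)
next
  case (add p q)
  then obtain P Q where "\<forall>t. p (x + t *s y) = poly P t" "\<forall>t. q (x + t *s y) = poly Q t" by blast
  then show ?case by (intro exI[of _ "P + Q"]) simp
next
  case (mult p q)
  then obtain P Q where "\<forall>t. p (x + t *s y) = poly P t" "\<forall>t. q (x + t *s y) = poly Q t" by blast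
  then show ?case by (intro exI[of _ "P * Q"]) simp
qed

lemma poly_all_zero: "(\<And>t. poly P t = 0) \<Longrightarrow> P = (0 :: complex poly)"
  using poly_all_0_iff_0 by blast

text \<open>Polynomial functions form an integral domain: restrict to the line through two points.\<close>

lemma poly_fun_integral_domain:
  assumes "poly_fun p" "poly_fun q" "\<And>z. p z * q z = 0" "p z0 \<noteq> 0"
  shows "q z = 0"
proof -
  obtain P where P: "\<And>t. p (z + t *s (z0 - z)) = poly P t" using poly_fun_line[OF assms(1)] by blast
  obtain Q where Q: "\<And>t. q (z + t *s (z0 - z)) = poly Q t" using poly_fun_line[OF assms(2)] by blast
  have "P * Q = 0" by (rule poly_all_zero) (simp add: assms(3) flip: P Q)
  moreover have "P \<noteq> 0" using P[of 1] assms(4) by auto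
  ultimately have "Q = 0" by simp
  then show ?thesis using Q[of 0] by simp
qed

lemma poly_fun_generic:
  assumes "poly_fun p" "p z0 \<noteq> 0" "poly_fun q" "\<And>z. p z \<noteq> 0 \<Longrightarrow> q z = 0"
  shows "q z = 0"
  using poly_fun_integral_domain[OF assms(1,3) _ assms(2)] assms(4) by auto

lemma poly_fun_common_nonzero:
  assumes "poly_fun p" "p z0 \<noteq> 0" "poly_fun q" "q z1 \<noteq> 0"
  shows "\<exists>z. p z \<noteq> 0 \<and> q z \<noteq> 0"
  using poly_fun_generic[OF assms(1-3)] assms(4) by blast

text \<open>A polynomial vanishing on a hyperplane is divisible by its equation.  The quotient is a
  difference quotient along the direction \<open>e\<close>, and these are built by induction.\<close>

lemma poly_fun_difference_quotient:
  fixes b e :: "complex ^ 'a::finite"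
  assumes "poly_fun p"
  shows "\<exists>p'. poly_fun p' \<and> (\<forall>x. p x - p (x - cdot b x *s e) = cdot b x * p' x)"
  using assms
proof (induction rule: poly_fun_induct)
  case (const c)
  show ?case by (rule exI[of _ "\<lambda>_. 0"]) simp
next
  case (coord k)
  show ?case by (rule exI[of _ "\<lambda>_. e $ k"]) simp
next
  case (add p q)
  then obtain p' q' where *: "poly_fun p'" "\<And>x. p x - p (x - cdot b x *s e) = cdot b x * p' x"
    "poly_fun q'" "\<And>x. q x - q (x - cdot b x *s e) = cdot b x * q' x" by blast
  have "p x + q x - (p (x - cdot b x *s e) + q (x - cdot b x *s e)) = cdot b x * (p' x + q' x)" for x
    by (simp only: distrib_left *(2)[symmetric] *(4)[symmetric] add_diff_add)
  moreover have "poly_fun (\<lambda>x. p' x + q' x)" using * by simp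
  ultimately show ?case by blast
next
  case (mult p q)
  then obtain p' q' where *: "poly_fun p'" "\<And>x. p x - p (x - cdot b x *s e) = cdot b x * p' x"
    "poly_fun q'" "\<And>x. q x - q (x - cdot b x *s e) = cdot b x * q' x" by blast
  have "poly_fun (\<lambda>x. p (x - cdot b x *s e))" using mult(1) by (rule poly_fun_compose) simp
  then have "poly_fun (\<lambda>x. p' x * q x + p (x - cdot b x *s e) * q' x)" using *(1,3) mult(1,2) by simp
  moreover have "p x * q x - p (x - cdot b x *s e) * q (x - cdot b x *s e)
      = cdot b x * (p' x * q x + p (x - cdot b x *s e) * q' x)" for x
  proof -
    have "p x * q x - p (x - cdot b x *s e) * q (x - cdot b x *s e)
       = (p x - p (x - cdot b x *s e)) * q x + p (x - cdot b x *s e) * (q x - q (x - cdot b x *s e))"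
      by (simp add: algebra_simps)
    then show ?thesis unfolding *(2,4) by (simp add: algebra_simps)
  qed
  ultimately show ?case by blast
qed

lemma ex_cdot_eq_1: "b \<noteq> 0 \<Longrightarrow> \<exists>e. cdot b e = 1"
proof -
  assume "b \<noteq> 0"
  then obtain m where "b $ m \<noteq> 0" by (auto simp: vec_eq_iff)
  then show ?thesis by (intro exI[of _ "axis m (1 / b $ m)"]) simp
qed

lemma poly_fun_divide_linear:
  fixes b :: "complex ^ 'a::finite"
  assumes "poly_fun p" "b \<noteq> 0" "\<And>x. cdot b x = 0 \<Longrightarrow> p x = 0"
  shows "\<exists>p'. poly_fun p' \<and> (\<forall>x. p x = cdot b x * p' x)"
proof -
  obtain e where e: "cdot b e = 1" using ex_cdot_eq_1[OF assms(2)] by blast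
  have "p (x - cdot b x *s e) = 0" for x
    by (rule assms(3)) (simp add: cdot_diff_right cdot_scale_right e)
  then show ?thesis using poly_fun_difference_quotient[OF assms(1), of b e] by simp
qed

section \<open>Derivatives of polynomial functions\<close>

definition pd :: "'a \<Rightarrow> (complex ^ 'a::finite \<Rightarrow> complex) \<Rightarrow> complex ^ 'a \<Rightarrow> complex" where
  "pd k p z = dir_deriv p z (axis k 1)"

lemma has_derivative_line: "((\<lambda>t::complex. z + t *s v) has_derivative (\<lambda>t. t *s v)) (at s)"
proof -
  have "linear (\<lambda>t::complex. t *s v)"
    by (rule linearI) (simp_all add: vec_eq_iff algebra_simps)
  then have "bounded_linear (\<lambda>t::complex. t *s v)" using linear_conv_bounded_linear by blast
  from has_derivative_add[OF has_derivative_const bounded_linear_imp_has_derivative[OF this], of z "at s"]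
  show ?thesis by simp
qed

lemma dir_deriv_eq:
  assumes "(p has_derivative D) (at z)" "\<And>c v. D (c *s v) = c * D v"
  shows "dir_deriv p z v = D v"
proof -
  have lin: "((\<lambda>t. z + t *s v) has_derivative (\<lambda>t. t *s v)) (at 0)"
    by (rule has_derivative_line)
  have "((\<lambda>t. p (z + t *s v)) has_derivative (\<lambda>t. D (t *s v))) (at 0)"
    using has_derivative_compose[OF lin, of p D] assms(1) by simp
  moreover have "(\<lambda>t. D (t *s v)) = (*) (D v)" by (rule ext) (simp add: assms(2) mult.commute)
  ultimately have "((\<lambda>t. p (z + t *s v)) has_field_derivative D v) (at 0)"
    by (simp add: has_field_derivative_def)
  then show ?thesis unfolding dir_deriv_def by (rule DERIV_imp_deriv)
qed

lemma poly_fun_has_derivative_ex: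
  fixes p :: "complex ^ 'a::finite \<Rightarrow> complex"
  assumes "poly_fun p"
  shows "\<exists>q. (\<forall>k. poly_fun (\<lambda>z. q z $ k)) \<and> (\<forall>z. (p has_derivative (\<lambda>v. cdot (q z) v)) (at z))"
  using assms
proof (induction rule: poly_fun_induct)
  case (const c)
  show ?case by (rule exI[of _ "\<lambda>_. 0"]) simp
next
  case (coord k)
  have "((\<lambda>z :: complex ^ 'a. z $ k) has_derivative (\<lambda>v. v $ k)) (at z)" for z
    by (rule bounded_linear.has_derivative[OF bounded_linear_vec_nth]) (auto intro: derivative_eq_intros)
  then show ?case by (intro exI[of _ "\<lambda>_. axis k 1"]) simp
next
  case (add p q)
  then obtain p' q' where *: "\<forall>k. poly_fun (\<lambda>z. p' z $ k)" "\<And>z. (p has_derivative (\<lambda>v. cdot (p' z) v)) (at z)"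
    "\<forall>k. poly_fun (\<lambda>z. q' z $ k)" "\<And>z. (q has_derivative (\<lambda>v. cdot (q' z) v)) (at z)" by blast
  have "((\<lambda>z. p z + q z) has_derivative (\<lambda>v. cdot (p' z + q' z) v)) (at z)" for z
    using has_derivative_add[OF *(2)[of z] *(4)[of z]] by (simp add: cdot_add_left)
  then show ?case using *(1,3) by (intro exI[of _ "\<lambda>z. p' z + q' z"]) simp
next
  case (mult p q)
  then obtain p' q' where *: "\<forall>k. poly_fun (\<lambda>z. p' z $ k)" "\<And>z. (p has_derivative (\<lambda>v. cdot (p' z) v)) (at z)"
    "\<forall>k. poly_fun (\<lambda>z. q' z $ k)" "\<And>z. (q has_derivative (\<lambda>v. cdot (q' z) v)) (at z)" by blast
  have "((\<lambda>z. p z * q z) has_derivative (\<lambda>v. cdot (p z *s q' z + q z *s p' z) v)) (at z)" for z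
    using has_derivative_mult[OF *(2)[of z] *(4)[of z]]
    by (simp add: cdot_add_left cdot_scale_left mult.commute)
  then show ?case using *(1,3) mult(1,2) by (intro exI[of _ "\<lambda>z. p z *s q' z + q z *s p' z"]) simp
qed

definition grad :: "(complex ^ 'a::finite \<Rightarrow> complex) \<Rightarrow> complex ^ 'a \<Rightarrow> complex ^ 'a" where
  "grad p z = (\<chi> k. pd k p z)"

lemma grad_nth [simp]: "grad p z $ k = pd k p z" by (simp add: grad_def)

lemma grad_unique:
  assumes "(p has_derivative (\<lambda>v. cdot q v)) (at z)" shows "grad p z = q"
  using dir_deriv_eq[OF assms] by (simp add: vec_eq_iff pd_def cdot_scale_right)

lemma poly_fun_has_derivative: "poly_fun p \<Longrightarrow> (p has_derivative (\<lambda>v. cdot (grad p z) v)) (at z)"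
  and poly_fun_pd [simp, intro]: "poly_fun p \<Longrightarrow> poly_fun (\<lambda>z. pd k p z)"
proof -
  assume "poly_fun p"
  then obtain q where q: "\<And>k. poly_fun (\<lambda>z. q z $ k)" "\<And>z. (p has_derivative (\<lambda>v. cdot (q z) v)) (at z)"
    using poly_fun_has_derivative_ex by blast
  have g: "grad p z = q z" for z by (rule grad_unique[OF q(2)])
  show "(p has_derivative (\<lambda>v. cdot (grad p z) v)) (at z)" unfolding g by (rule q(2))
  have "(\<lambda>z. pd k p z) = (\<lambda>z. q z $ k)" by (simp flip: g)
  then show "poly_fun (\<lambda>z. pd k p z)" using q(1)[of k] by simp
qed

lemma dir_deriv_poly_fun: "poly_fun p \<Longrightarrow> dir_deriv p z v = cdot (grad p z) v"
  by (rule dir_deriv_eq[OF poly_fun_has_derivative]) (auto simp: cdot_scale_right)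

lemma pd_const [simp]: "pd k (\<lambda>z. c) = (\<lambda>z. 0)"
  by (rule ext) (simp add: pd_def dir_deriv_def)

lemma pd_coord [simp]: "pd k (\<lambda>z. z $ j) = (\<lambda>z. if k = j then 1 else 0)"
proof
  fix z :: "complex ^ 'a"
  have "((\<lambda>z :: complex ^ 'a. z $ j) has_derivative (\<lambda>v. cdot (axis j 1) v)) (at z)"
    by (simp, rule bounded_linear.has_derivative[OF bounded_linear_vec_nth]) (auto intro: derivative_eq_intros)
  then have "grad (\<lambda>z :: complex ^ 'a. z $ j) z $ k = axis j 1 $ k" using grad_unique by metis
  then show "pd k (\<lambda>z. z $ j) z = (if k = j then 1 else 0)" by (auto simp: axis_def)
qed

lemma pd_add: "poly_fun p \<Longrightarrow> poly_fun q \<Longrightarrow> pd k (\<lambda>z. p z + q z) = (\<lambda>z. pd k p z + pd k q z)"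
proof
  fix z assume "poly_fun p" "poly_fun q"
  then have "((\<lambda>z. p z + q z) has_derivative (\<lambda>v. cdot (grad p z + grad q z) v)) (at z)"
    using has_derivative_add[OF poly_fun_has_derivative poly_fun_has_derivative, of p q z] by (simp add: cdot_add_left)
  then have "grad (\<lambda>z. p z + q z) z $ k = (grad p z + grad q z) $ k" using grad_unique by metis
  then show "pd k (\<lambda>z. p z + q z) z = pd k p z + pd k q z" by simp
qed

lemma pd_mult: "poly_fun p \<Longrightarrow> poly_fun q \<Longrightarrow> pd k (\<lambda>z. p z * q z) = (\<lambda>z. p z * pd k q z + q z * pd k p z)"
proof
  fix z assume "poly_fun p" "poly_fun q"
  then have "((\<lambda>z. p z * q z) has_derivative (\<lambda>v. cdot (p z *s grad q z + q z *s grad p z) v)) (at z)"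
    using has_derivative_mult[OF poly_fun_has_derivative poly_fun_has_derivative, of p q z]
    by (simp add: cdot_add_left cdot_scale_left mult.commute)
  then have "grad (\<lambda>z. p z * q z) z $ k = (p z *s grad q z + q z *s grad p z) $ k" using grad_unique by metis
  then show "pd k (\<lambda>z. p z * q z) z = p z * pd k q z + q z * pd k p z" by simp
qed

lemma pd_uminus: "poly_fun p \<Longrightarrow> pd k (\<lambda>z. - p z) = (\<lambda>z. - pd k p z)"
  using pd_mult[of "\<lambda>_. -1" p k] by simp

lemma pd_diff: "poly_fun p \<Longrightarrow> poly_fun q \<Longrightarrow> pd k (\<lambda>z. p z - q z) = (\<lambda>z. pd k p z - pd k q z)"
  using pd_add[of p "\<lambda>z. - q z" k] pd_uminus[of q k] by simp

lemma pd_sum: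
  "(\<And>i. i \<in> I \<Longrightarrow> poly_fun (p i)) \<Longrightarrow> pd k (\<lambda>z. \<Sum>i\<in>I. p i z) = (\<lambda>z. \<Sum>i\<in>I. pd k (p i) z)"
  by (induction I rule: infinite_finite_induct) (auto simp: pd_add)

lemma poly_fun_line_deriv:
  assumes "poly_fun p"
  shows "((\<lambda>t. p (x + t *s y)) has_field_derivative cdot (grad p (x + t *s y)) y) (at t)"
proof -
  have "((\<lambda>t. x + t *s y) has_derivative (\<lambda>t. t *s y)) (at t)" by (rule has_derivative_line)
  from has_derivative_compose[OF this poly_fun_has_derivative[OF assms]]
  have "((\<lambda>t. p (x + t *s y)) has_derivative (\<lambda>h. cdot (grad p (x + t *s y)) (h *s y))) (at t)" .
  moreover have "(\<lambda>h. cdot (grad p (x + t *s y)) (h *s y)) = (*) (cdot (grad p (x + t *s y)) y)"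
    by (rule ext) (simp add: cdot_scale_right mult.commute)
  ultimately show ?thesis by (simp add: has_field_derivative_def)
qed

lemma poly_fun_line_holomorphic: "poly_fun p \<Longrightarrow> (\<lambda>t. p (x + t *s y)) holomorphic_on S"
  unfolding holomorphic_on_def field_differentiable_def
  using poly_fun_line_deriv[of p x y] has_field_derivative_at_within by blast

lemma poly_fun_linear_part:
  assumes "poly_fun p" "\<And>t x. p (t *s x) = t * p x"
  shows "p x = cdot (grad p 0) x"
proof -
  have "((\<lambda>t. p (0 + t *s x)) has_field_derivative cdot (grad p (0 + 0 *s x)) x) (at 0)"
    by (rule poly_fun_line_deriv[OF assms(1)])
  then have "((\<lambda>t. t * p x) has_field_derivative cdot (grad p 0) x) (at 0)"
    by (simp add: assms(2))
  moreover have "((\<lambda>t. t * p x) has_field_derivative p x) (at 0)"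
    by (rule derivative_eq_intros refl | simp)+
  ultimately show ?thesis by (metis DERIV_unique)
qed

section \<open>Non-empty spectra in seminormed algebras\<close>

lemma sum_root_unity_powers:
  fixes N m :: nat assumes "0 < m" "m < N"
  shows "(\<Sum>k<N. (cis (2 * pi / N) ^ k) ^ m) = 0"
proof -
  define z where "z = cis (2 * pi / N) ^ m"
  have "z ^ N = 1"
  proof -
    have "cis (2 * pi / N) ^ N = 1" using assms by (simp add: Complex.DeMoivre)
    then show ?thesis by (metis z_def mult.commute power_mult power_one)
  qed
  have "z \<noteq> 1"
  proof
    assume "z = 1"
    then have "cis (2 * pi * m / N) = 1" by (simp add: z_def Complex.DeMoivre mult.commute)
    then have "cos (2 * pi * m / N) = 1" by (metis cis.simps(1) one_complex.simps(1))
    then obtain j :: int where "2 * pi * m / N = of_int j * 2 * pi" using cos_one_2pi_int by blast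
    then have "real m = of_int j * real N" using assms by (simp add: field_simps)
    then have "int m = j * int N" by (metis of_int_eq_iff of_int_mult of_int_of_nat_eq)
    then have "int N dvd int m" by simp
    then show False using assms by (simp add: nat_dvd_not_less)
  qed
  have "(cis (2 * pi / N) ^ k) ^ m = z ^ k" for k by (simp add: z_def mult.commute flip: power_mult)
  moreover have "(\<Sum>k<N. z ^ k) = 0"
  proof -
    have "(1 - z) * (\<Sum>k<N. z ^ k) = 0" using one_diff_power_eq[of z N] \<open>z ^ N = 1\<close> by simp
    then show ?thesis using \<open>z \<noteq> 1\<close> by simp
  qed
  ultimately show ?thesis by simp
qed

locale seminormed_algebra =
  fixes A :: "'b::comm_ring_1 set" and cst :: "complex \<Rightarrow> 'b" and d :: "'b \<Rightarrow> real"
  assumes cst_in [simp]: "cst c \<in> A"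
    and add_in [simp]: "x \<in> A \<Longrightarrow> y \<in> A \<Longrightarrow> x + y \<in> A"
    and mult_in [simp]: "x \<in> A \<Longrightarrow> y \<in> A \<Longrightarrow> x * y \<in> A"
    and cst_add: "cst (a + b) = cst a + cst b"
    and cst_mult: "cst (a * b) = cst a * cst b"
    and cst_1: "cst 1 = 1"
    and d_nonneg: "x \<in> A \<Longrightarrow> 0 \<le> d x"
    and d_add: "x \<in> A \<Longrightarrow> y \<in> A \<Longrightarrow> d (x + y) \<le> d x + d y"
    and d_mult: "x \<in> A \<Longrightarrow> y \<in> A \<Longrightarrow> d (x * y) \<le> d x * d y"
    and d_cst: "d (cst c) \<le> norm c"
    and d_1: "d 1 = 1"
begin

lemma cst_0: "cst 0 = 0" using cst_add[of 0 0] by simp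
lemma cst_minus: "cst (- c) = - cst c" using cst_add[of c "-c"] cst_0 by (simp add: eq_neg_iff_add_eq_0 add.commute)
lemma cst_diff: "cst (a - b) = cst a - cst b" using cst_add[of a "-b"] cst_minus by simp
lemma cst_power: "cst (c ^ n) = cst c ^ n" by (induction n) (simp_all add: cst_1 cst_mult)
lemma cst_sum: "cst (sum f I) = (\<Sum>i\<in>I. cst (f i))"
  by (induction I rule: infinite_finite_induct) (simp_all add: cst_0 cst_add)
lemma one_in [simp]: "1 \<in> A" using cst_in[of 1] cst_1 by simp
lemma zero_in [simp]: "0 \<in> A" using cst_in[of 0] cst_0 by simp
lemma uminus_eq: "- x = cst (-1) * x" by (simp add: cst_minus cst_1)
lemma uminus_in [simp]: "x \<in> A \<Longrightarrow> - x \<in> A" by (simp add: uminus_eq del: mult_minus1)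
lemma diff_in [simp]: "x \<in> A \<Longrightarrow> y \<in> A \<Longrightarrow> x - y \<in> A" using add_in[of x "-y"] by simp
lemma power_in [simp]: "x \<in> A \<Longrightarrow> x ^ n \<in> A" by (induction n) auto
lemma sum_in [simp]: "(\<And>i. i \<in> I \<Longrightarrow> f i \<in> A) \<Longrightarrow> sum f I \<in> A"
  by (induction I rule: infinite_finite_induct) auto

lemma d_cst_mult: "x \<in> A \<Longrightarrow> d (cst c * x) \<le> norm c * d x"
  using d_mult[of "cst c" x] d_cst[of c] d_nonneg[of x]
  by (meson cst_in mult_right_mono order_trans)
lemma d_uminus: "x \<in> A \<Longrightarrow> d (- x) \<le> d x" using d_cst_mult[of x "-1"] uminus_eq by simp
lemma d_diff: "x \<in> A \<Longrightarrow> y \<in> A \<Longrightarrow> d (x - y) \<le> d x + d y"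
  using d_add[of x "-y"] d_uminus[of y] by simp
lemma d_diff_eq: "z = x - y \<Longrightarrow> x \<in> A \<Longrightarrow> y \<in> A \<Longrightarrow> d z \<le> d x + d y"
  using d_diff by simp
lemma d_0: "d 0 = 0" using d_cst[of 0] d_nonneg[of 0] cst_0 by simp
lemma d_sum: "(\<And>i. i \<in> I \<Longrightarrow> f i \<in> A) \<Longrightarrow> d (sum f I) \<le> (\<Sum>i\<in>I. d (f i))"
proof (induction I rule: infinite_finite_induct)
  case (insert i I)
  have "d (sum f (insert i I)) \<le> d (f i) + d (sum f I)"
    using insert d_add[of "f i" "sum f I"] by simp
  then show ?case using insert by force
qed (simp_all add: d_0)
lemma d_power: "x \<in> A \<Longrightarrow> d (x ^ n) \<le> d x ^ n"
proof (induction n)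
  case (Suc n)
  have "d (x ^ Suc n) \<le> d x * d (x ^ n)" using Suc d_mult[of x "x ^ n"] by simp
  also have "\<dots> \<le> d x * d x ^ n" using Suc d_nonneg by (intro mult_left_mono) auto
  finally show ?case by simp
qed (simp add: d_1)

lemma d_power_le: "x \<in> A \<Longrightarrow> d x \<le> q \<Longrightarrow> d (x ^ n) \<le> q ^ n"
  using d_power[of x n] power_mono[of "d x" q n] d_nonneg[of x] by simp

lemma sharpen_inverse:
  assumes "g \<in> A" "w \<in> A" "d (1 - g * w) \<le> q" "q < 1" "\<epsilon> > 0"
  shows "\<exists>g'\<in>A. d (1 - g' * w) < \<epsilon> \<and> d g' \<le> d g / (1 - q)"
proof -
  define e where "e = 1 - g * w"
  have e: "e \<in> A" using assms by (simp add: e_def)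
  have q0: "0 \<le> q" using assms d_nonneg[OF e] by (simp add: e_def)
  obtain k where k: "q ^ k < \<epsilon>" using real_arch_pow_inv[of \<epsilon> q] assms by blast
  define g' where "g' = g * (\<Sum>i<k. e ^ i)"
  have "1 - g' * w = e ^ k"
  proof -
    have "g' * w = (1 - e) * (\<Sum>i<k. e ^ i)" by (simp add: g'_def e_def mult_ac)
    then have "g' * w = 1 - e ^ k" using one_diff_power_eq[of e k] by simp
    then show ?thesis by simp
  qed
  moreover have "d (e ^ k) \<le> q ^ k"
    using e assms(3) by (intro d_power_le) (simp_all add: e_def)
  moreover have "d g' \<le> d g / (1 - q)"
  proof -
    have "d (\<Sum>i<k. e ^ i) \<le> (\<Sum>i<k. d (e ^ i))" using e by (intro d_sum) simp
    also have "\<dots> \<le> (\<Sum>i<k. q ^ i)"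
    proof (rule sum_mono)
      fix i
      show "d (e ^ i) \<le> q ^ i"
        using e assms(3) by (intro d_power_le) (simp_all add: e_def)
    qed
    also have "\<dots> \<le> 1 / (1 - q)"
    proof -
      have "(1 - q) * (\<Sum>i<k. q ^ i) \<le> 1" using one_diff_power_eq[of q k] q0 by (metis diff_ge_0_iff_ge add_le_same_cancel1 diff_add_cancel le_add_same_cancel1 zero_le_power diff_le_eq)
      then show ?thesis using assms(4) by (simp add: field_simps)
    qed
    finally have "d (\<Sum>i<k. e ^ i) \<le> 1 / (1 - q)" .
    then have "d g * d (\<Sum>i<k. e ^ i) \<le> d g * (1 / (1 - q))"
      using d_nonneg assms(1) by (intro mult_left_mono) auto
    then show ?thesis using d_mult[of g "\<Sum>i<k. e ^ i"] assms(1) e unfolding g'_def by force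
  qed
  moreover have "g' \<in> A" using assms e by (simp add: g'_def)
  ultimately show ?thesis using k by (intro bexI[of _ g']) auto
qed

text \<open>The elementary argument of Rickart: if \<open>u - c\<close> were invertible for every \<open>c\<close>, then the average of
  \<open>c / (u - c)\<close> over the \<open>N\<close>-th roots \<open>c\<close> of \<open>\<rho> ^ N\<close>, that is \<open>\<rho> ^ N / (u ^ N - \<rho> ^ N)\<close>, would depend
  on \<open>\<rho>\<close> with a modulus of continuity that is uniform in \<open>N\<close>.  For large \<open>\<rho>\<close> it tends to \<open>-1\<close>
  as \<open>N\<close> grows, and this property spreads downwards in \<open>\<rho>\<close> by steps of a fixed size, but for small \<open>\<rho>\<close>
  the average is small.\<close>

theorem spectrum_nonempty:
  assumes u: "u \<in> A"
  shows "\<exists>c. \<forall>g\<in>A. d (1 - g * (u - cst c)) \<ge> 1"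
proof (rule ccontr)
  assume "\<not> ?thesis"
  then have inv: "\<exists>g\<in>A. d (1 - g * (u - cst c)) < 1" for c by (meson not_le)
  define R where "R = 2 * d u + 1"
  have R: "R > 0" "d u / R \<le> 1 / 2" using d_nonneg[OF u] by (auto simp: R_def field_simps)
  have loc: "\<exists>r>0. \<exists>B. \<forall>c\<in>ball c0 r. \<forall>\<epsilon>>0. \<exists>g\<in>A. d (1 - g * (u - cst c)) < \<epsilon> \<and> d g \<le> B" for c0
  proof -
    obtain g1 where g1: "g1 \<in> A" "d (1 - g1 * (u - cst c0)) < 1" using inv by blast
    obtain g0 where g0: "g0 \<in> A" "d (1 - g0 * (u - cst c0)) < 1/4"
      using sharpen_inverse[OF g1(1) _ order_refl g1(2), of "1/4"] u by auto
    show ?thesis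
    proof (rule exI[of _ "1 / (4 * (d g0 + 1))"], rule conjI[OF _ exI[of _ "d g0 / (1 - 1/2)"]], goal_cases)
      case 1
      have "d g0 \<ge> 0" using d_nonneg g0 by blast
      then show ?case by simp
    next
      case 2
      have p: "d g0 \<ge> 0" using d_nonneg g0 by blast
      show ?case
      proof (intro ballI allI impI)
      fix c and \<epsilon> :: real assume c: "c \<in> ball c0 (1 / (4 * (d g0 + 1)))" and "\<epsilon> > 0"
      have eq: "1 - g0 * (u - cst c) = (1 - g0 * (u - cst c0)) - g0 * cst (c0 - c)"
        by (simp add: cst_diff algebra_simps)
      have "d (1 - g0 * (u - cst c)) \<le> d (1 - g0 * (u - cst c0)) + d (g0 * cst (c0 - c))"
        unfolding eq using g0 u by (intro d_diff) auto
      also have "d (1 - g0 * (u - cst c0)) \<le> 1/4" using g0 by simp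
      also have "d (g0 * cst (c0 - c)) \<le> norm (c0 - c) * d g0"
        using d_cst_mult[OF g0(1), of "c0 - c"] by (simp add: mult.commute)
      also have "\<dots> \<le> (1 / (4 * (d g0 + 1))) * d g0"
        using c p by (intro mult_right_mono) (auto simp: dist_norm)
      also have "\<dots> \<le> 1/4" using p by (simp add: field_simps)
      finally have "d (1 - g0 * (u - cst c)) \<le> 1/2" by simp
      then show "\<exists>g\<in>A. d (1 - g * (u - cst c)) < \<epsilon> \<and> d g \<le> d g0 / (1 - 1/2)"
        using g0(1) u \<open>\<epsilon> > 0\<close> by (intro sharpen_inverse) auto
      qed
    qed
  qed
  define P where "P c0 r B \<longleftrightarrow> (\<forall>c\<in>ball c0 r. \<forall>\<epsilon>>0. \<exists>g\<in>A. d (1 - g * (u - cst c)) < \<epsilon> \<and> d g \<le> B)" for c0 r B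
  have "\<forall>c0. \<exists>r B. r > 0 \<and> P c0 r B" using loc unfolding P_def by blast
  then obtain r B0 where r0: "\<And>c0. r c0 > 0" and rP: "\<And>c0. P c0 (r c0) (B0 c0)" by metis
  have rB: "\<exists>g\<in>A. d (1 - g * (u - cst c)) < \<epsilon> \<and> d g \<le> B0 c0" if "c \<in> ball c0 (r c0)" "\<epsilon> > 0" for c0 c \<epsilon>
    using rP[of c0] that unfolding P_def by blast
  have "cball (0::complex) R \<subseteq> (\<Union>c\<in>cball 0 R. ball c (r c))" using r0 by (auto intro!: bexI)
  then obtain C where C: "finite C" "cball (0::complex) R \<subseteq> (\<Union>c\<in>C. ball c (r c))"
    by (rule compactE_image[OF compact_cball _, rotated]) auto
  define B where "B = (\<Sum>c\<in>C. \<bar>B0 c\<bar>) + 1"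
  have B: "B \<ge> 1" by (simp add: B_def sum_nonneg)
  have B0B: "B0 c \<le> B" if "c \<in> C" for c
    using member_le_sum[OF that, of "\<lambda>c. \<bar>B0 c\<bar>"] C(1) unfolding B_def by fastforce
  define Inv where "Inv c \<epsilon> g \<longleftrightarrow> g \<in> A \<and> d (1 - g * (u - cst c)) < \<epsilon> \<and> d g \<le> B" for c \<epsilon> g
  have Inv_ex: "\<exists>g. Inv c \<epsilon> g" if "norm c \<le> R" "\<epsilon> > 0" for c \<epsilon>
  proof -
    have "c \<in> cball 0 R" using that by simp
    then obtain c0 where c0: "c0 \<in> C" "c \<in> ball c0 (r c0)" using C(2) by blast
    show ?thesis using rB[OF c0(2) that(2)] B0B[OF c0(1)] unfolding Inv_def by force
  qed
  have Inv_diff: "d (g - g') \<le> 2 * B * \<epsilon> + B\<^sup>2 * norm (c - c')" if "Inv c \<epsilon> g" "Inv c' \<epsilon> g'" for c c' \<epsilon> g g'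
  proof -
    have gA: "g \<in> A" "g' \<in> A" and dg: "d g \<le> B" "d g' \<le> B"
      and e: "d (1 - g * (u - cst c)) \<le> \<epsilon>" "d (1 - g' * (u - cst c')) \<le> \<epsilon>"
      using that by (auto simp: Inv_def)
    have p: "0 \<le> d g" "0 \<le> d g'" "0 \<le> d (1 - g * (u - cst c))" "0 \<le> d (1 - g' * (u - cst c'))"
      using gA u by (auto intro!: d_nonneg)
    have "g - g' = (g * (1 - g' * (u - cst c')) - g' * (1 - g * (u - cst c))) + cst (c - c') * (g * g')"
      by (simp add: cst_diff algebra_simps)
    also have "d \<dots> \<le> d (g * (1 - g' * (u - cst c')) - g' * (1 - g * (u - cst c))) + d (cst (c - c') * (g * g'))"
      using gA u by (intro d_add) auto
    also have "d (g * (1 - g' * (u - cst c')) - g' * (1 - g * (u - cst c)))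
       \<le> d (g * (1 - g' * (u - cst c'))) + d (g' * (1 - g * (u - cst c)))"
      using gA u by (intro d_diff) auto
    also have "d (g * (1 - g' * (u - cst c'))) \<le> d g * d (1 - g' * (u - cst c'))"
      using gA u by (intro d_mult) auto
    also have "\<dots> \<le> B * \<epsilon>" using p dg e B by (intro mult_mono) auto
    also have "d (g' * (1 - g * (u - cst c))) \<le> d g' * d (1 - g * (u - cst c))"
      using gA u by (intro d_mult) auto
    also have "\<dots> \<le> B * \<epsilon>" using p dg e B by (intro mult_mono) auto
    also have "d (cst (c - c') * (g * g')) \<le> norm (c - c') * (d g * d g')"
      using d_cst_mult[of "g * g'" "c - c'"] d_mult[of g g'] gA
      by (meson mult_in mult_left_mono norm_ge_zero order_trans)
    also have "\<dots> \<le> norm (c - c') * (B * B)" using p dg B by (intro mult_left_mono mult_mono) auto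
    finally show ?thesis by (simp add: power2_eq_square mult_ac)
  qed
  define w where "w N k = cis (2 * pi / real N) ^ k" for N k :: nat
  have w_norm [simp]: "norm (w N k) = 1" for N k by (simp add: w_def norm_power)
  define AV where "AV N \<rho> \<epsilon> a \<longleftrightarrow> (\<exists>g. (\<forall>k. Inv (of_real \<rho> * w N k) \<epsilon> (g k)) \<and>
      a = cst (1 / of_nat N) * (\<Sum>k<N. cst (of_real \<rho> * w N k) * g k))" for N :: nat and \<rho> \<epsilon> :: real and a
  define v where "v N \<rho> = cst (1 / of_real \<rho> ^ N) * u ^ N" for N :: nat and \<rho> :: real
  have vA [simp]: "v N \<rho> \<in> A" for N \<rho> using u by (simp add: v_def)
  have AV_in: "a \<in> A" if "AV N \<rho> \<epsilon> a" for N \<rho> \<epsilon> a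
    using that by (auto simp: AV_def Inv_def intro!: mult_in sum_in)
  have AV_ex: "\<exists>a. AV N \<rho> \<epsilon> a" if "0 < \<rho>" "\<rho> \<le> R" "\<epsilon> > 0" for N \<rho> \<epsilon>
  proof -
    have "\<exists>g. Inv (of_real \<rho> * w N k) \<epsilon> g" for k using that by (intro Inv_ex) (simp_all add: norm_mult)
    then obtain g where "\<And>k. Inv (of_real \<rho> * w N k) \<epsilon> (g k)" by metis
    then show ?thesis unfolding AV_def by blast
  qed
  have AV_small: "d a \<le> \<rho> * B" if av: "AV N \<rho> \<epsilon> a" and "0 < \<rho>" "N > 0" for N \<rho> \<epsilon> a
  proof -
    obtain g where g: "\<And>k. Inv (of_real \<rho> * w N k) \<epsilon> (g k)"
      and a: "a = cst (1 / of_nat N) * (\<Sum>k<N. cst (of_real \<rho> * w N k) * g k)" using av unfolding AV_def by blast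
    have gA: "g k \<in> A" "d (g k) \<le> B" for k using g by (auto simp: Inv_def)
    have "d (\<Sum>k<N. cst (of_real \<rho> * w N k) * g k) \<le> (\<Sum>k<N. d (cst (of_real \<rho> * w N k) * g k))"
      using gA by (intro d_sum) auto
    also have "\<dots> \<le> (\<Sum>k<N. \<rho> * B)"
    proof (rule sum_mono)
      fix k
      have "d (cst (of_real \<rho> * w N k) * g k) \<le> norm (of_real \<rho> * w N k) * d (g k)" using gA by (intro d_cst_mult)
      also have "\<dots> \<le> \<rho> * B" using gA that d_nonneg by (auto simp: norm_mult intro!: mult_mono)
      finally show "d (cst (of_real \<rho> * w N k) * g k) \<le> \<rho> * B" .
    qed
    finally have *: "d (\<Sum>k<N. cst (of_real \<rho> * w N k) * g k) \<le> N * (\<rho> * B)" by simp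
    have "d a \<le> norm (1 / of_nat N :: complex) * d (\<Sum>k<N. cst (of_real \<rho> * w N k) * g k)"
      unfolding a using gA by (intro d_cst_mult) auto
    also have "\<dots> \<le> (1 / N) * (N * (\<rho> * B))" using * that by (intro mult_mono) (auto simp: norm_divide gA intro!: d_nonneg)
    finally show ?thesis using that by simp
  qed
  have AV_diff: "d (a - a') \<le> \<bar>\<rho> - \<rho>'\<bar> * B + R * (2 * B * \<epsilon> + B\<^sup>2 * \<bar>\<rho> - \<rho>'\<bar>)"
    if av: "AV N \<rho> \<epsilon> a" "AV N \<rho>' \<epsilon> a'" and "0 < \<rho>" "0 < \<rho>'" "\<rho>' \<le> R" "N > 0" "\<epsilon> > 0" for N \<rho> \<rho>' \<epsilon> a a'
  proof -
    obtain g where g: "\<And>k. Inv (of_real \<rho> * w N k) \<epsilon> (g k)"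
      and a: "a = cst (1 / of_nat N) * (\<Sum>k<N. cst (of_real \<rho> * w N k) * g k)" using av(1) unfolding AV_def by blast
    obtain g' where g': "\<And>k. Inv (of_real \<rho>' * w N k) \<epsilon> (g' k)"
      and a': "a' = cst (1 / of_nat N) * (\<Sum>k<N. cst (of_real \<rho>' * w N k) * g' k)" using av(2) unfolding AV_def by blast
    have gA: "g k \<in> A" "d (g k) \<le> B" "g' k \<in> A" "d (g' k) \<le> B" for k using g g' by (auto simp: Inv_def)
    let ?K = "\<bar>\<rho> - \<rho>'\<bar> * B + R * (2 * B * \<epsilon> + B\<^sup>2 * \<bar>\<rho> - \<rho>'\<bar>)"
    define t where "t k = cst (of_real (\<rho> - \<rho>') * w N k) * g k + cst (of_real \<rho>' * w N k) * (g k - g' k)" for k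
    have tA: "t k \<in> A" for k using gA by (simp add: t_def)
    have "d (t k) \<le> ?K" for k
    proof -
      have "d (t k) \<le> d (cst (of_real (\<rho> - \<rho>') * w N k) * g k) + d (cst (of_real \<rho>' * w N k) * (g k - g' k))"
        unfolding t_def using gA by (intro d_add) auto
      also have "d (cst (of_real (\<rho> - \<rho>') * w N k) * g k) \<le> \<bar>\<rho> - \<rho>'\<bar> * d (g k)"
        using d_cst_mult[of "g k" "of_real (\<rho> - \<rho>') * w N k"] gA by (simp add: norm_mult flip: of_real_diff)
      also have "\<dots> \<le> \<bar>\<rho> - \<rho>'\<bar> * B" using gA by (intro mult_left_mono) auto
      also have "d (cst (of_real \<rho>' * w N k) * (g k - g' k)) \<le> \<rho>' * d (g k - g' k)"
        using d_cst_mult[of "g k - g' k" "of_real \<rho>' * w N k"] gA that by (simp add: norm_mult)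
      also have "\<dots> \<le> R * (2 * B * \<epsilon> + B\<^sup>2 * \<bar>\<rho> - \<rho>'\<bar>)"
      proof (rule mult_mono)
        have "norm (of_real \<rho> * w N k - of_real \<rho>' * w N k) = \<bar>\<rho> - \<rho>'\<bar>"
          by (simp add: norm_mult flip: of_real_diff left_diff_distrib)
        then show "d (g k - g' k) \<le> 2 * B * \<epsilon> + B\<^sup>2 * \<bar>\<rho> - \<rho>'\<bar>" using Inv_diff[OF g[of k] g'[of k]] by simp
      qed (use that R gA d_nonneg in auto)
      finally show ?thesis by simp
    qed
    then have "(\<Sum>k<N. d (t k)) \<le> N * ?K" using sum_bounded_above[of "{..<N}" "\<lambda>k. d (t k)" ?K] by simp
    then have *: "d (\<Sum>k<N. t k) \<le> N * ?K" using d_sum[of "{..<N}" t] tA by force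
    have aa: "a - a' = cst (1 / of_nat N) * (\<Sum>k<N. t k)"
      unfolding a a' right_diff_distrib[symmetric] sum_subtractf[symmetric]
      by (intro arg_cong[of _ _ "\<lambda>x. cst (1 / of_nat N) * x"] sum.cong)
         (simp_all add: t_def cst_diff cst_mult algebra_simps)
    have "d (a - a') \<le> norm (1 / of_nat N :: complex) * d (\<Sum>k<N. t k)"
      unfolding aa using tA by (intro d_cst_mult) auto
    also have "\<dots> \<le> (1 / N) * (N * ?K)" using * that by (intro mult_mono) (auto simp: norm_divide tA intro!: d_nonneg)
    finally show ?thesis using that by simp
  qed
  have AV_inv: "\<exists>\<epsilon>0>0. \<forall>\<epsilon> a. 0 < \<epsilon> \<longrightarrow> \<epsilon> \<le> \<epsilon>0 \<longrightarrow> AV N \<rho> \<epsilon> a \<longrightarrow> d (a * (v N \<rho> - 1) - 1) \<le> \<eta>"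
    if "0 < \<rho>" "N > 0" "\<eta> > 0" for N \<rho> \<eta>
  proof -
    define q where "q k = (\<Sum>i<N. cst (of_real \<rho> * w N k) ^ (N - Suc i) * u ^ i)" for k
    have qA: "q k \<in> A" for k using u by (simp add: q_def)
    define K where "K = (\<Sum>k<N. d (q k)) + 1"
    have K: "K > 0" unfolding K_def using qA by (intro add_nonneg_pos sum_nonneg d_nonneg) auto
    have rN: "of_real \<rho> ^ N \<noteq> (0::complex)" using that by simp
    show ?thesis
    proof (intro exI[of _ "\<eta> * \<rho> ^ N / (\<rho> * K)"] conjI allI impI)
      show "0 < \<eta> * \<rho> ^ N / (\<rho> * K)" using that K by simp
      fix \<epsilon> a assume \<epsilon>: "0 < \<epsilon>" "\<epsilon> \<le> \<eta> * \<rho> ^ N / (\<rho> * K)" and "AV N \<rho> \<epsilon> a"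
      then obtain g where g: "\<And>k. Inv (of_real \<rho> * w N k) \<epsilon> (g k)"
        and a: "a = cst (1 / of_nat N) * (\<Sum>k<N. cst (of_real \<rho> * w N k) * g k)" unfolding AV_def by blast
      have gA: "g k \<in> A" for k using g by (auto simp: Inv_def)
      define e where "e k = 1 - g k * (u - cst (of_real \<rho> * w N k))" for k
      have eA: "e k \<in> A" "d (e k) \<le> \<epsilon>" for k using g[of k] u by (auto simp: e_def Inv_def)
      have wN: "w N k ^ N = 1" for k
      proof -
        have "cis (2 * pi / real N) ^ N = 1" using that by (simp add: Complex.DeMoivre)
        then show ?thesis unfolding w_def by (metis mult.commute power_mult power_one)
      qed
      have q1: "(u - cst (of_real \<rho> * w N k)) * q k = u ^ N - cst (of_real \<rho> ^ N)" for k
        using power_diff_sumr2[of u N "cst (of_real \<rho> * w N k)"] by (simp add: q_def power_mult_distrib wN flip: cst_power)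
      have gq: "g k * (u ^ N - cst (of_real \<rho> ^ N)) = q k - e k * q k" for k
        unfolding q1[of k, symmetric] by (simp add: e_def algebra_simps)
      have qs: "(\<Sum>k<N. cst (of_real \<rho> * w N k) * q k) = cst (of_nat N * of_real \<rho> ^ N)"
      proof -
        have "(\<Sum>k<N. cst (of_real \<rho> * w N k) * q k)
           = (\<Sum>k<N. \<Sum>i<N. cst ((of_real \<rho> * w N k) ^ (N - i)) * u ^ i)"
          unfolding q_def sum_distrib_left
          by (intro sum.cong refl) (simp add: cst_power Suc_diff_Suc flip: mult.assoc power_Suc)
        also have "\<dots> = (\<Sum>i<N. cst (\<Sum>k<N. (of_real \<rho> * w N k) ^ (N - i)) * u ^ i)"
          by (subst sum.swap) (simp add: cst_sum sum_distrib_right)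
        also have "\<dots> = (\<Sum>i<N. if i = 0 then cst (of_nat N * of_real \<rho> ^ N) else 0)"
        proof (intro sum.cong refl)
          fix i assume i: "i \<in> {..<N}"
          have s: "(\<Sum>k<N. (of_real \<rho> * w N k) ^ (N - i)) = of_real \<rho> ^ (N - i) * (\<Sum>k<N. w N k ^ (N - i))"
            by (simp add: power_mult_distrib sum_distrib_left)
          show "cst (\<Sum>k<N. (of_real \<rho> * w N k) ^ (N - i)) * u ^ i = (if i = 0 then cst (of_nat N * of_real \<rho> ^ N) else 0)"
          proof (cases "i = 0")
            case True
            then show ?thesis by (simp add: power_mult_distrib wN)
          next
            case False
            then have "(\<Sum>k<N. w N k ^ (N - i)) = 0"
              unfolding w_def using i by (intro sum_root_unity_powers) auto
            then show ?thesis using False by (simp add: s cst_0)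
          qed
        qed
        also have "\<dots> = cst (of_nat N * of_real \<rho> ^ N)" using that by simp
        finally show ?thesis .
      qed
      define E where "E = (\<Sum>k<N. cst (of_real \<rho> * w N k) * (e k * q k))"
      have EA: "E \<in> A" unfolding E_def using eA qA by (intro sum_in mult_in) auto
      have aE: "a * (u ^ N - cst (of_real \<rho> ^ N)) = cst (of_real \<rho> ^ N) - cst (1 / of_nat N) * E"
      proof -
        have "a * (u ^ N - cst (of_real \<rho> ^ N))
          = cst (1 / of_nat N) * (\<Sum>k<N. cst (of_real \<rho> * w N k) * (g k * (u ^ N - cst (of_real \<rho> ^ N))))"
          by (simp add: a sum_distrib_right mult.assoc)
        also have "\<dots> = cst (1 / of_nat N) * (cst (of_nat N * of_real \<rho> ^ N) - E)"
          unfolding gq E_def qs[symmetric] by (simp add: right_diff_distrib sum_subtractf)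
        also have "\<dots> = cst (1 / of_nat N * (of_nat N * of_real \<rho> ^ N)) - cst (1 / of_nat N) * E"
          by (simp only: cst_mult right_diff_distrib)
        finally show ?thesis using that by simp
      qed
      have c1: "cst (1 / of_real \<rho> ^ N) * cst (of_real \<rho> ^ N) = 1"
        using that by (simp add: cst_1 flip: cst_mult)
      have "a * (v N \<rho> - 1) - 1 = cst (1 / of_real \<rho> ^ N) * (a * (u ^ N - cst (of_real \<rho> ^ N))) - 1"
        using c1 by (simp add: v_def algebra_simps)
      also have "\<dots> = (cst (1 / of_real \<rho> ^ N) * cst (of_real \<rho> ^ N) - cst (1 / of_real \<rho> ^ N) * cst (1 / of_nat N) * E) - 1"
        unfolding aE by (simp only: right_diff_distrib mult.assoc)
      also have "\<dots> = - (cst (1 / of_real \<rho> ^ N * (1 / of_nat N)) * E)"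
        unfolding c1 cst_mult[of "1 / of_real \<rho> ^ N" "1 / of_nat N"] by simp
      finally have "d (a * (v N \<rho> - 1) - 1) \<le> d (cst (1 / of_real \<rho> ^ N * (1 / of_nat N)) * E)"
        using d_uminus EA by simp
      also have "\<dots> \<le> norm (1 / of_real \<rho> ^ N * (1 / of_nat N) :: complex) * d E" using EA by (intro d_cst_mult)
      also have "\<dots> \<le> (1 / \<rho> ^ N) * d E"
        using that d_nonneg[OF EA] by (intro mult_right_mono) (auto simp: norm_mult norm_divide norm_power field_simps)
      finally have s1: "d (a * (v N \<rho> - 1) - 1) \<le> (1 / \<rho> ^ N) * d E" .
      have "d E \<le> \<rho> * (\<epsilon> * K)"
      proof -
        have "d E \<le> (\<Sum>k<N. d (cst (of_real \<rho> * w N k) * (e k * q k)))" unfolding E_def using eA qA by (intro d_sum) auto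
        also have "\<dots> \<le> (\<Sum>k<N. \<rho> * (\<epsilon> * d (q k)))"
        proof (rule sum_mono)
          fix k
          have "d (cst (of_real \<rho> * w N k) * (e k * q k)) \<le> \<rho> * d (e k * q k)"
            using d_cst_mult[of "e k * q k" "of_real \<rho> * w N k"] eA qA that by (simp add: norm_mult)
          also have "\<dots> \<le> \<rho> * (d (e k) * d (q k))" using that eA qA by (intro mult_left_mono d_mult) auto
          also have "\<dots> \<le> \<rho> * (\<epsilon> * d (q k))" using that eA qA d_nonneg by (intro mult_left_mono mult_right_mono) auto
          finally show "d (cst (of_real \<rho> * w N k) * (e k * q k)) \<le> \<rho> * (\<epsilon> * d (q k))" .
        qed
        also have "\<dots> = \<rho> * (\<epsilon> * (\<Sum>k<N. d (q k)))" by (simp add: sum_distrib_left)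
        also have "\<dots> \<le> \<rho> * (\<epsilon> * K)" using that \<epsilon> by (intro mult_left_mono) (auto simp: K_def)
        finally show ?thesis .
      qed
      then have "1 / \<rho> ^ N * d E \<le> 1 / \<rho> ^ N * (\<rho> * (\<epsilon> * K))" using that by (intro mult_left_mono) auto
      also have "1 / \<rho> ^ N * (\<rho> * (\<epsilon> * K)) \<le> \<eta>" using \<epsilon>(2) that K by (simp add: field_simps)
      finally show "d (a * (v N \<rho> - 1) - 1) \<le> \<eta>" using s1 by linarith
    qed
  qed
  define T where "T = {\<rho>. 0 < \<rho> \<and> \<rho> \<le> R \<and> (\<exists>N>0. d (v N \<rho>) \<le> 1/2)}"
  have near: "\<exists>N>0. \<exists>\<epsilon>0>0. \<forall>\<epsilon> a. 0 < \<epsilon> \<longrightarrow> \<epsilon> \<le> \<epsilon>0 \<longrightarrow> AV N \<rho> \<epsilon> a \<longrightarrow> d (a + 1) \<le> 1/8" if T: "\<rho> \<in> T" for \<rho>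
  proof -
    have \<rho>: "0 < \<rho>" "\<rho> \<le> R" using that by (auto simp: T_def)
    obtain N where N: "N > 0" "d (v N \<rho>) \<le> 1/2" using T by (auto simp: T_def)
    obtain m where m: "(1/2::real) ^ m < 1 / (16 * (R * B))" using real_arch_pow_inv[of "1 / (16 * (R * B))" "1/2"] R B by auto
    have m0: "m > 0"
    proof (rule ccontr)
      assume "\<not> m > 0"
      then have "1 < 1 / (16 * (R * B))" using m by simp
      moreover have "R * B \<ge> 1" using B d_nonneg[OF u] mult_mono[of 1 R 1 B] by (simp add: R_def)
      ultimately show False by (simp add: field_simps)
    qed
    have "1 / of_real \<rho> ^ (N * m) = (1 / of_real \<rho> ^ N :: complex) ^ m" by (simp add: power_mult power_one_over)
    then have "v (N * m) \<rho> = v N \<rho> ^ m" unfolding v_def by (simp only: cst_power power_mult_distrib power_mult)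
    then have dv: "d (v (N * m) \<rho>) \<le> (1/2) ^ m"
      using d_power[of "v N \<rho>" m] power_mono[OF N(2), of m] d_nonneg[of "v N \<rho>"] by simp
    have NM: "N * m > 0" using N m0 by simp
    obtain \<epsilon>0 where \<epsilon>0: "\<epsilon>0 > 0" "\<And>\<epsilon> a. 0 < \<epsilon> \<Longrightarrow> \<epsilon> \<le> \<epsilon>0 \<Longrightarrow> AV (N * m) \<rho> \<epsilon> a \<Longrightarrow> d (a * (v (N * m) \<rho> - 1) - 1) \<le> 1/16"
      using AV_inv[OF \<rho>(1) NM, of "1/16"] by auto
    show ?thesis
    proof (intro exI[of _ "N * m"] exI[of _ \<epsilon>0] conjI allI impI)
      fix \<epsilon> a assume \<epsilon>: "0 < \<epsilon>" "\<epsilon> \<le> \<epsilon>0" and a: "AV (N * m) \<rho> \<epsilon> a"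
      have aA: "a \<in> A" using AV_in a by blast
      have "a + 1 = a * v (N * m) \<rho> - (a * (v (N * m) \<rho> - 1) - 1)" by (simp add: algebra_simps)
      then have "d (a + 1) \<le> d (a * v (N * m) \<rho>) + d (a * (v (N * m) \<rho> - 1) - 1)" using aA by (intro d_diff_eq) simp_all
      also have "d (a * v (N * m) \<rho>) \<le> d a * d (v (N * m) \<rho>)" using aA by (intro d_mult) auto
      also have "\<dots> \<le> (R * B) * (1 / (16 * (R * B)))"
      proof (intro mult_mono)
        show "d a \<le> R * B" using AV_small[OF a \<rho>(1) NM] \<rho> B by (meson mult_right_mono order_trans zero_le_one)
      qed (use dv m R B d_nonneg in auto)
      also have "\<dots> = 1/16" using R B by simp
      finally show "d (a + 1) \<le> 1/8" using \<epsilon>0(2)[OF \<epsilon> a] by simp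
    qed (use NM \<epsilon>0 in auto)
  qed
  define h where "h = 1 / (16 * (B + R * B\<^sup>2))"
  have hp: "B + R * B\<^sup>2 > 0" using R B by (intro add_pos_nonneg) auto
  have h: "h > 0" using hp by (simp add: h_def)
  have step: "\<rho>' \<in> T" if rT: "\<rho> \<in> T" and "0 < \<rho>'" "\<rho>' \<le> \<rho>" "\<rho> - \<rho>' \<le> h" for \<rho> \<rho>'
  proof -
    have \<rho>: "0 < \<rho>" "\<rho> \<le> R" "\<rho>' \<le> R" using that by (auto simp: T_def)
    have r'0: "0 < \<rho>'" by fact
    obtain N \<epsilon>0 where N: "N > 0" "\<epsilon>0 > 0" "\<And>\<epsilon> a. 0 < \<epsilon> \<Longrightarrow> \<epsilon> \<le> \<epsilon>0 \<Longrightarrow> AV N \<rho> \<epsilon> a \<Longrightarrow> d (a + 1) \<le> 1/8"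
      using near[OF rT] by auto
    obtain \<epsilon>1 where \<epsilon>1: "\<epsilon>1 > 0" "\<And>\<epsilon> a. 0 < \<epsilon> \<Longrightarrow> \<epsilon> \<le> \<epsilon>1 \<Longrightarrow> AV N \<rho>' \<epsilon> a \<Longrightarrow> d (a * (v N \<rho>' - 1) - 1) \<le> 1/16"
      using AV_inv[OF r'0 N(1), of "1/16"] by auto
    define \<epsilon> where "\<epsilon> = min (min \<epsilon>0 \<epsilon>1) (1 / (32 * (R * B)))"
    have \<epsilon>: "0 < \<epsilon>" "\<epsilon> \<le> \<epsilon>0" "\<epsilon> \<le> \<epsilon>1" "\<epsilon> \<le> 1 / (32 * (R * B))" using N \<epsilon>1 R B by (auto simp: \<epsilon>_def)
    obtain a a' where a: "AV N \<rho> \<epsilon> a" "AV N \<rho>' \<epsilon> a'" using AV_ex[OF \<rho>(1,2) \<epsilon>(1)] AV_ex[OF r'0 \<rho>(3) \<epsilon>(1)] by metis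
    have aA: "a \<in> A" "a' \<in> A" using AV_in a by auto
    have d1: "d (a + 1) \<le> 1/8" using N(3)[OF \<epsilon>(1,2) a(1)] .
    have d2: "d (a - a') \<le> 1/8"
    proof -
      have "\<bar>\<rho> - \<rho>'\<bar> * (B + R * B\<^sup>2) \<le> h * (B + R * B\<^sup>2)" using that hp by (intro mult_right_mono) auto
      moreover have "h * (B + R * B\<^sup>2) = 1/16" using hp by (simp add: h_def)
      moreover have "R * (2 * B * \<epsilon>) \<le> 1/16" using \<epsilon>(4) R B by (simp add: field_simps)
      ultimately show ?thesis using AV_diff[OF a \<rho>(1) r'0 \<rho>(3) N(1) \<epsilon>(1)] by (simp add: algebra_simps)
    qed
    have "a' + 1 = (a + 1) - (a - a')" by simp
    then have "d (a' + 1) \<le> d (a + 1) + d (a - a')" by (rule d_diff_eq) (use aA in simp_all)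
    then have d3: "d (a' + 1) \<le> 1/4" using d1 d2 by linarith
    define x where "x = a' * (v N \<rho>' - 1) - 1"
    have dx: "d x \<le> 1/16" "x \<in> A" using \<epsilon>1(2)[OF \<epsilon>(1,3) a(2)] aA by (auto simp: x_def)
    have "v N \<rho>' = (a' + 1) * v N \<rho>' - (a' + 1) - x" by (simp add: x_def algebra_simps)
    then have "d (v N \<rho>') \<le> d ((a' + 1) * v N \<rho>' - (a' + 1)) + d x" by (rule d_diff_eq) (use aA dx in simp_all)
    also have "d ((a' + 1) * v N \<rho>' - (a' + 1)) \<le> d ((a' + 1) * v N \<rho>') + d (a' + 1)" using aA by (intro d_diff) auto
    also have "d ((a' + 1) * v N \<rho>') \<le> d (a' + 1) * d (v N \<rho>')" using aA by (intro d_mult) auto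
    also have "\<dots> \<le> 1/4 * d (v N \<rho>')" using d3 d_nonneg by (intro mult_right_mono) auto
    finally have "d (v N \<rho>') \<le> 1/2" using dx d3 by simp
    then show ?thesis using N(1) that \<rho> by (auto simp: T_def)
  qed
  have RT: "R \<in> T"
  proof -
    have "d (v 1 R) \<le> norm (1 / of_real R ^ 1 :: complex) * d (u ^ 1)" unfolding v_def using u by (intro d_cst_mult) auto
    also have "\<dots> = d u / R" using R by (simp add: norm_divide)
    finally have "d (v 1 R) \<le> 1/2" using R by linarith
    then show ?thesis unfolding T_def using R zero_less_one by blast
  qed
  have all: "\<rho> \<in> T" if "0 < \<rho>" "\<rho> \<le> R" "R - \<rho> \<le> real k * h" for \<rho> k
    using that
  proof (induction k arbitrary: \<rho>)
    case 0
    then show ?case using RT by simp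
  next
    case (Suc k)
    define \<rho>1 where "\<rho>1 = min R (\<rho> + h)"
    have k: "R - \<rho> \<le> real k * h + h" using Suc.prems(3) by (simp add: distrib_right add.commute)
    have "0 \<le> real k * h" using h by simp
    then have 1: "R - \<rho>1 \<le> real k * h" using k unfolding \<rho>1_def min_def by simp
    have 2: "0 < \<rho>1" "\<rho>1 \<le> R" "\<rho> \<le> \<rho>1" "\<rho>1 - \<rho> \<le> h"
      using Suc.prems(1,2) h R(1) unfolding \<rho>1_def min_def by simp_all
    show ?case by (rule step[OF Suc.IH[OF 2(1,2) 1] Suc.prems(1) 2(3,4)])
  qed
  define \<rho> where "\<rho> = min R (1 / (4 * B))"
  have \<rho>: "0 < \<rho>" "\<rho> \<le> R" using R B by (simp_all add: \<rho>_def)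
  have "\<rho> * B \<le> 1 / (4 * B) * B" using B by (intro mult_right_mono) (simp_all add: \<rho>_def)
  then have \<rho>B: "\<rho> * B \<le> 1/4" using B by simp
  obtain k where "R - \<rho> < real k * h" using reals_Archimedean3[OF h] by blast
  then have "\<rho> \<in> T" using all[OF \<rho>, of k] by simp
  then obtain N \<epsilon>0 where N: "N > 0" "\<epsilon>0 > 0" "\<And>\<epsilon> a. 0 < \<epsilon> \<Longrightarrow> \<epsilon> \<le> \<epsilon>0 \<Longrightarrow> AV N \<rho> \<epsilon> a \<Longrightarrow> d (a + 1) \<le> 1/8"
    using near[of \<rho>] by auto
  obtain a where a: "AV N \<rho> \<epsilon>0 a" using AV_ex[OF \<rho> N(2)] by blast
  have "1 = (a + 1) - a" by simp
  then have "d 1 \<le> d (a + 1) + d a" by (rule d_diff_eq) (use AV_in[OF a] in simp_all)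
  then show False using N(3)[OF N(2) order_refl a] AV_small[OF a \<rho>(1) N(1)] \<rho>B d_1 by linarith
qed

end

section \<open>Polynomials without common zeros on a face of a polydisc\<close>

definition face :: "'n \<Rightarrow> real \<Rightarrow> real \<Rightarrow> (complex ^ 'n::finite) set" where
  "face i r R = {x. norm (x $ i) = r \<and> (\<forall>j. j \<noteq> i \<longrightarrow> norm (x $ j) \<le> R)}"

definition laurent :: "'n \<Rightarrow> real \<Rightarrow> real \<Rightarrow> (complex ^ 'n::finite \<Rightarrow> complex) set" where
  "laurent i r R = {f. \<exists>N P. poly_fun P \<and> (\<forall>x\<in>face i r R. (x $ i) ^ N * f x = P x)}"

definition sup_norm :: "'x set \<Rightarrow> ('x \<Rightarrow> complex) \<Rightarrow> real" where
  "sup_norm F f = (SUP x\<in>F. norm (f x))"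

lemma norm_le_sum_components: "norm (x :: complex ^ 'n::finite) \<le> (\<Sum>j\<in>UNIV. norm (x $ j))"
  unfolding norm_vec_def by (rule L2_set_le_sum) simp

lemma compact_coordinate_bounds:
  fixes B :: "'n::finite \<Rightarrow> complex set"
  assumes "\<And>j. compact (B j)"
  shows "compact {x :: complex ^ 'n. \<forall>j. x $ j \<in> B j}"
proof -
  have "closed {x :: complex ^ 'n. \<forall>j. x $ j \<in> B j}"
  proof -
    have "{x :: complex ^ 'n. \<forall>j. x $ j \<in> B j} = (\<Inter>j. (\<lambda>x. x $ j) -` B j)" by auto
    moreover have "closed ((\<lambda>x :: complex ^ 'n. x $ j) -` B j)" for j
      by (intro continuous_closed_vimage compact_imp_closed assms) (auto intro!: continuous_intros)
    ultimately show ?thesis by auto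
  qed
  moreover have "bounded {x :: complex ^ 'n. \<forall>j. x $ j \<in> B j}"
  proof -
    have "\<forall>j. \<exists>K. \<forall>z\<in>B j. norm z \<le> K" using assms compact_imp_bounded bounded_iff by blast
    then obtain K where K: "\<And>j z. z \<in> B j \<Longrightarrow> norm z \<le> K j" by metis
    have "norm x \<le> (\<Sum>j\<in>UNIV. K j)" if "\<forall>j. x $ j \<in> B j" for x :: "complex ^ 'n"
      using norm_le_sum_components[of x] sum_mono[of UNIV "\<lambda>j. norm (x $ j)" K] K that by fastforce
    then show ?thesis by (auto simp: bounded_iff)
  qed
  ultimately show ?thesis by (simp add: compact_eq_bounded_closed)
qed

lemma compact_face: "compact (face i r R)"
proof -
  have "face i r R = {x. \<forall>j. x $ j \<in> (if j = i then sphere 0 r else cball 0 R)}"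
    by (auto simp: face_def)
  then show ?thesis using compact_coordinate_bounds[of "\<lambda>j. if j = i then sphere 0 r else cball 0 R"] by simp
qed

lemma face_nonempty: "0 \<le> r \<Longrightarrow> 0 \<le> R \<Longrightarrow> face i r R \<noteq> {}"
proof -
  assume "0 \<le> r" "0 \<le> R"
  then have "(\<chi> j. if j = i then of_real r else 0) \<in> face i r R" by (simp add: face_def)
  then show ?thesis by blast
qed

text \<open>The shape of the face makes every character of the closure of the algebra of Laurent polynomials
  (poles along \<open>x $ i = 0\<close> only) the evaluation at a point of the face.  Instead of characters, proper
  ideals are enlarged by one \<open>x $ l - c\<close> at a time.\<close>

locale laurent_face =
  fixes i :: "'n::finite" and r R :: real
  assumes r: "0 < r" and R: "r \<le> R"
begin

abbreviation "F \<equiv> face i r R"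
abbreviation "LA \<equiv> laurent i r R"
abbreviation "nrm \<equiv> sup_norm F"

lemma xi: "x \<in> F \<Longrightarrow> x $ i \<noteq> 0" using r by (auto simp: face_def)

lemma LA_poly: "poly_fun P \<Longrightarrow> P \<in> LA"
  unfolding laurent_def by (auto intro!: exI[of _ "0::nat"] exI[of _ P])

lemma LA_const: "(\<lambda>_. c) \<in> LA" by (rule LA_poly) simp

lemma LA_inverse: "(\<lambda>x. 1 / x $ i) \<in> LA"
proof -
  have "\<forall>x\<in>F. (x $ i) ^ 1 * (1 / x $ i) = (\<lambda>_. 1) x" using xi by simp
  then show ?thesis unfolding laurent_def using poly_fun_const by blast
qed

lemma LA_add: "f \<in> LA \<Longrightarrow> g \<in> LA \<Longrightarrow> f + g \<in> LA"
proof -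
  assume "f \<in> LA" "g \<in> LA"
  then obtain N P M Q where *: "poly_fun P" "\<And>x. x \<in> F \<Longrightarrow> (x $ i) ^ N * f x = P x"
    "poly_fun Q" "\<And>x. x \<in> F \<Longrightarrow> (x $ i) ^ M * g x = Q x" unfolding laurent_def by blast
  have "(x $ i) ^ (N + M) * (f + g) x = (x $ i) ^ M * P x + (x $ i) ^ N * Q x" if "x \<in> F" for x
    unfolding *(2)[OF that, symmetric] *(4)[OF that, symmetric] by (simp add: power_add algebra_simps)
  moreover have "poly_fun (\<lambda>x. (x $ i) ^ M * P x + (x $ i) ^ N * Q x)" using * by simp
  ultimately show ?thesis unfolding laurent_def by blast
qed

lemma LA_mult: "f \<in> LA \<Longrightarrow> g \<in> LA \<Longrightarrow> f * g \<in> LA"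
proof -
  assume "f \<in> LA" "g \<in> LA"
  then obtain N P M Q where *: "poly_fun P" "\<And>x. x \<in> F \<Longrightarrow> (x $ i) ^ N * f x = P x"
    "poly_fun Q" "\<And>x. x \<in> F \<Longrightarrow> (x $ i) ^ M * g x = Q x" unfolding laurent_def by blast
  have "(x $ i) ^ (N + M) * (f * g) x = P x * Q x" if "x \<in> F" for x
    unfolding *(2)[OF that, symmetric] *(4)[OF that, symmetric] by (simp add: power_add algebra_simps)
  moreover have "poly_fun (\<lambda>x. P x * Q x)" using * by simp
  ultimately show ?thesis unfolding laurent_def by blast
qed

lemma LA_bdd: "f \<in> LA \<Longrightarrow> bdd_above ((\<lambda>x. norm (f x)) ` F)"
proof -
  assume "f \<in> LA"
  then obtain N P where *: "poly_fun P" "\<And>x. x \<in> F \<Longrightarrow> (x $ i) ^ N * f x = P x" unfolding laurent_def by blast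
  have "continuous_on F (\<lambda>x. norm (P x / (x $ i) ^ N))"
    using xi by (intro continuous_intros poly_fun_continuous *) auto
  then have "bounded ((\<lambda>x. norm (P x / (x $ i) ^ N)) ` F)"
    using compact_continuous_image compact_face compact_imp_bounded by blast
  then have "bdd_above ((\<lambda>x. norm (P x / (x $ i) ^ N)) ` F)" by (rule bounded_imp_bdd_above)
  moreover have "(\<lambda>x. norm (P x / (x $ i) ^ N)) ` F = (\<lambda>x. norm (f x)) ` F"
    by (rule image_cong[OF refl]) (simp add: xi flip: *(2))
  ultimately show ?thesis by simp
qed

lemma nrm_ge: "f \<in> LA \<Longrightarrow> x \<in> F \<Longrightarrow> norm (f x) \<le> nrm f"
  unfolding sup_norm_def by (rule cSUP_upper[OF _ LA_bdd])

lemma F_ne: "F \<noteq> {}" using r R by (intro face_nonempty) auto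

lemma nrm_le: "(\<And>x. x \<in> F \<Longrightarrow> norm (f x) \<le> K) \<Longrightarrow> nrm f \<le> K"
  unfolding sup_norm_def using F_ne by (rule cSUP_least)

lemma nrm_nonneg: "f \<in> LA \<Longrightarrow> 0 \<le> nrm f"
  using F_ne nrm_ge[of f] norm_ge_zero order_trans by blast

definition ideal :: "(complex ^ 'n \<Rightarrow> complex) set \<Rightarrow> bool" where
  "ideal J \<longleftrightarrow> J \<subseteq> LA \<and> 0 \<in> J \<and> (\<forall>f\<in>J. \<forall>g\<in>J. f + g \<in> J) \<and> (\<forall>f\<in>LA. \<forall>g\<in>J. f * g \<in> J)"

definition proper :: "(complex ^ 'n \<Rightarrow> complex) set \<Rightarrow> bool" where
  "proper J \<longleftrightarrow> ideal J \<and> (\<forall>j\<in>J. 1 \<le> nrm (1 - j))"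

definition dst :: "(complex ^ 'n \<Rightarrow> complex) set \<Rightarrow> (complex ^ 'n \<Rightarrow> complex) \<Rightarrow> real" where
  "dst J f = (INF j\<in>J. nrm (f - j))"

lemma LA_one: "1 \<in> LA" using LA_const[of 1] by (simp add: one_fun_def)
lemma LA_zero: "0 \<in> LA" using LA_const[of 0] by (simp add: zero_fun_def)

lemma LA_uminus: "f \<in> LA \<Longrightarrow> - f \<in> LA"
proof -
  assume "f \<in> LA"
  moreover have "- f = (\<lambda>_. -1) * f" by (rule ext) simp
  ultimately show ?thesis using LA_mult LA_const by metis
qed

lemma LA_diff: "f \<in> LA \<Longrightarrow> g \<in> LA \<Longrightarrow> f - g \<in> LA"
  using LA_add[of f "- g"] LA_uminus by simp

lemma ideal_uminus: "ideal J \<Longrightarrow> f \<in> J \<Longrightarrow> - f \<in> J"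
proof -
  assume "ideal J" "f \<in> J"
  moreover have "- f = (\<lambda>_. -1) * f" by (rule ext) simp
  ultimately show ?thesis unfolding ideal_def using LA_const by metis
qed

lemma seminormed_algebra_dst:
  assumes J: "proper J"
  shows "seminormed_algebra LA (\<lambda>c _. c) (dst J)"
proof -
  have id: "ideal J" and JLA: "j \<in> J \<Longrightarrow> j \<in> LA" and J0: "0 \<in> J" for j
    using J by (auto simp: proper_def ideal_def)
  have bb: "bdd_below ((\<lambda>j. nrm (f - j)) ` J)" if "f \<in> LA" for f
    using nrm_nonneg LA_diff that JLA by (intro bdd_belowI[of _ 0]) auto
  have le: "dst J f \<le> nrm (f - j)" if "f \<in> LA" "j \<in> J" for f j
    unfolding dst_def using that by (intro cINF_lower bb)
  have ge: "\<exists>j\<in>J. nrm (f - j) < dst J f + \<epsilon>" if "f \<in> LA" "\<epsilon> > 0" for f \<epsilon>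
  proof (rule ccontr)
    assume "\<not> ?thesis"
    then have "dst J f + \<epsilon> \<le> dst J f" unfolding dst_def using J0 by (intro cINF_greatest) (auto simp: not_less)
    then show False using that by simp
  qed
  have nn: "0 \<le> dst J f" if "f \<in> LA" for f
    unfolding dst_def using J0 that nrm_nonneg LA_diff JLA by (intro cINF_greatest) auto
  show ?thesis
  proof
    show "(\<lambda>_. c) \<in> LA" for c by (rule LA_const)
    show "x + y \<in> LA" if "x \<in> LA" "y \<in> LA" for x y using that by (rule LA_add)
    show "x * y \<in> LA" if "x \<in> LA" "y \<in> LA" for x y using that by (rule LA_mult)
    show "(\<lambda>_. a + b) = (\<lambda>_. a) + (\<lambda>_. b)" for a b :: complex by (rule ext) simp
    show "(\<lambda>_. a * b) = (\<lambda>_. a) * (\<lambda>_. b)" for a b :: complex by (rule ext) simp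
    show "(\<lambda>_. 1 :: complex) = 1" by (rule ext) simp
    show "0 \<le> dst J x" if "x \<in> LA" for x by (rule nn[OF that])
    show "dst J (\<lambda>_. c) \<le> norm c" for c
    proof -
      have "dst J (\<lambda>_. c) \<le> nrm ((\<lambda>_. c) - 0)" using J0 LA_const by (intro le) auto
      also have "\<dots> \<le> norm c" by (rule nrm_le) simp
      finally show ?thesis .
    qed
    show "dst J 1 = 1"
    proof (rule antisym)
      have "dst J 1 \<le> nrm (1 - 0)" using J0 LA_one by (intro le) auto
      also have "\<dots> \<le> 1" by (rule nrm_le) simp
      finally show "dst J 1 \<le> 1" .
      show "1 \<le> dst J 1" unfolding dst_def using J J0 by (intro cINF_greatest) (auto simp: proper_def)
    qed
    fix f g assume f: "f \<in> LA" and g: "g \<in> LA"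
    show "dst J (f + g) \<le> dst J f + dst J g"
    proof (rule field_le_epsilon)
      fix \<epsilon> :: real assume "\<epsilon> > 0"
      then obtain j k where j: "j \<in> J" "nrm (f - j) < dst J f + \<epsilon> / 2" and k: "k \<in> J" "nrm (g - k) < dst J g + \<epsilon> / 2"
        using ge[OF f, of "\<epsilon> / 2"] ge[OF g, of "\<epsilon> / 2"] by auto
      have "j + k \<in> J" using id j k by (auto simp: ideal_def)
      then have "dst J (f + g) \<le> nrm ((f + g) - (j + k))" using f g by (intro le LA_add)
      also have "\<dots> \<le> nrm (f - j) + nrm (g - k)"
      proof (rule nrm_le)
        fix x assume x: "x \<in> F"
        have "((f + g) - (j + k)) x = (f - j) x + (g - k) x" by simp
        then have "norm (((f + g) - (j + k)) x) \<le> norm ((f - j) x) + norm ((g - k) x)" by (metis norm_triangle_ineq)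
        then show "norm (((f + g) - (j + k)) x) \<le> nrm (f - j) + nrm (g - k)"
          using nrm_ge[OF LA_diff[OF f JLA[OF j(1)]] x] nrm_ge[OF LA_diff[OF g JLA[OF k(1)]] x] by linarith
      qed
      finally show "dst J (f + g) \<le> dst J f + dst J g + \<epsilon>" using j k by simp
    qed
    show "dst J (f * g) \<le> dst J f * dst J g"
    proof (rule field_le_epsilon)
      fix e :: real assume e: "e > 0"
      define K where "K = dst J f + dst J g + 1"
      have K: "K \<ge> 1" using nn f g by (simp add: K_def)
      define \<epsilon> where "\<epsilon> = min 1 (e / K)"
      have \<epsilon>: "0 < \<epsilon>" "\<epsilon> \<le> 1" "\<epsilon> * K \<le> e" using e K by (auto simp: \<epsilon>_def min_def field_simps)
      obtain j k where j: "j \<in> J" "nrm (f - j) < dst J f + \<epsilon>" and k: "k \<in> J" "nrm (g - k) < dst J g + \<epsilon>"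
        using ge[OF f \<epsilon>(1)] ge[OF g \<epsilon>(1)] by auto
      define m where "m = k * f + (j * g + - (j * k))"
      have "m \<in> J" unfolding m_def using id j k f g JLA ideal_uminus
        unfolding ideal_def by (metis mult.commute)
      then have "dst J (f * g) \<le> nrm (f * g - m)" using f g by (intro le LA_mult)
      also have "\<dots> \<le> nrm (f - j) * nrm (g - k)"
      proof (rule nrm_le)
        fix x assume x: "x \<in> F"
        have "(f * g - m) x = (f - j) x * (g - k) x" by (simp add: m_def algebra_simps)
        then have "norm ((f * g - m) x) = norm ((f - j) x) * norm ((g - k) x)" by (metis norm_mult)
        also have "\<dots> \<le> nrm (f - j) * nrm (g - k)"
          using nrm_ge[OF LA_diff[OF f JLA[OF j(1)]] x] nrm_ge[OF LA_diff[OF g JLA[OF k(1)]] x]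
          by (intro mult_mono nrm_nonneg LA_diff f JLA j) auto
        finally show "norm ((f * g - m) x) \<le> nrm (f - j) * nrm (g - k)" .
      qed
      also have "\<dots> \<le> (dst J f + \<epsilon>) * (dst J g + \<epsilon>)"
        using j k nn f g \<epsilon> by (intro mult_mono nrm_nonneg LA_diff g JLA add_nonneg_nonneg) auto
      also have "\<dots> = dst J f * dst J g + \<epsilon> * (dst J f + dst J g + \<epsilon>)" by (simp add: algebra_simps)
      also have "\<epsilon> * (dst J f + dst J g + \<epsilon>) \<le> \<epsilon> * K" using \<epsilon> by (intro mult_left_mono) (auto simp: K_def)
      finally show "dst J (f * g) \<le> dst J f * dst J g + e" using \<epsilon> by simp
    qed
  qed
qed

lemma extend_proper:
  assumes J: "proper J" and u: "u \<in> LA"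
  shows "\<exists>c J'. proper J' \<and> J \<subseteq> J' \<and> u - (\<lambda>_. c) \<in> J'"
proof -
  interpret seminormed_algebra LA "\<lambda>c _. c" "dst J" by (rule seminormed_algebra_dst[OF J])
  obtain c where c: "\<And>g. g \<in> LA \<Longrightarrow> dst J (1 - g * (u - (\<lambda>_. c))) \<ge> 1" using spectrum_nonempty[OF u] by blast
  define w where "w = u - (\<lambda>_. c)"
  have w: "w \<in> LA" unfolding w_def by (intro LA_diff u LA_const)
  define J' where "J' = {j + g * w | j g. j \<in> J \<and> g \<in> LA}"
  have id: "ideal J" and JLA: "j \<in> J \<Longrightarrow> j \<in> LA" and J0: "0 \<in> J" for j
    using J by (auto simp: proper_def ideal_def)
  have mem: "j + g * w \<in> J'" if "j \<in> J" "g \<in> LA" for j g using that J'_def by blast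
  have "ideal J'"
    unfolding ideal_def
  proof (intro conjI ballI subsetI)
    fix f assume "f \<in> J'" then show "f \<in> LA" unfolding J'_def using w JLA by (auto intro!: LA_add LA_mult)
  next
    show "0 \<in> J'" using mem[OF J0 LA_zero] by simp
  next
    fix f g assume "f \<in> J'" "g \<in> J'"
    then obtain j a k b where *: "f = j + a * w" "j \<in> J" "a \<in> LA" "g = k + b * w" "k \<in> J" "b \<in> LA"
      unfolding J'_def by blast
    have eq: "f + g = (j + k) + (a + b) * w" unfolding * by (simp add: algebra_simps)
    have "j + k \<in> J" using * id by (simp add: ideal_def)
    then show "f + g \<in> J'" unfolding eq using * by (intro mem LA_add)
  next
    fix f g assume f: "f \<in> LA" and "g \<in> J'"
    then obtain j a where *: "g = j + a * w" "j \<in> J" "a \<in> LA" unfolding J'_def by blast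
    have eq: "f * g = f * j + (f * a) * w" unfolding * by (simp add: algebra_simps)
    have "f * j \<in> J" using * id f by (simp add: ideal_def)
    then show "f * g \<in> J'" unfolding eq using * f by (intro mem LA_mult)
  qed
  moreover have "1 \<le> nrm (1 - f)" if fJ: "f \<in> J'" for f
  proof -
    obtain j g where *: "f = j + g * w" "j \<in> J" "g \<in> LA" using fJ unfolding J'_def by blast
    have LA1: "1 - g * w \<in> LA" using * w by (intro LA_diff LA_one LA_mult)
    have "1 \<le> dst J (1 - g * w)" using c[OF *(3)] by (simp add: w_def)
    also have "\<dots> \<le> nrm ((1 - g * w) - j)" unfolding dst_def
      using * nrm_nonneg LA_diff LA1 JLA by (intro cINF_lower bdd_belowI[of _ 0]) auto
    also have "(1 - g * w) - j = 1 - f" unfolding * by simp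
    finally show ?thesis .
  qed
  ultimately have "proper J'" by (simp add: proper_def)
  moreover have "J \<subseteq> J'" using mem[OF _ LA_zero] by auto
  moreover have "w \<in> J'" using mem[OF J0 LA_one] by simp
  ultimately show ?thesis unfolding w_def by blast
qed

lemma proper_ideal_point:
  assumes J: "proper J" and L: "finite (L :: 'n set)"
  shows "\<exists>c J'. proper J' \<and> J \<subseteq> J' \<and> (\<forall>l\<in>L. (\<lambda>x. x $ l - c l) \<in> J')"
  using L
proof induction
  case empty
  show ?case using J by auto
next
  case (insert l L)
  then obtain c J' where *: "proper J'" "J \<subseteq> J'" "\<forall>l\<in>L. (\<lambda>x. x $ l - c l) \<in> J'" by blast
  obtain b J2 where 2: "proper J2" "J' \<subseteq> J2" "(\<lambda>x. x $ l) - (\<lambda>_. b) \<in> J2"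
    using extend_proper[OF *(1) LA_poly[OF poly_fun_coord]] by blast
  have "(\<lambda>x. x $ l) - (\<lambda>_. b) = (\<lambda>x. x $ l - b)" by (rule ext) simp
  then have "\<forall>k\<in>insert l L. (\<lambda>x. x $ k - (c(l := b)) k) \<in> J2" using * 2 insert.hyps by auto
  then show ?case using 2 * by blast
qed

theorem no_common_zero_combination:
  fixes a :: "complex ^ 'n \<Rightarrow> complex ^ 'm::finite"
  assumes a: "\<And>k. poly_fun (\<lambda>x. a x $ k)" and nz: "\<And>x. x \<in> F \<Longrightarrow> a x \<noteq> 0"
  shows "\<exists>H :: complex ^ 'n \<Rightarrow> complex ^ 'm. (\<forall>k. poly_fun (\<lambda>x. H x $ k)) \<and> (\<forall>x\<in>F. cdot (H x) (a x) \<noteq> 0)"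
proof -
  define J where "J = {f. \<exists>h. (\<forall>k. h k \<in> LA) \<and> f = (\<lambda>x. \<Sum>k\<in>UNIV. h k x * a x $ k)}"
  have JI: "(\<lambda>x. \<Sum>k\<in>UNIV. h k x * a x $ k) \<in> J" if "\<And>k. h k \<in> LA" for h
    using that unfolding J_def by blast
  have LA_sum: "(\<lambda>x. \<Sum>k\<in>K. f k x) \<in> LA" if "\<And>k. f k \<in> LA" for f :: "'m \<Rightarrow> complex ^ 'n \<Rightarrow> complex" and K
  proof (induction K rule: infinite_finite_induct)
    case (insert k K)
    have "(\<lambda>x. \<Sum>k\<in>insert k K. f k x) = f k + (\<lambda>x. \<Sum>k\<in>K. f k x)" using insert by (intro ext) simp
    then show ?case using LA_add[OF that insert.IH] by simp
  qed (auto simp: LA_const)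
  have idJ: "ideal J" unfolding ideal_def
  proof (intro conjI ballI subsetI)
    fix f assume "f \<in> J"
    then obtain h where h: "\<And>k. h k \<in> LA" "f = (\<lambda>x. \<Sum>k\<in>UNIV. h k x * a x $ k)" unfolding J_def by blast
    have "(\<lambda>x. h k x * a x $ k) \<in> LA" for k using LA_mult[OF h(1) LA_poly[OF a]] by (simp add: times_fun_def)
    then show "f \<in> LA" unfolding h(2) by (rule LA_sum)
  next
    have "(0 :: complex ^ 'n \<Rightarrow> complex) = (\<lambda>x. \<Sum>k\<in>UNIV. (\<lambda>_. 0) x * a x $ k)" by (rule ext) simp
    then show "0 \<in> J" using JI[of "\<lambda>_ _. 0", OF LA_const] by metis
  next
    fix f g assume "f \<in> J" "g \<in> J"
    then obtain h l where h: "\<And>k. h k \<in> LA" "f = (\<lambda>x. \<Sum>k\<in>UNIV. h k x * a x $ k)"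
      and l: "\<And>k. l k \<in> LA" "g = (\<lambda>x. \<Sum>k\<in>UNIV. l k x * a x $ k)" unfolding J_def by blast
    have "f + g = (\<lambda>x. \<Sum>k\<in>UNIV. (h k + l k) x * a x $ k)"
      unfolding h l by (rule ext) (simp add: distrib_right sum.distrib)
    then show "f + g \<in> J" using JI[of "\<lambda>k. h k + l k"] LA_add h l by simp
  next
    fix f g assume f: "f \<in> LA" and "g \<in> J"
    then obtain l where l: "\<And>k. l k \<in> LA" "g = (\<lambda>x. \<Sum>k\<in>UNIV. l k x * a x $ k)" unfolding J_def by blast
    have "f * g = (\<lambda>x. \<Sum>k\<in>UNIV. (f * l k) x * a x $ k)"
      unfolding l by (rule ext) (simp add: sum_distrib_left mult.assoc)
    then show "f * g \<in> J" using JI[of "\<lambda>k. f * l k"] LA_mult f l by simp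
  qed
  have aJ: "(\<lambda>x. a x $ k) \<in> J" for k
  proof -
    have "(\<lambda>x. a x $ k) = (\<lambda>x. \<Sum>j\<in>UNIV. (\<lambda>_. if j = k then 1 else 0) x * a x $ j)"
      by (rule ext) (simp add: mult_delta_left)
    then show ?thesis using JI[of "\<lambda>j _. if j = k then 1 else 0"] LA_const by simp
  qed
  have "\<not> proper J"
  proof
    assume "proper J"
    then obtain c J' where J': "proper J'" "J \<subseteq> J'" "\<And>l. (\<lambda>x. x $ l - c l) \<in> J'"
      using proper_ideal_point[of J UNIV] by auto
    have id: "ideal J'" and JLA: "j \<in> J' \<Longrightarrow> j \<in> LA" for j using J' by (auto simp: proper_def ideal_def)
    have Jadd: "f \<in> J' \<Longrightarrow> g \<in> J' \<Longrightarrow> f + g \<in> J'" and Jmult: "f \<in> LA \<Longrightarrow> g \<in> J' \<Longrightarrow> f * g \<in> J'" for f g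
      using id by (auto simp: ideal_def)
    have big: "\<exists>x\<in>F. norm (1 - j x) \<ge> 1 - \<epsilon>" if j: "j \<in> J'" and "\<epsilon> > 0" for j \<epsilon>
    proof (rule ccontr)
      assume "\<not> ?thesis"
      then have "nrm (1 - j) \<le> 1 - \<epsilon>" by (intro nrm_le) (auto simp: not_le less_imp_le)
      then show False using J'(1) j \<open>\<epsilon> > 0\<close> unfolding proper_def by fastforce
    qed
    define C where "C = (\<chi> l. c l)"
    have pC: "(\<lambda>x. p x - p C) \<in> J'" if "poly_fun p" for p using that
    proof (induction rule: poly_fun_induct)
      case (const c)
      have "(\<lambda>x. c - c) = (0 :: complex ^ 'n \<Rightarrow> complex)" by (rule ext) simp
      then show ?case using id by (simp add: ideal_def zero_fun_def)
    next
      case (coord k)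
      then show ?case using J'(3)[of k] by (simp add: C_def)
    next
      case (add p q)
      have "(\<lambda>x. p x + q x - (p C + q C)) = (\<lambda>x. p x - p C) + (\<lambda>x. q x - q C)" by (rule ext) simp
      then show ?case using Jadd add by simp
    next
      case (mult p q)
      have "(\<lambda>x. p x * q x - p C * q C) = p * (\<lambda>x. q x - q C) + (\<lambda>_. q C) * (\<lambda>x. p x - p C)"
        by (rule ext) (simp add: algebra_simps)
      then show ?case using Jadd Jmult mult LA_poly LA_const by simp
    qed
    have aux: False if "1 - (1 - t) / 2 \<le> n" "n \<le> t" "t < 1" for t n :: real
    proof -
      have "(1 - t) / 2 > 0" using that(3) by simp
      then have "1 - (1 - t) / 2 > t" by (simp add: field_simps)
      then show False using that by simp
    qed
    have "C \<in> F"
    proof (rule ccontr)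
      assume "C \<notin> F"
      then consider "norm (c i) < r" | l where "l = i" "norm (c l) > r" | l where "l \<noteq> i" "norm (c l) > R"
        unfolding face_def C_def by force
      then show False
      proof cases
        case 1
        define g where "g = (\<lambda>x. 1 / x $ i) * (\<lambda>x. x $ i - c i)"
        have "g \<in> J'" unfolding g_def by (intro Jmult LA_inverse J')
        moreover have "1 - norm (c i) / r > 0" using 1 r by simp
        ultimately obtain x where x: "x \<in> F" "norm (1 - g x) \<ge> 1 - (1 - norm (c i) / r) / 2"
          using big by (metis half_gt_zero)
        have "1 - g x = c i / x $ i" using xi[OF x(1)] by (simp add: g_def field_simps)
        then have "norm (1 - g x) = norm (c i) / r"
          using x(1) by (simp add: norm_divide face_def)
        moreover have "norm (c i) / r < 1" using 1 r by simp
        ultimately show False using aux[OF x(2)] by simp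
      next
        case (2 l)
        have n0: "norm (c l) > 0" using 2 r by linarith
        then have c0: "c l \<noteq> 0" by auto
        define g where "g = (\<lambda>_. - (1 / c l)) * (\<lambda>x. x $ l - c l)"
        have "g \<in> J'" unfolding g_def by (intro Jmult LA_const J')
        moreover have "1 - r / norm (c l) > 0" using 2 n0 by simp
        ultimately obtain x where x: "x \<in> F" "norm (1 - g x) \<ge> 1 - (1 - r / norm (c l)) / 2"
          using big by (metis half_gt_zero)
        have "1 - g x = x $ l / c l" using c0 by (simp add: g_def field_simps)
        then have "norm (1 - g x) = r / norm (c l)"
          using x(1) 2 by (simp add: norm_divide face_def)
        moreover have "r / norm (c l) < 1" using 2 n0 by simp
        ultimately show False using aux[OF x(2)] by simp
      next
        case (3 l)
        have n0: "norm (c l) > 0" using 3 r R by linarith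
        then have c0: "c l \<noteq> 0" by auto
        define g where "g = (\<lambda>_. - (1 / c l)) * (\<lambda>x. x $ l - c l)"
        have "g \<in> J'" unfolding g_def by (intro Jmult LA_const J')
        moreover have "1 - R / norm (c l) > 0" using 3 n0 by simp
        ultimately obtain x where x: "x \<in> F" "norm (1 - g x) \<ge> 1 - (1 - R / norm (c l)) / 2"
          using big by (metis half_gt_zero)
        have "1 - g x = x $ l / c l" using c0 by (simp add: g_def field_simps)
        then have "norm (1 - g x) \<le> R / norm (c l)"
          using x(1) 3 n0 by (simp add: norm_divide face_def divide_right_mono)
        moreover have "R / norm (c l) < 1" using 3 n0 by simp
        ultimately show False using aux[OF x(2)] by simp
      qed
    qed
    then have "a C \<noteq> 0" by (rule nz)
    then obtain k where k: "a C $ k \<noteq> 0" by (auto simp: vec_eq_iff)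
    define f where "f = (\<lambda>_. 1 / a C $ k) * ((\<lambda>x. a x $ k) + (- (\<lambda>x. a x $ k - a C $ k)))"
    have "f \<in> J'" unfolding f_def
      using aJ[of k] J'(2) pC[OF a[of k]] by (intro Jmult LA_const Jadd ideal_uminus[OF id]) auto
    moreover have "f x = 1" for x using k by (simp add: f_def)
    ultimately show False using big[of f "1/2"] by auto
  qed
  then obtain f where f: "f \<in> J" "nrm (1 - f) < 1" using idJ by (auto simp: proper_def)
  obtain h where h: "\<And>k. h k \<in> LA" "f = (\<lambda>x. \<Sum>k\<in>UNIV. h k x * a x $ k)" using f(1) unfolding J_def by blast
  have "\<forall>k. \<exists>N P. poly_fun P \<and> (\<forall>x\<in>F. (x $ i) ^ N * h k x = P x)" using h(1) unfolding laurent_def by blast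
  then obtain N P where NP: "\<And>k. poly_fun (P k)" "\<And>k x. x \<in> F \<Longrightarrow> (x $ i) ^ N k * h k x = P k x" by metis
  define M where "M = (\<Sum>k\<in>UNIV. N k)"
  have NM: "N k \<le> M" for k unfolding M_def by (rule member_le_sum) auto
  define H where "H x = (\<chi> k. (x $ i) ^ (M - N k) * P k x)" for x
  have "poly_fun (\<lambda>x. H x $ k)" for k using NP(1) by (simp add: H_def)
  moreover have "cdot (H x) (a x) \<noteq> 0" if x: "x \<in> F" for x
  proof -
    have "H x $ k = (x $ i) ^ M * h k x" for k
    proof -
      have "(x $ i) ^ (M - N k) * ((x $ i) ^ N k * h k x) = (x $ i) ^ M * h k x"
        using NM[of k] by (simp flip: mult.assoc power_add)
      then show ?thesis by (simp add: H_def NP(2)[OF x])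
    qed
    then have "cdot (H x) (a x) = (x $ i) ^ M * f x" by (simp add: cdot_def h(2) sum_distrib_left mult.assoc)
    moreover have "f x \<noteq> 0"
    proof
      assume "f x = 0"
      then have "norm ((1 - f) x) = 1" by simp
      then show False using f nrm_ge[OF LA_diff[OF LA_one] x, of f] idJ by (auto simp: ideal_def)
    qed
    ultimately show ?thesis using xi[OF x] by simp
  qed
  ultimately show ?thesis by blast
qed

end

section \<open>Determinant identities\<close>

definition repl_col :: "complex ^ 'n ^ 'n \<Rightarrow> 'n \<Rightarrow> complex ^ 'n \<Rightarrow> complex ^ 'n ^ 'n::finite" where
  "repl_col A j v = (\<chi> a b. if b = j then v $ a else A $ a $ b)"

lemma det_repl_col_expand:
  fixes A :: "complex ^ 'n ^ 'n::finite"
  shows "det (repl_col A j v) = (\<Sum>k\<in>UNIV. v $ k * det (repl_col A j (axis k 1)))"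
proof -
  have tr: "transpose (repl_col A j w) = (\<chi> i. if i = j then w else column i A)" for w
    by (simp add: vec_eq_iff transpose_def repl_col_def column_def)
  have dt: "det (repl_col A j w) = det (\<chi> i. if i = j then w else column i A)" for w
    unfolding tr[symmetric] by simp
  have v: "v = (\<Sum>k\<in>UNIV. v $ k *s axis k 1)" by (simp add: basis_expansion)
  have "det (\<chi> i. if i = j then v else column i A)
      = det (\<chi> i. if i = j then (\<Sum>k\<in>UNIV. v $ k *s axis k 1) else column i A)"
    by (subst v) (rule refl)
  also have "\<dots> = (\<Sum>k\<in>UNIV. det (\<chi> i. if i = j then v $ k *s axis k 1 else column i A))"
    by (rule det_linear_row_sum[of UNIV j "\<lambda>_ k. v $ k *s axis k 1" "\<lambda>i. column i A"]) simp
  also have "\<dots> = (\<Sum>k\<in>UNIV. v $ k * det (\<chi> i. if i = j then axis k 1 else column i A))"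
    by (intro sum.cong refl det_row_mul[of j _ "\<lambda>_. axis _ 1" "\<lambda>i. column i A"])
  finally show ?thesis unfolding dt .
qed

lemma cramer_repl_col: "det (repl_col A k (A *v x)) = x $ k * det (A :: complex ^ 'n ^ 'n::finite)"
  unfolding repl_col_def by (rule cramer_lemma)

text \<open>The transposed Cramer rule, that is \<open>adj\<^sup>T C = det\<close>; for singular \<open>C\<close> it follows by
  deforming \<open>C\<close> to \<open>C + z\<close>.\<close>

lemma adjugate_identity:
  fixes C :: "complex ^ 'n ^ 'n::finite" and X :: "complex ^ 'n"
  shows "(\<Sum>i\<in>UNIV. C $ i $ k * det (\<chi> a b. if a = i then X $ b else C $ a $ b)) = det C * X $ k"
proof -
  have inv: "(\<Sum>i\<in>UNIV. D $ i $ k * det (\<chi> a b. if a = i then X $ b else D $ a $ b)) = det D * X $ k"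
    if D: "det D \<noteq> 0" for D :: "complex ^ 'n ^ 'n"
  proof -
    have "det (transpose D) \<noteq> 0" using D by simp
    then have "invertible (transpose D)" by (simp add: invertible_det_nz)
    then obtain B where B: "transpose D ** B = mat 1" unfolding invertible_def by blast
    define u where "u = B *v X"
    have u: "transpose D *v u = X" unfolding u_def by (simp add: matrix_vector_mul_assoc B)
    have "det (\<chi> a b. if a = i then X $ b else D $ a $ b) = u $ i * det D" for i
    proof -
      have "transpose (\<chi> a b. if a = i then X $ b else D $ a $ b) = repl_col (transpose D) i (transpose D *v u)"
        unfolding u by (simp add: vec_eq_iff transpose_def repl_col_def)
      then have "det (transpose (\<chi> a b. if a = i then X $ b else D $ a $ b)) = det (repl_col (transpose D) i (transpose D *v u))"
        by (rule arg_cong)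
      then show ?thesis unfolding det_transpose cramer_repl_col .
    qed
    then have "(\<Sum>i\<in>UNIV. D $ i $ k * det (\<chi> a b. if a = i then X $ b else D $ a $ b))
        = (\<Sum>i\<in>UNIV. D $ i $ k * u $ i) * det D" by (simp add: sum_distrib_right mult.assoc)
    also have "(\<Sum>i\<in>UNIV. D $ i $ k * u $ i) = X $ k"
      unfolding u[symmetric] by (simp add: matrix_vector_mult_def transpose_def)
    finally show ?thesis by simp
  qed
  define D where "D z = (\<chi> a b. C $ a $ b + z $ 1 * (if a = b then 1 else 0))" for z :: "complex ^ 1"
  have Dp: "poly_fun (\<lambda>z. D z $ a $ b)" for a b unfolding D_def by simp
  define p where "p z = det (D z)" for z
  define q where "q z = (\<Sum>i\<in>UNIV. D z $ i $ k * det (\<chi> a b. if a = i then X $ b else D z $ a $ b)) - det (D z) * X $ k" for z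
  have pp: "poly_fun p" unfolding p_def by (intro poly_fun_det Dp)
  have pq: "poly_fun q"
  proof -
    have "poly_fun (\<lambda>z. (\<chi> a b. if a = i then X $ b else D z $ a $ b) $ a' $ b')" for i a' b'
      using Dp by (cases "a' = i") simp_all
    then show ?thesis unfolding q_def by (intro poly_fun_diff poly_fun_sum poly_fun_mult poly_fun_det poly_fun_const Dp)
  qed
  have "\<exists>z0. p z0 \<noteq> 0"
  proof -
    define E where "E t = (\<chi> a b. (if a = b then 1 else 0) + t $ 1 * C $ a $ b)" for t :: "complex ^ 1"
    have "poly_fun (\<lambda>t. det (E t))" by (intro poly_fun_det) (simp add: E_def)
    moreover have "E 0 = mat 1" by (simp add: E_def vec_eq_iff mat_def)
    then have "det (E 0) \<noteq> 0" by simp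
    moreover have "poly_fun (\<lambda>t :: complex ^ 1. t $ 1)" "(\<chi> i. 1 :: complex ^ 1) $ 1 \<noteq> 0" by simp_all
    ultimately obtain t :: "complex ^ 1" where t: "det (E t) \<noteq> 0" "t $ 1 \<noteq> 0"
      using poly_fun_common_nonzero[of "\<lambda>t. det (E t)" 0 "\<lambda>t :: complex ^ 1. t $ 1" "\<chi> i. 1"] by auto
    define z where "z = (\<chi> i :: 1. 1 / t $ 1)"
    have m: "(mat c ** B) $ a $ b = c * B $ a $ b" for c :: complex and B :: "complex ^ 'n ^ 'n" and a b
      by (simp add: matrix_matrix_mult_def mat_def mult_delta_left)
    have "E t $ a $ b = t $ 1 * D z $ a $ b" for a b
      using t(2) by (simp add: E_def D_def z_def field_simps)
    then have "E t = mat (t $ 1) ** D z" by (simp add: vec_eq_iff m)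
    then have "det (D z) \<noteq> 0" using t(1) det_mul[of "mat (t $ 1)" "D z"] by auto
    then show ?thesis unfolding p_def by blast
  qed
  then obtain z0 where "p z0 \<noteq> 0" by blast
  moreover have "q z = 0" if "p z \<noteq> 0" for z using inv[of "D z"] that by (simp add: p_def q_def)
  ultimately have q0: "q 0 = 0" using poly_fun_generic[OF pp _ pq] by blast
  have D0: "D 0 = C" by (simp add: D_def vec_eq_iff)
  show ?thesis using q0 unfolding q_def D0 by simp
qed

section \<open>Averages over roots of unity\<close>

lemma average_root_unity:
  assumes hol: "f holomorphic_on ball 0 R" and cont: "continuous_on (cball 0 R) f"
    and M: "\<And>z. norm z \<le> R \<Longrightarrow> norm (f z) \<le> M" and r: "0 < r" "r < R" and N: "N > 0"
  shows "norm ((\<Sum>k<N. f (of_real r * cis (2 * pi / real N) ^ k)) / of_nat N - f 0) \<le> M * (r / R) ^ N / (1 - r / R)"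
proof -
  define w where "w k = cis (2 * pi / real N) ^ k" for k :: nat
  define c where "c m = (deriv ^^ m) f 0 / fact m" for m
  define q where "q = r / R"
  have q: "0 < q" "q < 1" using r by (auto simp: q_def)
  have "norm (f 0) \<le> M" using r by (intro M) simp
  then have M0: "0 \<le> M" using norm_ge_zero order_trans by blast
  have cb: "norm (c m * of_real r ^ m) \<le> M * q ^ m" for m
  proof -
    have "norm ((deriv ^^ m) f 0) \<le> fact m * M / R ^ m"
      using r by (intro Cauchy_inequality[OF hol cont]) (auto intro!: M)
    then have "norm (c m) \<le> M / R ^ m" by (simp add: c_def norm_divide field_simps)
    then have "norm (c m) * r ^ m \<le> M / R ^ m * r ^ m" using r by (intro mult_right_mono) auto
    then show ?thesis using r by (simp add: norm_mult norm_power q_def power_divide)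
  qed
  define A where "A m = (\<Sum>k<N. w k ^ m) / of_nat N" for m
  have wn: "norm (w k) = 1" for k by (simp add: w_def norm_power)
  have A1: "norm (A m) \<le> 1" for m
  proof -
    have "norm (\<Sum>k<N. w k ^ m) \<le> (\<Sum>k<N. norm (w k ^ m))" by (rule norm_sum)
    then show ?thesis using N by (simp add: A_def norm_divide norm_power wn)
  qed
  have A0: "A 0 = 1" using N by (simp add: A_def)
  have Am: "A m = 0" if "0 < m" "m < N" for m
    using sum_root_unity_powers[OF that] by (simp add: A_def w_def)
  have "(\<lambda>m. c m * of_real r ^ m * A m) sums ((\<Sum>k<N. f (of_real r * w k)) / of_nat N)"
  proof -
    have "(\<lambda>m. c m * (of_real r * w k) ^ m) sums f (of_real r * w k)" for k
      using holomorphic_power_series[OF hol, of "of_real r * w k"] r by (simp add: c_def norm_mult wn)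
    then have "(\<lambda>m. \<Sum>k<N. c m * (of_real r * w k) ^ m) sums (\<Sum>k<N. f (of_real r * w k))"
      by (intro sums_sum)
    then have "(\<lambda>m. (\<Sum>k<N. c m * (of_real r * w k) ^ m) / of_nat N) sums ((\<Sum>k<N. f (of_real r * w k)) / of_nat N)"
      by (rule sums_divide)
    moreover have "(\<Sum>k<N. c m * (of_real r * w k) ^ m) / of_nat N = c m * of_real r ^ m * A m" for m
      by (simp add: A_def power_mult_distrib sum_distrib_left mult.assoc)
    ultimately show ?thesis by simp
  qed
  then have "(\<lambda>m. c (m + N) * of_real r ^ (m + N) * A (m + N)) sums
     ((\<Sum>k<N. f (of_real r * w k)) / of_nat N - (\<Sum>m<N. c m * of_real r ^ m * A m))"
    by (subst sums_iff_shift) simp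
  moreover have "(\<Sum>m<N. c m * of_real r ^ m * A m) = f 0"
  proof -
    have "(\<Sum>m<N. c m * of_real r ^ m * A m) = (\<Sum>m<N. if m = 0 then f 0 else 0)"
      by (intro sum.cong refl) (auto simp: A0 Am c_def)
    then show ?thesis using N by simp
  qed
  ultimately have S: "(\<lambda>m. c (m + N) * of_real r ^ (m + N) * A (m + N)) sums
     ((\<Sum>k<N. f (of_real r * w k)) / of_nat N - f 0)" by simp
  have T: "(\<lambda>m. (M * q ^ N) * q ^ m) sums ((M * q ^ N) * (1 / (1 - q)))"
    using q by (intro sums_mult geometric_sums) simp
  have "norm (c (m + N) * of_real r ^ (m + N) * A (m + N)) \<le> (M * q ^ N) * q ^ m" for m
  proof -
    have "norm (c (m + N) * of_real r ^ (m + N)) * norm (A (m + N)) \<le> (M * q ^ (m + N)) * 1"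
      using cb[of "m + N"] A1[of "m + N"] q M0 by (intro mult_mono) auto
    then show ?thesis by (simp add: norm_mult power_add mult_ac)
  qed
  then have "norm (\<Sum>m. c (m + N) * of_real r ^ (m + N) * A (m + N)) \<le> (\<Sum>m. (M * q ^ N) * q ^ m)"
    using sums_summable[OF T] by (rule norm_suminf_le)
  then show ?thesis unfolding sums_unique[OF S, symmetric] sums_unique[OF T, symmetric] by (simp add: w_def q_def)
qed

definition upd :: "complex ^ 'n::finite \<Rightarrow> 'n \<Rightarrow> complex \<Rightarrow> complex ^ 'n" where
  "upd x j t = (\<chi> l. if l = j then t else x $ l)"

lemma upd_nth [simp]: "upd x j t $ l = (if l = j then t else x $ l)" by (simp add: upd_def)

lemma upd_line: "upd x j t = upd x j 0 + t *s axis j 1" by (simp add: vec_eq_iff axis_def)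

lemma poly_fun_upd_holomorphic: "poly_fun P \<Longrightarrow> (\<lambda>t. P (upd x j t)) holomorphic_on S"
proof -
  assume P: "poly_fun P"
  have eq: "(\<lambda>t. P (upd x j t)) = (\<lambda>t. P (upd x j 0 + t *s axis j 1))"
    by (rule ext, rule arg_cong[where f = P], rule upd_line)
  show ?thesis unfolding eq by (rule poly_fun_line_holomorphic[OF P])
qed

definition torus_point :: "real \<Rightarrow> nat \<Rightarrow> ('n \<Rightarrow> nat) \<Rightarrow> complex ^ 'n::finite" where
  "torus_point r N k = (\<chi> j. of_real r * cis (2 * pi / real N) ^ k j)"

definition grid :: "nat \<Rightarrow> ('n::finite \<Rightarrow> nat) set" where "grid N = {k. \<forall>j. k j < N}"

definition Av :: "real \<Rightarrow> nat \<Rightarrow> (complex ^ 'n::finite \<Rightarrow> complex) \<Rightarrow> complex" where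
  "Av r N f = (\<Sum>k\<in>grid N. f (torus_point r N k)) / of_nat (card (grid N :: ('n \<Rightarrow> nat) set))"

definition torus :: "real \<Rightarrow> (complex ^ 'n::finite) set" where "torus r = {x. \<forall>j. norm (x $ j) = r}"

lemma finite_grid [simp]: "finite (grid N :: ('n::finite \<Rightarrow> nat) set)"
proof -
  have "grid N = (UNIV :: 'n set) \<rightarrow>\<^sub>E {..<N}" by (auto simp: grid_def PiE_def Pi_def extensional_def)
  then show ?thesis by (simp add: finite_PiE)
qed

lemma grid_nonempty: "N > 0 \<Longrightarrow> grid N \<noteq> {}"
  by (auto simp: grid_def intro!: exI[of _ "\<lambda>_. 0"])

lemma card_grid_pos: "N > 0 \<Longrightarrow> card (grid N :: ('n::finite \<Rightarrow> nat) set) > 0"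
  using grid_nonempty by (simp add: card_gt_0_iff)

lemma torus_point_in: "0 \<le> r \<Longrightarrow> torus_point r N k \<in> torus r"
  by (simp add: torus_def torus_point_def norm_mult norm_power)

lemma Av_cong: "0 \<le> r \<Longrightarrow> (\<And>x. x \<in> torus r \<Longrightarrow> f x = g x) \<Longrightarrow> Av r N f = Av r N g"
  unfolding Av_def using torus_point_in by (metis (no_types, lifting) sum.cong)

lemma Av_add: "Av r N (\<lambda>x. f x + g x) = Av r N f + Av r N g"
  by (simp add: Av_def sum.distrib add_divide_distrib)

lemma Av_const: "N > 0 \<Longrightarrow> Av r N (\<lambda>x :: complex ^ 'n::finite. c) = c"
  using grid_nonempty[of N, where 'a='n] by (simp add: Av_def)

lemma sum_grid_upd:
  "(\<Sum>k\<in>grid N. \<Sum>m<N. g (k(j := m))) = of_nat N * (\<Sum>k\<in>grid N. g k :: complex)" for j :: "'n::finite"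
proof -
  have "(\<Sum>k\<in>grid N. \<Sum>m<N. g (k(j := m))) = (\<Sum>(k, m)\<in>grid N \<times> {..<N}. g (k(j := m)))"
    by (rule sum.cartesian_product)
  also have "\<dots> = (\<Sum>(k, m)\<in>grid N \<times> {..<N}. g k)"
    by (rule sum.reindex_bij_witness[of _ "\<lambda>(k, m). (k(j := m), k j)" "\<lambda>(k, m). (k(j := m), k j)"])
       (auto simp: grid_def)
  also have "\<dots> = (\<Sum>k\<in>grid N. \<Sum>m<N. g k)" by (rule sum.cartesian_product[symmetric])
  finally show ?thesis by (simp add: sum_distrib_left)
qed

lemma Av_replace:
  fixes f :: "complex ^ 'n::finite \<Rightarrow> complex"
  assumes r: "0 < r" "r < R" and N: "N > 0"
    and hol: "\<And>x. x \<in> torus r \<Longrightarrow> (\<lambda>t. f (upd x j t)) holomorphic_on ball 0 R"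
    and cont: "\<And>x. x \<in> torus r \<Longrightarrow> continuous_on (cball 0 R) (\<lambda>t. f (upd x j t))"
    and M: "\<And>x t. x \<in> torus r \<Longrightarrow> norm t \<le> R \<Longrightarrow> norm (f (upd x j t)) \<le> M"
  shows "norm (Av r N f - Av r N (\<lambda>x. f (upd x j 0))) \<le> M * (r / R) ^ N / (1 - r / R)"
proof -
  let ?K = "grid N :: ('n \<Rightarrow> nat) set" and ?B = "M * (r / R) ^ N / (1 - r / R)"
  define w where "w k = cis (2 * pi / real N) ^ k" for k :: nat
  have up: "torus_point r N (k(j := m)) = upd (torus_point r N k) j (of_real r * w m)" for k m
    by (simp add: torus_point_def vec_eq_iff w_def)
  have "norm ((\<Sum>m<N. f (torus_point r N (k(j := m)))) / of_nat N - f (upd (torus_point r N k) j 0)) \<le> ?B" for k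
  proof -
    have t: "torus_point r N k \<in> torus r" using r by (intro torus_point_in) simp
    show ?thesis unfolding up w_def
      using average_root_unity[OF hol[OF t] cont[OF t] M[OF t] r N] by simp
  qed
  note B = this
  have NK: "of_nat N \<noteq> (0::complex)" using N by simp
  have cK: "card ?K > 0" by (rule card_grid_pos[OF N])
  have "(\<Sum>k\<in>?K. f (torus_point r N k)) = (\<Sum>k\<in>?K. (\<Sum>m<N. f (torus_point r N (k(j := m)))) / of_nat N)"
    using sum_grid_upd[where N = N and g = "\<lambda>k. f (torus_point r N k)" and j = j] NK
    by (simp add: sum_divide_distrib[symmetric])
  then have "Av r N f - Av r N (\<lambda>x. f (upd x j 0))
     = (\<Sum>k\<in>?K. (\<Sum>m<N. f (torus_point r N (k(j := m)))) / of_nat N - f (upd (torus_point r N k) j 0)) / of_nat (card ?K)"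
    by (simp add: Av_def sum_subtractf diff_divide_distrib)
  also have "norm \<dots> \<le> (\<Sum>k\<in>?K. ?B) / of_nat (card ?K)"
    unfolding norm_divide norm_of_nat by (intro divide_right_mono order_trans[OF norm_sum] sum_mono B) auto
  also have "\<dots> = ?B" using grid_nonempty[OF N, where 'a='n] by simp
  finally show ?thesis .
qed

section \<open>A torus residue\<close>

text \<open>If \<open>y $ k\<close> has no zeros on the \<open>k\<close>-th face, then \<open>h \<mapsto> Av (h * \<Prod> x / \<Prod> y)\<close> is, in the limit,
  the Grothendieck residue of \<open>h\<close> with respect to \<open>y\<close>.\<close>

locale polydisc_system =
  fixes y :: "complex ^ 'n::finite \<Rightarrow> complex ^ 'n" and r R :: real
  assumes r: "0 < r" "r < R"
    and y_poly: "\<And>k. poly_fun (\<lambda>x. y x $ k)"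
    and y_face: "\<And>k x. x \<in> face k r R \<Longrightarrow> y x $ k \<noteq> 0"
begin

definition slab :: "'n \<Rightarrow> (complex ^ 'n) set" where
  "slab j = {x. norm (x $ j) \<le> R \<and> (\<forall>m. m \<noteq> j \<longrightarrow> norm (x $ m) = r)}"

lemma compact_slab: "compact (slab j)"
proof -
  have "slab j = {x. \<forall>m. x $ m \<in> (if m = j then cball 0 R else sphere 0 r)}" by (auto simp: slab_def)
  then show ?thesis using compact_coordinate_bounds[of "\<lambda>m. if m = j then cball 0 R else sphere 0 r"] by simp
qed

lemma slab_face: "x \<in> slab j \<Longrightarrow> m \<noteq> j \<Longrightarrow> x \<in> face m r R"
  using r by (force simp: slab_def face_def)

lemma torus_face: "x \<in> torus r \<Longrightarrow> x \<in> face m r R"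
  using r by (auto simp: torus_def face_def)

lemma Av_rational_replace:
  assumes P: "poly_fun P" and Q: "poly_fun Q" and nz: "\<And>x. x \<in> slab j \<Longrightarrow> Q x \<noteq> 0"
  shows "(\<lambda>N. Av r N (\<lambda>x. P x / Q x) - Av r N (\<lambda>x. P (upd x j 0) / Q (upd x j 0))) \<longlonglongrightarrow> 0"
proof -
  have "continuous_on (slab j) (\<lambda>x. P x / Q x)"
    using nz by (intro continuous_on_divide poly_fun_continuous P Q) auto
  then have "bounded ((\<lambda>x. P x / Q x) ` slab j)"
    using compact_continuous_image compact_slab compact_imp_bounded by blast
  then obtain M where M: "\<And>x. x \<in> slab j \<Longrightarrow> norm (P x / Q x) \<le> M" unfolding bounded_iff by blast
  have us: "upd x j t \<in> slab j" if "x \<in> torus r" "norm t \<le> R" for x t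
    using that by (auto simp: slab_def torus_def)
  have b: "norm (Av r N (\<lambda>x. P x / Q x) - Av r N (\<lambda>x. P (upd x j 0) / Q (upd x j 0))) \<le> M * (r / R) ^ N / (1 - r / R)"
    if N: "N > 0" for N
  proof (rule Av_replace[OF r N])
    fix x :: "complex ^ 'n" assume x: "x \<in> torus r"
    show "(\<lambda>t. P (upd x j t) / Q (upd x j t)) holomorphic_on ball 0 R"
    proof (rule holomorphic_on_divide)
      show "(\<lambda>t. P (upd x j t)) holomorphic_on ball 0 R" "(\<lambda>t. Q (upd x j t)) holomorphic_on ball 0 R"
        by (intro poly_fun_upd_holomorphic P Q)+
      show "Q (upd x j t) \<noteq> 0" if "t \<in> ball 0 R" for t using that us[OF x] nz by simp
    qed
    show "continuous_on (cball 0 R) (\<lambda>t. P (upd x j t) / Q (upd x j t))"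
    proof (rule continuous_on_divide)
      show "continuous_on (cball 0 R) (\<lambda>t. P (upd x j t))" "continuous_on (cball 0 R) (\<lambda>t. Q (upd x j t))"
        by (intro holomorphic_on_imp_continuous_on poly_fun_upd_holomorphic P Q)+
      show "\<forall>t\<in>cball 0 R. Q (upd x j t) \<noteq> 0" using us[OF x] nz by simp
    qed
    show "norm (P (upd x j t) / Q (upd x j t)) \<le> M" if "norm t \<le> R" for t by (rule M[OF us[OF x that]])
  qed
  have "(\<lambda>N. M * (r / R) ^ N / (1 - r / R)) \<longlonglongrightarrow> M * 0 / (1 - r / R)"
    using r by (intro tendsto_intros LIMSEQ_power_zero) auto
  then have "(\<lambda>N. M * (r / R) ^ N / (1 - r / R)) \<longlonglongrightarrow> 0" by simp
  moreover have "\<forall>\<^sub>F N in sequentially. norm (Av r N (\<lambda>x. P x / Q x) - Av r N (\<lambda>x. P (upd x j 0) / Q (upd x j 0)))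
      \<le> M * (r / R) ^ N / (1 - r / R)"
    using eventually_gt_at_top[of 0] by eventually_elim (rule b)
  ultimately show ?thesis by (rule Lim_null_comparison[rotated])
qed

lemma Av_rational_kill:
  assumes P: "poly_fun P" and Q: "poly_fun Q" and nz: "\<And>x. x \<in> slab j \<Longrightarrow> Q x \<noteq> 0"
  shows "(\<lambda>N. Av r N (\<lambda>x. x $ j * P x / Q x)) \<longlonglongrightarrow> 0"
proof -
  have "Av r N (\<lambda>x :: complex ^ 'n. 0) = 0" for N by (simp add: Av_def)
  then show ?thesis
    using Av_rational_replace[of "\<lambda>x. x $ j * P x" Q j] P Q nz by simp
qed

definition res :: "nat \<Rightarrow> (complex ^ 'n \<Rightarrow> complex) \<Rightarrow> complex" where
  "res N h = Av r N (\<lambda>x. h x * (\<Prod>i\<in>UNIV. x $ i) / (\<Prod>i\<in>UNIV. y x $ i))"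

definition null :: "(complex ^ 'n \<Rightarrow> complex) \<Rightarrow> bool" where
  "null f \<longleftrightarrow> poly_fun f \<and> (\<forall>h. poly_fun h \<longrightarrow> (\<lambda>N. res N (\<lambda>x. h x * f x)) \<longlonglongrightarrow> 0)"

lemma null_mult: "poly_fun p \<Longrightarrow> null f \<Longrightarrow> null (\<lambda>x. p x * f x)"
  unfolding null_def
proof (intro conjI allI impI)
  assume p: "poly_fun p" and f: "poly_fun f \<and> (\<forall>h. poly_fun h \<longrightarrow> (\<lambda>N. res N (\<lambda>x. h x * f x)) \<longlonglongrightarrow> 0)"
  show "poly_fun (\<lambda>x. p x * f x)" using p f by simp
  fix h :: "complex ^ 'n \<Rightarrow> complex" assume "poly_fun h"
  then have "poly_fun (\<lambda>x. h x * p x)" using p by simp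
  then have "(\<lambda>N. res N (\<lambda>x. (h x * p x) * f x)) \<longlonglongrightarrow> 0" using f by blast
  then show "(\<lambda>N. res N (\<lambda>x. h x * (p x * f x))) \<longlonglongrightarrow> 0" by (simp add: mult.assoc)
qed

lemma null_add: "null f \<Longrightarrow> null g \<Longrightarrow> null (\<lambda>x. f x + g x)"
  unfolding null_def
proof (intro conjI allI impI)
  assume f: "poly_fun f \<and> (\<forall>h. poly_fun h \<longrightarrow> (\<lambda>N. res N (\<lambda>x. h x * f x)) \<longlonglongrightarrow> 0)"
    and g: "poly_fun g \<and> (\<forall>h. poly_fun h \<longrightarrow> (\<lambda>N. res N (\<lambda>x. h x * g x)) \<longlonglongrightarrow> 0)"
  show "poly_fun (\<lambda>x. f x + g x)" using f g by simp
  fix h :: "complex ^ 'n \<Rightarrow> complex" assume h: "poly_fun h"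
  have "(\<lambda>N. res N (\<lambda>x. h x * f x) + res N (\<lambda>x. h x * g x)) \<longlonglongrightarrow> 0 + 0"
    using f g h by (intro tendsto_add) auto
  moreover have "res N (\<lambda>x. h x * f x) + res N (\<lambda>x. h x * g x) = res N (\<lambda>x. h x * (f x + g x))" for N
    unfolding res_def Av_add[symmetric] by (simp add: algebra_simps add_divide_distrib)
  ultimately show "(\<lambda>N. res N (\<lambda>x. h x * (f x + g x))) \<longlonglongrightarrow> 0" by simp
qed

lemma null_zero: "null (\<lambda>x. 0)"
  unfolding null_def res_def by (simp add: Av_def)

lemma null_sum: "(\<And>i. i \<in> I \<Longrightarrow> null (f i)) \<Longrightarrow> null (\<lambda>x. \<Sum>i\<in>I. f i x)"
  by (induction I rule: infinite_finite_induct) (simp_all add: null_zero null_add)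

lemma null_minus: "null f \<Longrightarrow> null (\<lambda>x. - f x)"
  using null_mult[of "\<lambda>_. -1" f] by simp

lemma null_diff: "null f \<Longrightarrow> null g \<Longrightarrow> null (\<lambda>x. f x - g x)"
  using null_add[of f "\<lambda>x. - g x"] null_minus[of g] by simp

lemma null_y: "null (\<lambda>x. y x $ k)"
  unfolding null_def
proof (intro conjI allI impI y_poly)
  fix h :: "complex ^ 'n \<Rightarrow> complex" assume h: "poly_fun h"
  define Q where "Q x = (\<Prod>i\<in>UNIV-{k}. y x $ i)" for x
  have Q: "poly_fun Q" unfolding Q_def by (intro poly_fun_prod y_poly)
  have nz: "Q x \<noteq> 0" if "x \<in> slab k" for x using y_face slab_face[OF that] by (simp add: Q_def)
  have hP: "poly_fun (\<lambda>x. h x * (\<Prod>i\<in>UNIV-{k}. x $ i))" using h by simp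
  have "res N (\<lambda>x. h x * y x $ k) = Av r N (\<lambda>x. x $ k * (h x * (\<Prod>i\<in>UNIV-{k}. x $ i)) / Q x)" for N
    unfolding res_def
  proof (rule Av_cong)
    fix x :: "complex ^ 'n" assume x: "x \<in> torus r"
    have "y x $ k \<noteq> 0" using y_face torus_face[OF x] by blast
    then show "h x * y x $ k * (\<Prod>i\<in>UNIV. x $ i) / (\<Prod>i\<in>UNIV. y x $ i) = x $ k * (h x * (\<Prod>i\<in>UNIV-{k}. x $ i)) / Q x"
      by (simp add: Q_def prod.remove[of UNIV k])
  qed (use r in simp)
  then show "(\<lambda>N. res N (\<lambda>x. h x * y x $ k)) \<longlonglongrightarrow> 0" using Av_rational_kill[OF hP Q nz] by simp
qed

lemma null_syzygy:
  assumes Y: "\<And>k. poly_fun (\<lambda>x. Y x $ k)" and syz: "\<And>x. cdot (y x) (Y x) = 0"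
  shows "null (\<lambda>x. Y x $ i)"
  unfolding null_def
proof (intro conjI allI impI Y)
  fix h :: "complex ^ 'n \<Rightarrow> complex" assume h: "poly_fun h"
  define Q where "Q k x = y x $ i * (\<Prod>m\<in>UNIV-{k}. y x $ m)" for k x
  define P where "P k x = - (h x * Y x $ k * (\<Prod>m\<in>UNIV-{k}. x $ m))" for k x
  have Q: "poly_fun (Q k)" for k
    using poly_fun_mult[OF y_poly[of i] poly_fun_prod[of "UNIV-{k}" "\<lambda>m x. y x $ m", OF y_poly]]
    by (simp add: Q_def[abs_def])
  have P: "poly_fun (P k)" for k unfolding P_def[abs_def] using h Y by simp
  have nz: "Q k x \<noteq> 0" if "x \<in> slab k" "k \<noteq> i" for x k
    using y_face slab_face[OF that(1)] that(2) by (auto simp: Q_def)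
  have "res N (\<lambda>x. h x * Y x $ i) = (\<Sum>k\<in>UNIV-{i}. Av r N (\<lambda>x. x $ k * P k x / Q k x))" for N
  proof -
    have "res N (\<lambda>x. h x * Y x $ i) = Av r N (\<lambda>x. \<Sum>k\<in>UNIV-{i}. x $ k * P k x / Q k x)"
      unfolding res_def
    proof (rule Av_cong)
      fix x :: "complex ^ 'n" assume x: "x \<in> torus r"
      have yn: "y x $ k \<noteq> 0" for k using y_face torus_face[OF x] by blast
      have pn: "(\<Prod>m\<in>UNIV. y x $ m) \<noteq> 0" using yn by simp
      have t: "x $ k * P k x / Q k x = - (h x * (\<Prod>m\<in>UNIV. x $ m) / (y x $ i * (\<Prod>m\<in>UNIV. y x $ m))) * (y x $ k * Y x $ k)" for k
      proof -
        have "(\<Prod>m\<in>UNIV. y x $ m) = y x $ k * (\<Prod>m\<in>UNIV-{k}. y x $ m)"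
          "(\<Prod>m\<in>UNIV. x $ m) = x $ k * (\<Prod>m\<in>UNIV-{k}. x $ m)" by (simp_all add: prod.remove[of UNIV k])
        then show ?thesis using yn pn by (simp add: P_def Q_def)
      qed
      have "(\<Sum>k\<in>UNIV-{i}. y x $ k * Y x $ k) = - (y x $ i * Y x $ i)"
        using syz[of x] sum.remove[of UNIV i "\<lambda>k. y x $ k * Y x $ k"] by (simp add: cdot_def eq_neg_iff_add_eq_0 add.commute)
      then have "(\<Sum>k\<in>UNIV-{i}. x $ k * P k x / Q k x)
          = - (h x * (\<Prod>m\<in>UNIV. x $ m) / (y x $ i * (\<Prod>m\<in>UNIV. y x $ m))) * (- (y x $ i * Y x $ i))"
        unfolding t sum_distrib_left[symmetric] by simp
      also have "\<dots> = h x * Y x $ i * (\<Prod>i\<in>UNIV. x $ i) / (\<Prod>i\<in>UNIV. y x $ i)" using yn by simp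
      finally show "h x * Y x $ i * (\<Prod>i\<in>UNIV. x $ i) / (\<Prod>i\<in>UNIV. y x $ i) = (\<Sum>k\<in>UNIV-{i}. x $ k * P k x / Q k x)" by simp
    qed (use r in simp)
    also have "\<dots> = (\<Sum>k\<in>UNIV-{i}. Av r N (\<lambda>x. x $ k * P k x / Q k x))"
      by (simp add: Av_def sum_divide_distrib sum.swap[of _ "UNIV-{i}"])
    finally show ?thesis .
  qed
  moreover have "(\<lambda>N. \<Sum>k\<in>UNIV-{i}. Av r N (\<lambda>x. x $ k * P k x / Q k x)) \<longlonglongrightarrow> (\<Sum>k\<in>UNIV-{i}. 0)"
    by (intro tendsto_sum Av_rational_kill P Q nz) auto
  ultimately show "(\<lambda>N. res N (\<lambda>x. h x * Y x $ i)) \<longlonglongrightarrow> 0" by simp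
qed

definition restr :: "'n set \<Rightarrow> complex ^ 'n \<Rightarrow> complex ^ 'n" where
  "restr S x = (\<chi> j. if j \<in> S then x $ j else 0)"

text \<open>The residue of \<open>det M\<close>, for \<open>M x *v x = y x\<close>, is computed one variable at a time: by Cramer's rule
  only the \<open>i\<close>-th component of \<open>y\<close> contributes, it cancels, and what remains is holomorphic in \<open>x $ i\<close>.\<close>

lemma res_det:
  assumes M: "\<And>a b. poly_fun (\<lambda>x. M x $ a $ b)" and My: "\<And>x. M x *v x = y x" and u: "poly_fun u"
  shows "(\<lambda>N. res N (\<lambda>x. u x * det (M x))) \<longlonglongrightarrow> u 0"
proof -
  define MS where "MS S x = (\<chi> a b. if b \<in> S then M (restr S x) $ a $ b else if a = b then 1 else 0)" for S x
  define G where "G S x = u (restr S x) * det (MS S x) * (\<Prod>i\<in>S. x $ i) / (\<Prod>i\<in>S. y (restr S x) $ i)" for S x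
  have rp: "poly_fun (\<lambda>x. restr S x $ k)" for S k by (cases "k \<in> S") (simp_all add: restr_def)
  have Mp: "poly_fun (\<lambda>x. M (restr S x) $ a $ b)" for S a b
    using poly_fun_compose[OF M[of a b] rp] by simp
  have up: "poly_fun (\<lambda>x. u (restr S x))" for S using poly_fun_compose[OF u rp] by simp
  have yp: "poly_fun (\<lambda>x. y (restr S x) $ k)" for S k using poly_fun_compose[OF y_poly rp] by simp
  have MSp: "poly_fun (\<lambda>x. MS S x $ a $ b)" for S a b
    using Mp by (cases "b \<in> S") (simp_all add: MS_def)
  have rf: "restr S x \<in> face m r R" if "x \<in> face m r R" "m \<in> S" for S x m
    using that r by (auto simp: restr_def face_def)
  have "(\<lambda>N. Av r N (G S)) \<longlonglongrightarrow> u 0" if "finite S" for S :: "'n set"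
    using that
  proof induction
    case empty
    have "MS {} x = mat 1" for x by (simp add: MS_def mat_def)
    moreover have "restr {} x = 0" for x by (simp add: restr_def vec_eq_iff)
    ultimately have G: "G {} = (\<lambda>x. u 0)" by (simp add: G_def[abs_def])
    have "\<forall>\<^sub>F N in sequentially. Av r N (G {}) = u 0"
      using eventually_gt_at_top[of "0 :: nat"] unfolding G by eventually_elim (rule Av_const)
    then show ?case by (rule tendsto_eventually)
  next
    case (insert i S)
    let ?S = "insert i S"
    define D where "D k x = det (repl_col (MS ?S x) i (axis k 1))" for k x
    have Dp: "poly_fun (D k)" for k unfolding D_def[abs_def]
    proof (rule poly_fun_det)
      fix a b show "poly_fun (\<lambda>x. repl_col (MS ?S x) i (axis k 1) $ a $ b)"
        using MSp by (cases "b = i") (simp_all add: repl_col_def)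
    qed
    define P where "P k x = u (restr ?S x) * D k x * (\<Prod>m\<in>S-{k}. x $ m)" for k x
    define Q where "Q k x = (\<Prod>m\<in>?S-{k}. y (restr ?S x) $ m)" for k x
    have Pp: "poly_fun (P k)" for k unfolding P_def[abs_def] using up Dp by simp
    have Qp: "poly_fun (Q k)" for k unfolding Q_def[abs_def] using yp by simp
    have Qn: "Q k x \<noteq> 0" if "x \<in> slab k" for k x
      using y_face rf slab_face[OF that] insert.hyps by (simp add: Q_def)
    have Dk0: "D k x = 0" if "k \<notin> ?S" for k x
    proof -
      have ki: "k \<noteq> i" using that by auto
      have "column k (repl_col (MS ?S x) i (axis k 1)) = column i (repl_col (MS ?S x) i (axis k 1))"
        using that ki by (simp add: column_def repl_col_def MS_def vec_eq_iff axis_def)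
      then show ?thesis unfolding D_def using ki by (intro det_identical_columns[OF ki])
    qed
    have eq: "G ?S x = P i x / Q i x + (\<Sum>k\<in>S. x $ k * P k x / Q k x)" if x: "x \<in> torus r" for x
    proof -
      let ?X = "restr ?S x"
      have yn: "y ?X $ m \<noteq> 0" if "m \<in> ?S" for m using y_face rf[OF torus_face[OF x] that] by blast
      have "MS ?S x *v ?X = y ?X"
      proof -
        have "(MS ?S x *v ?X) $ a = (M ?X *v ?X) $ a" for a
          unfolding matrix_vector_mult_def vec_lambda_beta
          by (intro sum.cong refl) (auto simp: MS_def restr_def)
        then show ?thesis by (simp add: vec_eq_iff My)
      qed
      then have "?X $ i * det (MS ?S x) = det (repl_col (MS ?S x) i (y ?X))" using cramer_repl_col[of "MS ?S x" i ?X] by simp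
      also have "\<dots> = (\<Sum>k\<in>UNIV. y ?X $ k * D k x)" unfolding D_def by (rule det_repl_col_expand)
      also have "\<dots> = (\<Sum>k\<in>?S. y ?X $ k * D k x)" using Dk0 by (intro sum.mono_neutral_right) auto
      finally have c: "x $ i * det (MS ?S x) = (\<Sum>k\<in>?S. y ?X $ k * D k x)" by (simp add: restr_def)
      have "G ?S x = u ?X * (x $ i * det (MS ?S x)) * (\<Prod>m\<in>S. x $ m) / (\<Prod>m\<in>?S. y ?X $ m)"
        using insert.hyps by (simp add: G_def)
      also have "\<dots> = (\<Sum>k\<in>?S. u ?X * (y ?X $ k * D k x) * (\<Prod>m\<in>S. x $ m) / (\<Prod>m\<in>?S. y ?X $ m))"
        unfolding c by (simp only: sum_distrib_left sum_distrib_right sum_divide_distrib)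
      also have "\<dots> = (\<Sum>k\<in>?S. u ?X * D k x * (\<Prod>m\<in>S. x $ m) / Q k x)"
      proof (rule sum.cong[OF refl])
        fix k assume k: "k \<in> ?S"
        have "(\<Prod>m\<in>?S. y ?X $ m) = y ?X $ k * Q k x" unfolding Q_def using k insert.hyps by (intro prod.remove) auto
        then show "u ?X * (y ?X $ k * D k x) * (\<Prod>m\<in>S. x $ m) / (\<Prod>m\<in>?S. y ?X $ m)
            = u ?X * D k x * (\<Prod>m\<in>S. x $ m) / Q k x" using yn[OF k] by simp
      qed
      also have "\<dots> = u ?X * D i x * (\<Prod>m\<in>S. x $ m) / Q i x + (\<Sum>k\<in>S. u ?X * D k x * (\<Prod>m\<in>S. x $ m) / Q k x)"
        using insert.hyps by simp
      also have "u ?X * D i x * (\<Prod>m\<in>S. x $ m) / Q i x = P i x / Q i x" using insert.hyps by (simp add: P_def)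
      also have "(\<Sum>k\<in>S. u ?X * D k x * (\<Prod>m\<in>S. x $ m) / Q k x) = (\<Sum>k\<in>S. x $ k * P k x / Q k x)"
      proof (rule sum.cong[OF refl])
        fix k assume k: "k \<in> S"
        have "(\<Prod>m\<in>S. x $ m) = x $ k * (\<Prod>m\<in>S-{k}. x $ m)" using k insert.hyps by (intro prod.remove) auto
        then show "u ?X * D k x * (\<Prod>m\<in>S. x $ m) / Q k x = x $ k * P k x / Q k x" by (simp add: P_def)
      qed
      finally show ?thesis .
    qed
    have G0: "P i (upd x i 0) / Q i (upd x i 0) = G S x" for x
    proof -
      have ru: "restr ?S (upd x i 0) = restr S x" using insert.hyps by (auto simp: restr_def vec_eq_iff)
      have "repl_col (MS ?S (upd x i 0)) i (axis i 1) = MS S x"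
        using insert.hyps by (auto simp: repl_col_def MS_def ru vec_eq_iff axis_def)
      then have "D i (upd x i 0) = det (MS S x)" by (simp add: D_def)
      moreover have "(\<Prod>m\<in>S-{i}. upd x i 0 $ m) = (\<Prod>m\<in>S. x $ m)" using insert.hyps by (intro prod.cong) auto
      moreover have "Q i (upd x i 0) = (\<Prod>m\<in>S. y (restr S x) $ m)" using insert.hyps by (simp add: Q_def ru)
      ultimately show ?thesis by (simp add: P_def G_def ru)
    qed
    have "Av r N (G ?S) = (Av r N (\<lambda>x. P i x / Q i x) - Av r N (\<lambda>x. P i (upd x i 0) / Q i (upd x i 0)))
        + (\<Sum>k\<in>S. Av r N (\<lambda>x. x $ k * P k x / Q k x)) + Av r N (G S)" for N
    proof -
      have "Av r N (G ?S) = Av r N (\<lambda>x. P i x / Q i x + (\<Sum>k\<in>S. x $ k * P k x / Q k x))"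
        using r eq by (intro Av_cong) auto
      also have "\<dots> = Av r N (\<lambda>x. P i x / Q i x) + Av r N (\<lambda>x. \<Sum>k\<in>S. x $ k * P k x / Q k x)" by (rule Av_add)
      also have "Av r N (\<lambda>x. \<Sum>k\<in>S. x $ k * P k x / Q k x) = (\<Sum>k\<in>S. Av r N (\<lambda>x. x $ k * P k x / Q k x))"
        by (simp add: Av_def sum_divide_distrib sum.swap[of _ S])
      finally show ?thesis by (simp add: G0)
    qed
    moreover have "(\<lambda>N. (Av r N (\<lambda>x. P i x / Q i x) - Av r N (\<lambda>x. P i (upd x i 0) / Q i (upd x i 0)))
        + (\<Sum>k\<in>S. Av r N (\<lambda>x. x $ k * P k x / Q k x)) + Av r N (G S)) \<longlonglongrightarrow> 0 + (\<Sum>k\<in>S. 0) + u 0"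
      by (intro tendsto_add tendsto_sum Av_rational_replace Av_rational_kill insert.IH Pp Qp Qn) auto
    ultimately show ?case by simp
  qed
  then have "(\<lambda>N. Av r N (G UNIV)) \<longlonglongrightarrow> u 0" by simp
  moreover have "G UNIV = (\<lambda>x. u x * det (M x) * (\<Prod>i\<in>UNIV. x $ i) / (\<Prod>i\<in>UNIV. y x $ i))"
  proof -
    have "restr UNIV x = x" "MS UNIV x = M x" for x by (simp_all add: restr_def MS_def vec_eq_iff)
    then show ?thesis by (simp add: G_def[abs_def])
  qed
  ultimately show ?thesis by (simp add: res_def)
qed

end

section \<open>Syzygies at an isolated zero\<close>

lemma poly_fun_hadamard:
  fixes p :: "complex ^ 'n::finite \<Rightarrow> complex"
  assumes "poly_fun p"
  shows "\<exists>q. (\<forall>k. poly_fun (\<lambda>x. q x $ k)) \<and> (\<forall>x. p x = p 0 + cdot (q x) x) \<and> grad p 0 = q 0"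
proof -
  have "\<exists>q. (\<forall>k. poly_fun (\<lambda>x. q x $ k)) \<and> (\<forall>x. p x = p 0 + cdot (q x) x)" using assms
  proof (induction rule: poly_fun_induct)
    case (const c)
    show ?case by (rule exI[of _ "\<lambda>_. 0"]) simp
  next
    case (coord k)
    show ?case by (rule exI[of _ "\<lambda>_. axis k 1"]) simp
  next
    case (add p q)
    then obtain p' q' where *: "\<And>k. poly_fun (\<lambda>x. p' x $ k)" "\<And>x. p x = p 0 + cdot (p' x) x"
      "\<And>k. poly_fun (\<lambda>x. q' x $ k)" "\<And>x. q x = q 0 + cdot (q' x) x" by blast
    have A: "p x + q x = p 0 + q 0 + cdot (p' x + q' x) x" for x
    proof -
      have "p x + q x = (p 0 + cdot (p' x) x) + (q 0 + cdot (q' x) x)" by (rule arg_cong2[where f = "(+)", OF *(2) *(4)])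
      then show ?thesis by (simp add: cdot_add_left)
    qed
    have B: "\<forall>k. poly_fun (\<lambda>x. (p' x + q' x) $ k)" using *(1,3) by simp
    show ?case by (rule exI[of _ "\<lambda>x. p' x + q' x"], rule conjI[OF B], rule allI, rule A)
  next
    case (mult p q)
    then obtain p' q' where *: "\<And>k. poly_fun (\<lambda>x. p' x $ k)" "\<And>x. p x = p 0 + cdot (p' x) x"
      "\<And>k. poly_fun (\<lambda>x. q' x $ k)" "\<And>x. q x = q 0 + cdot (q' x) x" by blast
    have A: "p x * q x = p 0 * q 0 + cdot (p x *s q' x + q 0 *s p' x) x" for x
    proof -
      have "p x * q x = p x * (q 0 + cdot (q' x) x)" by (simp only: *(4)[of x, symmetric])
      also have "\<dots> = q 0 * (p 0 + cdot (p' x) x) + p x * cdot (q' x) x"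
        by (simp only: *(2)[of x, symmetric]) (simp add: distrib_left mult.commute)
      also have "\<dots> = p 0 * q 0 + cdot (p x *s q' x + q 0 *s p' x) x"
        by (simp add: cdot_add_left cdot_scale_left distrib_left mult.commute)
      finally show ?thesis .
    qed
    have B: "\<forall>k. poly_fun (\<lambda>x. (p x *s q' x + q 0 *s p' x) $ k)" using *(1,3) mult(1,2) by simp
    show ?case by (rule exI[of _ "\<lambda>x. p x *s q' x + q 0 *s p' x"], rule conjI[OF B], rule allI, rule A)
  qed
  then obtain q where q: "\<And>k. poly_fun (\<lambda>x. q x $ k)" "\<And>x. p x = p 0 + cdot (q x) x" by blast
  define c where "c = p 0"
  have p: "p = (\<lambda>x. c + (\<Sum>k\<in>UNIV. q x $ k * x $ k))"
  proof (rule ext)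
    fix x show "p x = c + (\<Sum>k\<in>UNIV. q x $ k * x $ k)" using q(2)[of x] unfolding c_def cdot_def .
  qed
  have "pd j (\<lambda>x. c + (\<Sum>k\<in>UNIV. q x $ k * x $ k)) 0 = q 0 $ j" for j
    by (simp add: pd_add pd_sum pd_mult q(1) mult_delta_right)
  then have "grad p 0 = q 0" by (simp add: vec_eq_iff p)
  then show ?thesis using q by blast
qed

lemma poly_fun_hadamard0:
  fixes p :: "complex ^ 'n::finite \<Rightarrow> complex"
  assumes "poly_fun p" "p 0 = 0"
  shows "\<exists>q. (\<forall>k. poly_fun (\<lambda>x. q x $ k)) \<and> (\<forall>x. p x = cdot (q x) x) \<and> grad p 0 = q 0"
  using poly_fun_hadamard[OF assms(1)] unfolding assms(2) add_0 .

locale isolated_zero =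
  fixes a :: "complex ^ 'n::finite \<Rightarrow> complex ^ 'n" and \<epsilon> :: real
  assumes a_poly: "\<And>k. poly_fun (\<lambda>x. a x $ k)" and a_0: "a 0 = 0"
    and eps: "0 < \<epsilon>" and iso: "\<And>x. x \<noteq> 0 \<Longrightarrow> norm x < \<epsilon> \<Longrightarrow> a x \<noteq> 0"
begin

lemma ex_polydisc_system:
  "\<exists>C y r R. polydisc_system y r R \<and> (\<forall>i k. poly_fun (\<lambda>x. C x $ i $ k)) \<and> (\<forall>x. y x = C x *v a x)"
proof -
  define R where "R = \<epsilon> / (2 * real CARD('n))"
  define r where "r = R / 2"
  have R: "0 < R" "real CARD('n) * R < \<epsilon>" using eps by (auto simp: R_def)
  have r: "0 < r" "r < R" "r \<le> R" using R by (auto simp: r_def)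
  have nz: "a x \<noteq> 0" if x: "x \<in> face i r R" for i x
  proof -
    have b: "norm (x $ j) \<le> R" for j using x r by (cases "j = i") (auto simp: face_def)
    have "norm x \<le> (\<Sum>j\<in>UNIV. norm (x $ j))" by (rule norm_le_sum_components)
    also have "\<dots> \<le> real CARD('n) * R" using sum_bounded_above[of UNIV "\<lambda>j. norm (x $ j)" R] b by simp
    finally have "norm x < \<epsilon>" using R by simp
    moreover have "x \<noteq> 0" using x r by (auto simp: face_def)
    ultimately show ?thesis by (intro iso)
  qed
  have "\<exists>H :: complex ^ 'n \<Rightarrow> complex ^ 'n. (\<forall>k. poly_fun (\<lambda>x. H x $ k)) \<and> (\<forall>x\<in>face i r R. cdot (H x) (a x) \<noteq> 0)" for i
  proof -
    interpret laurent_face i r R using r by unfold_locales auto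
    show ?thesis using no_common_zero_combination[OF a_poly nz] .
  qed
  then have "\<forall>i. \<exists>H :: complex ^ 'n \<Rightarrow> complex ^ 'n. (\<forall>k. poly_fun (\<lambda>x. H x $ k)) \<and> (\<forall>x\<in>face i r R. cdot (H x) (a x) \<noteq> 0)"
    by blast
  from choice[OF this] obtain H where H: "\<And>i k. poly_fun (\<lambda>x. H i x $ k)" "\<And>i x. x \<in> face i r R \<Longrightarrow> cdot (H i x) (a x) \<noteq> 0"
    by blast
  define C where "C x = (\<chi> i. H i x)" for x
  have Ca: "(C x *v a x) $ i = cdot (H i x) (a x)" for x i
    by (simp add: C_def matrix_vector_mult_def cdot_def)
  have Cp: "poly_fun (\<lambda>x. C x $ i $ k)" for i k using H(1) by (simp add: C_def)
  have "polydisc_system (\<lambda>x. C x *v a x) r R"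
  proof
    show "poly_fun (\<lambda>x. (C x *v a x) $ k)" for k by (intro poly_fun_matrix_vector Cp a_poly)
    show "(C x *v a x) $ k \<noteq> 0" if "x \<in> face k r R" for k x using H(2)[OF that] by (simp add: Ca)
  qed (use r in auto)
  then show ?thesis using Cp by blast
qed

text \<open>By local duality \<open>X\<close> has components in the ideal of the components of \<open>a\<close>, hence a linear part
  depending only on the linear part of \<open>a\<close>.  Rather than proving membership, the residue detects the
  failure of the second statement: it kills \<open>det C\<close> times the ideal generated by \<open>a\<close> and \<open>X\<close>, but
  if a component of \<open>X\<close> had a non-zero derivative in a direction \<open>e\<close> in which that of \<open>a\<close> vanishes,
  this ideal would contain, up to a unit, \<open>det T\<close> for \<open>a x = T x *v x\<close>.\<close>

lemma syzygy_axis: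
  assumes X: "\<And>k. poly_fun (\<lambda>x. X x $ k)" and syz: "\<And>x. cdot (a x) (X x) = 0"
  shows "X 0 $ i = 0" and "(\<And>j. pd e (\<lambda>x. a x $ j) 0 = 0) \<Longrightarrow> pd e (\<lambda>x. X x $ i) 0 = 0"
proof -
  obtain C y r R where "polydisc_system y r R" and Cp: "\<And>i k. poly_fun (\<lambda>x. C x $ i $ k)"
    and y: "\<And>x. y x = C x *v a x" using ex_polydisc_system by blast
  then interpret polydisc_system y r R by simp
  define Z where "Z f \<longleftrightarrow> null (\<lambda>x. det (C x) * f x)" for f
  have dC: "poly_fun (\<lambda>x. det (C x))" by (intro poly_fun_det Cp)
  have Z_mult: "Z (\<lambda>x. h x * f x)" if "poly_fun h" "Z f" for h f
    using null_mult[of h "\<lambda>x. det (C x) * f x"] that by (simp add: Z_def mult.left_commute)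
  have Z_mult': "Z (\<lambda>x. f x * h x)" if "poly_fun h" "Z f" for h f
    using Z_mult[OF that] by (simp add: mult.commute)
  have Z_add: "Z (\<lambda>x. f x + g x)" if "Z f" "Z g" for f g
    using null_add[of "\<lambda>x. det (C x) * f x" "\<lambda>x. det (C x) * g x"] that by (simp add: Z_def distrib_left)
  have Z_diff: "Z (\<lambda>x. f x - g x)" if "Z f" "Z g" for f g
    using null_diff[of "\<lambda>x. det (C x) * f x" "\<lambda>x. det (C x) * g x"] that by (simp add: Z_def right_diff_distrib)
  have Z_sum: "Z (\<lambda>x. \<Sum>i\<in>I. f i x)" if "\<And>i. i \<in> I \<Longrightarrow> Z (f i)" for I :: "'n set" and f
    using null_sum[of I "\<lambda>i x. det (C x) * f i x"] that by (simp add: Z_def sum_distrib_left)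
  have rcp: "poly_fun (\<lambda>x. repl_col (A x) j (axis k 1) $ p $ q)"
    if "\<And>p q. poly_fun (\<lambda>x. A x $ p $ q)" for A :: "complex ^ 'n \<Rightarrow> complex ^ 'n ^ 'n" and j k p q
    using that by (cases "q = j") (simp_all add: repl_col_def)
  have Za: "Z (\<lambda>x. a x $ j)" for j
  proof -
    have "det (C x) * a x $ j = (\<Sum>k\<in>UNIV. det (repl_col (C x) j (axis k 1)) * y x $ k)" for x
      using cramer_repl_col[of "C x" j "a x"] det_repl_col_expand[of "C x" j "C x *v a x"]
      by (simp add: y mult.commute)
    then show ?thesis unfolding Z_def
      by (simp only:) (intro null_sum null_mult null_y poly_fun_det rcp Cp)
  qed
  have ZX: "Z (\<lambda>x. X x $ k)" for k
  proof -
    define Y where "Y x = (\<chi> i. det (\<chi> a b. if a = i then X x $ b else C x $ a $ b))" for x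
    have Yp: "poly_fun (\<lambda>x. Y x $ i)" for i
    proof -
      have "poly_fun (\<lambda>x. (\<chi> a b. if a = i then X x $ b else C x $ a $ b) $ p $ q)" for p q
        using X Cp by (cases "p = i") simp_all
      then show ?thesis unfolding Y_def by (simp add: poly_fun_det)
    qed
    have adj: "(\<Sum>i\<in>UNIV. C x $ i $ k * Y x $ i) = det (C x) * X x $ k" for x k
      unfolding Y_def by (simp add: adjugate_identity)
    have "cdot (y x) (Y x) = 0" for x
    proof -
      have "cdot (y x) (Y x) = (\<Sum>i\<in>UNIV. (\<Sum>k\<in>UNIV. C x $ i $ k * a x $ k) * Y x $ i)"
        by (simp add: cdot_def y matrix_vector_mult_def)
      also have "\<dots> = (\<Sum>i\<in>UNIV. \<Sum>k\<in>UNIV. a x $ k * (C x $ i $ k * Y x $ i))"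
        by (simp only: sum_distrib_right) (simp only: mult_ac)
      also have "\<dots> = (\<Sum>k\<in>UNIV. a x $ k * (\<Sum>i\<in>UNIV. C x $ i $ k * Y x $ i))"
        by (subst sum.swap) (simp add: sum_distrib_left)
      also have "\<dots> = det (C x) * cdot (a x) (X x)"
        unfolding adj by (simp add: cdot_def sum_distrib_left mult.left_commute)
      finally show ?thesis by (simp add: syz)
    qed
    then have "null (\<lambda>x. Y x $ i)" for i by (intro null_syzygy Yp)
    then show ?thesis unfolding Z_def adj[symmetric] by (intro null_sum null_mult Cp)
  qed
  have "\<exists>q. (\<forall>k. poly_fun (\<lambda>x. q x $ k)) \<and> (\<forall>x. a x $ j = cdot (q x) x) \<and> grad (\<lambda>x. a x $ j) 0 = q 0" for j
    by (rule poly_fun_hadamard0[OF a_poly]) (simp add: a_0)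
  then have "\<forall>j. \<exists>q. (\<forall>k. poly_fun (\<lambda>x. q x $ k)) \<and> (\<forall>x. a x $ j = cdot (q x) x) \<and> grad (\<lambda>x. a x $ j) 0 = q 0"
    by blast
  from choice[OF this] obtain t where t: "\<And>j k. poly_fun (\<lambda>x. t j x $ k)" "\<And>j x. a x $ j = cdot (t j x) x"
    "\<And>j. grad (\<lambda>x. a x $ j) 0 = t j 0" by blast
  define T where "T x = (\<chi> j. t j x)" for x
  have Tp: "poly_fun (\<lambda>x. T x $ j $ k)" for j k using t(1) by (simp add: T_def)
  have Tx: "T x *v x = a x" for x by (simp add: T_def vec_eq_iff matrix_vector_mult_def t(2) cdot_def)
  have unit: "u 0 = 0" if u: "poly_fun u" and Zu: "Z (\<lambda>x. u x * det (T x))" for u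
  proof -
    have L1: "(\<lambda>N. res N (\<lambda>x. u x * det (C x ** T x))) \<longlonglongrightarrow> u 0"
    proof (rule res_det[OF _ _ u])
      show "poly_fun (\<lambda>x. (C x ** T x) $ p $ q)" for p q using Cp Tp by (simp add: matrix_matrix_mult_def)
      show "(C x ** T x) *v x = y x" for x by (simp add: y Tx flip: matrix_vector_mul_assoc)
    qed
    have L2: "(\<lambda>N. res N (\<lambda>x. 1 * (det (C x) * (u x * det (T x))))) \<longlonglongrightarrow> 0"
    proof -
      have "\<forall>h. poly_fun h \<longrightarrow> (\<lambda>N. res N (\<lambda>x. h x * (det (C x) * (u x * det (T x))))) \<longlonglongrightarrow> 0"
        using Zu unfolding Z_def null_def by blast
      from this[rule_format, OF poly_fun_const] show ?thesis .
    qed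
    have eq: "(\<lambda>x. 1 * (det (C x) * (u x * det (T x)))) = (\<lambda>x. u x * det (C x ** T x))"
      by (rule ext) (simp add: det_mul)
    show ?thesis by (rule LIMSEQ_unique[OF L1 L2[unfolded eq]])
  qed
  have X0: "X 0 $ k = 0" for k
    by (rule unit[OF X Z_mult'[OF poly_fun_det[of T, OF Tp] ZX]])
  show "X 0 $ i = 0" by (rule X0)
  assume ae: "\<And>j. pd e (\<lambda>x. a x $ j) 0 = 0"
  show "pd e (\<lambda>x. X x $ i) 0 = 0"
  proof (rule ccontr)
    assume ne: "pd e (\<lambda>x. X x $ i) 0 \<noteq> 0"
    define g where "g x = X x $ i" for x
    have gp: "poly_fun g" unfolding g_def[abs_def] by (rule X)
    have Zg: "Z g" unfolding g_def[abs_def] by (rule ZX)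
    have "g 0 = 0" by (simp add: g_def X0)
    then obtain q where q: "\<And>k. poly_fun (\<lambda>x. q x $ k)" "\<And>x. g x = cdot (q x) x" "grad g 0 = q 0"
      using poly_fun_hadamard0[OF gp] by blast
    have gX: "g = (\<lambda>x. X x $ i)" by (rule ext) (rule g_def)
    have "q 0 $ e = pd e g 0" unfolding q(3)[symmetric] by (rule grad_nth)
    then have qe: "q 0 $ e \<noteq> 0" using ne unfolding gX by simp
    have "T 0 $ j $ e = 0" for j
    proof -
      have "T 0 $ j $ e = grad (\<lambda>x. a x $ j) 0 $ e" unfolding t(3) T_def by simp
      then show ?thesis unfolding grad_nth ae .
    qed
    then have "\<exists>q. (\<forall>k. poly_fun (\<lambda>x. q x $ k)) \<and> (\<forall>x. T x $ j $ e = cdot (q x) x)" for j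
      using poly_fun_hadamard0[OF Tp[of j e]] by blast
    then have "\<forall>j. \<exists>q. (\<forall>k. poly_fun (\<lambda>x. q x $ k)) \<and> (\<forall>x. T x $ j $ e = cdot (q x) x)" by blast
    from choice[OF this] obtain \<tau> where \<tau>: "\<And>j k. poly_fun (\<lambda>x. \<tau> j x $ k)" "\<And>j x. T x $ j $ e = cdot (\<tau> j x) x" by blast
    define E where "E x = (\<chi> m k. if k = e then (if m = e then 1 else 0) else if m = e then - q x $ k else if m = k then q x $ e else 0)" for x
    have Ep: "poly_fun (\<lambda>x. E x $ m $ k)" for m k
      using q(1) by (cases "k = e"; cases "m = e"; cases "m = k") (simp_all add: E_def)
    have Em: "(E x *v z) $ m = q x $ e * z $ m" if "m \<noteq> e" for x z m
    proof -
      have "(E x *v z) $ m = (\<Sum>k\<in>UNIV. if k = m then q x $ e * z $ m else 0)"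
        unfolding matrix_vector_mult_def vec_lambda_beta E_def using that by (intro sum.cong) auto
      then show ?thesis by simp
    qed
    have Ee: "(E x *v z) $ e = z $ e - (\<Sum>k\<in>UNIV-{e}. q x $ k * z $ k)" for x z
    proof -
      have "(E x *v z) $ e = E x $ e $ e * z $ e + (\<Sum>k\<in>UNIV-{e}. E x $ e $ k * z $ k)"
        unfolding matrix_vector_mult_def vec_lambda_beta by (rule sum.remove) auto
      also have "(\<Sum>k\<in>UNIV-{e}. E x $ e $ k * z $ k) = (\<Sum>k\<in>UNIV-{e}. - (q x $ k * z $ k))"
        by (intro sum.cong) (auto simp: E_def)
      finally show ?thesis by (simp add: E_def sum_negf)
    qed
    have gsplit: "g x = q x $ e * x $ e + (\<Sum>k\<in>UNIV-{e}. q x $ k * x $ k)" for x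
      unfolding q(2) cdot_def by (rule sum.remove) auto
    have detE0: "det (E 0) \<noteq> 0"
    proof -
      have ker: "z = 0" if z: "E 0 *v z = 0" for z
      proof -
        have zm: "z $ m = 0" if "m \<noteq> e" for m
          using Em[OF that, of 0 z] z qe by simp
        have ze: "z $ e = 0" using Ee[of 0 z] z zm by simp
        have "z $ m = 0" for m by (cases "m = e") (simp_all add: zm ze)
        then show ?thesis by (simp add: vec_eq_iff)
      qed
      have "\<exists>B. B ** E 0 = mat 1" by (rule matrix_left_invertible_ker[THEN iffD2]) (use ker in blast)
      then show ?thesis using invertible_det_nz invertible_left_inverse by blast
    qed
    define B where "B x = T x ** E x" for x
    have Bp: "poly_fun (\<lambda>x. B x $ m $ k)" for m k unfolding B_def matrix_matrix_mult_def using Tp Ep by simp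
    define x0 where "x0 x = upd x e 0" for x :: "complex ^ 'n"
    have Bx0: "B x *v x0 x = q x $ e *s a x - g x *s column e (T x)" for x
    proof -
      have "(E x *v x0 x) $ m = (q x $ e *s x - g x *s axis e 1) $ m" for m
      proof (cases "m = e")
        case True
        have "(\<Sum>k\<in>UNIV-{e}. q x $ k * x0 x $ k) = (\<Sum>k\<in>UNIV-{e}. q x $ k * x $ k)"
          by (intro sum.cong) (auto simp: x0_def)
        then show ?thesis using gsplit[of x] by (simp add: True Ee x0_def)
      next
        case False
        then show ?thesis by (simp add: Em x0_def axis_def)
      qed
      then have "E x *v x0 x = q x $ e *s x - g x *s axis e 1" by (simp add: vec_eq_iff)
      then have "B x *v x0 x = T x *v (q x $ e *s x - g x *s axis e 1)" by (simp add: B_def flip: matrix_vector_mul_assoc)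
      also have "\<dots> = q x $ e *s (T x *v x) - g x *s (T x *v axis e 1)"
        by (simp add: matrix_vector_mult_diff_distrib vector_scalar_commute)
      also have "T x *v axis e 1 = column e (T x)"
        by (simp add: vec_eq_iff matrix_vector_mult_def column_def axis_def mult_delta_right)
      finally show ?thesis by (simp add: Tx)
    qed
    define Bm where "Bm m x = repl_col (B x) e (\<chi> j. \<tau> j x $ m)" for m x
    define D where "D m x = det (Bm m x)" for m x
    have Bmp: "poly_fun (\<lambda>x. Bm m x $ p $ q)" for m p q
      using Bp \<tau>(1) by (cases "q = e") (simp_all add: Bm_def repl_col_def)
    have Dp: "poly_fun (D m)" for m unfolding D_def[abs_def] by (intro poly_fun_det Bmp)
    have detB: "det (B x) = (\<Sum>m\<in>UNIV. x $ m * D m x)" for x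
    proof -
      have Bjj: "repl_col (B x) e (column e (T x)) = B x"
      proof -
        have "B x $ p $ e = T x $ p $ e" for p
        proof -
          have "B x $ p $ e = (\<Sum>k\<in>UNIV. if k = e then T x $ p $ e else 0)"
            unfolding B_def matrix_matrix_mult_def vec_lambda_beta by (intro sum.cong) (auto simp: E_def)
          then show ?thesis by simp
        qed
        then show ?thesis by (auto simp: repl_col_def column_def vec_eq_iff)
      qed
      define d where "d k = det (repl_col (B x) e (axis k 1))" for k
      have "det (B x) = (\<Sum>k\<in>UNIV. column e (T x) $ k * d k)"
        using det_repl_col_expand[of "B x" e "column e (T x)"] by (simp add: Bjj d_def)
      also have "\<dots> = (\<Sum>k\<in>UNIV. (\<Sum>m\<in>UNIV. \<tau> k x $ m * x $ m) * d k)"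
        by (simp add: column_def \<tau>(2) cdot_def)
      also have "\<dots> = (\<Sum>k\<in>UNIV. \<Sum>m\<in>UNIV. x $ m * (\<tau> k x $ m * d k))"
        by (simp only: sum_distrib_right) (simp only: mult_ac)
      also have "\<dots> = (\<Sum>m\<in>UNIV. x $ m * (\<Sum>k\<in>UNIV. \<tau> k x $ m * d k))"
        by (subst sum.swap) (simp add: sum_distrib_left)
      also have "(\<lambda>m. \<Sum>k\<in>UNIV. \<tau> k x $ m * d k) = (\<lambda>m. D m x)"
        unfolding D_def Bm_def d_def by (rule ext, subst (2) det_repl_col_expand) simp
      finally show ?thesis .
    qed
    have ZD: "Z (\<lambda>x. x $ l * D m x)" if l: "l \<noteq> e" for l m
    proof -
      have eq: "x $ l * D m x = (\<Sum>k\<in>UNIV. (q x $ e * a x $ k - g x * T x $ k $ e) * det (repl_col (Bm m x) l (axis k 1)))" for x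
      proof -
        have "(Bm m x *v x0 x) $ p = (B x *v x0 x) $ p" for p
          unfolding matrix_vector_mult_def vec_lambda_beta
          by (intro sum.cong) (auto simp: Bm_def repl_col_def x0_def)
        then have v: "Bm m x *v x0 x = q x $ e *s a x - g x *s column e (T x)" by (simp add: vec_eq_iff Bx0)
        have "x0 x $ l * D m x = det (repl_col (Bm m x) l (Bm m x *v x0 x))"
          unfolding D_def by (rule cramer_repl_col[symmetric])
        also have "\<dots> = (\<Sum>k\<in>UNIV. (q x $ e *s a x - g x *s column e (T x)) $ k * det (repl_col (Bm m x) l (axis k 1)))"
          unfolding v by (rule det_repl_col_expand)
        finally have "x0 x $ l * D m x = (\<Sum>k\<in>UNIV. (q x $ e *s a x - g x *s column e (T x)) $ k * det (repl_col (Bm m x) l (axis k 1)))" .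
        then show ?thesis using l by (simp add: x0_def column_def)
      qed
      show ?thesis unfolding eq
        by (intro Z_sum Z_mult' Z_diff Z_mult Za q(1) poly_fun_det rcp Bmp Tp Zg)
    qed
    have "q x $ e * det (B x) = (\<Sum>m\<in>UNIV-{e}. q x $ e * (x $ m * D m x)) + g x * D e x
        - (\<Sum>l\<in>UNIV-{e}. q x $ l * (x $ l * D e x))" for x
    proof -
      have "det (B x) = x $ e * D e x + (\<Sum>m\<in>UNIV-{e}. x $ m * D m x)"
        unfolding detB by (rule sum.remove) auto
      then have "q x $ e * det (B x) = q x $ e * x $ e * D e x + (\<Sum>m\<in>UNIV-{e}. q x $ e * (x $ m * D m x))"
        by (simp add: distrib_left sum_distrib_left)
      moreover have "q x $ e * x $ e = g x - (\<Sum>k\<in>UNIV-{e}. q x $ k * x $ k)" using gsplit[of x] by simp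
      ultimately show ?thesis by (simp add: left_diff_distrib sum_distrib_right mult.assoc)
    qed
    moreover have "Z (\<lambda>x. (\<Sum>m\<in>UNIV-{e}. q x $ e * (x $ m * D m x)) + g x * D e x
        - (\<Sum>l\<in>UNIV-{e}. q x $ l * (x $ l * D e x)))"
      by (intro Z_diff Z_add Z_sum Z_mult ZD q(1) Z_mult'[OF Dp Zg]) auto
    ultimately have "Z (\<lambda>x. q x $ e * det (B x))" by simp
    moreover have "q x $ e * det (B x) = (q x $ e * det (E x)) * det (T x)" for x by (simp add: B_def det_mul)
    ultimately have "Z (\<lambda>x. (q x $ e * det (E x)) * det (T x))" by simp
    then have "q 0 $ e * det (E 0) = 0" by (intro unit poly_fun_mult poly_fun_det q(1) Ep)
    then show False using qe detE0 by simp
  qed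
qed

end

theorem isolated_zero_syzygy:
  assumes "isolated_zero a \<epsilon>"
    and X: "\<And>k. poly_fun (\<lambda>x. X x $ k)" and syz: "\<And>x. cdot (a x) (X x) = 0"
  shows "X 0 = 0"
    and "(\<And>j. cdot (grad (\<lambda>x. a x $ j) 0) v = 0) \<Longrightarrow> cdot (grad (\<lambda>x. X x $ i) 0) v = 0"
proof -
  interpret isolated_zero a \<epsilon> by fact
  show "X 0 = 0" using syzygy_axis(1)[OF X syz] by (simp add: vec_eq_iff)
  assume av: "\<And>j. cdot (grad (\<lambda>x. a x $ j) 0) v = 0"
  show "cdot (grad (\<lambda>x. X x $ i) 0) v = 0"
  proof (cases "v = 0")
    case True then show ?thesis by simp
  next
    case False
    then obtain e where e: "v $ e \<noteq> 0" by (auto simp: vec_eq_iff)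
    define L where "L x = (\<chi> k. (if k = e then 0 else x $ k) + x $ e * v $ k)" for x :: "complex ^ 'a"
    have Lp: "poly_fun (\<lambda>x. L x $ k)" for k by (cases "k = e") (simp_all add: L_def)
    have L0: "L 0 = 0" by (simp add: L_def vec_eq_iff)
    have Le: "L (0 + t *s axis e 1) = 0 + t *s v" for t by (simp add: L_def vec_eq_iff axis_def)
    have pdL: "pd e (\<lambda>x. p (L x)) 0 = cdot (grad p 0) v" if "poly_fun p" for p
      using dir_deriv_poly_fun[OF that, of 0 v] by (simp add: pd_def dir_deriv_def Le del: add_0)
    define K where "K = (\<Sum>k\<in>UNIV. 1 + norm (v $ k))"
    have K: "K > 0" unfolding K_def by (intro sum_pos add_pos_nonneg) auto
    have nL: "norm (L x) \<le> K * norm x" for x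
    proof -
      have "norm (L x $ k) \<le> (1 + norm (v $ k)) * norm x" for k
      proof -
        have c: "norm (x $ j) \<le> norm x" for j by (rule Finite_Cartesian_Product.norm_nth_le)
        have "norm (L x $ k) \<le> norm (if k = e then 0 else x $ k) + norm (x $ e * v $ k)"
          unfolding L_def by (simp only: vec_lambda_beta norm_triangle_ineq)
        also have "norm (if k = e then 0 else x $ k) \<le> norm x" using c by simp
        also have "norm (x $ e * v $ k) \<le> norm x * norm (v $ k)" using c by (simp add: norm_mult mult_right_mono)
        finally show ?thesis by (simp add: algebra_simps)
      qed
      then have "(\<Sum>k\<in>UNIV. norm (L x $ k)) \<le> (\<Sum>k\<in>UNIV. (1 + norm (v $ k)) * norm x)" by (rule sum_mono)
      then show ?thesis using norm_le_sum_components[of "L x"] by (simp add: K_def sum_distrib_right)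
    qed
    have Lnz: "L x \<noteq> 0" if "x \<noteq> 0" for x
    proof
      assume L: "L x = 0"
      then have "L x $ e = 0" by simp
      then have xe: "x $ e = 0" using e by (simp add: L_def)
      have "x $ k = 0" for k
      proof -
        have "L x $ k = 0" using L by simp
        then show ?thesis using xe by (cases "k = e") (simp_all add: L_def)
      qed
      then show False using that by (simp add: vec_eq_iff)
    qed
    interpret b: isolated_zero "\<lambda>x. a (L x)" "\<epsilon> / K"
    proof
      show "poly_fun (\<lambda>x. a (L x) $ k)" for k using poly_fun_compose[OF a_poly[of k] Lp] .
      show "a (L 0) = 0" by (simp add: L0 a_0)
      show "0 < \<epsilon> / K" using eps K by simp
      fix x :: "complex ^ 'a" assume x: "x \<noteq> 0" "norm x < \<epsilon> / K"
      have "K * norm x < \<epsilon>" using x(2) K by (simp add: field_simps)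
      then have "norm (L x) < \<epsilon>" using nL[of x] by simp
      then show "a (L x) \<noteq> 0" using Lnz[OF x(1)] by (intro iso)
    qed
    have "pd e (\<lambda>x. X (L x) $ i) 0 = 0"
    proof (rule b.syzygy_axis(2))
      show "poly_fun (\<lambda>x. X (L x) $ k)" for k using poly_fun_compose[OF X[of k] Lp] .
      show "cdot (a (L x)) (X (L x)) = 0" for x by (rule syz)
      show "pd e (\<lambda>x. a (L x) $ j) 0 = 0" for j using pdL[OF a_poly[of j]] av by simp
    qed
    then show ?thesis using pdL[OF X[of i]] by simp
  qed
qed

section \<open>Calculus of polynomial one-forms\<close>

definition jac :: "(complex ^ 'n::finite \<Rightarrow> complex ^ 'm::finite) \<Rightarrow> complex ^ 'n \<Rightarrow> complex ^ 'n \<Rightarrow> complex ^ 'm" where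
  "jac a x u = (\<chi> k. cdot (grad (\<lambda>x. a x $ k) x) u)"

lemma grad_mult: "poly_fun f \<Longrightarrow> poly_fun g \<Longrightarrow> grad (\<lambda>x. f x * g x) x = f x *s grad g x + g x *s grad f x"
  by (simp add: vec_eq_iff pd_mult)

lemma grad_sum: "(\<And>i. i \<in> I \<Longrightarrow> poly_fun (f i)) \<Longrightarrow> grad (\<lambda>x. \<Sum>i\<in>I. f i x) x = (\<Sum>i\<in>I. grad (f i) x)"
  by (simp add: vec_eq_iff pd_sum)

lemma grad_const [simp]: "grad (\<lambda>x. c) x = 0" by (simp add: vec_eq_iff)

lemma grad_cdot_const [simp]: "grad (\<lambda>x. cdot l x) x = l"
  unfolding cdot_def by (simp add: vec_eq_iff pd_sum pd_mult mult_delta_right)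

lemma jac_id: "jac (\<lambda>x. x) x u = u"
  by (simp add: jac_def vec_eq_iff cdot_def mult_delta_left)

lemma jac_const: "jac (\<lambda>x. w) x u = 0" by (simp add: jac_def vec_eq_iff)

lemma jac_linear: "jac (\<lambda>x. S *v x) x u = S *v u"
proof -
  have row: "(S *v x) $ k = cdot (row k S) x" for k x
    by (simp add: matrix_vector_mult_def cdot_def row_def)
  have "jac (\<lambda>x. S *v x) x u $ k = (S *v u) $ k" for k
    unfolding jac_def vec_lambda_beta row grad_cdot_const ..
  then show ?thesis unfolding vec_eq_iff by blast
qed

lemma grad_cdot:
  fixes a Y :: "complex ^ 'n::finite \<Rightarrow> complex ^ 'm::finite"
  assumes a: "\<And>k. poly_fun (\<lambda>x. a x $ k)" and Y: "\<And>k. poly_fun (\<lambda>x. Y x $ k)"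
  shows "cdot (grad (\<lambda>x. cdot (a x) (Y x)) x) u = cdot (jac a x u) (Y x) + cdot (a x) (jac Y x u)"
proof -
  have "grad (\<lambda>x. cdot (a x) (Y x)) x = (\<Sum>k\<in>UNIV. a x $ k *s grad (\<lambda>x. Y x $ k) x + Y x $ k *s grad (\<lambda>x. a x $ k) x)"
    unfolding cdot_def by (subst grad_sum) (simp_all add: grad_mult a Y)
  moreover have "cdot (\<Sum>k\<in>K. f k) u = (\<Sum>k\<in>K. cdot (f k) u)" for f :: "'m \<Rightarrow> complex ^ 'n" and K
    by (induction K rule: infinite_finite_induct) (simp_all add: cdot_add_left)
  ultimately have "cdot (grad (\<lambda>x. cdot (a x) (Y x)) x) u
     = (\<Sum>k\<in>UNIV. a x $ k * cdot (grad (\<lambda>x. Y x $ k) x) u + Y x $ k * cdot (grad (\<lambda>x. a x $ k) x) u)"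
    by (simp add: cdot_add_left cdot_scale_left)
  also have "\<dots> = cdot (a x) (jac Y x u) + cdot (Y x) (jac a x u)"
    by (simp add: cdot_def[of "a x"] cdot_def[of "Y x"] jac_def sum.distrib)
  finally show ?thesis by (simp add: cdot_commute[of "Y x"])
qed

lemma jac_add_right: "jac a x (u + v) = jac a x u + jac a x v"
  and jac_scale_right: "jac a x (c *s u) = c *s jac a x u"
  by (simp_all add: jac_def vec_eq_iff cdot_add_right cdot_scale_right)

lemma poly_fun_jac: "(\<And>k. poly_fun (\<lambda>x. a x $ k)) \<Longrightarrow> poly_fun (\<lambda>x. jac a x u $ k)"
  by (simp add: jac_def)

lemma ext_deriv_jac:
  assumes a: "\<And>k. poly_fun (\<lambda>x. a x $ k)"
  shows "ext_deriv a x u w = cdot (jac a x u) w - cdot (jac a x w) u"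
proof -
  have "dir_deriv (\<lambda>x. one_form a x w) x u = cdot (jac a x u) w" for u w
  proof -
    have "dir_deriv (\<lambda>x. cdot (a x) w) x u = cdot (grad (\<lambda>x. cdot (a x) w) x) u"
      by (rule dir_deriv_poly_fun) (simp add: a)
    also have "\<dots> = cdot (jac a x u) w" using grad_cdot[of a "\<lambda>_. w" x u] a by (simp add: jac_const)
    finally show ?thesis by (simp add: one_form_eq_cdot)
  qed
  then show ?thesis by (simp add: ext_deriv_def)
qed

lemma norm_scale: "norm (c *s x :: complex ^ 'n::finite) = norm c * norm x"
  by (simp add: norm_vec_def norm_mult L2_set_right_distrib)

lemma poly_fun_uniform:
  fixes v w :: "complex ^ 'n::finite"
  assumes f: "poly_fun f" and \<eta>: "\<eta> > 0"
  shows "\<exists>\<delta>>0. \<forall>s z. norm s \<le> r \<longrightarrow> norm z < \<delta> \<longrightarrow> norm (f (s *s v + z *s w) - f (s *s v)) < \<eta>"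
proof -
  define B where "B = \<bar>r\<bar> * norm v + norm w"
  have "uniformly_continuous_on (cball 0 B) f"
    by (intro compact_uniformly_continuous poly_fun_continuous f compact_cball)
  then obtain d where d: "d > 0" "\<And>x x'. x \<in> cball 0 B \<Longrightarrow> x' \<in> cball 0 B \<Longrightarrow> dist x' x < d \<Longrightarrow> dist (f x') (f x) < \<eta>"
    unfolding uniformly_continuous_on_def using \<eta> by metis
  define \<delta> where "\<delta> = min 1 (d / (norm w + 1))"
  have w1: "norm w + 1 > 0" by (simp add: add_nonneg_pos)
  have \<delta>: "\<delta> > 0" using d(1) w1 by (simp add: \<delta>_def)
  show ?thesis
  proof (intro exI[of _ \<delta>] conjI allI impI \<delta>)
    fix s z :: complex assume s: "norm s \<le> r" and z: "norm z < \<delta>"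
    have z1: "norm z \<le> 1" "norm z * (norm w + 1) < d" using z w1 by (auto simp: \<delta>_def field_simps)
    have sv: "norm (s *s v) \<le> \<bar>r\<bar> * norm v" unfolding norm_scale using s by (intro mult_right_mono) auto
    have zw: "norm (z *s w) \<le> norm w" unfolding norm_scale using z1 mult_right_mono[of "norm z" 1 "norm w"] by simp
    have 1: "s *s v \<in> cball 0 B" using sv by (simp add: B_def add_increasing2)
    have 2: "s *s v + z *s w \<in> cball 0 B" using sv zw norm_triangle_ineq[of "s *s v" "z *s w"] by (simp add: B_def)
    have "norm (z *s w) \<le> norm z * (norm w + 1)" unfolding norm_scale by (intro mult_left_mono) auto
    then have "dist (s *s v + z *s w) (s *s v) < d" using z1 by (simp add: dist_norm)
    from d(2)[OF 1 2 this] show "norm (f (s *s v + z *s w) - f (s *s v)) < \<eta>" by (simp add: dist_norm)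
  qed
qed

text \<open>One equation in two variables has no isolated zeros: apply the maximum principle to \<open>1 / h\<close> on
  discs parallel to the second axis.\<close>

lemma poly_fun_nonisolated_zero:
  fixes h :: "complex ^ 'n::finite \<Rightarrow> complex"
  assumes h: "poly_fun h" and h0: "h 0 = 0" and \<delta>: "\<delta> > 0"
  shows "\<exists>s t. (s \<noteq> 0 \<or> t \<noteq> 0) \<and> norm s < \<delta> \<and> norm t < \<delta> \<and> h (s *s f + t *s g) = 0"
proof (rule ccontr)
  assume "\<not> ?thesis"
  then have nz: "h (s *s f + t *s g) \<noteq> 0" if "s \<noteq> 0 \<or> t \<noteq> 0" "norm s < \<delta>" "norm t < \<delta>" for s t
    using that by blast
  define r where "r = \<delta> / 2"
  have r: "0 < r" "r < \<delta>" using \<delta> by (auto simp: r_def)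
  have cont: "continuous_on (sphere 0 r) (\<lambda>t. norm (h (t *s g)))"
  proof -
    have "(\<lambda>t. h (0 + t *s g)) holomorphic_on sphere 0 r" by (rule poly_fun_line_holomorphic[OF h])
    then have "continuous_on (sphere 0 r) (\<lambda>t. h (t *s g))"
      unfolding add_0 by (rule holomorphic_on_imp_continuous_on)
    then show ?thesis by (intro continuous_intros)
  qed
  have ne: "sphere (0::complex) r \<noteq> {}" using r by simp
  obtain t0 where t0: "t0 \<in> sphere 0 r" "\<And>t. t \<in> sphere 0 r \<Longrightarrow> norm (h (t0 *s g)) \<le> norm (h (t *s g))"
    using continuous_attains_inf[OF compact_sphere ne cont] by blast
  define c where "c = norm (h (t0 *s g))"
  have "h (0 *s f + t0 *s g) \<noteq> 0" using t0(1) r by (intro nz) auto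
  then have c: "c > 0" by (simp add: c_def)
  obtain d where d: "d > 0" "\<And>s z. norm s \<le> r \<Longrightarrow> norm z < d \<Longrightarrow> norm (h (s *s g + z *s f) - h (s *s g)) < c / 2"
    using poly_fun_uniform[OF h, of "c / 2" r g f] c by auto
  define s where "s = complex_of_real (min (d / 2) (\<delta> / 2))"
  have s: "s \<noteq> 0" "norm s < d" "norm s < \<delta>" using d \<delta> by (auto simp: s_def min_def)
  define \<phi> where "\<phi> t = h (s *s f + t *s g)" for t
  have hol: "\<phi> holomorphic_on UNIV" unfolding \<phi>_def[abs_def] by (rule poly_fun_line_holomorphic[OF h])
  have \<phi>nz: "\<phi> t \<noteq> 0" if "norm t \<le> r" for t unfolding \<phi>_def using that s r by (intro nz) auto
  have "norm (1 / \<phi> 0) \<le> 2 / c"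
  proof (rule maximum_modulus_frontier[of "\<lambda>t. 1 / \<phi> t" "cball 0 r"])
    have "(\<lambda>t. 1 / \<phi> t) holomorphic_on cball 0 r"
      using \<phi>nz by (intro holomorphic_intros holomorphic_on_subset[OF hol]) auto
    then show "(\<lambda>t. 1 / \<phi> t) holomorphic_on interior (cball 0 r)" "continuous_on (closure (cball 0 r)) (\<lambda>t. 1 / \<phi> t)"
      by (auto intro: holomorphic_on_subset holomorphic_on_imp_continuous_on)
    fix t assume "t \<in> frontier (cball (0::complex) r)"
    then have t: "norm t = r" using r by (simp add: frontier_cball)
    have "norm (\<phi> t - h (t *s g)) < c / 2" using d(2)[of t s] t s by (simp add: \<phi>_def add.commute)
    moreover have "c \<le> norm (h (t *s g))" unfolding c_def using t by (intro t0) simp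
    ultimately have "c / 2 \<le> norm (\<phi> t)" using norm_triangle_ineq2[of "h (t *s g)" "\<phi> t"] by (simp add: norm_minus_commute)
    then have "1 / norm (\<phi> t) \<le> 1 / (c / 2)" using c by (intro divide_left_mono mult_pos_pos) auto
    then show "norm (1 / \<phi> t) \<le> 2 / c" by (simp add: norm_divide)
  qed (use r in auto)
  then have "1 / norm (\<phi> 0) \<le> 2 / c" by (simp add: norm_divide)
  moreover have "norm (\<phi> 0) < c / 2" using d(2)[of 0 s] s r h0 by (simp add: \<phi>_def)
  moreover have "norm (\<phi> 0) > 0" using \<phi>nz[of 0] r by simp
  ultimately show False using c by (simp add: field_simps)
qed

lemma poly_vector_order:
  fixes Al :: "'n::finite \<Rightarrow> complex poly"
  assumes "Al k0 \<noteq> 0"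
  shows "\<exists>b G. (\<forall>k. Al k = [:0, 1:] ^ b * G k) \<and> (\<exists>k. poly (G k) 0 \<noteq> 0)"
proof -
  define Q where "Q b \<longleftrightarrow> (\<forall>k. [:0, 1:] ^ b dvd Al k)" for b :: nat
  have "Q 0" by (simp add: Q_def)
  moreover have bd: "b \<le> degree (Al k0)" if "Q b" for b
  proof -
    have "[:0, 1:] ^ b dvd Al k0" using that by (simp add: Q_def)
    then have "degree ([:0, 1:] ^ b :: complex poly) \<le> degree (Al k0)" using assms by (rule dvd_imp_degree_le)
    then show ?thesis by (simp add: degree_linear_power)
  qed
  ultimately have Qg: "Q (GREATEST b. Q b)" by (intro GreatestI_nat[of Q 0 "degree (Al k0)"])
  define b where "b = (GREATEST b. Q b)"
  have "\<forall>k. \<exists>g. Al k = [:0, 1:] ^ b * g" using Qg unfolding b_def Q_def dvd_def .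
  from choice[OF this] obtain G where G: "\<And>k. Al k = [:0, 1:] ^ b * G k" by blast
  have "\<exists>k. poly (G k) 0 \<noteq> 0"
  proof (rule ccontr)
    assume "\<not> ?thesis"
    then have "[:0, 1:] dvd G k" for k using poly_eq_0_iff_dvd[of "G k" 0] by simp
    then have "[:0, 1:] ^ b * [:0, 1:] dvd [:0, 1:] ^ b * G k" for k by (rule mult_dvd_mono[OF dvd_refl])
    then have "Q (Suc b)" unfolding Q_def by (simp only: G[symmetric] power_Suc2) blast
    then have "Suc b \<le> b" unfolding b_def by (rule Greatest_le_nat[of Q _ "degree (Al k0)"]) (rule bd)
    then show False by simp
  qed
  then show ?thesis using G by blast
qed

lemma poly_fun_extract_power:
  fixes F :: "complex ^ 'n::finite \<Rightarrow> complex"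
  assumes F: "poly_fun F" "F z \<noteq> 0" and b: "b \<noteq> 0"
  shows "\<exists>k w. poly_fun w \<and> (\<forall>x. F x = cdot b x ^ k * w x) \<and> (\<exists>x. cdot b x = 0 \<and> w x \<noteq> 0)"
proof -
  define Q where "Q k \<longleftrightarrow> (\<exists>w. poly_fun w \<and> (\<forall>x. F x = cdot b x ^ k * w x))" for k :: nat
  obtain e where e: "cdot b e = 1" using ex_cdot_eq_1[OF b] by blast
  obtain P where P: "\<And>t. F (z + t *s e) = poly P t" using poly_fun_line[OF F(1)] by blast
  have P0: "P \<noteq> 0" using P[of 0] F(2) by auto
  have Q0: "Q 0" unfolding Q_def using F(1) by auto
  have bd: "k \<le> degree P" if "Q k" for k
  proof -
    obtain w where w: "poly_fun w" "\<And>x. F x = cdot b x ^ k * w x" using \<open>Q k\<close> unfolding Q_def by blast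
    obtain W where W: "\<And>t. w (z + t *s e) = poly W t" using poly_fun_line[OF w(1)] by blast
    have "poly P t = poly ([:cdot b z, 1:] ^ k * W) t" for t
      using w(2)[of "z + t *s e"] by (simp add: P W cdot_add_right cdot_scale_right e)
    then have PW: "P = [:cdot b z, 1:] ^ k * W" using poly_eq_poly_eq_iff[of P] by blast
    then have "[:cdot b z, 1:] ^ k dvd P" by simp
    then have "degree ([:cdot b z, 1:] ^ k) \<le> degree P" using P0 by (rule dvd_imp_degree_le)
    then show ?thesis by (simp add: degree_linear_power)
  qed
  define k where "k = (GREATEST k. Q k)"
  have "Q k" unfolding k_def by (rule GreatestI_nat[of Q 0 "degree P", OF Q0 bd])
  then obtain w where w: "poly_fun w" "\<And>x. F x = cdot b x ^ k * w x" unfolding Q_def by blast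
  have "\<exists>x. cdot b x = 0 \<and> w x \<noteq> 0"
  proof (rule ccontr)
    assume "\<not> ?thesis"
    then obtain w' where w': "poly_fun w'" "\<And>x. w x = cdot b x * w' x"
      using poly_fun_divide_linear[OF w(1) b] by blast
    have "Q (Suc k)" unfolding Q_def using w' w(2) by (intro exI[of _ w']) (simp add: mult_ac)
    then have "Suc k \<le> k" unfolding k_def by (rule Greatest_le_nat[of Q _ "degree P"]) (rule bd)
    then show False by simp
  qed
  then show ?thesis using w by blast
qed

lemma ex_two_kernel_vectors:
  fixes b :: "complex ^ 'n::finite"
  assumes card: "3 \<le> CARD('n)" and b: "b \<noteq> 0"
  shows "\<exists>f g. cdot b f = 0 \<and> cdot b g = 0 \<and> (\<forall>s t. s *s f + t *s g = 0 \<longrightarrow> s = 0 \<and> t = 0)"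
proof -
  obtain m where m: "b $ m \<noteq> 0" using b by (auto simp: vec_eq_iff)
  have "card (UNIV - {m}) \<ge> 2" using card by simp
  then have "UNIV - {m} \<noteq> {}" by (metis card.empty not_numeral_le_zero)
  then obtain i where i: "i \<in> UNIV - {m}" by blast
  have "card (UNIV - {m} - {i}) \<ge> 1" using card i by simp
  then have "UNIV - {m} - {i} \<noteq> {}" by (metis card.empty not_one_le_zero)
  then obtain j where j: "j \<in> UNIV - {m} - {i}" by blast
  define f where "f = axis i (b $ m) - axis m (b $ i)"
  define g where "g = axis j (b $ m) - axis m (b $ j)"
  have ij: "i \<noteq> m" "j \<noteq> m" "j \<noteq> i" using i j by auto
  have "s = 0 \<and> t = 0" if 0: "s *s f + t *s g = 0" for s t
  proof -
    have "(s *s f + t *s g) $ i = 0" "(s *s f + t *s g) $ j = 0" by (simp_all add: 0)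
    then show ?thesis using m ij by (simp add: f_def g_def axis_def)
  qed
  moreover have "cdot b f = 0" "cdot b g = 0" by (simp_all add: f_def g_def cdot_diff_right)
  ultimately show ?thesis by blast
qed

section \<open>The isolated singularity is nondegenerate\<close>

text \<open>Where \<open>P\<close> is proportional to \<open>a\<close>, the factor is holomorphic off the isolated zero.  It extends over the
zero by the maximum principle on discs parallel to \<open>v\<close>, and its value at the origin is zero because, in the
direction \<open>w\<close>, \<open>P\<close> vanishes to higher order than \<open>a\<close>.  So along \<open>v\<close> the order of
\<open>P\<close> exceeds that of \<open>a\<close>.\<close>

lemma proportional_leading_term:
  fixes a P :: "complex ^ 'n::finite \<Rightarrow> complex ^ 'n"
  assumes iz: "isolated_zero a \<epsilon>"
    and P: "\<And>k. poly_fun (\<lambda>x. P x $ k)"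
    and prp: "\<And>x i j. a x $ i * P x $ j = a x $ j * P x $ i"
    and P0: "P 0 = 0" and dP: "jac P 0 w = 0" and dw: "jac a 0 w \<noteq> 0"
    and ind: "\<And>s z. s *s v + z *s w = 0 \<Longrightarrow> s = 0 \<and> z = 0"
    and G: "\<And>s k. a (s *s v) $ k = s ^ b * poly (G k) s"
    and \<pi>: "\<And>s k. P (s *s v) $ k = s ^ b * poly (\<pi> k) s"
  shows "poly (\<pi> i) 0 = 0"
proof -
  interpret isolated_zero a \<epsilon> by (rule iz)
  define r where "r = \<epsilon> / (2 * (norm v + norm w + 1))"
  have nvw: "norm v + norm w + 1 > 0" by (simp add: add_nonneg_pos)
  have r: "r > 0" using eps nvw by (simp add: r_def)
  have nz: "a (s *s v + z *s w) \<noteq> 0" if s: "norm s < 2 * r" and z: "norm z < 2 * r" and sz: "s \<noteq> 0 \<or> z \<noteq> 0" for s z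
  proof (rule iso)
    show "s *s v + z *s w \<noteq> 0" using ind sz by blast
    have "norm (s *s v + z *s w) \<le> norm s * norm v + norm z * norm w"
      using norm_triangle_ineq[of "s *s v" "z *s w"] by (simp add: norm_scale)
    also have "\<dots> \<le> 2 * r * norm v + 2 * r * norm w" using s z by (intro add_mono mult_right_mono) auto
    also have "\<dots> < 2 * r * (norm v + norm w + 1)" using r by (simp add: algebra_simps)
    also have "\<dots> = \<epsilon>"
    proof -
      have "c > 0 \<Longrightarrow> 2 * (\<epsilon> / (2 * c)) * c = \<epsilon>" for c :: real by simp
      from this[OF nvw] show ?thesis by (simp only: r_def)
    qed
    finally show "norm (s *s v + z *s w) < \<epsilon>" .
  qed
  define lam where "lam x = P x $ (SOME j. a x $ j \<noteq> 0) / a x $ (SOME j. a x $ j \<noteq> 0)" for x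
  have lam: "lam x = P x $ j / a x $ j" if j: "a x $ j \<noteq> 0" for x j
  proof -
    have "a x $ (SOME j. a x $ j \<noteq> 0) \<noteq> 0" using j by (rule someI)
    then show ?thesis using j prp[of x j "SOME j. a x $ j \<noteq> 0"] by (simp add: lam_def field_simps)
  qed
  have Pl: "P x $ k = lam x * a x $ k" if "a x \<noteq> 0" for x k
  proof -
    obtain j where j: "a x $ j \<noteq> 0" using \<open>a x \<noteq> 0\<close> by (auto simp: vec_eq_iff)
    show ?thesis using prp[of x j k] j by (simp add: lam[OF j] field_simps)
  qed
  define N where "N f x = (\<Sum>k\<in>UNIV. norm (f x $ k))" for f :: "complex ^ 'n \<Rightarrow> complex ^ 'n" and x
  have Npos: "N a x > 0" if "a x \<noteq> 0" for x
  proof -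
    obtain j where j: "a x $ j \<noteq> 0" using \<open>a x \<noteq> 0\<close> by (auto simp: vec_eq_iff)
    then show ?thesis unfolding N_def by (intro sum_pos2[of _ j]) auto
  qed
  have NP: "N P x = norm (lam x) * N a x" if "a x \<noteq> 0" for x
    using Pl[OF that] by (simp add: N_def norm_mult sum_distrib_left)
  have line: "continuous_on UNIV (\<lambda>q. fst q *s v + snd q *s w)"
  proof -
    have "(\<lambda>q. fst q *s v + snd q *s w) = (\<lambda>q. \<chi> i. fst q * v $ i + snd q * w $ i)"
      by (rule ext) (simp add: vec_eq_iff)
    then show ?thesis by (simp only:) (intro continuous_intros)
  qed
  have contf: "continuous_on K (\<lambda>q. f (fst q *s v + snd q *s w))" if "poly_fun f" for f K
    by (rule continuous_on_compose2[OF poly_fun_continuous[OF that, of UNIV] continuous_on_subset[OF line]]) auto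
  define K where "K = sphere (0::complex) r \<times> cball (0::complex) r"
  have "continuous_on K (\<lambda>q. N P (fst q *s v + snd q *s w) / N a (fst q *s v + snd q *s w))"
    unfolding N_def
  proof (intro continuous_on_divide continuous_on_sum continuous_on_norm contf P a_poly ballI)
    fix q assume "q \<in> K"
    then have "norm (fst q) = r" "norm (snd q) \<le> r" by (auto simp: K_def)
    then have "a (fst q *s v + snd q *s w) \<noteq> 0" using r by (intro nz) auto
    then show "(\<Sum>k\<in>UNIV. norm (a (fst q *s v + snd q *s w) $ k)) \<noteq> 0" using Npos unfolding N_def by fastforce
  qed
  moreover have "compact K" unfolding K_def by (intro compact_Times compact_sphere compact_cball)
  ultimately have "bounded ((\<lambda>q. N P (fst q *s v + snd q *s w) / N a (fst q *s v + snd q *s w)) ` K)"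
    by (intro compact_imp_bounded compact_continuous_image)
  then obtain M where M: "\<And>q. q \<in> K \<Longrightarrow> norm (N P (fst q *s v + snd q *s w) / N a (fst q *s v + snd q *s w)) \<le> M"
    unfolding bounded_iff by blast
  have lamM: "norm (lam (s *s v + z *s w)) \<le> M" if s: "norm s = r" and z: "norm z \<le> r" for s z
  proof -
    have x: "a (s *s v + z *s w) \<noteq> 0" using s z r by (intro nz) auto
    have "(s, z) \<in> K" using s z by (simp add: K_def)
    from M[OF this] show ?thesis using Npos[OF x] by (simp add: NP[OF x])
  qed
  have hol: "(\<lambda>s. lam (s *s v + z *s w)) holomorphic_on ball 0 (2 * r)" if z: "z \<noteq> 0" "norm z < 2 * r" for z
  proof (subst holomorphic_on_open[OF open_ball], intro ballI)
    fix s0 :: complex assume "s0 \<in> ball 0 (2 * r)"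
    then have "a (s0 *s v + z *s w) \<noteq> 0" using z by (intro nz) auto
    then obtain j where j: "a (s0 *s v + z *s w) $ j \<noteq> 0" by (auto simp: vec_eq_iff)
    have hf: "(\<lambda>s. f (s *s v + z *s w)) holomorphic_on UNIV" if "poly_fun f" for f
      using poly_fun_line_holomorphic[OF that, of "z *s w" v UNIV] by (simp only: add.commute)
    define U where "U = {s. a (s *s v + z *s w) $ j \<noteq> 0}"
    have U: "open U" unfolding U_def
      by (intro open_Collect_neq holomorphic_on_imp_continuous_on[OF hf] a_poly continuous_on_const)
    have "(\<lambda>s. P (s *s v + z *s w) $ j / a (s *s v + z *s w) $ j) holomorphic_on U"
      by (intro holomorphic_on_divide holomorphic_on_subset[OF hf] P a_poly) (auto simp: U_def)
    then have "(\<lambda>s. lam (s *s v + z *s w)) holomorphic_on U"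
      by (rule holomorphic_transform) (simp add: U_def lam)
    moreover have "s0 \<in> U" using j by (simp add: U_def)
    ultimately show "\<exists>f'. ((\<lambda>s. lam (s *s v + z *s w)) has_field_derivative f') (at s0)"
      using U by (simp add: holomorphic_on_open)
  qed
  have lam0: "((\<lambda>z. lam (z *s w)) \<longlongrightarrow> 0) (at 0)"
  proof -
    obtain k where k: "jac a 0 w $ k \<noteq> 0" using dw by (auto simp: vec_eq_iff)
    have quot: "((\<lambda>z. f (z *s w) / z) \<longlongrightarrow> cdot (grad f 0) w) (at 0)" if f: "poly_fun f" and f0: "f 0 = 0" for f
      using poly_fun_line_deriv[OF f, of 0 w 0] f0 by (simp add: DERIV_def)
    have qa: "((\<lambda>z. a (z *s w) $ k / z) \<longlongrightarrow> jac a 0 w $ k) (at 0)"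
      using quot[OF a_poly[of k]] a_0 by (simp add: jac_def)
    have "((\<lambda>z. P (z *s w) $ k / z) \<longlongrightarrow> jac P 0 w $ k) (at 0)"
      using quot[OF P[of k]] P0 by (simp add: jac_def)
    then have "((\<lambda>z. (P (z *s w) $ k / z) / (a (z *s w) $ k / z)) \<longlongrightarrow> jac P 0 w $ k / jac a 0 w $ k) (at 0)"
      using qa k by (rule tendsto_divide)
    moreover have "eventually (\<lambda>z. a (z *s w) $ k / z \<noteq> 0) (at 0)"
      using qa k by (rule tendsto_imp_eventually_ne)
    then have "eventually (\<lambda>z. (P (z *s w) $ k / z) / (a (z *s w) $ k / z) = lam (z *s w)) (at 0)"
    proof eventually_elim
      case (elim z)
      then have "z \<noteq> 0" "a (z *s w) $ k \<noteq> 0" by auto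
      then show ?case by (simp add: lam)
    qed
    ultimately have "((\<lambda>z. lam (z *s w)) \<longlongrightarrow> jac P 0 w $ k / jac a 0 w $ k) (at 0)"
      by (rule Lim_transform_eventually)
    then show ?thesis by (simp add: dP)
  qed
  have "norm (lam (of_real r *s v + 0 *s w)) \<le> M" using r by (intro lamM) auto
  then have M0: "M \<ge> 0" by (rule order_trans[OF norm_ge_zero])
  have bound: "norm (poly (\<pi> i) 0) * r ^ b \<le> (M + 1) * \<eta>" if \<eta>: "\<eta> > 0" for \<eta>
  proof -
    obtain \<delta>1 where \<delta>1: "\<delta>1 > 0" "\<And>s z. norm s \<le> r \<Longrightarrow> norm z < \<delta>1 \<Longrightarrow> norm (a (s *s v + z *s w) $ i - a (s *s v) $ i) < \<eta>"
      using poly_fun_uniform[OF a_poly[of i] \<eta>, of r v w] by blast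
    obtain \<delta>2 where \<delta>2: "\<delta>2 > 0" "\<And>s z. norm s \<le> r \<Longrightarrow> norm z < \<delta>2 \<Longrightarrow> norm (P (s *s v + z *s w) $ i - P (s *s v) $ i) < \<eta>"
      using poly_fun_uniform[OF P[of i] \<eta>, of r v w] by blast
    define \<delta> where "\<delta> = min r (min \<delta>1 \<delta>2)"
    have \<delta>: "\<delta> > 0" using r \<delta>1 \<delta>2 by (simp add: \<delta>_def)
    have step: "norm (lam (z *s w) * poly (G i) 0 - poly (\<pi> i) 0) * r ^ b \<le> (M + 1) * \<eta>"
      if z: "z \<noteq> 0" "norm z < \<delta>" for z
    proof -
      define D where "D s = lam (s *s v + z *s w) * poly (G i) s - poly (\<pi> i) s" for s
      have zr: "norm z < r" "norm z < \<delta>1" "norm z < \<delta>2" using z by (auto simp: \<delta>_def)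
      have Dh: "D holomorphic_on ball 0 (2 * r)" unfolding D_def[abs_def]
        using zr r z by (intro holomorphic_intros hol) auto
      have "norm (D 0) \<le> (M + 1) * \<eta> / r ^ b"
      proof (rule maximum_modulus_frontier[of D "cball 0 r"])
        show "D holomorphic_on interior (cball 0 r)" "continuous_on (closure (cball 0 r)) D"
          using r by (auto intro!: holomorphic_on_subset[OF Dh] continuous_on_subset[OF holomorphic_on_imp_continuous_on[OF Dh]])
        fix s assume "s \<in> frontier (cball (0::complex) r)"
        then have s: "norm s = r" using r by (simp add: frontier_cball)
        define x where "x = s *s v + z *s w"
        have x: "a x \<noteq> 0" unfolding x_def using s z zr r by (intro nz) auto
        have "s ^ b * D s = lam x * a (s *s v) $ i - P (s *s v) $ i" by (simp add: D_def G \<pi> x_def algebra_simps)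
        also have "\<dots> = (P x $ i - P (s *s v) $ i) - lam x * (a x $ i - a (s *s v) $ i)"
          by (simp add: Pl[OF x] algebra_simps)
        finally have "norm (s ^ b * D s) \<le> norm (P x $ i - P (s *s v) $ i) + norm (lam x) * norm (a x $ i - a (s *s v) $ i)"
          by (metis norm_mult norm_triangle_ineq4)
        also have "\<dots> \<le> \<eta> + M * \<eta>"
        proof (intro add_mono mult_mono M0)
          show "norm (P x $ i - P (s *s v) $ i) \<le> \<eta>" using \<delta>2(2)[of s z] s zr by (simp add: x_def)
          show "norm (a x $ i - a (s *s v) $ i) \<le> \<eta>" using \<delta>1(2)[of s z] s zr by (simp add: x_def)
          show "norm (lam x) \<le> M" unfolding x_def using s zr by (intro lamM) auto
        qed auto
        finally have "r ^ b * norm (D s) \<le> (M + 1) * \<eta>" by (simp add: norm_mult norm_power s algebra_simps)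
        then show "norm (D s) \<le> (M + 1) * \<eta> / r ^ b" using r by (simp add: field_simps)
      qed (use r in auto)
      then show ?thesis using r by (simp add: D_def field_simps)
    qed
    have "eventually (\<lambda>z. norm (lam (z *s w) * poly (G i) 0 - poly (\<pi> i) 0) * r ^ b \<le> (M + 1) * \<eta>) (at 0)"
      unfolding eventually_at using \<delta> step by (auto simp: dist_norm)
    moreover have "((\<lambda>z. norm (lam (z *s w) * poly (G i) 0 - poly (\<pi> i) 0) * r ^ b) \<longlongrightarrow> norm (0 * poly (G i) 0 - poly (\<pi> i) 0) * r ^ b) (at 0)"
      by (intro tendsto_intros lam0)
    ultimately have "norm (0 * poly (G i) 0 - poly (\<pi> i) 0) * r ^ b \<le> (M + 1) * \<eta>"
      by (intro tendsto_upperbound) auto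
    then show ?thesis by simp
  qed
  have "norm (poly (\<pi> i) 0) * r ^ b \<le> 0"
  proof (rule field_le_epsilon)
    fix e :: real assume e: "e > 0"
    have "norm (poly (\<pi> i) 0) * r ^ b \<le> (M + 1) * (e / (M + 1))" using e M0 by (intro bound) auto
    then show "norm (poly (\<pi> i) 0) * r ^ b \<le> 0 + e" using M0 by simp
  qed
  moreover have "r ^ b > 0" using r by simp
  ultimately show ?thesis by (simp add: mult_le_0_iff)
qed

definition proj_field :: "complex ^ 'n ^ 'n \<Rightarrow> complex ^ 'n::finite \<Rightarrow> complex ^ 'n \<Rightarrow> complex ^ 'n" where
  "proj_field S l x = S *v x - cdot l x *s x"

lemma poly_fun_proj_field [simp, intro]: "poly_fun (\<lambda>x. proj_field S l x $ k)"
  by (simp add: proj_field_def)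

lemma jac_diff: "(\<And>k. poly_fun (\<lambda>x. f x $ k)) \<Longrightarrow> (\<And>k. poly_fun (\<lambda>x. g x $ k)) \<Longrightarrow>
    jac (\<lambda>x. f x - g x) x u = jac f x u - jac g x u"
  by (simp add: jac_def vec_eq_iff pd_diff cdot_def algebra_simps sum_subtractf)

lemma jac_proj_field: "jac (proj_field S l) x u = S *v u - cdot l u *s x - cdot l x *s u"
proof -
  have "jac (\<lambda>x. cdot l x *s x) x u $ k = (cdot l u *s x + cdot l x *s u) $ k" for k
  proof -
    have "grad (\<lambda>x. cdot l x * x $ k) x = cdot l x *s grad (\<lambda>x. x $ k) x + x $ k *s l"
      by (simp add: grad_mult)
    moreover have "cdot (grad (\<lambda>x. x $ k) x) u = u $ k" using jac_id[of x u] by (simp add: jac_def vec_eq_iff)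
    ultimately show ?thesis by (simp add: jac_def cdot_add_left cdot_scale_left)
  qed
  then have "jac (\<lambda>x. cdot l x *s x) x u = cdot l u *s x + cdot l x *s u" by (simp add: vec_eq_iff)
  then show ?thesis unfolding proj_field_def[abs_def]
    by (subst jac_diff) (simp_all add: jac_linear)
qed

text \<open>The situation in an affine chart after the constant terms of the fields are known to vanish: the pairs \<open>(S, l)\<close>
represent the fields \<open>S x - (l \<cdot> x) x\<close>, and at a generic point these span the kernel of the form.\<close>

locale projective_symmetries = isolated_zero a \<epsilon>
  for a :: "complex ^ 'n::finite \<Rightarrow> complex ^ 'n" and \<epsilon> :: real +
  fixes LL :: "((complex ^ 'n ^ 'n) \<times> (complex ^ 'n)) set" and p :: "complex ^ 'n \<Rightarrow> complex" and z0 :: "complex ^ 'n"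
  assumes card3: "3 \<le> CARD('n)" and integrable: "integrable_form a"
    and tangent: "\<And>S l x. (S, l) \<in> LL \<Longrightarrow> cdot (a x) (proj_field S l x) = 0"
    and bracket: "\<And>S l S' l'. (S, l) \<in> LL \<Longrightarrow> (S', l') \<in> LL \<Longrightarrow>
      (S' ** S - S ** S', transpose S *v l' - transpose S' *v l) \<in> LL"
    and p_poly: "poly_fun p" and p_nz: "p z0 \<noteq> 0"
    and a_nz: "\<And>x. p x \<noteq> 0 \<Longrightarrow> a x \<noteq> 0"
    and span: "\<And>x u. p x \<noteq> 0 \<Longrightarrow> cdot (a x) u = 0 \<Longrightarrow> \<exists>S l. (S, l) \<in> LL \<and> u = proj_field S l x"
begin

lemma distinct_index: "\<exists>k. k \<noteq> i \<and> k \<noteq> (j :: 'n)"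
proof (rule ccontr)
  assume "\<not> ?thesis"
  then have "(UNIV :: 'n set) \<subseteq> {i, j}" by blast
  then have "CARD('n) \<le> card {i, j}" by (intro card_mono) auto
  also have "\<dots> \<le> 2" by (cases "i = j") auto
  finally show False using card3 by simp
qed

abbreviation E where "E \<equiv> ext_deriv a"

lemma E_axis: "E x (axis i 1) (axis k 1) = pd i (\<lambda>x. a x $ k) x - pd k (\<lambda>x. a x $ i) x"
  by (simp add: ext_deriv_jac[OF a_poly] jac_def)

lemma integr: "cdot (a x) u * E x v w + cdot (a x) v * E x w u + cdot (a x) w * E x u v = 0"
  using integrable by (simp add: integrable_form_def one_form_eq_cdot)

text \<open>The coefficients of \<open>d\<omega>\<close> in three of the coordinates are the components of a vector field which is
annihilated by \<open>\<omega>\<close>, by integrability.  The third coordinate is available because \<open>n \<ge> 3\<close>.\<close>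

lemma E_axis_0: "E 0 (axis i 1) (axis j 1) = 0"
proof (cases "i = j")
  case True then show ?thesis by (simp add: E_axis)
next
  case False
  obtain k where k: "k \<noteq> i" "k \<noteq> j" using distinct_index by blast
  define e where "e j = (axis j 1 :: complex ^ 'n)" for j
  define X where "X x = E x (e j) (e k) *s e i + E x (e k) (e i) *s e j + E x (e i) (e j) *s e k" for x
  have 1: "poly_fun (\<lambda>x. X x $ m)" for m
    by (simp add: X_def e_def E_axis a_poly)
  have 2: "cdot (a x) (X x) = 0" for x
    using integr[of x "e i" "e j" "e k"] by (simp add: X_def cdot_add_right cdot_scale_right mult.commute)
  have "X 0 = 0" using isolated_zero_syzygy(1)[OF isolated_zero_axioms 1 2] .
  then have "X 0 $ k = 0" by simp
  then show ?thesis using k by (simp add: X_def e_def axis_def)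
qed

definition H :: "complex ^ 'n ^ 'n" where "H = (\<chi> k i. pd i (\<lambda>x. a x $ k) 0)"

lemma H_sym: "H $ i $ k = H $ k $ i"
  using E_axis_0[of i k] by (simp add: H_def E_axis)

lemma transpose_H: "transpose H = H"
  by (simp add: transpose_def vec_eq_iff H_sym)

lemma H_jac: "H *v u = jac a 0 u"
  by (simp add: H_def jac_def matrix_vector_mult_def cdot_def vec_eq_iff)

lemma H_row: "(H *v v = 0) \<longleftrightarrow> (\<forall>j. cdot (grad (\<lambda>x. a x $ j) 0) v = 0)"
  by (simp add: H_jac jac_def vec_eq_iff)

lemma syzygy_kernel:
  assumes "\<And>k. poly_fun (\<lambda>x. X x $ k)" "\<And>x. cdot (a x) (X x) = 0" "H *v v = 0"
  shows "jac X 0 v = 0"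
proof -
  have "jac X 0 v $ i = 0" for i
    unfolding jac_def vec_lambda_beta
    by (rule isolated_zero_syzygy(2)[OF isolated_zero_axioms assms(1,2)]) (use assms(3) H_row in blast)+
  then show ?thesis by (simp add: vec_eq_iff)
qed

definition F where "F x = cdot (a x) x"

lemma F_poly: "poly_fun F" by (simp add: F_def[abs_def] a_poly)

text \<open>Otherwise the radial field is tangent to the foliation.  Its linear part is the identity, so \<open>H\<close> would be
injective; but the second derivatives of \<open>a \<cdot> x = 0\<close> say \<open>H = 0\<close>.\<close>

lemma F_nonzero: "\<exists>x. F x \<noteq> 0"
proof (rule ccontr)
  assume "\<not> ?thesis"
  then have F: "cdot (a x) x = 0" for x by (simp add: F_def)
  have inj: "v = 0" if "H *v v = 0" for v
    using syzygy_kernel[of "\<lambda>x. x", OF _ F that] by (simp add: jac_id)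
  have sum1: "pd i (pd j (\<lambda>x. cdot (a x) x)) 0 = H $ j $ i + H $ i $ j" for i j
  proof -
    have "pd j (\<lambda>x. cdot (a x) x) x = a x $ j + (\<Sum>k\<in>UNIV. x $ k * pd j (\<lambda>x. a x $ k) x)" for x
    proof -
      have "pd j (\<lambda>x. cdot (a x) x) x = cdot (grad (\<lambda>x. cdot (a x) x) x) (axis j 1)" by simp
      also have "\<dots> = cdot (jac a x (axis j 1)) x + cdot (a x) (axis j 1)"
        by (subst grad_cdot) (simp_all add: a_poly jac_id)
      finally show ?thesis by (simp add: jac_def cdot_def[of _ x] mult.commute)
    qed
    then have pj: "pd j (\<lambda>x. cdot (a x) x) = (\<lambda>x. a x $ j + (\<Sum>k\<in>UNIV. x $ k * pd j (\<lambda>x. a x $ k) x))" by blast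
    show ?thesis unfolding pj
      by (simp add: pd_add pd_sum pd_mult a_poly H_def mult_delta_right)
  qed
  have sum0: "H $ j $ i + H $ i $ j = 0" for i j by (simp add: sum1[symmetric] F)
  have "H $ i $ j = 0" for i j
  proof -
    have "2 * H $ i $ j = 0" using sum0[of i j] unfolding H_sym[of j i] by (simp only: mult_2)
    then show ?thesis by simp
  qed
  then have "H *v axis undefined 1 = 0" by (simp add: matrix_vector_mult_def vec_eq_iff)
  then have "axis undefined (1::complex) = (0 :: complex ^ 'n)" by (rule inj)
  then have "axis undefined (1::complex) $ (undefined :: 'n) = 0" by simp
  then show False by (simp add: axis_def)
qed

lemma kernel_S: "H *v v = 0 \<Longrightarrow> (S, l) \<in> LL \<Longrightarrow> S *v v = 0"
  using syzygy_kernel[of "proj_field S l" v] tangent[of S l] by (simp add: jac_proj_field)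

text \<open>If \<open>H = 0\<close> then all linear parts \<open>S\<close> vanish and the fields are radial, too few to span the kernel of
\<open>a\<close> at a generic point.\<close>

lemma H_nonzero: "\<exists>w. H *v w \<noteq> 0"
proof (rule ccontr)
  assume "\<not> ?thesis"
  then have S0: "S *v v = 0" if "(S, l) \<in> LL" for S l v using kernel_S that by blast
  obtain x where x: "p x \<noteq> 0" using p_nz by blast
  have par: "\<exists>c. u = c *s x" if u: "cdot (a x) u = 0" for u
  proof -
    obtain S l where "(S, l) \<in> LL" "u = proj_field S l x" using span[OF x u] by blast
    then show ?thesis using S0 by (intro exI[of _ "- cdot l x"]) (simp add: proj_field_def vec_eq_iff)
  qed
  obtain f g where fg: "cdot (a x) f = 0" "cdot (a x) g = 0" "\<And>s t. s *s f + t *s g = 0 \<Longrightarrow> s = 0 \<and> t = 0"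
    using ex_two_kernel_vectors[OF card3 a_nz[OF x]] by blast
  obtain c d where cd: "f = c *s x" "g = d *s x" using par fg by blast
  have "d *s f + (- c) *s g = 0" by (simp add: cd vec_eq_iff)
  then have "d = 0 \<and> c = 0" using fg(3) by fastforce
  then have "1 *s f + 0 *s g = 0" by (simp add: cd)
  then show False using fg(3) by fastforce
qed

text \<open>On the kernel line of \<open>v\<close> the fields have no linear part, so the Lie derivative \<open>P\<close> of \<open>\<omega>\<close>
has leading coefficient \<open>S\<^sup>T \<beta>\<close>, where \<open>\<beta>\<close> is the leading coefficient of \<open>a\<close>.  By
integrability \<open>P\<close> is proportional to \<open>a\<close>.\<close>

lemma kernel_beta:
  assumes v: "v \<noteq> 0" "H *v v = 0"
  shows "\<exists>\<beta>. \<beta> \<noteq> 0 \<and> (\<forall>S l. (S, l) \<in> LL \<longrightarrow> transpose S *v \<beta> = 0)"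
proof -
  have "\<forall>k. \<exists>Q. \<forall>t. a (0 + t *s v) $ k = poly Q t" using poly_fun_line[OF a_poly] by blast
  from choice[OF this] obtain Al where Al0: "\<And>k t. a (0 + t *s v) $ k = poly (Al k) t" by blast
  have Al: "a (t *s v) $ k = poly (Al k) t" for k t using Al0[of t k] by simp
  have "\<exists>k. Al k \<noteq> 0"
  proof (rule ccontr)
    assume "\<not> ?thesis"
    then have z: "a (t *s v) = 0" for t by (simp add: vec_eq_iff Al)
    define t where "t = complex_of_real (\<epsilon> / (2 * norm v))"
    have nv: "norm v > 0" using v by simp
    have "norm (t *s v) = \<epsilon> / 2" using eps nv by (simp add: norm_scale t_def norm_divide norm_mult)
    moreover have "t *s v \<noteq> 0" using eps nv v(1) by (simp add: t_def)
    ultimately show False using iso[of "t *s v"] z eps by simp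
  qed
  then obtain k0 where "Al k0 \<noteq> 0" by blast
  from poly_vector_order[of Al, OF this] obtain b G where G: "\<And>k. Al k = [:0, 1:] ^ b * G k" and G0: "\<exists>k. poly (G k) 0 \<noteq> 0"
    by blast
  have aG: "a (s *s v) $ k = s ^ b * poly (G k) s" for s k by (simp add: Al G poly_power)
  define \<beta> :: "complex ^ 'n" where "\<beta> = (\<chi> k. poly (G k) 0)"
  have "\<beta> \<noteq> 0" using G0 by (auto simp: \<beta>_def vec_eq_iff)
  moreover have "transpose S *v \<beta> = 0" if LL: "(S, l) \<in> LL" for S l
  proof -
    define X where "X = proj_field S l"
    define P where "P x = (\<chi> m. \<Sum>i\<in>UNIV. X x $ i * E x (axis i 1) (axis m 1))" for x
    have PE: "P x $ m = E x (X x) (axis m 1)" for x m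
      by (simp add: P_def ext_deriv_jac[OF a_poly] E_axis jac_def cdot_def[of _ "X x"] right_diff_distrib sum_subtractf mult.commute)
    have P_poly: "poly_fun (\<lambda>x. P x $ k)" for k by (simp add: P_def E_axis a_poly X_def)
    have prp: "a x $ i * P x $ j = a x $ j * P x $ i" for x i j
    proof -
      have "E x (axis j 1) (X x) = - E x (X x) (axis j 1)" by (simp add: ext_deriv_jac[OF a_poly])
      then show ?thesis using integr[of x "X x" "axis i 1" "axis j 1"] tangent[OF LL, of x]
        by (simp add: PE X_def)
    qed
    have X0: "X 0 = 0" by (simp add: X_def proj_field_def)
    have P0: "P 0 = 0" by (simp add: P_def X0 vec_eq_iff)
    obtain w where w: "H *v w \<noteq> 0" using H_nonzero by blast
    have dP: "jac P 0 w = 0"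
    proof -
      have gP: "grad (\<lambda>x. P x $ m) 0 = 0" for m
      proof -
        have "grad (\<lambda>x. X x $ i * E x (axis i 1) (axis m 1)) 0 = 0" for i
          by (subst grad_mult) (simp_all add: X_def E_axis a_poly E_axis_0[unfolded E_axis] X0[unfolded X_def])
        then show ?thesis unfolding P_def vec_lambda_beta
          by (subst grad_sum) (simp_all add: X_def E_axis a_poly)
      qed
      show ?thesis unfolding jac_def gP by (simp add: vec_eq_iff)
    qed
    have ind: "s = 0 \<and> z = 0" if 0: "s *s v + z *s w = 0" for s z
    proof -
      have "H *v (s *s v + z *s w) = 0" by (simp add: 0)
      then have "z *s (H *v w) = 0" by (simp add: matrix_vector_right_distrib vector_scalar_commute v)
      then have "z = 0" using w by simp
      then show ?thesis using 0 v by simp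
    qed
    define \<pi> where "\<pi> m = [:- cdot l v:] * ([:0, of_nat b:] * G m + [:0, 0, 1:] * pderiv (G m))
      + (\<Sum>i\<in>UNIV. G i * [: S $ i $ m, - (l $ m * v $ i) :]) - [:0, cdot l v:] * G m" for m
    have P\<pi>: "P (s *s v) $ m = s ^ b * poly (\<pi> m) s" for s m
    proof -
      have Xs: "X (s *s v) = (- (s\<^sup>2 * cdot l v)) *s v"
        by (simp add: X_def proj_field_def vector_scalar_commute kernel_S[OF v(2) LL] cdot_scale_right vec_eq_iff power2_eq_square)
      have "((\<lambda>t. a (0 + t *s v) $ m) has_field_derivative cdot (grad (\<lambda>x. a x $ m) (0 + s *s v)) v) (at s)"
        by (rule poly_fun_line_deriv[OF a_poly])
      then have "(poly (Al m) has_field_derivative cdot (grad (\<lambda>x. a x $ m) (s *s v)) v) (at s)"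
        by (simp add: Al)
      then have der: "jac a (s *s v) v $ m = poly (pderiv (Al m)) s"
        unfolding jac_def vec_lambda_beta using poly_DERIV DERIV_unique by blast
      have sder: "s * poly (pderiv (Al m)) s = s ^ b * (of_nat b * poly (G m) s + s * poly (pderiv (G m)) s)"
      proof -
        have "s * poly (pderiv ([:0, 1:] ^ n)) s = of_nat n * s ^ n" for n
        proof (induction n)
          case (Suc n)
          have "s * poly (pderiv ([:0, 1:] ^ Suc n)) s = s * (s * poly (pderiv ([:0, 1:] ^ n)) s) + s * s ^ n"
            by (simp add: pderiv_mult pderiv_pCons poly_power algebra_simps)
          then show ?case unfolding Suc by (simp add: algebra_simps)
        qed (simp add: pderiv_1)
        moreover have "s * poly (pderiv ([:0, 1:] ^ b * G m)) s
            = (s * poly (pderiv ([:0, 1:] ^ b)) s) * poly (G m) s + s ^ b * (s * poly (pderiv (G m)) s)"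
          by (simp add: pderiv_mult poly_power algebra_simps)
        ultimately show ?thesis unfolding G by (simp add: algebra_simps)
      qed
      have "cdot (jac a x u) (X x) + cdot (a x) (jac X x u) = 0" for x u
      proof -
        have "cdot (grad (\<lambda>x. cdot (a x) (X x)) x) u = cdot (jac a x u) (X x) + cdot (a x) (jac X x u)"
          by (rule grad_cdot) (simp_all add: a_poly X_def)
        then show ?thesis using tangent[OF LL] by (simp add: X_def)
      qed
      then have jX: "cdot (jac a x u) (X x) = - cdot (a x) (jac X x u)" for x u by (simp add: eq_neg_iff_add_eq_0)
      have "P (s *s v) $ m = jac a (s *s v) (X (s *s v)) $ m + cdot (a (s *s v)) (jac X (s *s v) (axis m 1))"
        by (simp add: PE ext_deriv_jac[OF a_poly] jX)
      also have "jac a (s *s v) (X (s *s v)) $ m = - (s * cdot l v) * (s * poly (pderiv (Al m)) s)"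
        unfolding Xs jac_scale_right by (simp add: der power2_eq_square)
      also have "cdot (a (s *s v)) (jac X (s *s v) (axis m 1))
          = (\<Sum>i\<in>UNIV. a (s *s v) $ i * (S $ i $ m - l $ m * s * v $ i)) - s * cdot l v * a (s *s v) $ m"
      proof -
        have "cdot (a (s *s v)) (S *v axis m 1 - l $ m *s (s *s v)) = (\<Sum>i\<in>UNIV. a (s *s v) $ i * (S $ i $ m - l $ m * s * v $ i))"
        proof -
          have "(S *v axis m 1) $ k = S $ k $ m" for k
            by (simp add: matrix_vector_mult_def axis_def if_distrib cong: if_cong)
          then show ?thesis by (simp add: cdot_def mult.assoc)
        qed
        then show ?thesis by (simp add: X_def jac_proj_field cdot_diff_right cdot_scale_right)
      qed
      also have "(\<Sum>i\<in>UNIV. a (s *s v) $ i * (S $ i $ m - l $ m * s * v $ i))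
          = s ^ b * poly (\<Sum>i\<in>UNIV. G i * [: S $ i $ m, - (l $ m * v $ i) :]) s"
        by (simp add: aG poly_sum sum_distrib_left algebra_simps)
      finally show ?thesis unfolding sder aG \<pi>_def
        by (simp add: algebra_simps)
    qed
    have "poly (\<pi> m) 0 = 0" for m
      by (rule proportional_leading_term[OF isolated_zero_axioms P_poly prp P0 dP _ ind aG P\<pi>])
        (use w H_jac in auto)
    then show ?thesis
      by (simp add: \<pi>_def poly_sum \<beta>_def vec_eq_iff matrix_vector_mult_def transpose_def mult.commute)
  qed
  ultimately show ?thesis by blast
qed


lemma jac_field: "(S, l) \<in> LL \<Longrightarrow> cdot (jac a x u) (proj_field S l x)
    = - cdot (a x) (S *v u) + cdot l u * F x + cdot l x * cdot (a x) u"
proof -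
  assume LL: "(S, l) \<in> LL"
  have "cdot (grad (\<lambda>x. cdot (a x) (proj_field S l x)) x) u
      = cdot (jac a x u) (proj_field S l x) + cdot (a x) (jac (proj_field S l) x u)"
    by (rule grad_cdot) (simp_all add: a_poly)
  then show ?thesis using tangent[OF LL]
    by (simp add: jac_proj_field cdot_diff_right cdot_add_right cdot_scale_right F_def algebra_simps)
qed

lemma jac_radial: "cdot (jac a x u) x = cdot (grad F x) u - cdot (a x) u"
proof -
  have "cdot (grad (\<lambda>x. cdot (a x) x) x) u = cdot (jac a x u) x + cdot (a x) (jac (\<lambda>x. x) x u)"
    by (rule grad_cdot) (simp_all add: a_poly)
  then show ?thesis by (simp add: jac_id F_def[abs_def])
qed

lemma ext_deriv_fields:
  assumes LL: "(S, l) \<in> LL" "(S', l') \<in> LL"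
  shows "E x (proj_field S l x) (proj_field S' l' x) = 0"
proof -
  define X X' where X: "X = proj_field S l x" and X': "X' = proj_field S' l' x"
  have S: "cdot (a x) (S *v x) = cdot l x * F x" "cdot (a x) (S' *v x) = cdot l' x * F x"
    using tangent[OF LL(1), of x] tangent[OF LL(2), of x] by (auto simp: proj_field_def cdot_diff_right cdot_scale_right F_def)
  have "cdot (a x) (S' *v (S *v x)) - cdot (a x) (S *v (S' *v x)) = (cdot l' (S *v x) - cdot l (S' *v x)) * F x"
    using tangent[OF bracket[OF LL], of x]
    unfolding proj_field_def cdot_diff_right cdot_diff_left cdot_scale_right F_def matrix_vector_mult_diff_rdistrib
      matrix_vector_mul_assoc[symmetric] cdot_matrix[symmetric]
    by simp
  then have br: "cdot (a x) (S' *v (S *v x)) = cdot (a x) (S *v (S' *v x)) + (cdot l' (S *v x) - cdot l (S' *v x)) * F x"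
    by (simp add: algebra_simps)
  have aX: "cdot (a x) X = 0" "cdot (a x) X' = 0" unfolding X X' by (rule tangent LL)+
  have e: "cdot (jac a x X) X' = - cdot (a x) (S' *v X) + cdot l' X * F x"
    "cdot (jac a x X') X = - cdot (a x) (S *v X') + cdot l X' * F x"
    using jac_field[OF LL(1), of x X'] jac_field[OF LL(2), of x X] by (simp_all add: aX flip: X X')
  have q: "cdot (a x) (S' *v X) = cdot (a x) (S' *v (S *v x)) - cdot l x * (cdot l' x * F x)"
    "cdot (a x) (S *v X') = cdot (a x) (S *v (S' *v x)) - cdot l' x * (cdot l x * F x)"
    by (simp_all add: X X' proj_field_def matrix_vector_mult_diff_distrib vector_scalar_commute cdot_diff_right cdot_scale_right S)
  have l: "cdot l' X = cdot l' (S *v x) - cdot l x * cdot l' x" "cdot l X' = cdot l (S' *v x) - cdot l' x * cdot l x"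
    by (simp_all add: X X' proj_field_def cdot_diff_right cdot_scale_right)
  show ?thesis unfolding X[symmetric] X'[symmetric] ext_deriv_jac[OF a_poly] e q l br by (simp add: algebra_simps)
qed

lemma ext_deriv_radial:
  assumes LL: "(S, l) \<in> LL"
  shows "E x (proj_field S l x) x = cdot (grad F x) (proj_field S l x) - cdot l x * F x"
proof -
  have S: "cdot (a x) (S *v x) = cdot l x * F x"
    using tangent[OF LL(1), of x] by (auto simp: proj_field_def cdot_diff_right cdot_scale_right F_def)
  show ?thesis unfolding ext_deriv_jac[OF a_poly] jac_field[OF LL] jac_radial
    by (simp add: S tangent[OF LL] F_def)
qed

lemma decompose:
  assumes x: "p x \<noteq> 0" "F x \<noteq> 0"
  shows "\<exists>S l. (S, l) \<in> LL \<and> u = proj_field S l x + (cdot (a x) u / F x) *s x"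
proof -
  have "cdot (a x) (u - (cdot (a x) u / F x) *s x) = 0"
    using x by (simp add: cdot_diff_right cdot_scale_right F_def)
  from span[OF x(1) this] show ?thesis by (auto simp: diff_eq_eq)
qed

text \<open>In terms of forms: \<open>y (F d\<omega> - dF \<and> \<omega>) = F \<beta> \<and> \<omega>\<close> with \<open>y = \<beta> \<cdot> x\<close>.
At a generic point it suffices to insert fields of the Lie algebra and the radial field, for which
\<open>d\<omega>\<close> and \<open>dF\<close> are known.\<close>

lemma structure_identity:
  assumes \<beta>: "\<And>S l. (S, l) \<in> LL \<Longrightarrow> transpose S *v \<beta> = 0"
  shows "cdot \<beta> x * (F x * E x u w - cdot (grad F x) u * cdot (a x) w + cdot (grad F x) w * cdot (a x) u)
     - F x * (cdot \<beta> u * cdot (a x) w - cdot \<beta> w * cdot (a x) u) = 0" (is "?D x = 0")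
proof -
  obtain x0 where x0: "p x0 * F x0 \<noteq> 0"
    using poly_fun_common_nonzero[OF p_poly p_nz F_poly] F_nonzero by auto
  have D_poly: "poly_fun ?D"
    by (simp add: ext_deriv_jac[OF a_poly] a_poly F_poly poly_fun_jac)
  show ?thesis
  proof (rule poly_fun_generic[of "\<lambda>x. p x * F x", OF poly_fun_mult[OF p_poly F_poly] x0 D_poly])
    fix x assume "p x * F x \<noteq> 0"
    then have x: "p x \<noteq> 0" "F x \<noteq> 0" by auto
    define \<tau> \<tau>' where \<tau>: "\<tau> = cdot (a x) u / F x" and \<tau>': "\<tau>' = cdot (a x) w / F x"
    obtain S l where LL: "(S, l) \<in> LL" and u0: "u = proj_field S l x + \<tau> *s x" using decompose[OF x] unfolding \<tau> by blast
    obtain S' l' where LL': "(S', l') \<in> LL" and w0: "w = proj_field S' l' x + \<tau>' *s x" using decompose[OF x] unfolding \<tau>' by blast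
    define X X' where X: "X = proj_field S l x" and X': "X' = proj_field S' l' x"
    have u: "u = X + \<tau> *s x" and w: "w = X' + \<tau>' *s x" using u0 w0 X X' by auto
    have au: "cdot (a x) u = \<tau> * F x" and aw: "cdot (a x) w = \<tau>' * F x" using x by (auto simp: \<tau> \<tau>')
    have b0: "cdot \<beta> (S *v x) = 0" "cdot \<beta> (S' *v x) = 0"
      unfolding cdot_matrix \<beta>[OF LL] \<beta>[OF LL'] by simp_all
    have bX: "cdot \<beta> X = - cdot l x * cdot \<beta> x" "cdot \<beta> X' = - cdot l' x * cdot \<beta> x"
      by (simp_all add: X X' proj_field_def cdot_diff_right b0 cdot_scale_right)
    have bil: "E x (y + c *s x) (z + d *s x) = E x y z + d * E x y x - c * E x z x" for y z c d
      by (simp add: ext_deriv_jac[OF a_poly] jac_add_right jac_scale_right cdot_add_left cdot_add_right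
        cdot_scale_left cdot_scale_right algebra_simps)
    have Euw: "E x u w = \<tau>' * (cdot (grad F x) X - cdot l x * F x) - \<tau> * (cdot (grad F x) X' - cdot l' x * F x)"
      unfolding u w bil using ext_deriv_fields[OF LL LL', of x] ext_deriv_radial[OF LL, of x] ext_deriv_radial[OF LL', of x]
      by (simp add: X X')
    have gu: "cdot (grad F x) u = cdot (grad F x) X + \<tau> * cdot (grad F x) x"
      and gw: "cdot (grad F x) w = cdot (grad F x) X' + \<tau>' * cdot (grad F x) x"
      and bu: "cdot \<beta> u = - cdot l x * cdot \<beta> x + \<tau> * cdot \<beta> x"
      and bw: "cdot \<beta> w = - cdot l' x * cdot \<beta> x + \<tau>' * cdot \<beta> x"
      by (simp_all add: u w cdot_add_right cdot_scale_right bX)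
    show "?D x = 0" unfolding Euw gu gw bu bw au aw by (simp add: algebra_simps)
  qed
qed

text \<open>Let \<open>F = y\<^sup>k g\<close> with \<open>g\<close> not divisible by \<open>y\<close>.  The structure identity then contains the term
\<open>(k + 1) g \<beta> \<and> \<omega>\<close>, all others being divisible by \<open>y\<close>.  So \<open>\<omega>\<close> is a
multiple of \<open>\<beta>\<close> on the hyperplane \<open>y = 0\<close>, and the zeros of that factor are not isolated.\<close>

theorem H_injective: "H *v v = 0 \<Longrightarrow> v = 0"
proof (rule ccontr)
  assume "H *v v = 0" "v \<noteq> 0"
  then obtain \<beta> where \<beta>0: "\<beta> \<noteq> 0" and \<beta>: "\<And>S l. (S, l) \<in> LL \<Longrightarrow> transpose S *v \<beta> = 0"
    using kernel_beta by blast
  obtain xF where "F xF \<noteq> 0" using F_nonzero by blast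
  from poly_fun_extract_power[OF F_poly this \<beta>0] obtain k g z1 where g: "poly_fun g"
    and Fg: "\<And>x. F x = cdot \<beta> x ^ k * g x" and z1: "cdot \<beta> z1 = 0" "g z1 \<noteq> 0" by blast
  obtain e where e: "cdot \<beta> e = 1" using ex_cdot_eq_1[OF \<beta>0] by blast
  have dF: "cdot \<beta> x * cdot (grad F x) u = of_nat k * F x * cdot \<beta> u + cdot \<beta> x ^ Suc k * cdot (grad g x) u" for x u
  proof -
    have "grad (\<lambda>x. cdot \<beta> x ^ m) x = (of_nat m * cdot \<beta> x ^ (m - 1)) *s \<beta>" for m
    proof (induction m)
      case (Suc m)
      have "grad (\<lambda>x. cdot \<beta> x ^ Suc m) x = cdot \<beta> x *s grad (\<lambda>x. cdot \<beta> x ^ m) x + cdot \<beta> x ^ m *s \<beta>"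
        by (simp add: grad_mult)
      also have "\<dots> = (of_nat (Suc m) * cdot \<beta> x ^ m) *s \<beta>"
        unfolding Suc by (cases m) (simp_all add: vec_eq_iff algebra_simps)
      finally show ?case by simp
    qed simp
    then have "grad F x = cdot \<beta> x ^ k *s grad g x + (g x * of_nat k * cdot \<beta> x ^ (k - 1)) *s \<beta>"
      unfolding Fg[abs_def] by (simp add: grad_mult g vec_eq_iff)
    then show ?thesis by (cases k) (simp_all add: Fg cdot_add_left cdot_scale_left algebra_simps)
  qed
  define W where "W x u w = cdot \<beta> u * cdot (a x) w - cdot \<beta> w * cdot (a x) u" for x u w
  define R where "R u w x = cdot \<beta> x * (g x * E x u w - cdot (grad g x) u * cdot (a x) w + cdot (grad g x) w * cdot (a x) u)
      - of_nat (Suc k) * g x * W x u w" for u w x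
  have R0: "R u w x = 0" for u w x
  proof (rule poly_fun_generic[of "\<lambda>x. cdot \<beta> x" e])
    show "poly_fun (R u w)" unfolding R_def[abs_def] W_def by (simp add: ext_deriv_jac[OF a_poly] a_poly g poly_fun_jac)
    fix x assume y: "cdot \<beta> x \<noteq> 0"
    have "cdot \<beta> x * (F x * E x u w) - (cdot \<beta> x * cdot (grad F x) u) * cdot (a x) w + (cdot \<beta> x * cdot (grad F x) w) * cdot (a x) u
       - F x * W x u w = 0"
      using structure_identity[OF \<beta>, where x = x and u = u and w = w] unfolding W_def by (simp add: algebra_simps)
    then have "cdot \<beta> x ^ k * R u w x = 0" unfolding dF unfolding Fg R_def W_def by (simp add: algebra_simps)
    then show "R u w x = 0" using y by simp
  qed (simp_all add: e)
  have W0: "W x u w = 0" if y: "cdot \<beta> x = 0" for x u w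
  proof -
    define pr where "pr x = x - cdot \<beta> x *s e" for x
    have pr: "cdot \<beta> (pr x) = 0" for x by (simp add: pr_def cdot_diff_right cdot_scale_right e)
    have pr_id: "pr x = x" if "cdot \<beta> x = 0" for x using that by (simp add: pr_def)
    have prp: "poly_fun (\<lambda>x. pr x $ k)" for k by (simp add: pr_def)
    have "W (pr x) u w = 0"
    proof (rule poly_fun_integral_domain[of "\<lambda>x. g (pr x)" "\<lambda>x. W (pr x) u w" z1])
      show "poly_fun (\<lambda>x. g (pr x))" by (rule poly_fun_compose[OF g prp])
      have "poly_fun (\<lambda>x. W x u w)" by (simp add: W_def a_poly)
      then show "poly_fun (\<lambda>x. W (pr x) u w)" by (rule poly_fun_compose) (rule prp)
      show "g (pr z) * W (pr z) u w = 0" for z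
        using R0[of u w "pr z"] by (auto simp: R_def pr simp del: of_nat_Suc)
      show "g (pr z1) \<noteq> 0" using z1 pr_id by simp
    qed
    then show ?thesis using pr_id[OF y] by simp
  qed
  define h where "h x = cdot (a x) e" for x
  have ah: "a x = h x *s \<beta>" if "cdot \<beta> x = 0" for x
  proof (rule cdot_eqI)
    fix w show "cdot (a x) w = cdot (h x *s \<beta>) w"
      using W0[OF that, of e w] by (simp add: W_def e h_def cdot_scale_left)
  qed
  obtain f f' where f: "cdot \<beta> f = 0" "cdot \<beta> f' = 0" and ind: "\<And>s t. s *s f + t *s f' = 0 \<Longrightarrow> s = 0 \<and> t = 0"
    using ex_two_kernel_vectors[OF card3 \<beta>0] by blast
  define \<delta> where "\<delta> = \<epsilon> / (2 * (norm f + norm f' + 1))"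
  have c: "norm f + norm f' + 1 > 0" by (simp add: add_nonneg_pos)
  have \<delta>: "\<delta> > 0" using eps c by (simp add: \<delta>_def)
  have "poly_fun h" "h 0 = 0" by (simp_all add: h_def[abs_def] a_poly a_0)
  from poly_fun_nonisolated_zero[OF this \<delta>] obtain s t where st: "s \<noteq> 0 \<or> t \<noteq> 0" "norm s < \<delta>" "norm t < \<delta>" "h (s *s f + t *s f') = 0"
    by blast
  define x where "x = s *s f + t *s f'"
  have "x \<noteq> 0" using ind st(1) unfolding x_def by blast
  moreover have "a x = 0" using ah[of x] st(4) by (simp add: x_def cdot_add_right cdot_scale_right f)
  moreover have "norm x < \<epsilon>"
  proof -
    have "norm x \<le> norm s * norm f + norm t * norm f'"
      unfolding x_def using norm_triangle_ineq[of "s *s f" "t *s f'"] by (simp add: norm_scale)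
    also have "\<dots> \<le> \<delta> * norm f + \<delta> * norm f'" using st by (intro add_mono mult_right_mono) auto
    also have "\<dots> \<le> \<delta> * (norm f + norm f' + 1)" using \<delta> by (simp add: algebra_simps)
    also have "\<dots> = \<epsilon> / 2"
    proof -
      have "c > 0 \<Longrightarrow> \<epsilon> / (2 * c) * c = \<epsilon> / 2" for c :: real by simp
      from this[OF c] show ?thesis by (simp only: \<delta>_def)
    qed
    also have "\<dots> < \<epsilon>" using eps by simp
    finally show ?thesis .
  qed
  ultimately show False using iso by blast
qed


end

context projective_symmetries
begin

lemma ex_inverse: "\<exists>G. G ** H = mat 1 \<and> H ** G = mat 1 \<and> transpose G = G"
proof -
  obtain G where G: "G ** H = mat 1"
    using matrix_left_invertible_ker[of H] H_injective by blast
  have HG: "H ** G = mat 1" using G by (simp add: matrix_left_right_inverse)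
  have "transpose G ** H = mat 1"
    using HG transpose_H by (metis matrix_transpose_mul transpose_mat)
  then have "transpose G = G" using HG by (metis matrix_mul_assoc matrix_mul_lid matrix_mul_rid)
  then show ?thesis using G HG by blast
qed

end

section \<open>Linearisation of the Lie algebra\<close>

lemma pd_commute: "poly_fun f \<Longrightarrow> pd i (pd j f) = pd j (pd i f)"
proof (induction rule: poly_fun_induct)
  case (coord k)
  then show ?case by simp
qed (simp_all add: pd_add pd_mult algebra_simps)

lemma pd_cdot_const [simp]: "pd j (\<lambda>x. cdot l x) = (\<lambda>x. l $ j)"
proof
  fix x show "pd j (\<lambda>x. cdot l x) x = l $ j" using grad_cdot_const[of l x] by (metis grad_nth)
qed

lemma second_pd_mult:
  assumes "poly_fun f" "poly_fun g"
  shows "pd j (pd m (\<lambda>x. f x * g x)) x = f x * pd j (pd m g) x + pd j f x * pd m g x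
    + pd m f x * pd j g x + pd j (pd m f) x * g x"
  using assms by (simp add: pd_mult pd_add algebra_simps)

lemma third_pd_mult:
  assumes "poly_fun f" "poly_fun g"
  shows "pd i (pd j (pd m (\<lambda>x. f x * g x))) x = f x * pd i (pd j (pd m g)) x
    + pd i f x * pd j (pd m g) x + pd j f x * pd i (pd m g) x + pd m f x * pd i (pd j g) x
    + pd i (pd j f) x * pd m g x + pd i (pd m f) x * pd j g x + pd j (pd m f) x * pd i g x
    + pd i (pd j (pd m f)) x * g x"
  using assms by (simp add: pd_mult pd_add algebra_simps)

context projective_symmetries
begin

definition A2 where "A2 k i j = pd i (pd j (\<lambda>x. a x $ k)) 0"

lemma A2_commute: "A2 k i j = A2 k j i"
  unfolding A2_def by (simp only: pd_commute[OF a_poly])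

lemma pd_proj_field:
  "pd m (\<lambda>x. proj_field S l x $ k) = (\<lambda>x. S $ k $ m - l $ m * x $ k - cdot l x * (if m = k then 1 else 0))"
proof
  fix x
  have "pd m (\<lambda>x. proj_field S l x $ k) x = jac (proj_field S l) x (axis m 1) $ k" by (simp add: jac_def)
  moreover have "(S *v axis m 1) $ k = S $ k $ m"
    by (simp add: matrix_vector_mult_def axis_def if_distrib cong: if_cong)
  moreover have "axis m 1 $ k = (if m = k then 1 else (0 :: complex))" by (simp add: axis_def)
  ultimately show "pd m (\<lambda>x. proj_field S l x $ k) x = S $ k $ m - l $ m * x $ k - cdot l x * (if m = k then 1 else 0)"
    by (simp add: jac_proj_field)
qed

lemma pd2_proj_field:
  "pd j (pd m (\<lambda>x. proj_field S l x $ k)) = (\<lambda>x. - l $ m * (if j = k then 1 else 0) - l $ j * (if m = k then 1 else 0))"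
  unfolding pd_proj_field by (cases "m = k") (simp_all add: pd_diff pd_mult fun_eq_iff)

lemma skew:
  assumes LL: "(S, l) \<in> LL"
  shows "H ** S = - transpose (H ** S)"
proof -
  have "(\<Sum>k\<in>UNIV. H $ k $ i * S $ k $ j + H $ k $ j * S $ k $ i) = 0" for i j
  proof -
    have "(\<lambda>x. \<Sum>k\<in>UNIV. a x $ k * proj_field S l x $ k) = (\<lambda>x. 0)"
      using tangent[OF LL] by (simp add: cdot_def)
    then have "pd i (pd j (\<lambda>x. \<Sum>k\<in>UNIV. a x $ k * proj_field S l x $ k)) 0 = 0" by simp
    then have "(\<Sum>k\<in>UNIV. pd i (pd j (\<lambda>x. a x $ k * proj_field S l x $ k)) 0) = 0"
      by (simp add: pd_sum a_poly)
    moreover have "pd i (pd j (\<lambda>x. a x $ k * proj_field S l x $ k)) 0 = H $ k $ i * S $ k $ j + H $ k $ j * S $ k $ i" for k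
      unfolding second_pd_mult[OF a_poly poly_fun_proj_field] pd_proj_field
      by (simp add: a_0 H_def proj_field_def)
    ultimately show ?thesis by simp
  qed
  then have 0: "(\<Sum>k\<in>UNIV. H $ k $ i * S $ k $ j) = - (\<Sum>k\<in>UNIV. H $ k $ j * S $ k $ i)" for i j
    by (simp add: sum.distrib eq_neg_iff_add_eq_0)
  have "(H ** S) $ i $ j = (- transpose (H ** S)) $ i $ j" for i j
    using 0[of i j] by (simp add: matrix_matrix_mult_def transpose_def H_sym[of i] H_sym[of j])
  then show ?thesis by (simp add: vec_eq_iff)
qed

text \<open>The third derivatives of \<open>a \<cdot> X = 0\<close> at the origin, for \<open>X\<close> in the Lie algebra.\<close>

lemma third_order:
  assumes LL: "(S, l) \<in> LL"
  shows "(\<Sum>k\<in>UNIV. A2 k i j * S $ k $ m) + (\<Sum>k\<in>UNIV. A2 k i m * S $ k $ j) + (\<Sum>k\<in>UNIV. A2 k j m * S $ k $ i)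
    = 2 * (H $ i $ j * l $ m + H $ i $ m * l $ j + H $ j $ m * l $ i)"
proof -
  have "(\<lambda>x. \<Sum>k\<in>UNIV. a x $ k * proj_field S l x $ k) = (\<lambda>x. 0)"
    using tangent[OF LL] by (simp add: cdot_def)
  then have "pd i (pd j (pd m (\<lambda>x. \<Sum>k\<in>UNIV. a x $ k * proj_field S l x $ k))) 0 = 0" by simp
  then have "(\<Sum>k\<in>UNIV. pd i (pd j (pd m (\<lambda>x. a x $ k * proj_field S l x $ k))) 0) = 0"
    by (simp add: pd_sum a_poly)
  moreover have "pd i (pd j (pd m (\<lambda>x. a x $ k * proj_field S l x $ k))) 0
      = A2 k i j * S $ k $ m + A2 k i m * S $ k $ j + A2 k j m * S $ k $ i
        - (H $ k $ i * (l $ m * (if j = k then 1 else 0) + l $ j * (if m = k then 1 else 0))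
          + H $ k $ j * (l $ m * (if i = k then 1 else 0) + l $ i * (if m = k then 1 else 0))
          + H $ k $ m * (l $ j * (if i = k then 1 else 0) + l $ i * (if j = k then 1 else 0)))" for k
    unfolding third_pd_mult[OF a_poly poly_fun_proj_field] pd2_proj_field
    unfolding pd_proj_field by (simp add: a_0 A2_def H_def proj_field_def algebra_simps)
  ultimately have "(\<Sum>k\<in>UNIV. A2 k i j * S $ k $ m + A2 k i m * S $ k $ j + A2 k j m * S $ k $ i
        - (H $ k $ i * (l $ m * (if j = k then 1 else 0) + l $ j * (if m = k then 1 else 0))
          + H $ k $ j * (l $ m * (if i = k then 1 else 0) + l $ i * (if m = k then 1 else 0))
          + H $ k $ m * (l $ j * (if i = k then 1 else 0) + l $ i * (if j = k then 1 else 0)))) = 0"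
    by simp
  moreover have "(\<Sum>k\<in>UNIV. f k * (c * (if i = k then 1 else 0))) = f i * c" for f :: "'n \<Rightarrow> complex" and c i
    by (simp add: mult_delta_right)
  ultimately have "(\<Sum>k\<in>UNIV. A2 k i j * S $ k $ m) + (\<Sum>k\<in>UNIV. A2 k i m * S $ k $ j) + (\<Sum>k\<in>UNIV. A2 k j m * S $ k $ i)
    - (H $ j $ i * l $ m + H $ m $ i * l $ j + (H $ i $ j * l $ m + H $ m $ j * l $ i) + (H $ i $ m * l $ j + H $ j $ m * l $ i)) = 0"
    by (simp only: sum.distrib sum_subtractf distrib_left)
  then have "(\<Sum>k\<in>UNIV. A2 k i j * S $ k $ m) + (\<Sum>k\<in>UNIV. A2 k i m * S $ k $ j) + (\<Sum>k\<in>UNIV. A2 k j m * S $ k $ i)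
    = H $ j $ i * l $ m + H $ m $ i * l $ j + H $ i $ j * l $ m + H $ m $ j * l $ i + H $ i $ m * l $ j + H $ j $ m * l $ i"
    by (simp add: algebra_simps)
  then show ?thesis by (simp add: H_sym[of j i] H_sym[of m i] H_sym[of m j] algebra_simps)
qed

definition D where "D j k t = A2 k t j - A2 j t k"

lemma D_eq: "D j k t = pd t (\<lambda>x. E x (axis j 1) (axis k 1)) 0"
  by (simp add: D_def A2_def E_axis pd_diff a_poly)

lemma D_skew: "D k j t = - D j k t" by (simp add: D_def)

lemma integr_second_order:
  "H $ i $ s * D j k t + H $ i $ t * D j k s + (H $ j $ s * D k i t + H $ j $ t * D k i s)
    + (H $ k $ s * D i j t + H $ k $ t * D i j s) = 0"
proof -
  define e where "e x j k = E x (axis j 1) (axis k 1)" for x and j k :: 'n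
  have ep: "poly_fun (\<lambda>x. e x j k)" for j k by (simp add: e_def E_axis a_poly)
  have e0: "e 0 j k = 0" for j k by (simp add: e_def E_axis_0)
  have De: "pd t (\<lambda>x. e x j k) 0 = D j k t" for j k t by (simp add: D_eq e_def)
  have He: "pd t (\<lambda>x. a x $ i) 0 = H $ i $ t" for i t by (simp add: H_def)
  have "(\<lambda>x. a x $ i * e x j k + a x $ j * e x k i + a x $ k * e x i j) = (\<lambda>x. 0)"
    using integr[of _ "axis i 1" "axis j 1" "axis k 1"] by (simp add: e_def)
  then have "pd s (pd t (\<lambda>x. a x $ i * e x j k + a x $ j * e x k i + a x $ k * e x i j)) 0 = 0" by simp
  then have "pd s (pd t (\<lambda>x. a x $ i * e x j k)) 0 + pd s (pd t (\<lambda>x. a x $ j * e x k i)) 0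
     + pd s (pd t (\<lambda>x. a x $ k * e x i j)) 0 = 0"
    by (simp add: pd_add a_poly ep)
  then show ?thesis
    by (simp add: second_pd_mult a_poly ep a_0 e0 De He algebra_simps)
qed

text \<open>Contract the third order relation with the inverse \<open>G\<close> of \<open>H\<close>.  In the second and third term only the
skew part of the second derivatives survives, as \<open>S G\<close> is skew; and integrability at second order says
\<open>d\<omega> = H x \<and> c\<close> in lowest order, which contraction with \<open>G\<close> turns into an explicit formula
for \<open>c\<close>.\<close>

theorem common_centre: "\<exists>c. \<forall>S l. (S, l) \<in> LL \<longrightarrow> l = transpose S *v c"
proof -
  obtain G where GH: "G ** H = mat 1" "H ** G = mat 1" "transpose G = G" using ex_inverse by blast
  define con where "con f = (\<Sum>i\<in>UNIV. \<Sum>s\<in>UNIV. G $ i $ s * f i s)" for f :: "'n \<Rightarrow> 'n \<Rightarrow> complex"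
  have con_add: "con (\<lambda>i s. f i s + g i s) = con f + con g" for f g
    by (simp add: con_def distrib_left sum.distrib)
  have con_scale: "con (\<lambda>i s. c * f i s) = c * con f" for c f
    by (simp only: con_def sum_distrib_left) (simp only: mult_ac)
  have con_scale_right: "con (\<lambda>i s. f i s * c) = con f * c" for c f
    by (simp only: con_def sum_distrib_right) (simp only: mult_ac)
  have con_minus: "con (\<lambda>i s. - f i s) = - con f" for f
    by (simp add: con_def sum_negf)
  have G_sym: "G $ i $ j = G $ j $ i" for i j
  proof -
    have "transpose G $ i $ j = G $ i $ j" by (simp only: GH(3))
    then show ?thesis by (simp add: transpose_def)
  qed
  have GH': "(\<Sum>s\<in>UNIV. G $ i $ s * H $ s $ j) = (if i = j then 1 else 0)" for i j
    using GH(1) by (simp add: matrix_matrix_mult_def mat_def vec_eq_iff)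
  have HG': "(\<Sum>s\<in>UNIV. H $ i $ s * G $ s $ j) = (if i = j then 1 else 0)" for i j
    using GH(2) by (simp add: matrix_matrix_mult_def mat_def vec_eq_iff)
  have c1: "con (\<lambda>i s. H $ i $ s) = of_nat CARD('n)"
  proof -
    have "con (\<lambda>i s. H $ i $ s) = (\<Sum>i\<in>(UNIV :: 'n set). 1)" unfolding con_def
      by (intro sum.cong refl) (subst H_sym, simp add: GH')
    then show ?thesis by simp
  qed
  have c2: "con (\<lambda>i s. H $ i $ t * f s) = f t" for f t
  proof -
    have "con (\<lambda>i s. H $ i $ t * f s) = (\<Sum>s\<in>UNIV. \<Sum>i\<in>UNIV. G $ i $ s * (H $ i $ t * f s))"
      unfolding con_def by (rule sum.swap)
    also have "\<dots> = (\<Sum>s\<in>UNIV. (\<Sum>i\<in>UNIV. H $ t $ i * G $ i $ s) * f s)"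
      by (simp only: sum_distrib_right H_sym[of t]) (simp only: mult_ac)
    finally show ?thesis by (simp add: HG' mult_delta_left)
  qed
  have c3: "con (\<lambda>i s. H $ j $ s * f i) = f j" for f j
  proof -
    have "con (\<lambda>i s. H $ j $ s * f i) = (\<Sum>i\<in>UNIV. (\<Sum>s\<in>UNIV. G $ i $ s * H $ s $ j) * f i)"
      unfolding con_def by (simp only: sum_distrib_right H_sym[of j]) (simp only: mult_ac)
    then show ?thesis by (simp add: GH' mult_delta_left)
  qed
  define \<gamma> where "\<gamma> k = con (\<lambda>i s. D k i s)" for k
  define n :: complex where "n = of_nat CARD('n)"
  have n1: "n - 1 \<noteq> 0"
  proof -
    have "n = 1 \<longleftrightarrow> CARD('n) = 1" unfolding n_def using of_nat_eq_iff[of "CARD('n)" 1] by (simp only: of_nat_1)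
    then show ?thesis using card3 by simp
  qed
  have n2: "n + 2 \<noteq> 0"
  proof -
    have "n + 2 = of_nat (CARD('n) + 2)" by (simp add: n_def)
    also have "\<dots> \<noteq> 0" by (simp only: of_nat_eq_0_iff)
    finally show ?thesis .
  qed
  define n' where "n' = n - 1"
  define c where "c k = - \<gamma> k / n'" for k
  have Dc: "D j k t = H $ j $ t * c k - H $ k $ t * c j" for j k t
  proof -
    have "con (\<lambda>i s. H $ i $ s * D j k t + H $ i $ t * D j k s + (H $ j $ s * D k i t + H $ j $ t * D k i s)
      + (H $ k $ s * D i j t + H $ k $ t * D i j s)) = 0"
      by (simp add: integr_second_order con_def)
    then have "n * D j k t + D j k t + (D k j t + H $ j $ t * \<gamma> k) + (D k j t + H $ k $ t * con (\<lambda>i s. D i j s)) = 0"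
      by (simp only: con_add con_scale con_scale_right c1 c2 c3 \<gamma>_def n_def)
    moreover have "con (\<lambda>i s. D i j s) = - \<gamma> j" unfolding \<gamma>_def by (subst D_skew) (rule con_minus)
    ultimately have "n' * D j k t = - H $ j $ t * \<gamma> k + H $ k $ t * \<gamma> j"
      by (simp add: D_skew[of k j] n'_def algebra_simps)
    then show ?thesis using n1 unfolding n'_def[symmetric] by (simp add: c_def field_simps)
  qed
  define d where "d k = con (A2 k)" for k
  define c' :: "complex ^ 'n" where "c' = (\<chi> k. (d k + 2 * c k) / (2 * (n + 2)))"
  have "l = transpose S *v c'" if LL: "(S, l) \<in> LL" for S l
  proof -
    define T where "T = S ** G"
    have TH: "T ** H = S" by (simp add: T_def matrix_mul_assoc[symmetric] GH(1))
    have T_skew: "T $ i $ k = - T $ k $ i" for i k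
    proof -
      have "T = G ** (H ** S) ** G" by (simp add: T_def matrix_mul_assoc GH(1))
      moreover have "transpose T = G ** transpose (H ** S) ** G"
        by (simp only: T_def matrix_transpose_mul transpose_H GH(3) matrix_mul_assoc[symmetric] GH(2) matrix_mul_rid)
      moreover have "G ** (- M) ** G = - (G ** M ** G)" for M :: "complex ^ 'n ^ 'n"
        by (simp add: matrix_matrix_mult_def vec_eq_iff sum_negf)
      then have "G ** (H ** S) ** G = - (G ** transpose (H ** S) ** G)"
        by (subst skew[OF LL])
      ultimately have "T = - transpose T" by (simp only:)
      then have "T $ i $ k = (- transpose T) $ i $ k" by simp
      then show ?thesis by (simp add: transpose_def)
    qed
    have S_nth: "S $ k $ m = (\<Sum>i\<in>UNIV. T $ k $ i * H $ i $ m)" for k m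
      using TH by (auto simp: matrix_matrix_mult_def vec_eq_iff)
    have T_nth: "T $ k $ i = (\<Sum>j\<in>UNIV. G $ i $ j * S $ k $ j)" for k i
    proof -
      have "G $ i $ j = G $ j $ i" for j by (rule G_sym)
      then show ?thesis by (simp add: T_def matrix_matrix_mult_def mult.commute)
    qed
    have "l $ m = (transpose S *v c') $ m" for m
    proof -
      define Q where "Q = (\<Sum>i\<in>UNIV. \<Sum>k\<in>UNIV. A2 k i m * T $ k $ i)"
      define cS where "cS = (\<Sum>k\<in>UNIV. c k * S $ k $ m)"
      have t1: "con (\<lambda>i j. \<Sum>k\<in>UNIV. A2 k i j * S $ k $ m) = (\<Sum>k\<in>UNIV. d k * S $ k $ m)"
      proof -
        have "con (\<lambda>i j. \<Sum>k\<in>K. f k i j) = (\<Sum>k\<in>K. con (f k))" for f and K :: "'n set"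
          by (induction K rule: infinite_finite_induct) (simp_all add: con_add, simp_all add: con_def)
        then show ?thesis by (simp add: con_scale_right d_def)
      qed
      have t2: "con (\<lambda>i j. \<Sum>k\<in>UNIV. A2 k i m * S $ k $ j) = Q"
      proof -
        have "(\<Sum>j\<in>UNIV. G $ i $ j * (\<Sum>k\<in>UNIV. A2 k i m * S $ k $ j)) = (\<Sum>k\<in>UNIV. A2 k i m * T $ k $ i)" for i
          unfolding T_nth sum_distrib_left by (subst sum.swap) (simp only: mult_ac)
        then show ?thesis by (simp add: con_def Q_def)
      qed
      have t3: "con (\<lambda>i j. \<Sum>k\<in>UNIV. A2 k j m * S $ k $ i) = Q"
      proof -
        have "con (\<lambda>i j. \<Sum>k\<in>UNIV. A2 k j m * S $ k $ i) = (\<Sum>j\<in>UNIV. \<Sum>i\<in>UNIV. G $ i $ j * (\<Sum>k\<in>UNIV. A2 k j m * S $ k $ i))"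
          unfolding con_def by (rule sum.swap)
        also have "\<dots> = con (\<lambda>i j. \<Sum>k\<in>UNIV. A2 k i m * S $ k $ j)"
        proof -
          show ?thesis unfolding con_def by (intro sum.cong refl) (subst G_sym, rule refl)
        qed
        finally show ?thesis using t2 by simp
      qed
      have Q: "2 * Q = 2 * cS"
      proof -
        have "Q = (\<Sum>i\<in>UNIV. \<Sum>k\<in>UNIV. A2 i k m * T $ i $ k)" unfolding Q_def by (rule sum.swap)
        also have "\<dots> = - (\<Sum>i\<in>UNIV. \<Sum>k\<in>UNIV. A2 i k m * T $ k $ i)"
          by (subst T_skew) (simp add: sum_negf)
        finally have "2 * Q = (\<Sum>i\<in>UNIV. \<Sum>k\<in>UNIV. (A2 k i m - A2 i k m) * T $ k $ i)"
          by (simp add: Q_def left_diff_distrib sum_subtractf)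
        also have "\<dots> = (\<Sum>i\<in>UNIV. \<Sum>k\<in>UNIV. (H $ i $ m * c k - H $ k $ m * c i) * T $ k $ i)"
        proof -
          have "A2 k i m - A2 i k m = H $ i $ m * c k - H $ k $ m * c i" for i k
            using Dc[of i k m] unfolding D_def A2_commute[of k m i] A2_commute[of i m k] .
          then show ?thesis by (simp only:)
        qed
        also have "\<dots> = (\<Sum>i\<in>UNIV. \<Sum>k\<in>UNIV. c k * (T $ k $ i * H $ i $ m)) - (\<Sum>i\<in>UNIV. \<Sum>k\<in>UNIV. c i * (T $ k $ i * H $ k $ m))"
          by (simp only: left_diff_distrib sum_subtractf) (simp only: mult_ac)
        also have "(\<Sum>i\<in>UNIV. \<Sum>k\<in>UNIV. c k * (T $ k $ i * H $ i $ m)) = cS"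
          unfolding cS_def S_nth sum_distrib_left by (rule sum.swap)
        also have "(\<Sum>i\<in>UNIV. \<Sum>k\<in>UNIV. c i * (T $ k $ i * H $ k $ m)) = - cS"
          unfolding cS_def S_nth sum_distrib_left by (subst T_skew) (simp add: sum_negf)
        finally show ?thesis by simp
      qed
      have "con (\<lambda>i j. (\<Sum>k\<in>UNIV. A2 k i j * S $ k $ m) + (\<Sum>k\<in>UNIV. A2 k i m * S $ k $ j) + (\<Sum>k\<in>UNIV. A2 k j m * S $ k $ i))
        = con (\<lambda>i j. 2 * (H $ i $ j * l $ m + H $ i $ m * l $ j + H $ m $ j * l $ i))"
        unfolding third_order[OF LL] H_sym[of m] ..
      then have "(\<Sum>k\<in>UNIV. d k * S $ k $ m) + Q + Q = 2 * (n * l $ m + l $ m + l $ m)"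
        unfolding con_add con_scale con_scale_right t1 t2 t3 c1 c2 c3 n_def[symmetric] .
      then have "2 * (n + 2) * l $ m = (\<Sum>k\<in>UNIV. d k * S $ k $ m) + 2 * cS" using Q by (simp add: algebra_simps)
      also have "\<dots> = (\<Sum>k\<in>UNIV. (d k + 2 * c k) * S $ k $ m)"
        by (simp add: cS_def sum_distrib_left distrib_right sum.distrib mult.assoc)
      finally have e: "2 * (n + 2) * l $ m = (\<Sum>k\<in>UNIV. (d k + 2 * c k) * S $ k $ m)" .
      have n3: "2 * (n + 2) \<noteq> 0" using n2 by (simp only: mult_eq_0_iff) simp
      have "l $ m = (\<Sum>k\<in>UNIV. (d k + 2 * c k) * S $ k $ m) / (2 * (n + 2))"
        unfolding nonzero_eq_divide_eq[OF n3] by (subst mult.commute) (rule e)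
      then show ?thesis
        by (simp add: matrix_vector_mult_def transpose_def c'_def sum_divide_distrib mult.commute)
    qed
    then show ?thesis by (simp add: vec_eq_iff)
  qed
  then show ?thesis by blast
qed

text \<open>By genericity, compare both sides on the fields of the Lie algebra and on the radial field.  On the former,
\<open>l = c S\<close> and the skewness of \<open>H S\<close> make the right hand side vanish.\<close>

theorem normal_form:
  "\<exists>c. \<forall>x. cdot x (H *v x) *s a x = F x *s (cdot x (H *v x) *s c + (1 - cdot c x) *s (H *v x))"
proof -
  obtain c where c: "\<And>S l. (S, l) \<in> LL \<Longrightarrow> l = transpose S *v c" using common_centre by blast
  define q where "q x = cdot x (H *v x)" for x
  define R where "R u x = q x * cdot (a x) u - F x * (q x * cdot c u + (1 - cdot c x) * cdot (H *v x) u)" for u x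
  obtain x0 where x0: "p x0 * F x0 \<noteq> 0"
    using poly_fun_common_nonzero[OF p_poly p_nz F_poly] F_nonzero by auto
  have "R u x = 0" for u x
  proof (rule poly_fun_generic[of "\<lambda>x. p x * F x", OF poly_fun_mult[OF p_poly F_poly] x0])
    show "poly_fun (R u)" by (simp add: R_def[abs_def] q_def a_poly F_poly)
    fix x assume "p x * F x \<noteq> 0"
    then have x: "p x \<noteq> 0" "F x \<noteq> 0" by auto
    define \<tau> where "\<tau> = cdot (a x) u / F x"
    obtain S l where LL: "(S, l) \<in> LL" and u: "u = proj_field S l x + \<tau> *s x" using decompose[OF x] unfolding \<tau>_def by blast
    have l: "cdot l x = cdot c (S *v x)" unfolding c[OF LL] cdot_matrix[symmetric] ..
    have "cdot x ((H ** S) *v x) = 0"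
    proof -
      have "cdot x ((H ** S) *v x) = - cdot x (transpose (H ** S) *v x)"
        by (subst skew[OF LL]) (simp add: cdot_def matrix_vector_mult_def sum_negf)
      also have "cdot x (transpose (H ** S) *v x) = cdot x ((H ** S) *v x)"
        unfolding cdot_matrix[of x "H ** S"] by (rule cdot_commute)
      finally have "cdot x ((H ** S) *v x) = - cdot x ((H ** S) *v x)" .
      then have "2 * cdot x ((H ** S) *v x) = 0" by (simp only: eq_neg_iff_add_eq_0 mult_2)
      then show ?thesis by simp
    qed
    then have HS: "cdot (H *v x) (S *v x) = 0"
      by (simp only: matrix_vector_mul_assoc[symmetric] cdot_matrix[of x H] transpose_H)
    have Hx: "cdot (H *v x) x = q x" unfolding q_def by (rule cdot_commute)
    have au: "cdot (a x) u = \<tau> * F x" using x by (simp add: \<tau>_def)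
    have Hu: "cdot (H *v x) u = (\<tau> - cdot c (S *v x)) * q x"
      by (simp add: u proj_field_def cdot_add_right cdot_diff_right cdot_scale_right HS Hx l algebra_simps)
    have cu: "cdot c u = cdot c (S *v x) - cdot c (S *v x) * cdot c x + \<tau> * cdot c x"
      by (simp add: u proj_field_def cdot_add_right cdot_diff_right cdot_scale_right l)
    show "R u x = 0" unfolding R_def au Hu cu by (simp add: algebra_simps)
  qed
  then have R0: "R u x = 0" for u x .
  have "cdot (q x *s a x) u = cdot (F x *s (q x *s c + (1 - cdot c x) *s (H *v x))) u" for x u
    using R0[of u x] unfolding R_def by (simp only: cdot_scale_left cdot_add_left right_minus_eq)
  then have "q x *s a x = F x *s (q x *s c + (1 - cdot c x) *s (H *v x))" for x
    by (rule cdot_eqI)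
  then show ?thesis unfolding q_def by blast
qed

end

section \<open>Holomorphic vector fields on projective space are linear\<close>

lemma homog_poly_fun_scale:
  assumes "homog_poly_fun d p" shows "p (c *s z) = c ^ d * p z"
proof -
  from assms obtain k where p: "p = (\<lambda>z. \<Sum>\<alpha>\<in>{\<alpha> :: 'a \<Rightarrow> nat. (\<Sum>i\<in>UNIV. \<alpha> i) = d}. k \<alpha> * (\<Prod>i\<in>UNIV. z $ i ^ \<alpha> i))"
    unfolding homog_poly_fun_def by blast
  have "(\<Prod>i\<in>UNIV. (c *s z) $ i ^ \<alpha> i) = c ^ d * (\<Prod>i\<in>UNIV. z $ i ^ \<alpha> i)" if "(\<Sum>i\<in>UNIV. \<alpha> i) = d" for \<alpha> :: "'a \<Rightarrow> nat"
    using that by (simp add: power_mult_distrib prod.distrib power_sum[symmetric])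
  then show ?thesis unfolding p sum_distrib_left by (intro sum.cong refl) simp
qed

lemma homog_poly_fun_poly: assumes "homog_poly_fun d p" shows "poly_fun p"
proof -
  from assms obtain k where p: "p = (\<lambda>z. \<Sum>\<alpha>\<in>{\<alpha> :: 'a \<Rightarrow> nat. (\<Sum>i\<in>UNIV. \<alpha> i) = d}. k \<alpha> * (\<Prod>i\<in>UNIV. z $ i ^ \<alpha> i))"
    unfolding homog_poly_fun_def by blast
  show ?thesis unfolding p by (intro poly_fun_sum poly_fun_mult poly_fun_const poly_fun_prod poly_fun_power poly_fun_coord)
qed

text \<open>Lagrange interpolation at \<open>0, 1, 2\<close>, one variable after the other.\<close>

lemma poly_fun_separately_quadratic:
  assumes "finite J"
  shows "(\<And>w w'. (\<And>i. i \<in> J \<Longrightarrow> w $ i = w' $ i) \<Longrightarrow> f w = f w') \<Longrightarrow>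
    (\<And>w j. j \<in> J \<Longrightarrow> \<exists>a b c. \<forall>t. f (w + t *s axis j 1) = a + b * t + c * t\<^sup>2) \<Longrightarrow>
    poly_fun (f :: complex ^ 'a::finite \<Rightarrow> complex)"
  using assms
proof (induction J arbitrary: f rule: finite_induct)
  case empty
  have "f w = f 0" for w by (rule empty.prems(1)) simp
  then have e: "f = (\<lambda>_. f 0)" by blast
  show ?case by (subst e) simp
next
  case (insert j J)
  define g where "g s w = f (w + (s - w $ j) *s axis j 1)" for s w
  have g: "poly_fun (g s)" for s
  proof (rule insert.IH)
    fix w w' :: "complex ^ 'a" assume ww: "\<And>i. i \<in> J \<Longrightarrow> w $ i = w' $ i"
    show "g s w = g s w'" unfolding g_def
      by (rule insert.prems(1)) (use ww in \<open>auto simp: axis_def\<close>)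
  next
    fix w :: "complex ^ 'a" and i assume i: "i \<in> J"
    then have ij: "i \<noteq> j" using insert.hyps by blast
    have e: "w + t *s axis i 1 + (s - (w + t *s axis i 1) $ j) *s axis j 1
        = (w + (s - w $ j) *s axis j 1) + t *s axis i 1" for t
      using ij by (simp add: vec_eq_iff axis_def)
    show "\<exists>a b c. \<forall>t. g s (w + t *s axis i 1) = a + b * t + c * t\<^sup>2"
      unfolding g_def e using insert.prems(2)[of i "w + (s - w $ j) *s axis j 1"] i by blast
  qed
  define h where "h w = (1 / 2) * (g 0 w * ((w $ j - 1) * (w $ j - 2)) - 2 * (g 1 w * (w $ j * (w $ j - 2))) + g 2 w * (w $ j * (w $ j - 1)))" for w
  have "f w = h w" for w
  proof -
    obtain a b c where abc: "\<And>t. f (w + t *s axis j 1) = a + b * t + c * t\<^sup>2"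
      using insert.prems(2)[OF insertI1, of w] by blast
    have fw: "f w = a" using abc[of 0] by simp
    have gs: "g s w = a + b * (s - w $ j) + c * (s - w $ j)\<^sup>2" for s unfolding g_def by (rule abc)
    have e2: "2 * f w = g 0 w * ((w $ j - 1) * (w $ j - 2)) - 2 * (g 1 w * (w $ j * (w $ j - 2))) + g 2 w * (w $ j * (w $ j - 1))"
      unfolding gs fw by algebra
    show ?thesis unfolding h_def e2[symmetric] by simp
  qed
  then have "f = h" by blast
  moreover have "poly_fun h" unfolding h_def[abs_def]
    by (intro poly_fun_add poly_fun_diff poly_fun_mult poly_fun_coord poly_fun_const g)
  ultimately show ?case by simp
qed

lemma continuous_on_vec_scale [continuous_intros]:
  "continuous_on S f \<Longrightarrow> continuous_on S g \<Longrightarrow> continuous_on S (\<lambda>x. f x *s (g x :: complex ^ 'n::finite))"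
proof -
  assume f: "continuous_on S f" and g: "continuous_on S g"
  have "(\<lambda>x. f x *s g x) = (\<lambda>x. \<chi> i. f x * g x $ i)" by (simp add: fun_eq_iff vec_eq_iff)
  then show ?thesis by (simp only:) (intro continuous_intros f g)
qed

lemma holo_on_continuous: "holo_on S f \<Longrightarrow> continuous_on S f"
  unfolding holo_on_def continuous_on_eq_continuous_within using has_derivative_continuous by blast

lemma holo_on_line:
  assumes f: "holo_on S f" and line: "\<And>t. x + t *s y \<in> S"
  shows "(\<lambda>t. f (x + t *s y)) holomorphic_on UNIV"
proof (subst holomorphic_on_open[OF open_UNIV], intro ballI)
  fix t
  obtain D where D: "(f has_derivative D) (at (x + t *s y) within S)" "\<And>c v. D (c *s v) = c * D v"
    using f line unfolding holo_on_def by blast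
  have "((\<lambda>t. x + t *s y) has_derivative (\<lambda>t. t *s y)) (at t)" by (rule has_derivative_line)
  moreover have "(f has_derivative D) (at (x + t *s y) within range (\<lambda>t. x + t *s y))"
    using D(1) by (rule has_derivative_subset) (use line in blast)
  ultimately have "((\<lambda>t. f (x + t *s y)) has_derivative (\<lambda>h. D (h *s y))) (at t)"
    by (rule has_derivative_in_compose)
  then have "((\<lambda>t. f (x + t *s y)) has_field_derivative D y) (at t)"
    by (simp add: D(2) has_field_derivative_def mult_commute_abs)
  then show "\<exists>f'. ((\<lambda>t. f (x + t *s y)) has_field_derivative f') (at t)" by blast
qed

locale chart_field =
  fixes V :: "'a::finite vfield" and o' :: 'a
  assumes V: "holo_vfield V"
begin

definition proj0 :: "complex ^ 'a \<Rightarrow> complex ^ 'a" where "proj0 x = x - x $ o' *s axis o' 1"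

lemma proj0_nth [simp]: "proj0 x $ k = (if k = o' then 0 else x $ k)"
  by (simp add: proj0_def axis_def)

lemma proj0_0 [simp]: "proj0 0 = 0" by (simp add: vec_eq_iff)

definition base :: "complex ^ 'a" where "base = axis o' 1"

lemma base_nth [simp]: "base $ k = (if k = o' then 1 else 0)" by (simp add: base_def axis_def)

definition f where "f x = V o' (base + proj0 x)"

lemma proj0_line: "proj0 (x + t *s y) = proj0 x + t *s proj0 y"
  by (simp add: vec_eq_iff)

lemma in_slice: "base + proj0 x \<in> slice o'" by (simp add: slice_def)

lemma f_o: "f x $ o' = 0"
  using V in_slice[of x] by (simp add: holo_vfield_def f_def)

lemma f_hol: "(\<lambda>t. f (x + t *s y) $ k) holomorphic_on UNIV"
proof -
  have "holo_on (slice o') (\<lambda>w. V o' w $ k)" using V by (simp add: holo_vfield_def)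
  from holo_on_line[OF this, of "base + proj0 x" "proj0 y"] show ?thesis
    by (simp add: f_def proj0_line add.assoc slice_def)
qed

lemma transition:
  assumes w: "w \<in> slice o'" and j: "w $ j \<noteq> 0"
  shows "V o' w $ k = w $ j * V j (inverse (w $ j) *s w) $ k - w $ j * w $ k * V j (inverse (w $ j) *s w) $ o'"
proof -
  have e: "V j (inverse (w $ j) *s w) = inverse (w $ j) *s V o' w - (V o' w $ j / (w $ j)\<^sup>2) *s w"
    using V w j unfolding holo_vfield_def by blast
  have "V o' w $ o' = 0" "w $ o' = 1" using V w unfolding holo_vfield_def slice_def by auto
  then show ?thesis unfolding e using j by (simp add: field_simps power2_eq_square)
qed

text \<open>As \<open>t\<close> tends to infinity the point tends to \<open>y\<close> at infinity, where the field is regular in the chart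
\<open>j\<close>; the transition formula then bounds its growth in the chart \<open>o'\<close> by \<open>t\<^sup>2\<close>, with a
leading coefficient proportional to \<open>y\<close>.\<close>

lemma growth:
  assumes j: "j \<noteq> o'" "y $ j \<noteq> 0"
  shows "((\<lambda>t. f (x + t *s y) $ k / t\<^sup>2) \<longlongrightarrow> - (y $ j * proj0 y $ k * V j (inverse (y $ j) *s proj0 y) $ o')) at_infinity"
proof -
  define w where "w t = base + proj0 (x + t *s y)" for t
  define u where "u t = inverse (w t $ j) *s w t" for t
  have inv: "((\<lambda>t::complex. inverse t) \<longlongrightarrow> 0) at_infinity" by (rule tendsto_inverse_0)
  have nz: "eventually (\<lambda>t::complex. t \<noteq> 0) at_infinity"
    unfolding eventually_at_infinity by (intro exI[of _ 1]) auto
  have lim: "((\<lambda>t. w t $ i / t) \<longlongrightarrow> proj0 y $ i) at_infinity" for i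
  proof -
    have "((\<lambda>t. (base + proj0 x) $ i * inverse t + proj0 y $ i) \<longlongrightarrow> (base + proj0 x) $ i * 0 + proj0 y $ i) at_infinity"
      by (intro tendsto_intros inv)
    moreover have "eventually (\<lambda>t. (base + proj0 x) $ i * inverse t + proj0 y $ i = w t $ i / t) at_infinity"
      using nz by eventually_elim (simp add: w_def proj0_line field_simps)
    ultimately show ?thesis by (simp add: Lim_transform_eventually)
  qed
  have yj: "proj0 y $ j = y $ j" using j by simp
  have wj: "eventually (\<lambda>t. w t $ j \<noteq> 0) at_infinity"
  proof -
    have "eventually (\<lambda>t. w t $ j / t \<noteq> 0) at_infinity"
      by (rule tendsto_imp_eventually_ne[OF lim[of j]]) (use j in simp)
    then show ?thesis by eventually_elim auto
  qed
  have u: "(u \<longlongrightarrow> inverse (y $ j) *s proj0 y) at_infinity"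
  proof (rule vec_tendstoI)
    fix i
    have "((\<lambda>t. (w t $ i / t) / (w t $ j / t)) \<longlongrightarrow> proj0 y $ i / proj0 y $ j) at_infinity"
      by (intro tendsto_divide lim) (use j in simp)
    moreover have "eventually (\<lambda>t. (w t $ i / t) / (w t $ j / t) = u t $ i) at_infinity"
      using nz wj by eventually_elim (simp add: u_def field_simps)
    ultimately have "((\<lambda>t. u t $ i) \<longlongrightarrow> proj0 y $ i / proj0 y $ j) at_infinity" by (rule Lim_transform_eventually)
    then show "((\<lambda>t. u t $ i) \<longlongrightarrow> (inverse (y $ j) *s proj0 y) $ i) at_infinity"
      unfolding yj by (simp add: field_simps)
  qed
  have us: "eventually (\<lambda>t. u t \<in> slice j) at_infinity"
    using wj by eventually_elim (simp add: u_def slice_def)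
  have Vu: "((\<lambda>t. V j (u t) $ i) \<longlongrightarrow> V j (inverse (y $ j) *s proj0 y) $ i) at_infinity" for i
  proof (rule continuous_on_tendsto_compose[OF _ u _ us])
    show "continuous_on (slice j) (\<lambda>w. V j w $ i)"
      using V by (intro holo_on_continuous) (simp add: holo_vfield_def)
    show "inverse (y $ j) *s proj0 y \<in> slice j" using j by (simp add: slice_def)
  qed
  have "((\<lambda>t. (w t $ j / t) * inverse t * V j (u t) $ k - (w t $ j / t) * (w t $ k / t) * V j (u t) $ o') \<longlongrightarrow>
     proj0 y $ j * 0 * V j (inverse (y $ j) *s proj0 y) $ k - proj0 y $ j * proj0 y $ k * V j (inverse (y $ j) *s proj0 y) $ o') at_infinity"
    by (intro tendsto_intros lim inv Vu)
  moreover have "eventually (\<lambda>t. (w t $ j / t) * inverse t * V j (u t) $ k - (w t $ j / t) * (w t $ k / t) * V j (u t) $ o'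
     = f (x + t *s y) $ k / t\<^sup>2) at_infinity"
    using nz wj
  proof eventually_elim
    case (elim t)
    have "f (x + t *s y) $ k = w t $ j * V j (u t) $ k - w t $ j * w t $ k * V j (u t) $ o'"
      unfolding f_def w_def[symmetric] u_def using transition[of "w t" j k] elim in_slice[of "x + t *s y"] by (simp add: w_def)
    then show ?case using elim by (simp add: field_simps power2_eq_square)
  qed
  ultimately show ?thesis unfolding yj by (simp add: Lim_transform_eventually)
qed

lemma f_line:
  assumes j: "j \<noteq> o'" "y $ j \<noteq> 0"
  shows "\<exists>a b. \<forall>t. f (x + t *s y) $ k
    = a + b * t - y $ j * proj0 y $ k * V j (inverse (y $ j) *s proj0 y) $ o' * t\<^sup>2"
proof -
  define L where "L = - (y $ j * proj0 y $ k * V j (inverse (y $ j) *s proj0 y) $ o')"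
  define g where "g t = f (x + t *s y) $ k" for t
  have lim: "((\<lambda>t. g t / t\<^sup>2) \<longlongrightarrow> L) at_infinity" unfolding g_def L_def by (rule growth[OF j])
  have "((\<lambda>t. norm (g t / t\<^sup>2)) \<longlongrightarrow> norm L) at_infinity" using lim by (rule tendsto_norm)
  then have "eventually (\<lambda>t. norm (g t / t\<^sup>2) < norm L + 1) at_infinity"
    by (rule order_tendstoD(2)) simp
  then obtain b where b: "\<And>t. norm t \<ge> b \<Longrightarrow> norm (g t / t\<^sup>2) < norm L + 1"
    unfolding eventually_at_infinity by blast
  have gb: "norm (g t) \<le> (norm L + 1) * norm t ^ 2" if t: "norm t \<ge> max b 1" for t
  proof -
    have "norm t > 0" using t by linarith
    moreover have "norm (g t / t\<^sup>2) < norm L + 1" using t b by simp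
    ultimately show ?thesis by (simp add: norm_divide norm_power field_simps)
  qed
  have gh: "g holomorphic_on UNIV" unfolding g_def[abs_def] by (rule f_hol)
  obtain a1 a2 a3 where g: "\<And>t. g t = a1 + a2 * t + a3 * t\<^sup>2"
  proof
    fix t
    have "g t = (\<Sum>k\<le>2. (deriv ^^ k) g 0 / fact k * t ^ k)" by (rule Liouville_polynomial[OF gh gb])
    then show "g t = g 0 + (deriv ^^ 1) g 0 * t + (deriv ^^ 2) g 0 / 2 * t\<^sup>2"
      by (simp add: numeral_2_eq_2 atMost_Suc)
  qed
  have inv: "((\<lambda>t::complex. inverse t) \<longlongrightarrow> 0) at_infinity" by (rule tendsto_inverse_0)
  have "((\<lambda>t. a1 * (inverse t * inverse t) + a2 * inverse t + a3) \<longlongrightarrow> a1 * (0 * 0) + a2 * 0 + a3) at_infinity"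
    by (intro tendsto_intros inv)
  moreover have "eventually (\<lambda>t. a1 * (inverse t * inverse t) + a2 * inverse t + a3 = g t / t\<^sup>2) at_infinity"
    unfolding eventually_at_infinity
  proof (intro exI[of _ 1] allI impI)
    fix t :: complex assume "1 \<le> norm t"
    then have "t \<noteq> 0" by auto
    then show "a1 * (inverse t * inverse t) + a2 * inverse t + a3 = g t / t\<^sup>2"
      by (simp add: g field_simps power2_eq_square)
  qed
  ultimately have "((\<lambda>t. g t / t\<^sup>2) \<longlongrightarrow> a3) at_infinity" by (simp add: Lim_transform_eventually)
  then have "a3 = L" using lim by (rule tendsto_unique[OF trivial_limit_at_infinity])
  then have "f (x + t *s y) $ k = a1 + a2 * t - y $ j * proj0 y $ k * V j (inverse (y $ j) *s proj0 y) $ o' * t\<^sup>2" for t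
    using g[of t] unfolding g_def L_def by simp
  then show ?thesis by blast
qed

lemma f_poly: "poly_fun (\<lambda>x. f x $ k)"
proof (rule poly_fun_separately_quadratic[of UNIV])
  fix w :: "complex ^ 'a" and j :: 'a
  show "\<exists>a b c. \<forall>t. f (w + t *s axis j 1) $ k = a + b * t + c * t\<^sup>2"
  proof (cases "j = o'")
    case True
    have "proj0 (axis j 1) = 0" by (simp add: True vec_eq_iff axis_def)
    then have "f (w + t *s axis j 1) $ k = f w $ k + 0 * t + 0 * t\<^sup>2" for t by (simp add: f_def proj0_line)
    then show ?thesis by blast
  next
    case False
    then obtain a b where "\<forall>t. f (w + t *s axis j 1) $ k = a + b * t
        - axis j 1 $ j * proj0 (axis j 1) $ k * V j (inverse (axis j 1 $ j) *s proj0 (axis j 1)) $ o' * t\<^sup>2"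
      using f_line[of j "axis j 1" w k] by (auto simp: axis_def)
    then have "\<forall>t. f (w + t *s axis j 1) $ k = a + b * t
        + (- axis j 1 $ j * proj0 (axis j 1) $ k * V j (inverse (axis j 1 $ j) *s proj0 (axis j 1)) $ o') * t\<^sup>2"
      by simp
    then show ?thesis by blast
  qed
next
  fix w w' :: "complex ^ 'a" assume "\<And>i. i \<in> UNIV \<Longrightarrow> w $ i = w' $ i"
  then have "w = w'" by (simp add: vec_eq_iff)
  then show "f w $ k = f w' $ k" by simp
qed simp


text \<open>The field is a polynomial of degree two whose quadratic part is a multiple \<open>l(x) x\<close> of the radial field, and the
factor is linear: these are the components of a matrix.\<close>

theorem linear: "\<exists>M. \<forall>w\<in>slice o'. V o' w = M *v w - (M *v w) $ o' *s w"
proof -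
  have d0: "proj0 (t *s x) = t *s proj0 x" for t x by (simp add: vec_eq_iff)
  define Q where "Q k x b \<longleftrightarrow> (\<forall>t. f (t *s x) $ k = f 0 $ k + b * t + (f x $ k - f 0 $ k - b) * t\<^sup>2)
      \<and> (\<forall>j. j \<noteq> o' \<longrightarrow> x $ j \<noteq> 0 \<longrightarrow> f x $ k - f 0 $ k - b = - (x $ j * proj0 x $ k * V j (inverse (x $ j) *s proj0 x) $ o'))" for k x b
  have exQ: "\<exists>b. Q k x b" for x k
    proof (cases "\<exists>j. j \<noteq> o' \<and> x $ j \<noteq> 0")
      case False
      then have "proj0 x = 0" by (auto simp: vec_eq_iff)
      then have ft: "f (t *s x) = f 0" for t by (simp add: f_def d0)
      have fx: "f x = f 0" using ft[of 1] by simp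
      have "Q k x 0" unfolding Q_def ft fx using False by auto
      then show ?thesis ..
    next
      case True
      have L: "\<exists>a b. \<forall>t. f (t *s x) $ k = a + b * t - x $ j * proj0 x $ k * V j (inverse (x $ j) *s proj0 x) $ o' * t\<^sup>2"
        if "j \<noteq> o'" "x $ j \<noteq> 0" for j
        using f_line[OF that, of 0 k] by (simp only: add_0)
      define c where "c j = - (x $ j * proj0 x $ k * V j (inverse (x $ j) *s proj0 x) $ o')" for j
      have L: "\<exists>a b. \<forall>t. f (t *s x) $ k = a + b * t + c j * t\<^sup>2" if jo: "j \<noteq> o'" "x $ j \<noteq> 0" for j
      proof -
        obtain a b where ab0: "\<forall>t. f (t *s x) $ k = a + b * t - x $ j * proj0 x $ k * V j (inverse (x $ j) *s proj0 x) $ o' * t\<^sup>2"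
          using L[OF jo] by blast
        have "f (t *s x) $ k = a + b * t + c j * t\<^sup>2" for t
          using spec[OF ab0, of t] by (simp add: c_def)
        then show ?thesis by blast
      qed
      obtain j where j: "j \<noteq> o'" "x $ j \<noteq> 0" using True by blast
      obtain a b where ab: "\<And>t. f (t *s x) $ k = a + b * t + c j * t\<^sup>2" using L[OF j] by blast
      have a: "f 0 $ k = a" using ab[of 0] by simp
      have c: "f x $ k - f 0 $ k - b = c j" using ab[of 1] a by simp
      have cc: "c i = c j" if io: "i \<noteq> o'" "x $ i \<noteq> 0" for i
      proof -
        obtain a' b' where ab': "\<And>t. f (t *s x) $ k = a' + b' * t + c i * t\<^sup>2" using L[OF io] by blast
        have "poly [:a', b', c i:] t = poly [:a, b, c j:] t" for t
          using ab[of t] ab'[of t] by (simp add: power2_eq_square algebra_simps)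
        then have "[:a', b', c i:] = [:a, b, c j:]" using poly_eq_poly_eq_iff by blast
        then show ?thesis by simp
      qed
      then have "Q k x b" unfolding Q_def c_def[symmetric] c
      proof (intro conjI allI impI)
        show "f (t *s x) $ k = f 0 $ k + b * t + c j * t\<^sup>2" for t unfolding a by (rule ab)
        show "c j = c i" if "i \<noteq> o'" "x $ i \<noteq> 0" for i using cc[OF that] by (rule sym)
      qed
      then show ?thesis ..
    qed
  define b where "b k x = (SOME b. Q k x b)" for k x
  have Qb: "Q k x (b k x)" for k x unfolding b_def by (rule someI_ex) (rule exQ)
  have b: "f (t *s x) $ k = f 0 $ k + b k x * t + (f x $ k - f 0 $ k - b k x) * t\<^sup>2" for x k t
    using Qb[of k x] unfolding Q_def by blast
  have lead0: "f x $ k - f 0 $ k - b k x = - (x $ j * proj0 x $ k * V j (inverse (x $ j) *s proj0 x) $ o')"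
    if "j \<noteq> o'" "x $ j \<noteq> 0" for x k j
    using Qb[of k x] that unfolding Q_def by blast
  define B where "B k = grad (\<lambda>x. f x $ k) 0" for k
  have bB: "b k x = cdot (B k) x" for k x
  proof -
    have "((\<lambda>t. f (0 + t *s x) $ k) has_field_derivative cdot (grad (\<lambda>x. f x $ k) (0 + 0 *s x)) x) (at 0)"
      by (rule poly_fun_line_deriv[OF f_poly])
    then have 1: "((\<lambda>t. f (t *s x) $ k) has_field_derivative cdot (B k) x) (at 0)" by (simp add: B_def)
    have "((\<lambda>t. f 0 $ k + b k x * t + (f x $ k - f 0 $ k - b k x) * t\<^sup>2) has_field_derivative b k x) (at 0)"
      by (auto intro!: derivative_eq_intros)
    then have "((\<lambda>t. f (t *s x) $ k) has_field_derivative b k x) (at 0)" unfolding b[symmetric] .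
    then show ?thesis using 1 DERIV_unique by blast
  qed
  define q where "q k x = f x $ k - f 0 $ k - cdot (B k) x" for k x
  have lead: "q k x = - (x $ j * proj0 x $ k * V j (inverse (x $ j) *s proj0 x) $ o')" if "j \<noteq> o'" "x $ j \<noteq> 0" for k x j
    using lead0[OF that] by (simp add: q_def bB)
  have q_poly: "poly_fun (q k)" for k unfolding q_def[abs_def] by (simp add: f_poly)
  have f_eq: "f x $ k = f 0 $ k + cdot (B k) x + q k x" for x k by (simp add: q_def)
  have q_scale: "q k (t *s x) = t\<^sup>2 * q k x" for k t x
    using b[of t x k] by (simp add: q_def bB cdot_scale_right algebra_simps)
  have q0: "q k x = 0" if "proj0 x = 0" for k x
  proof -
    have "proj0 (2 *s x) = 0" by (simp add: d0 that)
    then have "f (2 *s x) = f x" using that by (simp add: f_def)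
    moreover have "f x = f 0" using that by (simp add: f_def)
    ultimately show ?thesis using b[of 2 x k] by (simp add: q_def bB)
  qed
  have q_o: "q o' x = 0" for x
  proof (cases "\<exists>j. j \<noteq> o' \<and> x $ j \<noteq> 0")
    case True
    then obtain j where j: "j \<noteq> o'" "x $ j \<noteq> 0" by blast
    show ?thesis using lead[OF j, of o'] by simp
  next
    case False then have "proj0 x = 0" by (auto simp: vec_eq_iff) then show ?thesis by (rule q0)
  qed
  have q_zero: "q k x = 0" if k: "k \<noteq> o'" "x $ k = 0" for k x
  proof (cases "\<exists>j. j \<noteq> o' \<and> x $ j \<noteq> 0")
    case True
    then obtain j where j: "j \<noteq> o'" "x $ j \<noteq> 0" by blast
    show ?thesis using lead[OF j, of k] k by simp
  next
    case False then have "proj0 x = 0" by (auto simp: vec_eq_iff) then show ?thesis by (rule q0)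
  qed
  have cross: "q k x * x $ m = q m x * x $ k" if "k \<noteq> o'" "m \<noteq> o'" for k m x
  proof (cases "x $ m = 0")
    case True then show ?thesis using q_zero that by simp
  next
    case False then show ?thesis using lead[of m x k] lead[of m x m] that by simp
  qed
  have "\<exists>l. \<forall>k x. q k x = (if k = o' then 0 else x $ k * cdot l x)"
  proof (cases "\<exists>j::'a. j \<noteq> o'")
    case False
    then have k: "k = o'" for k by blast
    have "q k x = (if k = o' then 0 else x $ k * cdot 0 x)" for k x unfolding k[of k] by (simp add: q_o)
    then show ?thesis by blast
  next
    case True
    then obtain j :: 'a where j: "j \<noteq> o'" by blast
    have "cdot (axis j 1) x = 0 \<Longrightarrow> q j x = 0" for x using q_zero[OF j, of x] by simp
    moreover have "axis j (1::complex) \<noteq> (0 :: complex ^ 'a)"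
    proof
      assume "axis j (1::complex) = (0 :: complex ^ 'a)"
      then have "axis j (1::complex) $ j = (0 :: complex ^ 'a) $ j" by (simp only:)
      then show False by (simp add: axis_def)
    qed
    ultimately obtain g where g: "poly_fun g" "\<And>x. q j x = cdot (axis j 1) x * g x"
      using poly_fun_divide_linear[OF q_poly[of j]] by blast
    have qj: "q j x = x $ j * g x" for x using g(2)[of x] by simp
    have qk: "q k x - x $ k * g x = 0" if k: "k \<noteq> o'" for k x
    proof (rule poly_fun_generic[of "\<lambda>x. x $ j" "\<chi> i. 1" "\<lambda>x. q k x - x $ k * g x"])
      fix z :: "complex ^ 'a" assume z: "z $ j \<noteq> 0"
      have "z $ j * (q k z - z $ k * g z) = 0"
        using cross[OF k j, of z] by (simp add: qj algebra_simps)
      then show "q k z - z $ k * g z = 0" using z by simp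
    qed (simp_all add: q_poly g)
    have g_scale: "g (t *s x) - t * g x = 0" for t x
    proof (cases "t = 0")
      case False
      show ?thesis
      proof (rule poly_fun_generic[of "\<lambda>x. x $ j" "\<chi> i. 1" "\<lambda>x. g (t *s x) - t * g x"])
        show "poly_fun (\<lambda>x. g (t *s x) - t * g x)"
          by (intro poly_fun_diff poly_fun_compose[OF g(1)] poly_fun_mult poly_fun_const g(1)) simp
        fix z :: "complex ^ 'a" assume z: "z $ j \<noteq> 0"
        have "t * z $ j * (g (t *s z) - t * g z) = 0"
          using q_scale[of j t z] by (simp add: qj algebra_simps power2_eq_square)
        then show "g (t *s z) - t * g z = 0" using z False by simp
      qed simp_all
    next
      case True
      have "g 0 - 0 = 0"
      proof -
        define z :: "complex ^ 'a" where "z = (\<chi> i. 1)"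
        have "((\<lambda>t. g (0 + t *s z)) \<longlongrightarrow> g (0 + 0 *s z)) (at 0)"
          using DERIV_isCont[OF poly_fun_line_deriv[OF g(1), of 0 z 0]] by (simp add: isCont_def)
        moreover have "eventually (\<lambda>t. g (0 + t *s z) = t * g z) (at 0)"
        proof -
          have "g (t *s z) = t * g z" if "t \<noteq> 0" for t
            using q_scale[of j t z] that by (simp add: qj z_def power2_eq_square)
          then show ?thesis by (simp add: eventually_at_filter)
        qed
        ultimately have "((\<lambda>t. t * g z) \<longlongrightarrow> g 0) (at 0)" by (simp add: tendsto_cong)
        moreover have "((\<lambda>t. t * g z) \<longlongrightarrow> 0 * g z) (at 0)" by (intro tendsto_intros)
        ultimately show ?thesis using tendsto_unique[OF at_neq_bot] by fastforce
      qed
      then show ?thesis using True by simp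
    qed
    have gl: "g x = cdot (grad g 0) x" for x
      by (rule poly_fun_linear_part[OF g(1)]) (use g_scale in simp)
    have "q k x = x $ k * cdot (grad g 0) x" if k: "k \<noteq> o'" for k x
      using qk[OF k, of x] gl[of x] by simp
    then show ?thesis using q_o by (intro exI[of _ "grad g 0"]) simp
  qed
  then obtain l where l: "\<And>k x. q k x = (if k = o' then 0 else x $ k * cdot l x)" by blast
  define M :: "complex ^ 'a ^ 'a" where
    "M = (\<chi> k i. if i = o' then f 0 $ k else B k $ i - (if k = o' then l $ i else 0))"
  have Bo: "B o' = 0" by (simp add: B_def f_o)
  have "V o' w = M *v w - (M *v w) $ o' *s w" if w: "w \<in> slice o'" for w
  proof -
    define x where "x = proj0 w"
    have wo: "w $ o' = 1" using w by (simp add: slice_def)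
    have Vf: "V o' w = f x"
    proof -
      have "base + proj0 x = w" using wo by (simp add: x_def vec_eq_iff)
      then show ?thesis by (simp add: f_def)
    qed
    have Mw: "(M *v w) $ k = f 0 $ k + cdot (B k) x - (if k = o' then cdot l x else 0)" for k
    proof -
      have "(M *v w) $ k = (\<Sum>i\<in>UNIV. (if i = o' then f 0 $ k else 0) + B k $ i * x $ i - (if k = o' then l $ i * x $ i else 0))"
        unfolding matrix_vector_mult_def vec_lambda_beta M_def
        by (intro sum.cong refl) (auto simp: wo x_def algebra_simps)
      then show ?thesis by (simp add: sum.distrib sum_subtractf cdot_def)
    qed
    have "V o' w $ k = (M *v w - (M *v w) $ o' *s w) $ k" for k
      unfolding Vf f_eq[of x k] l by (simp add: Mw f_o Bo wo) (simp add: x_def)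
    then show ?thesis unfolding vec_eq_iff by blast
  qed
  then show ?thesis by blast
qed

end


lemma vf_bracket_linear:
  assumes X: "\<And>w. w \<in> slice i \<Longrightarrow> X i w = M *v w - (M *v w) $ i *s w"
    and Y: "\<And>w. w \<in> slice i \<Longrightarrow> Y i w = M' *v w - (M' *v w) $ i *s w"
    and w: "w \<in> slice i"
  shows "vf_bracket X Y i w = (M' ** M - M ** M') *v w - ((M' ** M - M ** M') *v w) $ i *s w"
proof -
  have fl: "N *v u - (N *v u) $ i *s u = proj_field N (row i N) u" for N and u :: "complex ^ 'a"
    by (simp add: proj_field_def matrix_vector_mult_def cdot_def row_def)
  have row: "cdot (row i N) u = (N *v u) $ i" for N and u :: "complex ^ 'a"
    by (simp add: matrix_vector_mult_def cdot_def row_def)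
  have dd: "dir_deriv (\<lambda>u. Z i u $ k) w v = jac (proj_field N (row i N)) w v $ k"
    if Z: "\<And>w. w \<in> slice i \<Longrightarrow> Z i w = proj_field N (row i N) w" and v: "v $ i = 0" for Z N v k
  proof -
    have "w + t *s v \<in> slice i" for t using w v by (simp add: slice_def)
    then have "dir_deriv (\<lambda>u. Z i u $ k) w v = dir_deriv (\<lambda>u. proj_field N (row i N) u $ k) w v"
      by (simp add: dir_deriv_def Z)
    then show ?thesis by (simp add: dir_deriv_poly_fun jac_def)
  qed
  have wi: "w $ i = 1" using w by (simp add: slice_def)
  have X0: "X i w $ i = 0" "Y i w $ i = 0" using wi by (simp_all add: X[OF w] Y[OF w])
  have "vf_bracket X Y i w $ k = (jac (proj_field M' (row i M')) w (X i w) - jac (proj_field M (row i M)) w (Y i w)) $ k" for k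
    using w dd[of Y M', OF Y[unfolded fl] X0(1)] dd[of X M, OF X[unfolded fl] X0(2)]
    by (simp add: vf_bracket_def)
  then have "vf_bracket X Y i w = jac (proj_field M' (row i M')) w (X i w) - jac (proj_field M (row i M)) w (Y i w)"
    by (simp only: vec_eq_iff) blast
  also have "\<dots> = (M' ** M - M ** M') *v w - ((M' ** M - M ** M') *v w) $ i *s w"
    unfolding jac_proj_field row X[OF w] Y[OF w] matrix_vector_mult_diff_rdistrib matrix_vector_mult_diff_distrib
      vector_scalar_commute matrix_vector_mul_assoc[symmetric]
    by (simp add: vec_eq_iff wi algebra_simps)
  finally show ?thesis .
qed

lemma mat_mult_vector: "mat c *v x = c *s (x :: complex ^ 'n::finite)"
  by (simp add: matrix_vector_mult_def mat_def vec_eq_iff mult_delta_left)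

lemma foliation_scale: assumes "foliation \<nu> A" shows "A (c *s z) = c ^ (\<nu> + 1) *s A z"
proof -
  have "A (c *s z) $ k = c ^ (\<nu> + 1) * A z $ k" for k
    using assms unfolding foliation_def by (intro homog_poly_fun_scale) blast
  then show ?thesis by (simp add: vec_eq_iff)
qed

lemma foliation_poly: "foliation \<nu> A \<Longrightarrow> poly_fun (\<lambda>z. A z $ k)"
  unfolding foliation_def by (intro homog_poly_fun_poly) blast

lemma foliation_radial: "foliation \<nu> A \<Longrightarrow> cdot (A z) z = 0"
  unfolding foliation_def cdot_def by (simp add: mult.commute)

text \<open>Generic points are those with \<open>p z \<noteq> 0\<close>.  Adding a multiple of the identity to a matrix does not change the
vector field, so \<open>MM\<close> is closed under it; this is why the matrices span the kernel of \<open>A z\<close> including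
the direction of \<open>z\<close>.\<close>

theorem L_foliation_matrices:
  fixes A :: "complex ^ 'a::finite \<Rightarrow> complex ^ 'a"
  assumes fol: "foliation \<nu> A" and LA: "L_foliation A"
  shows "\<exists>MM p z0. poly_fun p \<and> p z0 \<noteq> 0 \<and> (\<exists>d. \<forall>c z. p (c *s z) = c ^ d * p z) \<and> (\<forall>M\<in>MM. \<forall>c. M + mat c \<in> MM)
    \<and> (\<forall>M\<in>MM. \<forall>M'\<in>MM. M' ** M - M ** M' \<in> MM) \<and> (\<forall>M\<in>MM. \<forall>z. cdot (A z) (M *v z) = 0)
    \<and> (\<forall>z. p z \<noteq> 0 \<longrightarrow> A z \<noteq> 0 \<and> (\<forall>u. cdot (A z) u = 0 \<longrightarrow> (\<exists>M\<in>MM. u = M *v z)))"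
proof -
  obtain L where L: "lie_subalgebra L" and gen: "generic_CP (\<lambda>l. l \<notin> singular_set A \<and>
       (\<forall>i. \<forall>w\<in>l \<inter> slice i. (\<lambda>X. X i w) ` L = leaf_tangent A i w))"
    using LA unfolding L_foliation_def by blast
  obtain S where S: "CP_zariski_closed S" "S \<noteq> CP" and gS: "\<And>l. l \<in> CP - S \<Longrightarrow> l \<notin> singular_set A \<and>
       (\<forall>i. \<forall>w\<in>l \<inter> slice i. (\<lambda>X. X i w) ` L = leaf_tangent A i w)"
    using gen unfolding generic_CP_def by blast
  obtain P where P: "\<forall>p\<in>P. \<exists>d. homog_poly_fun d p" "S = {l\<in>CP. \<forall>p\<in>P. \<forall>z\<in>l. p z = 0}"
    using S(1) unfolding CP_zariski_closed_def by blast
  obtain p1 z1 where p1: "p1 \<in> P" "p1 z1 \<noteq> 0" using P(2) S(2) by blast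
  obtain d where d: "homog_poly_fun d p1" using P(1) p1(1) by blast
  have p1_poly: "poly_fun p1" using P(1) p1(1) homog_poly_fun_poly by blast
  define i :: 'a where "i = undefined"
  define p where "p z = p1 z * z $ i" for z
  have p_poly: "poly_fun p" unfolding p_def[abs_def] by (intro poly_fun_mult p1_poly poly_fun_coord)
  have "(axis i 1 :: complex ^ 'a) $ i \<noteq> 0" by (simp add: axis_def)
  from poly_fun_common_nonzero[OF p1_poly p1(2) poly_fun_coord this] obtain z0 where z0: "p z0 \<noteq> 0"
    by (auto simp: p_def)
  define fl where "fl M w = M *v w - (M *v w) $ i *s w" for M and w :: "complex ^ 'a"
  define MM where "MM = {M. \<exists>X\<in>L. \<forall>w\<in>slice i. X i w = fl M w}"
  have lin: "\<exists>M\<in>MM. \<forall>w\<in>slice i. X i w = fl M w" if X: "X \<in> L" for X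
  proof -
    have "holo_vfield X" using L X unfolding lie_subalgebra_def by blast
    then interpret chart_field X i by unfold_locales
    show ?thesis using linear X unfolding MM_def fl_def by blast
  qed
  have pt: "A z \<noteq> 0" "inverse (z $ i) *s z \<in> slice i"
    "(\<lambda>X. X i (inverse (z $ i) *s z)) ` L = leaf_tangent A i (inverse (z $ i) *s z)" if pz: "p z \<noteq> 0" for z
  proof -
    have z: "z $ i \<noteq> 0" "p1 z \<noteq> 0" using pz by (auto simp: p_def)
    then have z0: "z \<noteq> 0" by auto
    have zin: "z \<in> hline z" unfolding hline_def by (rule range_eqI[of _ _ 1]) simp
    have l: "hline z \<in> CP - S" using z0 z(2) p1(1) zin unfolding P(2) CP_def by blast
    show "A z \<noteq> 0"
    proof
      assume "A z = 0"
      then have "hline z \<in> singular_set A" using z0 unfolding singular_set_def by blast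
      then show False using gS[OF l] by blast
    qed
    show sl: "inverse (z $ i) *s z \<in> slice i" using z by (simp add: slice_def)
    have "inverse (z $ i) *s z \<in> hline z" unfolding hline_def by blast
    then show "(\<lambda>X. X i (inverse (z $ i) *s z)) ` L = leaf_tangent A i (inverse (z $ i) *s z)"
      using gS[OF l] sl by blast
  qed
  have plus: "M + mat c \<in> MM" if M: "M \<in> MM" for M c
  proof -
    obtain X where X: "X \<in> L" "\<And>w. w \<in> slice i \<Longrightarrow> X i w = fl M w" using M unfolding MM_def by blast
    have "fl (M + mat c) w = fl M w" if "w \<in> slice i" for w
      using that by (simp add: fl_def matrix_vector_mult_add_rdistrib mat_mult_vector slice_def vec_eq_iff algebra_simps)
    then show ?thesis using X unfolding MM_def by auto
  qed
  have br: "M' ** M - M ** M' \<in> MM" if M: "M \<in> MM" and M': "M' \<in> MM" for M M'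
  proof -
    obtain X where X: "X \<in> L" "\<And>w. w \<in> slice i \<Longrightarrow> X i w = fl M w" using M unfolding MM_def by blast
    obtain Y where Y: "Y \<in> L" "\<And>w. w \<in> slice i \<Longrightarrow> Y i w = fl M' w" using M' unfolding MM_def by blast
    have "vf_bracket X Y \<in> L" using L X(1) Y(1) unfolding lie_subalgebra_def by blast
    moreover have "vf_bracket X Y i w = fl (M' ** M - M ** M') w" if "w \<in> slice i" for w
      using vf_bracket_linear[of i X M Y M' w] X(2) Y(2) that unfolding fl_def by blast
    ultimately show ?thesis unfolding MM_def by blast
  qed
  have scale: "A (c *s z) = c ^ (\<nu> + 1) *s A z" for c z by (rule foliation_scale[OF fol])
  have tan: "cdot (A z) (M *v z) = 0" if M: "M \<in> MM" for M z
  proof (rule poly_fun_generic[of p z0 "\<lambda>z. cdot (A z) (M *v z)", OF p_poly z0])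
    show "poly_fun (\<lambda>z. cdot (A z) (M *v z))" using foliation_poly[OF fol] by simp
    fix z assume pz: "p z \<noteq> 0"
    define w where "w = inverse (z $ i) *s z"
    have z: "z $ i \<noteq> 0" using pz by (auto simp: p_def)
    obtain X where X: "X \<in> L" "\<And>w. w \<in> slice i \<Longrightarrow> X i w = fl M w" using M unfolding MM_def by blast
    have "X i w \<in> leaf_tangent A i w" using pt(3)[OF pz] X(1) unfolding w_def by blast
    then have "cdot (A w) (fl M w) = 0" using X(2) pt(2)[OF pz] by (simp add: leaf_tangent_def one_form_eq_cdot w_def)
    then have "cdot (A w) (M *v w) = 0"
      by (simp add: fl_def cdot_diff_right cdot_scale_right foliation_radial[OF fol])
    then show "cdot (A z) (M *v z) = 0"
      using z by (simp add: w_def scale cdot_scale_left cdot_scale_right vector_scalar_commute)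
  qed
  have span: "\<exists>M\<in>MM. u = M *v z" if pz: "p z \<noteq> 0" and u: "cdot (A z) u = 0" for z u
  proof -
    define w where "w = inverse (z $ i) *s z"
    have z: "z $ i \<noteq> 0" using pz by (auto simp: p_def)
    have w: "w \<in> slice i" using pt(2)[OF pz] by (simp add: w_def)
    define v where "v = inverse (z $ i) *s u - (inverse (z $ i) * u $ i) *s w"
    have "cdot (A w) v = 0"
      by (simp add: v_def cdot_diff_right cdot_scale_right foliation_radial[OF fol])
        (simp add: w_def scale cdot_scale_left u)
    moreover have "v $ i = 0" using w by (simp add: v_def slice_def)
    ultimately have "v \<in> leaf_tangent A i w" by (simp add: leaf_tangent_def one_form_eq_cdot)
    then obtain X where X: "X \<in> L" "v = X i w" using pt(3)[OF pz] unfolding w_def by blast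
    obtain M where M: "M \<in> MM" "v = fl M w" using lin[OF X(1)] X(2) w by auto
    define c where "c = inverse (z $ i) * u $ i - (M *v w) $ i"
    have "inverse (z $ i) *s u = (M + mat c) *v w"
      using M(2) by (simp add: v_def fl_def c_def matrix_vector_mult_add_rdistrib mat_mult_vector vec_eq_iff algebra_simps)
    then have "inverse (z $ i) *s u = inverse (z $ i) *s ((M + mat c) *v z)"
      by (simp add: w_def vector_scalar_commute)
    then have "u = (M + mat c) *v z" using z by simp
    then show ?thesis using plus[OF M(1)] by blast
  qed
  have hom: "\<exists>d. \<forall>c z. p (c *s z) = c ^ d * p z"
    by (intro exI[of _ "Suc d"] allI) (simp add: p_def homog_poly_fun_scale[OF d])
  have "poly_fun p \<and> p z0 \<noteq> 0 \<and> (\<exists>d. \<forall>c z. p (c *s z) = c ^ d * p z) \<and> (\<forall>M\<in>MM. \<forall>c. M + mat c \<in> MM)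
    \<and> (\<forall>M\<in>MM. \<forall>M'\<in>MM. M' ** M - M ** M' \<in> MM) \<and> (\<forall>M\<in>MM. \<forall>z. cdot (A z) (M *v z) = 0)
    \<and> (\<forall>z. p z \<noteq> 0 \<longrightarrow> A z \<noteq> 0 \<and> (\<forall>u. cdot (A z) u = 0 \<longrightarrow> (\<exists>M\<in>MM. u = M *v z)))"
  proof (intro conjI)
    show "\<forall>M\<in>MM. \<forall>c. M + mat c \<in> MM" using plus by blast
    show "\<forall>M\<in>MM. \<forall>M'\<in>MM. M' ** M - M ** M' \<in> MM" using br by blast
    show "\<forall>M\<in>MM. \<forall>z. cdot (A z) (M *v z) = 0" using tan by blast
    show "\<forall>z. p z \<noteq> 0 \<longrightarrow> A z \<noteq> 0 \<and> (\<forall>u. cdot (A z) u = 0 \<longrightarrow> (\<exists>M\<in>MM. u = M *v z))"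
      using span pt(1) by blast
  qed (rule p_poly z0 hom)+
  then show ?thesis by (intro exI) assumption
qed

section \<open>Hypersurfaces have codimension one\<close>

lemma poly_fun_nonconstant_pd:
  assumes f: "poly_fun f" and nc: "f x \<noteq> f 0"
  shows "\<exists>i z. pd i f z \<noteq> 0"
proof (rule ccontr)
  assume "\<not> ?thesis"
  then have g: "grad f z = 0" for z by (simp add: vec_eq_iff)
  obtain P where P: "\<And>t. f (0 + t *s x) = poly P t" using poly_fun_line[OF f] by blast
  have "((\<lambda>t. f (0 + t *s x)) has_field_derivative 0) (at t)" for t
    using poly_fun_line_deriv[OF f, of 0 x t] unfolding g by simp
  then have "(poly P has_field_derivative 0) (at t)" for t unfolding P .
  then have "poly (pderiv P) t = 0" for t using poly_DERIV[of P t] DERIV_unique by blast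
  then have "pderiv P = 0" by (rule poly_all_zero)
  then have "degree P = 0" by (simp add: pderiv_eq_0_iff)
  then obtain c where "P = [:c:]" by (rule degree_eq_zeroE)
  then have "f (0 + 1 *s x) = f (0 + 0 *s x)" unfolding P by simp
  then show False using nc by simp
qed

definition free_of :: "'a::finite \<Rightarrow> (complex ^ 'a \<Rightarrow> complex) \<Rightarrow> bool" where
  "free_of i p \<longleftrightarrow> poly_fun p \<and> (\<forall>x t. p (x + t *s axis i 1) = p x)"

lemma free_of_const [simp]: "free_of i (\<lambda>x. c)"
  and free_of_add: "free_of i p \<Longrightarrow> free_of i q \<Longrightarrow> free_of i (\<lambda>x. p x + q x)"
  and free_of_mult: "free_of i p \<Longrightarrow> free_of i q \<Longrightarrow> free_of i (\<lambda>x. p x * q x)"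
  by (simp_all add: free_of_def)

lemma free_of_poly: "free_of i p \<Longrightarrow> poly_fun p" by (simp add: free_of_def)

definition deg_less :: "'a::finite \<Rightarrow> nat \<Rightarrow> (complex ^ 'a \<Rightarrow> complex) \<Rightarrow> bool" where
  "deg_less i n p \<longleftrightarrow> (\<exists>c. (\<forall>k. free_of i (c k)) \<and> (\<forall>x. p x = (\<Sum>k<n. c k x * x $ i ^ k)))"

lemma deg_less_0: "deg_less i 0 p \<Longrightarrow> p x = 0"
  by (auto simp: deg_less_def)

lemma deg_less_zero [simp]: "deg_less i n (\<lambda>x. 0)"
  unfolding deg_less_def by (rule exI[of _ "\<lambda>k x. 0"]) simp

lemma deg_less_add:
  assumes "deg_less i n p" "deg_less i n q" shows "deg_less i n (\<lambda>x. p x + q x)"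
proof -
  obtain c where c: "\<And>k. free_of i (c k)" "\<And>x. p x = (\<Sum>k<n. c k x * x $ i ^ k)" using assms(1) unfolding deg_less_def by blast
  obtain d where d: "\<And>k. free_of i (d k)" "\<And>x. q x = (\<Sum>k<n. d k x * x $ i ^ k)" using assms(2) unfolding deg_less_def by blast
  have "p x + q x = (\<Sum>k<n. (c k x + d k x) * x $ i ^ k)" for x by (simp add: c d distrib_right sum.distrib)
  then show ?thesis unfolding deg_less_def using free_of_add[OF c(1) d(1)] by (intro exI[of _ "\<lambda>k x. c k x + d k x"]) blast
qed

lemma deg_less_mult_free:
  assumes "deg_less i n p" "free_of i m" shows "deg_less i n (\<lambda>x. m x * p x)"
proof -
  obtain c where c: "\<And>k. free_of i (c k)" "\<And>x. p x = (\<Sum>k<n. c k x * x $ i ^ k)" using assms(1) unfolding deg_less_def by blast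
  have "m x * p x = (\<Sum>k<n. (m x * c k x) * x $ i ^ k)" for x by (simp add: c sum_distrib_left mult.assoc)
  then show ?thesis unfolding deg_less_def using free_of_mult[OF assms(2) c(1)] by (intro exI[of _ "\<lambda>k x. m x * c k x"]) blast
qed

lemma deg_less_mono:
  assumes "deg_less i n p" "n \<le> m" shows "deg_less i m p"
proof -
  obtain c where c: "\<And>k. free_of i (c k)" "\<And>x. p x = (\<Sum>k<n. c k x * x $ i ^ k)" using assms(1) unfolding deg_less_def by blast
  define d where "d k = (if k < n then c k else (\<lambda>x. 0))" for k
  have "p x = (\<Sum>k<m. d k x * x $ i ^ k)" for x
    unfolding c(2) by (rule sum.mono_neutral_cong_left) (use assms(2) in \<open>auto simp: d_def\<close>)
  moreover have "free_of i (d k)" for k using c(1) by (simp add: d_def)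
  ultimately show ?thesis unfolding deg_less_def by blast
qed

lemma deg_less_shift: "deg_less i n p \<Longrightarrow> deg_less i (j + n) (\<lambda>x. x $ i ^ j * p x)"
proof (induction j)
  case (Suc j)
  then obtain c where c: "\<And>k. free_of i (c k)" "\<And>x. x $ i ^ j * p x = (\<Sum>k<j + n. c k x * x $ i ^ k)" unfolding deg_less_def by blast
  define d where "d k = (case k of 0 \<Rightarrow> (\<lambda>x. 0) | Suc k \<Rightarrow> c k)" for k
  have "x $ i ^ Suc j * p x = (\<Sum>k<Suc j + n. d k x * x $ i ^ k)" for x
  proof -
    have "x $ i ^ Suc j * p x = x $ i * (x $ i ^ j * p x)" by simp
    also have "\<dots> = (\<Sum>k<j + n. c k x * x $ i ^ Suc k)" unfolding c(2) by (simp add: sum_distrib_left mult_ac)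
    also have "\<dots> = (\<Sum>k<Suc j + n. d k x * x $ i ^ k)" by (simp add: sum.lessThan_Suc_shift d_def del: sum.lessThan_Suc)
    finally show ?thesis .
  qed
  moreover have "free_of i (d k)" for k using c(1) by (simp add: d_def split: nat.split)
  ultimately show ?case unfolding deg_less_def by blast
qed simp

lemma deg_less_free: "free_of i p \<Longrightarrow> deg_less i 1 p"
  unfolding deg_less_def by (rule exI[of _ "\<lambda>k. p"]) simp

lemma ex_deg_less:
  assumes "poly_fun p" shows "\<exists>n. deg_less i n p"
proof -
  from assms obtain S c where S: "finite S" "p = (\<lambda>z. \<Sum>\<alpha>\<in>S. c (\<alpha> :: 'a \<Rightarrow> nat) * (\<Prod>i\<in>UNIV. z $ i ^ \<alpha> i))"
    unfolding poly_fun_def by blast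
  have mono: "\<exists>n. deg_less i n (\<lambda>z. c \<alpha> * (\<Prod>i\<in>UNIV. z $ i ^ \<alpha> i))" for \<alpha>
  proof -
    have "free_of i (\<lambda>z. c \<alpha> * (\<Prod>j\<in>UNIV - {i}. z $ j ^ \<alpha> j))"
      unfolding free_of_def
    proof (intro conjI allI)
      fix x :: "complex ^ 'a" and t
      have "(\<Prod>j\<in>UNIV - {i}. (x + t *s axis i 1) $ j ^ \<alpha> j) = (\<Prod>j\<in>UNIV - {i}. x $ j ^ \<alpha> j)"
        by (intro prod.cong refl) (simp add: axis_def)
      then show "c \<alpha> * (\<Prod>j\<in>UNIV - {i}. (x + t *s axis i 1) $ j ^ \<alpha> j) = c \<alpha> * (\<Prod>j\<in>UNIV - {i}. x $ j ^ \<alpha> j)" by simp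
    qed (intro poly_fun_mult poly_fun_const poly_fun_prod poly_fun_power poly_fun_coord)
    from deg_less_shift[OF deg_less_free[OF this], of "\<alpha> i"]
    have "deg_less i (\<alpha> i + 1) (\<lambda>x. x $ i ^ \<alpha> i * (c \<alpha> * (\<Prod>j\<in>UNIV - {i}. x $ j ^ \<alpha> j)))" .
    moreover have "(\<lambda>x. x $ i ^ \<alpha> i * (c \<alpha> * (\<Prod>j\<in>UNIV - {i}. x $ j ^ \<alpha> j))) = (\<lambda>z. c \<alpha> * (\<Prod>i\<in>UNIV. z $ i ^ \<alpha> i))"
      by (rule ext) (subst prod.remove[of UNIV i], simp_all add: mult_ac)
    ultimately show ?thesis by auto
  qed
  have "\<exists>n. deg_less i n (\<lambda>z. \<Sum>\<alpha>\<in>S. c \<alpha> * (\<Prod>i\<in>UNIV. z $ i ^ \<alpha> i))"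
    using S(1)
  proof (induction S rule: finite_induct)
    case empty
    show ?case using deg_less_zero[of i 0] by auto
  next
    case (insert \<alpha> S)
    obtain m where m: "deg_less i m (\<lambda>z. \<Sum>\<alpha>\<in>S. c \<alpha> * (\<Prod>i\<in>UNIV. z $ i ^ \<alpha> i))" using insert.IH by blast
    obtain n where n: "deg_less i n (\<lambda>z. c \<alpha> * (\<Prod>i\<in>UNIV. z $ i ^ \<alpha> i))" using mono by blast
    have "deg_less i (max n m) (\<lambda>z. c \<alpha> * (\<Prod>i\<in>UNIV. z $ i ^ \<alpha> i) + (\<Sum>\<alpha>\<in>S. c \<alpha> * (\<Prod>i\<in>UNIV. z $ i ^ \<alpha> i)))"
      by (intro deg_less_add deg_less_mono[OF n] deg_less_mono[OF m]) auto
    then show ?case using insert.hyps by auto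
  qed
  then show ?thesis unfolding S(2) .
qed

lemma deg_less_Suc:
  assumes "deg_less i (Suc n) p"
  shows "\<exists>s q. free_of i s \<and> deg_less i n q \<and> (\<forall>x. p x = s x * x $ i ^ n + q x)"
proof -
  obtain c where c: "\<And>k. free_of i (c k)" "\<And>x. p x = (\<Sum>k<Suc n. c k x * x $ i ^ k)" using assms unfolding deg_less_def by blast
  have "deg_less i n (\<lambda>x. \<Sum>k<n. c k x * x $ i ^ k)" unfolding deg_less_def using c(1) by blast
  moreover have "p x = c n x * x $ i ^ n + (\<Sum>k<n. c k x * x $ i ^ k)" for x unfolding c(2) by simp
  ultimately show ?thesis using c(1) by blast
qed

lemma pseudo_division:
  assumes s: "free_of i s" and q: "deg_less i d q" and f: "\<And>x. f x = s x * x $ i ^ d + q x"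
  shows "deg_less i N p \<Longrightarrow> \<exists>k u v. poly_fun u \<and> deg_less i d v \<and> (\<forall>x. s x ^ k * p x = u x * f x + v x)"
proof (induction N arbitrary: p)
  case 0
  then have "deg_less i d p" by (rule deg_less_mono) simp
  then show ?case by (intro exI[of _ 0] exI[of _ "\<lambda>x. 0"] exI[of _ p]) simp
next
  case (Suc N)
  show ?case
  proof (cases "Suc N \<le> d")
    case True
    then have "deg_less i d p" using Suc.prems deg_less_mono by blast
    then show ?thesis by (intro exI[of _ 0] exI[of _ "\<lambda>x. 0"] exI[of _ p]) simp
  next
    case False
    then have dN: "d \<le> N" by simp
    obtain c p1 where c: "free_of i c" and p1: "deg_less i N p1" and p: "\<And>x. p x = c x * x $ i ^ N + p1 x"
      using deg_less_Suc[OF Suc.prems] by blast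
    define r where "r x = s x * p1 x + (\<lambda>x. -1) x * (c x * (x $ i ^ (N - d) * q x))" for x
    have "deg_less i (N - d + d) (\<lambda>x. x $ i ^ (N - d) * q x)" by (rule deg_less_shift[OF q])
    then have 1: "deg_less i N (\<lambda>x. x $ i ^ (N - d) * q x)" using dN by simp
    have "deg_less i N r" unfolding r_def[abs_def]
      by (rule deg_less_add[OF deg_less_mult_free[OF p1 s] deg_less_mult_free[OF deg_less_mult_free[OF 1 c] free_of_const]])
    from Suc.IH[OF this] obtain k u v where u: "poly_fun u" and v: "deg_less i d v" and e: "\<And>x. s x ^ k * r x = u x * f x + v x" by blast
    have xN: "x $ i ^ N = x $ i ^ (N - d) * x $ i ^ d" for x :: "complex ^ 'a" using dN by (simp flip: power_add)
    have "s x ^ Suc k * p x = (u x + s x ^ k * (c x * x $ i ^ (N - d))) * f x + v x" for x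
    proof -
      have "s x * p x = r x + (c x * x $ i ^ (N - d)) * f x" unfolding p f r_def xN by (simp add: algebra_simps)
      moreover have "s x ^ Suc k * p x = s x ^ k * (s x * p x)" by simp
      ultimately have "s x ^ Suc k * p x = s x ^ k * r x + s x ^ k * (c x * x $ i ^ (N - d)) * f x"
        by (simp only: distrib_left mult.assoc)
      then show ?thesis unfolding e by (simp only: distrib_right) (simp only: ac_simps)
    qed
    moreover have "poly_fun (\<lambda>x. u x + s x ^ k * (c x * x $ i ^ (N - d)))"
      using u free_of_poly[OF s] free_of_poly[OF c] by simp
    ultimately show ?thesis using v by blast
  qed
qed

definition poly_ideal :: "(complex ^ 'a::finite \<Rightarrow> complex) set \<Rightarrow> bool" where
  "poly_ideal I \<longleftrightarrow> (\<forall>p\<in>I. poly_fun p) \<and> (\<lambda>x. 0) \<in> I \<and> (\<forall>p\<in>I. \<forall>q\<in>I. (\<lambda>x. p x + q x) \<in> I)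
     \<and> (\<forall>p\<in>I. \<forall>r. poly_fun r \<longrightarrow> (\<lambda>x. r x * p x) \<in> I)"

text \<open>Let \<open>f\<close> depend on the variable \<open>i\<close>, and let \<open>I\<close> be maximal among the ideals that contain \<open>f\<close>
and no nonzero polynomial free of \<open>i\<close>.  By maximality \<open>I\<close> is prime.  If \<open>g\<close> has minimal degree in
\<open>I\<close> then, up to powers of its leading coefficient \<open>s\<close>, all elements of \<open>I\<close> are multiples of
\<open>g\<close>, by pseudo-division.  This yields enough points on the zero set \<open>Y\<close> to see that \<open>I\<close> is its
vanishing ideal, so \<open>Y\<close> is irreducible.  For an irreducible closed \<open>C \<supset> Y\<close>, \<open>C \<noteq> UNIV\<close>, the
vanishing ideal \<open>J \<subseteq> I\<close> is prime and not zero; if \<open>g \<notin> J\<close>, then dividing an element of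
\<open>J\<close> by \<open>g\<close> gives another one of smaller degree, without end.  So \<open>g \<in> J\<close>, whence \<open>I = J\<close>.  So nothing lies strictly between \<open>Y\<close> and the whole space.\<close>

theorem codimension_hypersurface:
  fixes f :: "complex ^ 'a::finite \<Rightarrow> complex"
  assumes f: "poly_fun f" and nc: "f x \<noteq> f 0"
  shows "codimension {z. f z = 0} \<le> 1"
proof -
  obtain i zi where i: "pd i f zi \<noteq> 0" using poly_fun_nonconstant_pd[OF f nc] by blast
  define FF where "FF = {I. poly_ideal I \<and> f \<in> I \<and> (\<forall>m\<in>I. free_of i m \<longrightarrow> m = (\<lambda>x. 0))}"
  have princ: "{p. \<exists>r. poly_fun r \<and> p = (\<lambda>x. r x * f x)} \<in> FF" (is "?P \<in> FF")
  proof -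
    have pi: "poly_ideal ?P" unfolding poly_ideal_def
    proof (intro conjI ballI allI impI)
      show "(\<lambda>x. 0) \<in> ?P" using poly_fun_const[of 0] by force
    next
      fix p q :: "complex ^ 'a \<Rightarrow> complex" assume "p \<in> ?P" "q \<in> ?P"
      then obtain r r' where r: "poly_fun r" "p = (\<lambda>x. r x * f x)" "poly_fun r'" "q = (\<lambda>x. r' x * f x)" by blast
      have "(\<lambda>x. p x + q x) = (\<lambda>x. (r x + r' x) * f x)" by (simp add: r distrib_right)
      then show "(\<lambda>x. p x + q x) \<in> ?P" using poly_fun_add[OF r(1,3)] by blast
    next
      fix p r' :: "complex ^ 'a \<Rightarrow> complex" assume "p \<in> ?P" "poly_fun r'"
      then obtain r where r: "poly_fun r" "p = (\<lambda>x. r x * f x)" by blast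
      have "(\<lambda>x. r' x * p x) = (\<lambda>x. (r' x * r x) * f x)" by (simp add: r mult.assoc)
      then show "(\<lambda>x. r' x * p x) \<in> ?P" using poly_fun_mult[OF \<open>poly_fun r'\<close> r(1)] by blast
    next
      fix p :: "complex ^ 'a \<Rightarrow> complex" assume "p \<in> ?P" then show "poly_fun p" using poly_fun_mult[OF _ f] by blast
    qed
    have fP: "f \<in> ?P"
    proof -
      have "f = (\<lambda>x. (\<lambda>x. 1) x * f x)" by simp
      then show ?thesis using poly_fun_const[of 1] by blast
    qed
    have "m = (\<lambda>x. 0)" if m: "m \<in> ?P" "free_of i m" for m
    proof (rule ccontr)
      assume "m \<noteq> (\<lambda>x. 0)"
      then obtain zm where zm: "m zm \<noteq> 0" by blast
      obtain r where r: "poly_fun r" "m = (\<lambda>x. r x * f x)" using m(1) by blast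
      obtain x1 where x1: "m x1 \<noteq> 0" "pd i f x1 \<noteq> 0"
        using poly_fun_common_nonzero[OF free_of_poly[OF m(2)] zm poly_fun_pd[OF f] i] by blast
      obtain P where P: "\<And>t. f (x1 + t *s axis i 1) = poly P t" using poly_fun_line[OF f] by blast
      obtain R where R: "\<And>t. r (x1 + t *s axis i 1) = poly R t" using poly_fun_line[OF r(1)] by blast
      have "poly (R * P) t = poly [:m x1:] t" for t
      proof -
        have "m (x1 + t *s axis i 1) = m x1" using m(2) unfolding free_of_def by blast
        moreover have "m (x1 + t *s axis i 1) = poly R t * poly P t" unfolding r(2) P R ..
        ultimately show ?thesis by simp
      qed
      then have RP: "R * P = [:m x1:]" using poly_eq_poly_eq_iff by blast
      then have "R \<noteq> 0" "P \<noteq> 0" using x1(1) by auto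
      then have "degree R + degree P = 0" using RP degree_mult_eq[of R P] by simp
      then have "degree P = 0" by simp
      then obtain c where c: "P = [:c:]" by (rule degree_eq_zeroE)
      have "((\<lambda>t. f (x1 + t *s axis i 1)) has_field_derivative cdot (grad f (x1 + 0 *s axis i 1)) (axis i 1)) (at 0)"
        by (rule poly_fun_line_deriv[OF f])
      then have "((\<lambda>t. c) has_field_derivative pd i f x1) (at 0)" unfolding P c by simp
      then have "pd i f x1 = 0" using DERIV_const DERIV_unique by blast
      then show False using x1(2) by simp
    qed
    then show ?thesis unfolding FF_def using pi fP by blast
  qed
  have "\<exists>I\<in>FF. \<forall>X\<in>FF. I \<subseteq> X \<longrightarrow> X = I"
  proof (rule subset_Zorn_nonempty)
    show "FF \<noteq> {}" using princ by blast
    fix C assume C: "C \<noteq> {}" "subset.chain FF C"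
    have CF: "I \<in> FF" if "I \<in> C" for I using C(2) that unfolding subset.chain_def by blast
    have tot: "I \<subseteq> J \<or> J \<subseteq> I" if "I \<in> C" "J \<in> C" for I J
      using C(2) that unfolding subset.chain_def by blast
    have id: "poly_ideal I" if "I \<in> C" for I using CF[OF that] unfolding FF_def by blast
    have "poly_ideal (\<Union>C)" unfolding poly_ideal_def
    proof (intro conjI ballI allI impI)
      show "poly_fun p" if "p \<in> \<Union>C" for p using that id unfolding poly_ideal_def by blast
      show "(\<lambda>x. 0) \<in> \<Union>C" using C(1) id unfolding poly_ideal_def by blast
      show "(\<lambda>x. r x * p x) \<in> \<Union>C" if "p \<in> \<Union>C" "poly_fun r" for p r using that id unfolding poly_ideal_def by blast
      fix p q assume "p \<in> \<Union>C" "q \<in> \<Union>C"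
      then obtain I J where IJ: "I \<in> C" "p \<in> I" "J \<in> C" "q \<in> J" by blast
      then obtain K where K: "K \<in> C" "p \<in> K" "q \<in> K" using tot by blast
      have "(\<lambda>x. p x + q x) \<in> K" using id[OF K(1)] K(2,3) unfolding poly_ideal_def by blast
      then show "(\<lambda>x. p x + q x) \<in> \<Union>C" using K(1) by blast
    qed
    moreover have "f \<in> \<Union>C" using C(1) CF unfolding FF_def by blast
    moreover have "\<forall>m\<in>\<Union>C. free_of i m \<longrightarrow> m = (\<lambda>x. 0)" using CF unfolding FF_def by blast
    ultimately show "\<Union>C \<in> FF" unfolding FF_def by blast
  qed
  then obtain I where IF: "I \<in> FF" and max: "\<And>X. X \<in> FF \<Longrightarrow> I \<subseteq> X \<Longrightarrow> X = I" by blast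
  have Ipoly: "poly_fun p" if "p \<in> I" for p using IF that unfolding FF_def poly_ideal_def by blast
  have I0: "(\<lambda>x. 0) \<in> I" using IF unfolding FF_def poly_ideal_def by blast
  have Iadd: "(\<lambda>x. p x + q x) \<in> I" if "p \<in> I" "q \<in> I" for p q using IF that unfolding FF_def poly_ideal_def by blast
  have Imult: "(\<lambda>x. r x * p x) \<in> I" if "p \<in> I" "poly_fun r" for p r using IF that unfolding FF_def poly_ideal_def by blast
  have fI: "f \<in> I" using IF unfolding FF_def by blast
  have Ifree: "m = (\<lambda>x. 0)" if "m \<in> I" "free_of i m" for m using IF that unfolding FF_def by blast
  have outside: "\<exists>r h m. poly_fun r \<and> h \<in> I \<and> free_of i m \<and> m \<noteq> (\<lambda>x. 0) \<and> m = (\<lambda>x. r x * p x + h x)"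
    if p: "poly_fun p" and pI: "p \<notin> I" for p
  proof (rule ccontr)
    assume no: "\<not> ?thesis"
    define X where "X = {g. \<exists>r h. poly_fun r \<and> h \<in> I \<and> g = (\<lambda>x. r x * p x + h x)}"
    have XI: "(\<lambda>x. r x * p x + h x) \<in> X" if "poly_fun r" "h \<in> I" for r h using that unfolding X_def by blast
    have IX: "h \<in> X" if "h \<in> I" for h using XI[OF poly_fun_const[of 0] that] by simp
    have "poly_ideal X" unfolding poly_ideal_def
    proof (intro conjI ballI allI impI)
      fix g assume "g \<in> X"
      then obtain r h where g: "poly_fun r" "h \<in> I" "g = (\<lambda>x. r x * p x + h x)" unfolding X_def by blast
      show "poly_fun g" unfolding g(3) using g(1) Ipoly[OF g(2)] p by simp
      show "(\<lambda>x. r' x * g x) \<in> X" if r': "poly_fun r'" for r'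
      proof -
        have "(\<lambda>x. r' x * g x) = (\<lambda>x. (r' x * r x) * p x + r' x * h x)" by (simp add: g(3) algebra_simps)
        then show ?thesis using XI[OF poly_fun_mult[OF r' g(1)] Imult[OF g(2) r']] by simp
      qed
      fix g' assume "g' \<in> X"
      then obtain r' h' where g': "poly_fun r'" "h' \<in> I" "g' = (\<lambda>x. r' x * p x + h' x)" unfolding X_def by blast
      have "(\<lambda>x. g x + g' x) = (\<lambda>x. (r x + r' x) * p x + (h x + h' x))" by (simp add: g(3) g'(3) algebra_simps)
      then show "(\<lambda>x. g x + g' x) \<in> X" using XI[OF poly_fun_add[OF g(1) g'(1)] Iadd[OF g(2) g'(2)]] by simp
    next
      show "(\<lambda>x. 0) \<in> X" by (rule IX[OF I0])
    qed
    moreover have "m = (\<lambda>x. 0)" if mX: "m \<in> X" and mf: "free_of i m" for m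
      using no mX mf unfolding X_def by blast
    ultimately have "X \<in> FF" unfolding FF_def using IX[OF fI] by blast
    then have "X = I" using max IX by blast
    moreover have "p \<in> X" using XI[OF poly_fun_const[of 1] I0] by simp
    ultimately show False using pI by simp
  qed
  have free_dom: "m = (\<lambda>x. 0) \<or> m' = (\<lambda>x. 0)" if "poly_fun m" "poly_fun m'" "\<And>x. m x * m' x = 0" for m m' :: "complex ^ 'a \<Rightarrow> complex"
    using poly_fun_integral_domain[OF that] by blast
  have prime: "p \<in> I \<or> q \<in> I" if p: "poly_fun p" and q: "poly_fun q" and pq: "(\<lambda>x. p x * q x) \<in> I" for p q
  proof (rule ccontr)
    assume "\<not> ?thesis"
    then have "p \<notin> I" "q \<notin> I" by auto
    obtain r h m where m: "poly_fun r" "h \<in> I" "free_of i m" "m \<noteq> (\<lambda>x. 0)" "m = (\<lambda>x. r x * p x + h x)"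
      using outside[OF p \<open>p \<notin> I\<close>] by blast
    obtain r' h' m' where m': "poly_fun r'" "h' \<in> I" "free_of i m'" "m' \<noteq> (\<lambda>x. 0)" "m' = (\<lambda>x. r' x * q x + h' x)"
      using outside[OF q \<open>q \<notin> I\<close>] by blast
    have "(\<lambda>x. ((r x * r' x) * (p x * q x) + m' x * h x) + (r x * p x) * h' x) \<in> I"
      by (intro Iadd Imult[OF pq] Imult[OF m(2)] Imult[OF m'(2)] poly_fun_mult[OF m(1) m'(1)]
        poly_fun_mult[OF m(1) p] free_of_poly[OF m'(3)])
    moreover have "(\<lambda>x. ((r x * r' x) * (p x * q x) + m' x * h x) + (r x * p x) * h' x) = (\<lambda>x. m x * m' x)"
      by (simp add: m(5) m'(5) algebra_simps)
    ultimately have "(\<lambda>x. m x * m' x) = (\<lambda>x. 0)" using Ifree free_of_mult[OF m(3) m'(3)] by simp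
    then have "m x * m' x = 0" for x by meson
    then show False using free_dom[OF free_of_poly[OF m(3)] free_of_poly[OF m'(3)]] m(4) m'(4) by blast
  qed
  define n0 where "n0 = (LEAST n. \<exists>p\<in>I. p \<noteq> (\<lambda>x. 0) \<and> deg_less i n p)"
  have f0: "f \<noteq> (\<lambda>x. 0)" using nc by auto
  obtain nf where "deg_less i nf f" using ex_deg_less[OF f] by blast
  then have ex: "\<exists>n. \<exists>p\<in>I. p \<noteq> (\<lambda>x. 0) \<and> deg_less i n p" using fI f0 by blast
  obtain g where g: "g \<in> I" "g \<noteq> (\<lambda>x. 0)" "deg_less i n0 g" using LeastI_ex[OF ex] unfolding n0_def by blast
  have small: "p = (\<lambda>x. 0)" if "p \<in> I" "deg_less i n p" "n < n0" for p n
    using not_less_Least[of n "\<lambda>n. \<exists>p\<in>I. p \<noteq> (\<lambda>x. 0) \<and> deg_less i n p"] that unfolding n0_def by blast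
  have "n0 \<noteq> 0"
  proof
    assume "n0 = 0"
    then have "g x = 0" for x using g(3) deg_less_0[of i g x] by simp
    then show False using g(2) by blast
  qed
  then obtain d where d: "n0 = Suc d" using not0_implies_Suc by blast
  obtain s q where s: "free_of i s" and q: "deg_less i d q" and gs: "\<And>x. g x = s x * x $ i ^ d + q x"
    using deg_less_Suc[of i d g] g(3) unfolding d by blast
  have gfun: "g = (\<lambda>x. s x * x $ i ^ d + q x)" using gs by blast
  have s0: "s \<noteq> (\<lambda>x. 0)"
  proof
    assume "s = (\<lambda>x. 0)"
    then have "g = q" using gfun by simp
    then show False using small[of g d] g q d by simp
  qed
  then obtain zs where zs: "s zs \<noteq> 0" by blast
  have d1: "d \<ge> 1"
  proof (rule ccontr)
    assume "\<not> d \<ge> 1"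
    then have d0: "d = 0" by simp
    then have "q x = 0" for x using q deg_less_0 by blast
    then have "g = s" using gfun d0 by simp
    then show False using Ifree[OF g(1)] s g(2) by simp
  qed
  have divide: "\<exists>k u. poly_fun u \<and> (\<forall>x. s x ^ k * p x = u x * g x)" if p: "p \<in> I" for p
  proof -
    obtain N where "deg_less i N p" using ex_deg_less[OF Ipoly[OF p]] by blast
    from pseudo_division[OF s q gs this] obtain k u v where u: "poly_fun u" and v: "deg_less i d v"
      and e: "\<And>x. s x ^ k * p x = u x * g x + v x" by blast
    have "(\<lambda>x. s x ^ k * p x + (- u x) * g x) \<in> I"
      using u by (intro Iadd Imult[OF p] Imult[OF g(1)] poly_fun_power free_of_poly[OF s] poly_fun_uminus)
    moreover have "(\<lambda>x. s x ^ k * p x + (- u x) * g x) = v" by (simp add: e fun_eq_iff)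
    ultimately have "v = (\<lambda>x. 0)" using small[of v d] v d by simp
    then show ?thesis using u e by auto
  qed
  define Y where "Y = {z. \<forall>p\<in>I. p z = 0}"
  have onY: "z \<in> Y" if gz: "g z = 0" and sz: "s z \<noteq> 0" for z
    unfolding Y_def
  proof (intro CollectI ballI)
    fix p assume "p \<in> I"
    then obtain k u where "\<And>x. s x ^ k * p x = u x * g x" using divide by blast
    then have "s z ^ k * p z = u z * g z" by blast
    then show "p z = 0" using gz sz by simp
  qed
  obtain c where c: "\<And>k. free_of i (c k)" "\<And>x. q x = (\<Sum>k<d. c k x * x $ i ^ k)" using q unfolding deg_less_def by blast
  define Q where "Q x = monom (s x) d + (\<Sum>k<d. monom (c k x) k)" for x
  have gQ: "g (x + t *s axis i 1) = poly (Q x) (x $ i + t)" for x t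
  proof -
    have "s (x + t *s axis i 1) = s x" using s unfolding free_of_def by blast
    moreover have "c k (x + t *s axis i 1) = c k x" for k using c(1)[of k] unfolding free_of_def by blast
    ultimately show ?thesis by (simp add: gs c(2) Q_def poly_sum poly_monom)
  qed
  have Qdeg: "degree (Q x) \<ge> 1" if "s x \<noteq> 0" for x
  proof -
    have "coeff (Q x) d = s x + (\<Sum>k<d. coeff (monom (c k x) k) d)" by (simp add: Q_def coeff_sum)
    also have "(\<Sum>k<d. coeff (monom (c k x) k) d) = 0" by (intro sum.neutral) simp
    finally have "coeff (Q x) d \<noteq> 0" using that by simp
    then show ?thesis using le_degree d1 by (metis order_trans)
  qed
  have vanish: "p \<in> I" if p: "poly_fun p" and pY: "\<And>z. z \<in> Y \<Longrightarrow> p z = 0" for p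
  proof (rule ccontr)
    assume "p \<notin> I"
    then obtain r h m where m: "poly_fun r" "h \<in> I" "free_of i m" "m \<noteq> (\<lambda>x. 0)" "m = (\<lambda>x. r x * p x + h x)"
      using outside[OF p] by blast
    obtain zm where "m zm \<noteq> 0" using m(4) by blast
    from poly_fun_common_nonzero[OF free_of_poly[OF m(3)] this free_of_poly[OF s] zs]
    obtain x1 where x1: "m x1 \<noteq> 0" "s x1 \<noteq> 0" by blast
    have "\<exists>j\<in>{1..degree (Q x1)}. coeff (Q x1) j \<noteq> 0"
    proof (rule bexI[of _ "degree (Q x1)"])
      have "Q x1 \<noteq> 0" using Qdeg[OF x1(2)] by auto
      then show "coeff (Q x1) (degree (Q x1)) \<noteq> 0" by (rule leading_coeff_neq_0)
    qed (use Qdeg[OF x1(2)] in simp)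
    then obtain \<xi> where "(\<Sum>j\<le>degree (Q x1). coeff (Q x1) j * \<xi> ^ j) = 0"
      using fundamental_theorem_of_algebra[of "coeff (Q x1)" "degree (Q x1)"] by blast
    then have \<xi>: "poly (Q x1) \<xi> = 0" by (simp add: poly_altdef)
    define y where "y = x1 + (\<xi> - x1 $ i) *s axis i 1"
    have "g y = 0" unfolding y_def gQ using \<xi> by simp
    moreover have "s y = s x1" "m y = m x1" using s m(3) unfolding y_def free_of_def by blast+
    ultimately have yY: "y \<in> Y" using onY x1 by simp
    then have "h y = 0" using m(2) unfolding Y_def by blast
    then have "m y = 0" using pY[OF yY] by (simp add: m(5))
    then show False using \<open>m y = m x1\<close> x1 by simp
  qed
  have one: "(\<lambda>x. 1) \<notin> I"
  proof
    assume "(\<lambda>x. 1) \<in> I"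
    then have "(\<lambda>x. 1 :: complex) = (\<lambda>x :: complex ^ 'a. 0)" using Ifree by simp
    then show False by (metis zero_neq_one)
  qed
  have irr: "irreducible_closed Y" unfolding irreducible_closed_def
  proof (intro conjI allI impI)
    show "zariski_closed Y" unfolding zariski_closed_def using Ipoly by (intro exI[of _ I]) (auto simp: Y_def)
    show "Y \<noteq> {}" using vanish[of "\<lambda>x. 1"] one by auto
    fix Y1 Y2 assume YY: "zariski_closed Y1 \<and> zariski_closed Y2 \<and> Y \<subseteq> Y1 \<union> Y2"
    obtain P1 where P1: "\<forall>p\<in>P1. poly_fun p" "Y1 = {z. \<forall>p\<in>P1. p z = 0}" using YY unfolding zariski_closed_def by blast
    obtain P2 where P2: "\<forall>p\<in>P2. poly_fun p" "Y2 = {z. \<forall>p\<in>P2. p z = 0}" using YY unfolding zariski_closed_def by blast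
    show "Y \<subseteq> Y1 \<or> Y \<subseteq> Y2"
    proof (rule ccontr)
      assume "\<not> ?thesis"
      then obtain y1 y2 where y: "y1 \<in> Y" "y1 \<notin> Y1" "y2 \<in> Y" "y2 \<notin> Y2" by blast
      obtain p1 where p1: "p1 \<in> P1" "p1 y1 \<noteq> 0" using y P1(2) by blast
      obtain p2 where p2: "p2 \<in> P2" "p2 y2 \<noteq> 0" using y P2(2) by blast
      have pp: "poly_fun p1" "poly_fun p2" using p1 p2 P1 P2 by blast+
      have "(\<lambda>x. p1 x * p2 x) \<in> I"
      proof (rule vanish)
        fix z assume "z \<in> Y"
        then have "z \<in> Y1 \<or> z \<in> Y2" using YY by blast
        then show "p1 z * p2 z = 0" using p1(1) p2(1) P1(2) P2(2) by auto
      qed (intro poly_fun_mult pp)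
      then have "p1 \<in> I \<or> p2 \<in> I" using prime pp by blast
      then show False using p1(2) p2(2) y(1,3) unfolding Y_def by blast
    qed
  qed
  have maximal: "C = UNIV" if C: "irreducible_closed C" and YC: "Y \<subset> C" for C
  proof (rule ccontr)
    assume "C \<noteq> UNIV"
    obtain P where P: "\<forall>p\<in>P. poly_fun p" "C = {z. \<forall>p\<in>P. p z = 0}"
      using C unfolding irreducible_closed_def zariski_closed_def by blast
    obtain p0 z0 where p0: "p0 \<in> P" "p0 z0 \<noteq> 0" using \<open>C \<noteq> UNIV\<close> P(2) by blast
    define J where "J = {p. poly_fun p \<and> (\<forall>z\<in>C. p z = 0)}"
    have JI: "p \<in> I" if "p \<in> J" for p using that YC vanish unfolding J_def by blast
    have Jprime: "p \<in> J \<or> h \<in> J" if p: "poly_fun p" and h: "poly_fun h" and ph: "\<And>z. z \<in> C \<Longrightarrow> p z * h z = 0" for p h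
    proof -
      have cl: "zariski_closed {z. p z = 0}" if "poly_fun p" for p :: "complex ^ 'a \<Rightarrow> complex"
        unfolding zariski_closed_def using that by (intro exI[of _ "{p}"]) simp
      have "C \<subseteq> {z. p z = 0} \<union> {z. h z = 0}" using ph by auto
      then have "C \<subseteq> {z. p z = 0} \<or> C \<subseteq> {z. h z = 0}"
        using C cl[OF p] cl[OF h] unfolding irreducible_closed_def by blast
      then show ?thesis using p h unfolding J_def by blast
    qed
    have sJ: "s \<notin> J" using JI Ifree s s0 by blast
    have p0p: "poly_fun p0" using P(1) p0(1) by blast
    from poly_fun_common_nonzero[OF p0p p0(2) free_of_poly[OF s] zs]
    obtain x1 where x1: "p0 x1 \<noteq> 0" "s x1 \<noteq> 0" by blast
    have gJ: "g \<in> J"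
    proof (rule ccontr)
      assume gnJ: "g \<notin> J"
      have "False" if "p \<in> J" "p x1 \<noteq> 0" "\<And>t. p (x1 + t *s axis i 1) = poly Pp t" "degree Pp = n" for p Pp n
        using that
      proof (induction n arbitrary: p Pp rule: less_induct)
        case (less n)
        obtain k u where u: "poly_fun u" "\<And>x. s x ^ k * p x = u x * g x" using divide[OF JI[OF less.prems(1)]] by blast
        have "u \<in> J \<or> g \<in> J"
        proof (rule Jprime[OF u(1) Ipoly[OF g(1)]])
          fix z assume "z \<in> C"
          then have "p z = 0" using less.prems(1) unfolding J_def by blast
          then show "u z * g z = 0" by (simp flip: u(2))
        qed
        then have uJ: "u \<in> J" using gnJ by blast
        have ux: "u x1 \<noteq> 0"
        proof
          assume "u x1 = 0"
          then have "s x1 ^ k * p x1 = 0" using u(2)[of x1] by simp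
          then show False using x1 less.prems(2) by simp
        qed
        obtain U where U: "\<And>t. u (x1 + t *s axis i 1) = poly U t" using poly_fun_line[OF u(1)] by blast
        define G where "G = pcompose (Q x1) [:x1 $ i, 1:]"
        have "poly (smult (s x1 ^ k) Pp) t = poly (U * G) t" for t
        proof -
          have "s (x1 + t *s axis i 1) = s x1" using s unfolding free_of_def by blast
          then show ?thesis using u(2)[of "x1 + t *s axis i 1"] unfolding less.prems(3) U gQ
            by (simp add: G_def poly_pcompose)
        qed
        then have e: "smult (s x1 ^ k) Pp = U * G" using poly_eq_poly_eq_iff by blast
        have U0: "U \<noteq> 0" using U[of 0] ux by auto
        have G1: "degree G \<ge> 1" using Qdeg[OF x1(2)] by (simp add: G_def degree_pcompose)
        then have "G \<noteq> 0" by auto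
        then have "degree (U * G) = degree U + degree G" by (rule degree_mult_eq[OF U0])
        then have "degree U < n" using e G1 less.prems(4) x1(2) by (metis add_gr_0 degree_smult_eq less_add_same_cancel1 less_eq_Suc_le One_nat_def power_not_zero)
        then show False using less.IH[OF _ uJ ux U refl] by blast
      qed
      moreover have "p0 \<in> J" using p0(1) P unfolding J_def by blast
      moreover obtain Pp where "\<And>t. p0 (x1 + t *s axis i 1) = poly Pp t" using poly_fun_line[OF p0p] by blast
      ultimately show False using x1(1) by blast
    qed
    have "I \<subseteq> J"
    proof
      fix p assume p: "p \<in> I"
      obtain k u where u: "poly_fun u" "\<And>x. s x ^ k * p x = u x * g x" using divide[OF p] by blast
      have v: "s z ^ k * p z = 0" if "z \<in> C" for z
        using gJ that unfolding u(2) J_def by simp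
      have "p \<in> J \<or> s \<in> J"
      proof -
        have "(\<forall>z\<in>C. s z ^ k * p z = 0) \<longrightarrow> p \<in> J \<or> s \<in> J"
        proof (induction k)
          case 0 then show ?case using Ipoly[OF p] unfolding J_def by simp
        next
          case (Suc k)
          show ?case
          proof
            assume a: "\<forall>z\<in>C. s z ^ Suc k * p z = 0"
            have "s \<in> J \<or> (\<lambda>z. s z ^ k * p z) \<in> J"
            proof (rule Jprime)
              fix z assume "z \<in> C"
              then have "s z ^ Suc k * p z = 0" using a by blast
              then show "s z * (s z ^ k * p z) = 0" by (simp add: mult.assoc)
            qed (use free_of_poly[OF s] Ipoly[OF p] in simp_all)
            then show "p \<in> J \<or> s \<in> J" using Suc.IH unfolding J_def by blast
          qed
        qed
        then show ?thesis using v by blast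
      qed
      then show "p \<in> J" using sJ by blast
    qed
    then have "C \<subseteq> Y" unfolding J_def Y_def by blast
    then show False using YC by blast
  qed
  have Yf: "Y \<subseteq> {z. f z = 0}" using fI unfolding Y_def by blast
  have chain: "k \<le> 1" if Ch: "C 0 = Y" "\<forall>j\<le>k. irreducible_closed (C j)" "\<forall>j<k. C j \<subset> C (Suc j)" for C :: "nat \<Rightarrow> (complex ^ 'a) set" and k
  proof (rule ccontr)
    assume "\<not> k \<le> 1"
    then have k: "1 \<le> k" "0 < k" "1 < k" by auto
    have c0: "C 0 \<subset> C (Suc 0)" using Ch(3) k(2) by blast
    have c1: "C 1 \<subset> C (Suc 1)" using Ch(3) k(3) by blast
    have "irreducible_closed (C 1)" using Ch(2) k(1) by blast
    moreover have "Y \<subset> C 1" using c0 Ch(1) by simp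
    ultimately have "C 1 = UNIV" by (rule maximal)
    then show False using c1 by blast
  qed
  have "codimension {z. f z = 0} \<le> (SUP k\<in>{k. \<exists>C. C 0 = Y \<and> (\<forall>j\<le>k. irreducible_closed (C j)) \<and> (\<forall>j<k. C j \<subset> C (Suc j))}. enat k)"
    unfolding codimension_def by (rule INF_lower) (use irr Yf in blast)
  also have "\<dots> \<le> 1"
  proof (rule SUP_least)
    fix k assume "k \<in> {k. \<exists>C. C 0 = Y \<and> (\<forall>j\<le>k. irreducible_closed (C j)) \<and> (\<forall>j<k. C j \<subset> C (Suc j))}"
    then have "k \<le> 1" using chain by blast
    then show "enat k \<le> 1" by (simp add: one_enat_def)
  qed
  finally show ?thesis .
qed

lemma codimension_antimono: "Z \<subseteq> W \<Longrightarrow> codimension W \<le> codimension Z"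
  unfolding codimension_def by (rule INF_superset_mono) auto

section \<open>Homogeneous coordinates at the singular point\<close>

lemma hyperplane_domain:
  fixes b :: "complex ^ 'n::finite"
  assumes b: "b \<noteq> 0" and f: "poly_fun f" and g: "poly_fun g" and fg: "\<And>x. cdot b x = 0 \<Longrightarrow> f x * g x = 0"
    and x0: "cdot b x0 = 0" "f x0 \<noteq> 0" and x: "cdot b x = 0"
  shows "g x = 0"
proof -
  obtain e where e: "cdot b e = 1" using ex_cdot_eq_1[OF b] by blast
  define pr where "pr x = x - cdot b x *s e" for x
  have pr: "cdot b (pr x) = 0" for x by (simp add: pr_def cdot_diff_right cdot_scale_right e)
  have pr_id: "pr x = x" if "cdot b x = 0" for x using that by (simp add: pr_def)
  have prp: "poly_fun (\<lambda>x. pr x $ k)" for k by (simp add: pr_def)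
  have "g (pr x) = 0"
  proof (rule poly_fun_integral_domain[of "\<lambda>x. f (pr x)" "\<lambda>x. g (pr x)" x0])
    show "poly_fun (\<lambda>x. f (pr x))" by (rule poly_fun_compose[OF f prp])
    show "poly_fun (\<lambda>x. g (pr x))" by (rule poly_fun_compose[OF g prp])
    show "f (pr z) * g (pr z) = 0" for z by (rule fg[OF pr])
    show "f (pr x0) \<noteq> 0" using x0 pr_id by simp
  qed
  then show ?thesis using pr_id[OF x] by simp
qed

definition vtl :: "complex ^ ('n::finite option) \<Rightarrow> complex ^ 'n" where "vtl z = (\<chi> k. z $ Some k)"

lemma hcons_nth [simp]: "hcons c x $ None = c" "hcons c x $ Some k = x $ k"
  by (simp_all add: hcons_def)

lemma vtl_nth [simp]: "vtl z $ k = z $ Some k" by (simp add: vtl_def)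

lemma vtl_hcons [simp]: "vtl (hcons c x) = x" by (simp add: vec_eq_iff)

lemma vec_option_eqI:
  fixes u v :: "complex ^ ('n::finite option)"
  assumes "u $ None = v $ None" "\<And>k. u $ Some k = v $ Some k" shows "u = v"
proof -
  have "u $ j = v $ j" for j using assms by (cases j) auto
  then show ?thesis by (simp add: vec_eq_iff)
qed

lemma hcons_vtl: "hcons (z $ None) (vtl z) = z" by (rule vec_option_eqI) simp_all

lemma hcons_add: "hcons a x + hcons b y = hcons (a + b) (x + y)"
  and hcons_diff: "hcons a x - hcons b y = hcons (a - b) (x - y)"
  and hcons_scale: "c *s hcons a x = hcons (c * a) (c *s x)"
  by (rule vec_option_eqI; simp)+

lemma hcons_zero: "hcons 0 0 = 0" by (rule vec_option_eqI) simp_all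

lemma hcons_inject: "hcons a x = hcons b y \<longleftrightarrow> a = b \<and> x = y"
  by (metis hcons_nth(1) vtl_hcons)

lemma sum_option: "(\<Sum>j\<in>(UNIV :: 'n::finite option set). f j) = f None + (\<Sum>k\<in>UNIV. f (Some k))"
  by (simp add: UNIV_option_conv sum.reindex)

lemma cdot_option: "cdot u v = u $ None * v $ None + cdot (vtl u) (vtl v)"
  by (simp add: cdot_def sum_option)

lemma poly_fun_hcons [simp, intro]: "poly_fun (\<lambda>x. hcons c x $ k)"
  by (cases k) simp_all

lemma axis_None: "axis None 1 = (hcons 1 0 :: complex ^ ('n::finite option))"
  by (rule vec_option_eqI) (simp_all add: axis_def)

lemma poly_map_continuous:
  assumes "\<And>k. poly_fun (\<lambda>x. f x $ k)" shows "continuous_on S (f :: complex ^ 'a::finite \<Rightarrow> complex ^ 'b::finite)"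
proof -
  have "continuous_on S (\<lambda>x. \<chi> k. f x $ k)"
    by (intro continuous_on_vec_lambda poly_fun_continuous assms)
  then show ?thesis by simp
qed

lemma ex_two_sided_inverse:
  fixes B :: "complex ^ 'a::finite ^ 'a"
  assumes "\<And>x. B *v x = 0 \<Longrightarrow> x = 0" shows "\<exists>C. B ** C = mat 1 \<and> C ** B = mat 1"
proof -
  obtain C where "C ** B = mat 1" using matrix_left_invertible_ker[of B] assms by blast
  then show ?thesis using matrix_left_right_inverse by blast
qed

lemma ex_matrix_with_column:
  fixes z :: "complex ^ 'a::finite" and o' :: 'a
  assumes "z \<noteq> 0"
  shows "\<exists>B C. B ** C = mat 1 \<and> C ** B = mat 1 \<and> B *v axis o' 1 = z"
proof -
  obtain i where i: "z $ i \<noteq> 0" using assms by (auto simp: vec_eq_iff)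
  define \<sigma> where "\<sigma> = Transposition.transpose o' i"
  have \<sigma>\<sigma>: "\<sigma> (\<sigma> k) = k" for k by (simp add: \<sigma>_def)
  have \<sigma>i: "\<sigma> i = o'" "\<sigma> o' = i" by (simp_all add: \<sigma>_def)
  define B :: "complex ^ 'a ^ 'a" where
    "B = (\<chi> k j. (if j = \<sigma> k then 1 else 0) + (if j = o' then z $ k - (if k = i then 1 else 0) else 0))"
  have B: "(B *v x) $ k = x $ \<sigma> k + (z $ k - (if k = i then 1 else 0)) * x $ o'" for x k
    by (simp add: B_def matrix_vector_mult_def distrib_right sum.distrib mult_delta_left)
  have inj: "x = 0" if x: "B *v x = 0" for x
  proof -
    have "(B *v x) $ i = 0" by (simp add: x)
    then have "z $ i * x $ o' = 0" by (simp add: B \<sigma>i algebra_simps)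
    then have xo: "x $ o' = 0" using i by simp
    have "x $ k = 0" for k
    proof -
      have "(B *v x) $ (\<sigma> k) = 0" by (simp add: x)
      then show ?thesis by (simp add: B \<sigma>\<sigma> xo)
    qed
    then show ?thesis by (simp add: vec_eq_iff)
  qed
  have "B *v axis o' 1 = z"
  proof -
    have "(B *v axis o' 1) $ k = z $ k" for k
    proof -
      have "\<sigma> k = o' \<longleftrightarrow> k = i" using \<sigma>\<sigma> \<sigma>i by metis
      then show ?thesis by (simp add: B axis_def)
    qed
    then show ?thesis by (simp add: vec_eq_iff)
  qed
  then show ?thesis using ex_two_sided_inverse[of B] inj by blast
qed

locale singular_chart =
  fixes A :: "complex ^ ('n::finite option) \<Rightarrow> complex ^ ('n option)" and \<nu> :: nat
    and MM :: "(complex ^ ('n option) ^ ('n option)) set" and p :: "complex ^ ('n option) \<Rightarrow> complex"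
    and z0 :: "complex ^ ('n option)" and B C :: "complex ^ ('n option) ^ ('n option)"
    and W :: "(complex ^ ('n option)) set" and d :: nat
  assumes card3: "3 \<le> CARD('n)" and fol: "foliation \<nu> A"
    and p_poly: "poly_fun p" and p_nz: "p z0 \<noteq> 0" and p_hom: "\<And>c z. p (c *s z) = c ^ d * p z"
    and plus: "\<And>M c. M \<in> MM \<Longrightarrow> M + mat c \<in> MM"
    and br: "\<And>M M'. M \<in> MM \<Longrightarrow> M' \<in> MM \<Longrightarrow> M' ** M - M ** M' \<in> MM"
    and tan: "\<And>M z. M \<in> MM \<Longrightarrow> cdot (A z) (M *v z) = 0"
    and A_nz: "\<And>z. p z \<noteq> 0 \<Longrightarrow> A z \<noteq> 0"
    and spn: "\<And>z u. p z \<noteq> 0 \<Longrightarrow> cdot (A z) u = 0 \<Longrightarrow> \<exists>M\<in>MM. u = M *v z"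
    and BC: "B ** C = mat 1" and CB: "C ** B = mat 1"
    and W: "open W" "B *v axis None 1 \<in> W"
    and sing: "A (B *v axis None 1) = 0"
    and iso: "\<And>z. z \<in> W \<Longrightarrow> A z = 0 \<Longrightarrow> \<exists>c. z = c *s (B *v axis None 1)"
begin

lemma BCv: "B *v (C *v z) = z" "C *v (B *v z) = z"
  by (simp_all add: matrix_vector_mul_assoc BC CB)

definition At where "At z = transpose B *v A (B *v z)"

lemma cdot_At: "cdot (At z) u = cdot (A (B *v z)) (B *v u)"
  unfolding At_def cdot_matrix[symmetric] ..

lemma At_radial: "cdot (At z) z = 0"
  unfolding cdot_At by (rule foliation_radial[OF fol])

lemma At_scale: "At (c *s z) = c ^ (\<nu> + 1) *s At z"
  unfolding At_def vector_scalar_commute foliation_scale[OF fol] ..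

lemma At_poly: "poly_fun (\<lambda>z. At z $ k)"
proof -
  have "poly_fun (\<lambda>z. A (B *v z) $ k)" for k by (rule poly_fun_compose[OF foliation_poly[OF fol]]) simp
  then show ?thesis unfolding At_def by (intro poly_fun_matrix_vector) simp_all
qed

definition a where "a x = vtl (At (hcons 1 x))"

lemma a_poly: "poly_fun (\<lambda>x. a x $ k)"
  unfolding a_def vtl_nth by (rule poly_fun_compose[OF At_poly]) simp

lemma cdot_a: "cdot (a x) u = cdot (At (hcons 1 x)) (hcons 0 u)"
  by (simp add: a_def cdot_option)

lemma cdot_a_x: "cdot (a x) x = - At (hcons 1 x) $ None"
  using At_radial[of "hcons 1 x"] by (simp add: cdot_option a_def eq_neg_iff_add_eq_0 add.commute)

lemma a_zero: "a x = 0 \<Longrightarrow> A (B *v hcons 1 x) = 0"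
proof -
  assume a: "a x = 0"
  have "At (hcons 1 x) $ None = 0" using cdot_a_x[of x] a by simp
  moreover have "At (hcons 1 x) $ Some k = 0" for k using a unfolding a_def vec_eq_iff by simp
  ultimately have 0: "At (hcons 1 x) = 0" by (intro vec_option_eqI) simp_all
  show ?thesis
  proof (rule cdot_eqI)
    fix w show "cdot (A (B *v hcons 1 x)) w = cdot 0 w"
      using cdot_At[of "hcons 1 x" "C *v w"] by (simp add: BCv 0)
  qed
qed

lemma ex_isolated_zero: "\<exists>\<epsilon>. isolated_zero a \<epsilon>"
proof -
  have "continuous_on UNIV (\<lambda>x. B *v hcons 1 x)" by (rule poly_map_continuous) simp
  then have "open ((\<lambda>x. B *v hcons 1 x) -` W)" by (rule open_vimage[OF W(1)])
  moreover have "0 \<in> (\<lambda>x. B *v hcons 1 x) -` W" using W(2) by (simp add: axis_None)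
  ultimately obtain \<epsilon> where \<epsilon>: "\<epsilon> > 0" "ball 0 \<epsilon> \<subseteq> (\<lambda>x. B *v hcons 1 x) -` W"
    unfolding open_contains_ball by blast
  have "isolated_zero a \<epsilon>"
  proof
    show "poly_fun (\<lambda>x. a x $ k)" for k by (rule a_poly)
    have "At (hcons 1 0) = 0" using sing unfolding At_def axis_None by simp
    then show "a 0 = 0" by (simp add: a_def vec_eq_iff)
    show "0 < \<epsilon>" by (rule \<epsilon>)
    fix x :: "complex ^ 'n" assume x: "x \<noteq> 0" "norm x < \<epsilon>"
    show "a x \<noteq> 0"
    proof
      assume "a x = 0"
      then have "A (B *v hcons 1 x) = 0" by (rule a_zero)
      moreover have "x \<in> ball 0 \<epsilon>" using x(2) by simp
      then have "B *v hcons 1 x \<in> W" using \<epsilon>(2) by blast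
      ultimately obtain c where "B *v hcons 1 x = c *s (B *v axis None 1)" using iso by blast
      then have "C *v (B *v hcons 1 x) = C *v (B *v (c *s axis None 1))" by (simp add: vector_scalar_commute)
      then have "hcons 1 x = hcons c 0" unfolding BCv by (simp add: axis_None hcons_scale)
      then show False using x(1) by (simp add: hcons_inject)
    qed
  qed
  then show ?thesis ..
qed

definition blk where "blk N = (\<chi> i j. N $ Some i $ Some j)" for N :: "complex ^ ('n option) ^ ('n option)"
definition lrow where "lrow N = (\<chi> j. N $ None $ Some j)" for N :: "complex ^ ('n option) ^ ('n option)"
definition conj where "conj M = C ** M ** B"

lemma conj_v: "conj M *v v = C *v (M *v (B *v v))"
  unfolding conj_def matrix_vector_mul_assoc matrix_mul_assoc ..

lemma column_None: "N *v hcons 1 0 = 0 \<Longrightarrow> N *v hcons y x = hcons (cdot (lrow N) x) (blk N *v x)"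
proof -
  assume N: "N *v hcons 1 0 = 0"
  have N0: "N $ k $ None = 0" for k
  proof -
    have "(N *v hcons 1 0) $ k = 0" by (simp add: N)
    then show ?thesis by (simp add: matrix_vector_mult_def sum_option)
  qed
  show ?thesis
    by (rule vec_option_eqI) (simp_all add: matrix_vector_mult_def sum_option N0 cdot_def lrow_def blk_def)
qed

lemma tan_conj: "M \<in> MM \<Longrightarrow> cdot (At z) (conj M *v z) = 0"
  unfolding cdot_At conj_v BCv by (rule tan)

text \<open>The affine field of the matrix is tangent to the foliation, so by \<open>isolated_zero_syzygy\<close> it vanishes at the
singular point.\<close>

lemma conj_fixes: "M \<in> MM \<Longrightarrow> \<exists>c. conj M *v hcons 1 0 = c *s hcons 1 0"
proof -
  assume M: "M \<in> MM"
  define N where "N = conj M"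
  define X where "X x = (\<chi> k. (N *v hcons 1 x) $ Some k - (N *v hcons 1 x) $ None * x $ k)" for x
  obtain \<epsilon> where \<epsilon>: "isolated_zero a \<epsilon>" using ex_isolated_zero by blast
  have 1: "poly_fun (\<lambda>x. X x $ k)" for k by (simp add: X_def)
  have "cdot (a x) (X x) = 0" for x
  proof -
    have "hcons 0 (X x) = N *v hcons 1 x - (N *v hcons 1 x) $ None *s hcons 1 x"
      by (rule vec_option_eqI) (simp_all add: X_def)
    then show ?thesis using tan_conj[OF M, of "hcons 1 x"] At_radial[of "hcons 1 x"]
      by (simp add: cdot_a cdot_diff_right cdot_scale_right N_def)
  qed
  from isolated_zero_syzygy(1)[OF \<epsilon> 1 this] have X0: "X 0 = 0" .
  have "(N *v hcons 1 0) $ Some k = 0" for k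
  proof -
    have "X 0 $ k = 0" by (simp add: X0)
    then show ?thesis by (simp add: X_def)
  qed
  then have "N *v hcons 1 0 = (N *v hcons 1 0) $ None *s hcons 1 0" by (intro vec_option_eqI) simp_all
  then show ?thesis unfolding N_def by blast
qed

definition LL where "LL = {(blk (conj M), lrow (conj M)) |M. M \<in> MM \<and> conj M *v hcons 1 0 = 0}"

lemma conj_plus_mat: "conj (M + mat c) *v v = conj M *v v + c *s v"
  by (simp add: conj_v matrix_vector_mult_add_rdistrib matrix_vector_right_distrib mat_mult_vector vector_scalar_commute BCv)

lemma ext_deriv_a: "ext_deriv a x u w = ext_deriv A (B *v hcons 1 x) (B *v hcons 0 u) (B *v hcons 0 w)"
proof -
  have "dir_deriv (\<lambda>x. one_form a x w) x u = dir_deriv (\<lambda>z. one_form A z (B *v hcons 0 w)) (B *v hcons 1 x) (B *v hcons 0 u)" for u w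
  proof -
    have "hcons 1 (x + t *s u) = hcons 1 x + t *s hcons 0 u" for t by (simp add: hcons_add hcons_scale)
    then show ?thesis
      by (simp add: dir_deriv_def one_form_eq_cdot cdot_a cdot_At matrix_vector_right_distrib vector_scalar_commute)
  qed
  then show ?thesis by (simp add: ext_deriv_def)
qed

text \<open>Subtracting a multiple of the identity from a matrix one may assume that it annihilates the singular point; the
remaining entries are \<open>S\<close> and \<open>l\<close>.\<close>

lemma affine_normal_form:
  "\<exists>H c. transpose H = H \<and> (\<forall>v. H *v v = 0 \<longrightarrow> v = 0) \<and>
    (\<forall>x. cdot x (H *v x) *s a x = cdot (a x) x *s (cdot x (H *v x) *s c + (1 - cdot c x) *s (H *v x)))"
proof -
  obtain \<epsilon> where \<epsilon>: "isolated_zero a \<epsilon>" using ex_isolated_zero by blast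
  define p' where "p' x = p (B *v hcons 1 x)" for x
  have "poly_fun (\<lambda>z. p (B *v z))" by (rule poly_fun_compose[OF p_poly]) simp
  moreover have "p (B *v (C *v z0)) \<noteq> 0" using p_nz by (simp add: BCv)
  moreover have "(hcons 1 0 :: complex ^ ('n option)) $ None \<noteq> 0" by simp
  ultimately obtain z where z: "p (B *v z) \<noteq> 0" "z $ None \<noteq> 0"
    using poly_fun_common_nonzero[of "\<lambda>z. p (B *v z)" "C *v z0" "\<lambda>z. z $ None"] by blast
  define x0 where "x0 = inverse (z $ None) *s vtl z"
  have hx0: "hcons 1 x0 = inverse (z $ None) *s z"
    using z(2) by (intro vec_option_eqI) (simp_all add: x0_def)
  have x0: "p' x0 \<noteq> 0" unfolding p'_def hx0 vector_scalar_commute p_hom using z by simp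
  interpret PS: projective_symmetries a \<epsilon> LL p' x0
  proof (rule projective_symmetries.intro[OF \<epsilon>], unfold_locales)
    show "3 \<le> CARD('n)" by (rule card3)
    show "integrable_form a"
      using fol unfolding foliation_def integrable_form_def ext_deriv_a one_form_eq_cdot cdot_a cdot_At by blast
    show "poly_fun p'" unfolding p'_def by (rule poly_fun_compose[OF p_poly]) simp
    show "p' x0 \<noteq> 0" by (rule x0)
    show "p' x \<noteq> 0 \<Longrightarrow> a x \<noteq> 0" for x using A_nz a_zero unfolding p'_def by blast
  next
    fix S l x assume "(S, l) \<in> LL"
    then obtain M where M: "M \<in> MM" "conj M *v hcons 1 0 = 0" "S = blk (conj M)" "l = lrow (conj M)"
      unfolding LL_def by blast
    have "hcons 0 (proj_field S l x) = conj M *v hcons 1 x - cdot l x *s hcons 1 x"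
      unfolding column_None[OF M(2)] by (simp add: M proj_field_def hcons_diff hcons_scale)
    then show "cdot (a x) (proj_field S l x) = 0"
      using tan_conj[OF M(1), of "hcons 1 x"] At_radial[of "hcons 1 x"]
      by (simp add: cdot_a cdot_diff_right cdot_scale_right)
  next
    fix S l S' l' assume "(S, l) \<in> LL" "(S', l') \<in> LL"
    then obtain M M' where M: "M \<in> MM" "conj M *v hcons 1 0 = 0" "S = blk (conj M)" "l = lrow (conj M)"
      and M': "M' \<in> MM" "conj M' *v hcons 1 0 = 0" "S' = blk (conj M')" "l' = lrow (conj M')"
      unfolding LL_def by blast
    define N where "N = conj (M' ** M - M ** M')"
    have Nv: "N *v v = conj M' *v (conj M *v v) - conj M *v (conj M' *v v)" for v
      unfolding N_def conj_v BCv matrix_vector_mult_diff_rdistrib matrix_vector_mult_diff_distrib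
        matrix_vector_mul_assoc[symmetric] ..
    have N0: "N *v hcons 1 0 = 0" unfolding Nv M(2) M'(2) by simp
    have act: "hcons (cdot (lrow N) x) (blk N *v x)
       = hcons (cdot l' (S *v x) - cdot l (S' *v x)) (S' *v (S *v x) - S *v (S' *v x))" for x
      unfolding column_None[OF N0, of 0 x, symmetric] Nv column_None[OF M(2)] column_None[OF M'(2)]
      by (simp add: M M' hcons_diff)
    have "blk N *v x = (S' ** S - S ** S') *v x" for x
      using act[of x] unfolding hcons_inject matrix_vector_mult_diff_rdistrib matrix_vector_mul_assoc[symmetric] by blast
    then have "blk N = S' ** S - S ** S'" unfolding matrix_eq by blast
    moreover have "lrow N = transpose S *v l' - transpose S' *v l"
    proof (rule cdot_eqI)
      fix x
      have "cdot (lrow N) x = cdot l' (S *v x) - cdot l (S' *v x)" using act[of x] unfolding hcons_inject by blast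
      then show "cdot (lrow N) x = cdot (transpose S *v l' - transpose S' *v l) x"
        unfolding cdot_matrix cdot_diff_left .
    qed
    ultimately have e: "(S' ** S - S ** S', transpose S *v l' - transpose S' *v l) = (blk N, lrow N)" by (simp only:)
    show "(S' ** S - S ** S', transpose S *v l' - transpose S' *v l) \<in> LL"
      unfolding e LL_def N_def using br[OF M(1) M'(1)] N0[unfolded N_def] by blast
  next
    fix x u assume px: "p' x \<noteq> 0" and u: "cdot (a x) u = 0"
    have "cdot (A (B *v hcons 1 x)) (B *v hcons 0 u) = 0" using u by (simp add: cdot_a cdot_At)
    then obtain M where M: "M \<in> MM" "B *v hcons 0 u = M *v (B *v hcons 1 x)"
      using spn px unfolding p'_def by blast
    have Mu: "hcons 0 u = conj M *v hcons 1 x" unfolding conj_v M(2)[symmetric] BCv ..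
    obtain c where c: "conj M *v hcons 1 0 = c *s hcons 1 0" using conj_fixes[OF M(1)] by blast
    define M0 where "M0 = M + mat (- c)"
    have M0: "M0 \<in> MM" unfolding M0_def by (rule plus[OF M(1)])
    have M00: "conj M0 *v hcons 1 0 = 0" unfolding M0_def conj_plus_mat c by (simp add: vec_eq_iff)
    define S l where "S = blk (conj M0)" and "l = lrow (conj M0)"
    have e1: "conj M0 *v hcons 1 x = hcons (cdot l x) (S *v x)"
      unfolding S_def l_def by (rule column_None[OF M00])
    have e2: "conj M0 *v hcons 1 x = hcons 0 u + (- c) *s hcons 1 x"
      unfolding Mu unfolding M0_def by (rule conj_plus_mat)
    have "hcons (cdot l x) (S *v x) = hcons 0 u + (- c) *s hcons 1 x" by (rule trans[OF e1[symmetric] e2])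
    then have "hcons (cdot l x) (S *v x) = hcons (- c) (u - c *s x)"
      by (simp add: hcons_add hcons_scale)
    then have "cdot l x = - c" "S *v x = u - c *s x" unfolding hcons_inject by auto
    then have "u = proj_field S l x" by (simp add: proj_field_def)
    moreover have "(S, l) \<in> LL" unfolding LL_def S_def l_def using M0 M00 by blast
    ultimately show "\<exists>S l. (S, l) \<in> LL \<and> u = proj_field S l x" by blast
  qed
  from PS.normal_form obtain c where
    c: "\<forall>x. cdot x (PS.H *v x) *s a x = PS.F x *s (cdot x (PS.H *v x) *s c + (1 - cdot c x) *s (PS.H *v x))" ..
  have "transpose PS.H = PS.H \<and> (\<forall>v. PS.H *v v = 0 \<longrightarrow> v = 0) \<and>
    (\<forall>x. cdot x (PS.H *v x) *s a x = cdot (a x) x *s (cdot x (PS.H *v x) *s c + (1 - cdot c x) *s (PS.H *v x)))"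
  proof (intro conjI allI impI)
    show "PS.H *v v = 0 \<Longrightarrow> v = 0" for v by (rule PS.H_injective)
    show "cdot x (PS.H *v x) *s a x = cdot (a x) x *s (cdot x (PS.H *v x) *s c + (1 - cdot c x) *s (PS.H *v x))" for x
      using spec[OF c, of x] unfolding PS.F_def .
  qed (rule PS.transpose_H)
  then show ?thesis by (intro exI)
qed

lemma A_nonzero: "\<exists>z. A z \<noteq> 0" using A_nz p_nz by blast

text \<open>Homogenise the affine normal form and take \<open>c \<cdot> x = 1\<close> as the hyperplane at infinity (the matrix \<open>K\<close>).
Dividing the resulting relations by \<open>H x\<close> and by the equation of that hyperplane exhibits the form as
\<open>\<psi>\<close> times the standard one.  The degree is read off from the homogeneity of the coefficient
\<open>- \<psi> q\<close>, with \<open>\<psi>\<close> constant.\<close>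

theorem conclusion:
  "\<nu> = 1 \<and> (\<exists>g :: complex ^ ('n option) ^ ('n option). invertible g \<and>
      (\<exists>Q :: complex ^ 'n ^ 'n. transpose Q = Q \<and> rank Q = CARD('n) \<and> chart_defined_by_d g A (quad_form Q)))"
proof -
  obtain H c where Hs: "transpose H = H" and Hi: "\<And>v. H *v v = 0 \<Longrightarrow> v = 0"
    and nf: "\<And>x. cdot x (H *v x) *s a x = cdot (a x) x *s (cdot x (H *v x) *s c + (1 - cdot c x) *s (H *v x))"
    using affine_normal_form by blast
  define q where "q x = cdot x (H *v x)" for x
  obtain G where G: "H ** G = mat 1" "G ** H = mat 1" using ex_two_sided_inverse[of H] Hi by blast
  have HG: "H *v (G *v x) = x" for x by (simp add: matrix_vector_mul_assoc G)
  have sym: "cdot x (H *v w) = cdot w (H *v x)" for x w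
    unfolding cdot_matrix[of x] Hs by (rule cdot_commute)
  obtain xq where xq: "q xq \<noteq> 0"
  proof (rule ccontr)
    assume "\<not> thesis"
    then have q0: "q x = 0" for x using that by blast
    have "cdot x (H *v w) = 0" for x w
    proof -
      have "q (x + w) = q x + q w + 2 * cdot x (H *v w)"
        by (simp add: q_def matrix_vector_right_distrib cdot_add_left cdot_add_right sym[of w x])
      then show ?thesis by (simp add: q0)
    qed
    then have "cdot (H *v w) x = cdot 0 x" for x w by (simp add: cdot_commute[of "H *v w"])
    then have "H *v w = 0" for w by (rule cdot_eqI)
    then have "axis undefined (1::complex) = (0 :: complex ^ 'n)" using Hi by blast
    then have "axis undefined (1::complex) $ (undefined :: 'n) = 0" by simp
    then show False by (simp add: axis_def)
  qed
  have rel0: "q x * At (hcons y x) $ Some k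
      + At (hcons y x) $ None * (q x * c $ k + (y - cdot c x) * (H *v x) $ k) = 0" if y: "y \<noteq> 0" for x y k
  proof -
    define z where "z = hcons y x"
    define w where "w = inverse y *s x"
    have hw: "hcons 1 w = inverse y *s z" using y by (simp add: w_def z_def hcons_scale)
    have aw: "a w $ k = inverse y ^ (\<nu> + 1) * At z $ Some k" unfolding a_def hw At_scale by simp
    have Fw: "cdot (a w) w = - (inverse y ^ (\<nu> + 1) * At z $ None)" unfolding cdot_a_x hw At_scale by simp
    have qw: "cdot w (H *v w) = inverse y * inverse y * q x"
      by (simp add: w_def q_def vector_scalar_commute cdot_scale_left cdot_scale_right)
    have Hw: "(H *v w) $ k = inverse y * (H *v x) $ k" by (simp add: w_def vector_scalar_commute)
    have cw: "cdot c w = inverse y * cdot c x" by (simp add: w_def cdot_scale_right)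
    have "(cdot w (H *v w) *s a w) $ k = (cdot (a w) w *s (cdot w (H *v w) *s c + (1 - cdot c w) *s (H *v w))) $ k"
      unfolding nf ..
    then have "inverse y * inverse y * q x * (inverse y ^ (\<nu> + 1) * At z $ Some k)
      = - (inverse y ^ (\<nu> + 1) * At z $ None) * (inverse y * inverse y * q x * c $ k + (1 - inverse y * cdot c x) * (inverse y * (H *v x) $ k))"
      unfolding vector_smult_component vector_add_component aw Fw qw Hw cw .
    then have "inverse y ^ (\<nu> + 1) * (inverse y * inverse y * q x * At z $ Some k
      + At z $ None * (inverse y * inverse y * q x * c $ k + (1 - inverse y * cdot c x) * (inverse y * (H *v x) $ k))) = 0"
      by (simp add: algebra_simps)
    moreover have "inverse y ^ (\<nu> + 1) \<noteq> 0" using y by simp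
    ultimately have "inverse y * inverse y * q x * At z $ Some k
      + At z $ None * (inverse y * inverse y * q x * c $ k + (1 - inverse y * cdot c x) * (inverse y * (H *v x) $ k)) = 0"
      by (simp only: mult_eq_0_iff) blast
    then have "y * y * (inverse y * inverse y * q x * At z $ Some k
      + At z $ None * (inverse y * inverse y * q x * c $ k + (1 - inverse y * cdot c x) * (inverse y * (H *v x) $ k))) = 0"
      by simp
    moreover have "y * y * (inverse y * inverse y * q x * At z $ Some k
      + At z $ None * (inverse y * inverse y * q x * c $ k + (1 - inverse y * cdot c x) * (inverse y * (H *v x) $ k)))
      = q x * At z $ Some k + At z $ None * (q x * c $ k + (y - cdot c x) * (H *v x) $ k)"
      using y by (simp add: field_simps)
    ultimately show ?thesis unfolding z_def by simp
  qed
  define K :: "complex ^ ('n option) ^ ('n option)" where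
    "K = (\<chi> i j. case i of None \<Rightarrow> (case j of None \<Rightarrow> 1 | Some j \<Rightarrow> c $ j) | Some i \<Rightarrow> (if j = Some i then 1 else 0))"
  have K: "K *v hcons y x = hcons (y + cdot c x) x" for y x
    by (rule vec_option_eqI) (simp_all add: K_def matrix_vector_mult_def sum_option cdot_def mult_delta_left)
  have Kinj: "z = 0" if z: "K *v z = 0" for z
  proof -
    have "hcons (z $ None + cdot c (vtl z)) (vtl z) = hcons 0 0"
      using z K[of "z $ None" "vtl z"] by (simp add: hcons_vtl hcons_zero)
    then have v: "vtl z = 0" "z $ None = 0" unfolding hcons_inject by auto
    have "hcons (z $ None) (vtl z) = 0" unfolding v hcons_zero ..
    then show ?thesis unfolding hcons_vtl .
  qed
  define g where "g = B ** K"
  obtain gi where gi: "g ** gi = mat 1" "gi ** g = mat 1"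
  proof -
    have "z = 0" if "g *v z = 0" for z
    proof -
      have "C *v (B *v (K *v z)) = C *v (g *v z)" unfolding g_def matrix_vector_mul_assoc ..
      then have "C *v (B *v (K *v z)) = 0" using that by simp
      then show ?thesis unfolding BCv by (rule Kinj)
    qed
    then show thesis using ex_two_sided_inverse[of g] that by blast
  qed
  have giv: "g *v (gi *v z) = z" "gi *v (g *v z) = z" for z by (simp_all add: matrix_vector_mul_assoc gi)
  define Ah where "Ah z = transpose K *v At (K *v z)" for z
  have cAh: "cdot (Ah z) u = cdot (At (K *v z)) (K *v u)" for z u unfolding Ah_def cdot_matrix[symmetric] ..
  have cAg: "cdot (Ah z) u = cdot (A (g *v z)) (g *v u)" for z u
    unfolding cAh cdot_At g_def by (simp only: matrix_vector_mul_assoc)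
  have Ah_poly: "poly_fun (\<lambda>z. Ah z $ k)" for k
  proof -
    have "poly_fun (\<lambda>z. At (K *v z) $ k)" for k by (rule poly_fun_compose[OF At_poly]) simp
    then show ?thesis unfolding Ah_def by (intro poly_fun_matrix_vector) simp_all
  qed
  have AhN: "Ah z $ None = At (K *v z) $ None" for z
  proof -
    have "cdot (Ah z) (hcons 1 0) = cdot (At (K *v z)) (hcons 1 0)" unfolding cAh K by simp
    then show ?thesis by (simp add: cdot_option)
  qed
  have AhS: "Ah z $ Some k = c $ k * At (K *v z) $ None + At (K *v z) $ Some k" for z k
  proof -
    have "cdot (Ah z) (hcons 0 (axis k 1)) = cdot (At (K *v z)) (hcons (c $ k) (axis k 1))" unfolding cAh K by simp
    then show ?thesis by (simp add: cdot_option)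
  qed
  have Ah_scale: "Ah (t *s z) = t ^ (\<nu> + 1) *s Ah z" for t z
    unfolding Ah_def vector_scalar_commute At_scale ..
  have qp: "poly_fun (\<lambda>z. q (vtl z))" unfolding q_def by simp
  have tp: "poly_fun (\<lambda>z. (H *v vtl z) $ k)" for k by simp
  have rel: "q (vtl z) * Ah z $ Some k + Ah z $ None * z $ None * (H *v vtl z) $ k = 0" for z k
  proof (rule poly_fun_generic[of "\<lambda>z. z $ None + cdot c (vtl z)" "hcons 1 0"
      "\<lambda>z. q (vtl z) * Ah z $ Some k + Ah z $ None * z $ None * (H *v vtl z) $ k"])
    show "poly_fun (\<lambda>z. q (vtl z) * Ah z $ Some k + Ah z $ None * z $ None * (H *v vtl z) $ k)"
      by (intro poly_fun_add poly_fun_mult qp tp Ah_poly poly_fun_coord)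
    fix z :: "complex ^ ('n option)" assume y: "z $ None + cdot c (vtl z) \<noteq> 0"
    have Kz: "K *v z = hcons (z $ None + cdot c (vtl z)) (vtl z)" using K[of "z $ None" "vtl z"] unfolding hcons_vtl .
    show "q (vtl z) * Ah z $ Some k + Ah z $ None * z $ None * (H *v vtl z) $ k = 0"
      using rel0[OF y, of "vtl z" k] unfolding AhN AhS Kz by (simp add: algebra_simps)
  qed simp_all
  have q_nz: "q (vtl (hcons 0 xq)) \<noteq> 0" using xq by simp
  have cross: "Ah z $ Some k * (H *v vtl z) $ j - Ah z $ Some j * (H *v vtl z) $ k = 0" for z j k
  proof (rule poly_fun_integral_domain[OF qp _ _ q_nz, of "\<lambda>z. Ah z $ Some k * (H *v vtl z) $ j - Ah z $ Some j * (H *v vtl z) $ k"])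
    show "poly_fun (\<lambda>z. Ah z $ Some k * (H *v vtl z) $ j - Ah z $ Some j * (H *v vtl z) $ k)"
      by (intro poly_fun_diff poly_fun_mult tp Ah_poly)
    show "q (vtl z) * (Ah z $ Some k * (H *v vtl z) $ j - Ah z $ Some j * (H *v vtl z) $ k) = 0" for z
      using rel[of z k] rel[of z j] by algebra
  qed
  define k0 :: 'n where "k0 = undefined"
  obtain j0 where j0: "j0 \<noteq> k0"
  proof -
    have "UNIV \<noteq> {k0}"
    proof
      assume "UNIV = {k0}"
      then have "CARD('n) = card {k0}" by (simp only:)
      then show False using card3 by simp
    qed
    then show thesis using that by blast
  qed
  define b :: "complex ^ ('n option)" where "b = hcons 0 (row k0 H)"
  have bt: "cdot b z = (H *v vtl z) $ k0" for z
    by (simp add: b_def cdot_option) (simp add: cdot_def matrix_vector_mult_def row_def)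
  have tax: "(H *v vtl (hcons 0 (G *v axis k 1))) $ j = (if j = k then 1 else 0)" for j k
    by (simp add: HG axis_def)
  have b0: "b \<noteq> 0" using bt[of "hcons 0 (G *v axis k0 1)"] tax[of k0 k0] by auto
  have "Ah z $ Some k0 = 0" if z: "cdot b z = 0" for z
  proof (rule hyperplane_domain[OF b0 tp[of j0] Ah_poly[of "Some k0"] _ _ _ z])
    show "(H *v vtl x) $ j0 * Ah x $ Some k0 = 0" if x: "cdot b x = 0" for x
      using cross[of x k0 j0] x unfolding bt by (simp add: mult.commute)
    show "cdot b (hcons 0 (G *v axis j0 1)) = 0" unfolding bt tax using j0 by simp
    show "(H *v vtl (hcons 0 (G *v axis j0 1))) $ j0 \<noteq> 0" unfolding tax by simp
  qed
  then obtain \<phi> where \<phi>: "poly_fun \<phi>" "\<And>z. Ah z $ Some k0 = cdot b z * \<phi> z"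
    using poly_fun_divide_linear[OF Ah_poly[of "Some k0"] b0] by blast
  have t_nz: "(H *v vtl (hcons 0 (G *v axis k0 1))) $ k0 \<noteq> 0" unfolding tax by simp
  have Ah\<phi>: "Ah z $ Some k - (H *v vtl z) $ k * \<phi> z = 0" for z k
  proof (rule poly_fun_integral_domain[OF tp[of k0] _ _ t_nz, of "\<lambda>z. Ah z $ Some k - (H *v vtl z) $ k * \<phi> z"])
    show "poly_fun (\<lambda>z. Ah z $ Some k - (H *v vtl z) $ k * \<phi> z)" by (intro poly_fun_diff poly_fun_mult tp Ah_poly \<phi>)
    show "(H *v vtl z) $ k0 * (Ah z $ Some k - (H *v vtl z) $ k * \<phi> z) = 0" for z
      using cross[of z k k0] unfolding \<phi>(2) bt by (simp add: algebra_simps)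
  qed
  have q\<phi>: "q (vtl z) * \<phi> z + Ah z $ None * z $ None = 0" for z
  proof (rule poly_fun_integral_domain[OF tp[of k0] _ _ t_nz, of "\<lambda>z. q (vtl z) * \<phi> z + Ah z $ None * z $ None"])
    show "poly_fun (\<lambda>z. q (vtl z) * \<phi> z + Ah z $ None * z $ None)" by (intro poly_fun_add poly_fun_mult qp \<phi> Ah_poly poly_fun_coord)
    show "(H *v vtl z) $ k0 * (q (vtl z) * \<phi> z + Ah z $ None * z $ None) = 0" for z
      using rel[of z k0] unfolding \<phi>(2) bt by (simp add: algebra_simps)
  qed
  define e0 :: "complex ^ ('n option)" where "e0 = hcons 1 0"
  have e0: "cdot e0 z = z $ None" for z by (simp add: e0_def cdot_option)
  have e00: "e0 \<noteq> 0" using e0[of e0] by (auto simp: e0_def)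
  have "\<phi> z = 0" if z: "cdot e0 z = 0" for z
  proof (rule hyperplane_domain[OF e00 qp \<phi>(1) _ _ q_nz z])
    show "q (vtl x) * \<phi> x = 0" if "cdot e0 x = 0" for x using q\<phi>[of x] that by (simp add: e0)
    show "cdot e0 (hcons 0 xq) = 0" by (simp add: e0)
  qed
  then obtain \<psi> where \<psi>: "poly_fun \<psi>" "\<And>z. \<phi> z = z $ None * \<psi> z"
    using poly_fun_divide_linear[OF \<phi>(1) e00] unfolding e0 by blast
  have AN: "Ah z $ None = - \<psi> z * q (vtl z)" for z
  proof -
    have "q (vtl z) * \<psi> z + Ah z $ None = 0"
    proof (rule poly_fun_integral_domain[of "\<lambda>z. z $ None" "\<lambda>z. q (vtl z) * \<psi> z + Ah z $ None" e0])
      show "poly_fun (\<lambda>z. q (vtl z) * \<psi> z + Ah z $ None)" by (intro poly_fun_add poly_fun_mult qp \<psi> Ah_poly)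
      show "z $ None * (q (vtl z) * \<psi> z + Ah z $ None) = 0" for z using q\<phi>[of z] unfolding \<psi>(2) by (simp add: algebra_simps)
    qed (simp_all add: e0_def)
    then show ?thesis by (simp add: eq_neg_iff_add_eq_0 algebra_simps)
  qed
  have AS: "Ah z $ Some k = \<psi> z * z $ None * (H *v vtl z) $ k" for z k
    using Ah\<phi>[of z k] unfolding \<psi>(2) by (simp add: algebra_simps)
  have A0: "A (g *v z) = 0" if z: "\<psi> z = 0" for z
  proof (rule cdot_eqI)
    have Ah0: "Ah z = 0" by (rule vec_option_eqI) (simp_all add: AN AS z)
    fix w show "cdot (A (g *v z)) w = cdot 0 w" using cAg[of z "gi *v w"] by (simp add: Ah0 giv)
  qed
  have const: "\<psi> z = \<psi> 0" for z
  proof (rule ccontr)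
    assume nc: "\<psi> z \<noteq> \<psi> 0"
    have pf: "poly_fun (\<lambda>w. \<psi> (gi *v w))" by (rule poly_fun_compose[OF \<psi>(1)]) simp
    have "codimension {w. \<psi> (gi *v w) = 0} \<le> 1"
      by (rule codimension_hypersurface[OF pf, of "g *v z"]) (simp add: giv nc)
    moreover have "{w. \<psi> (gi *v w) = 0} \<subseteq> {w. A w = 0}"
    proof
      fix w assume "w \<in> {w. \<psi> (gi *v w) = 0}"
      then show "w \<in> {w. A w = 0}" using A0[of "gi *v w"] by (simp add: giv)
    qed
    then have "codimension {w. A w = 0} \<le> codimension {w. \<psi> (gi *v w) = 0}" by (rule codimension_antimono)
    moreover have "codimension {w. A w = 0} \<ge> 2" using fol unfolding foliation_def by blast
    ultimately have "(2 :: enat) \<le> 1" by (meson order_trans)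
    then show False by (simp add: one_enat_def numeral_eq_enat)
  qed
  define \<gamma> where "\<gamma> = \<psi> 0"
  have \<gamma>: "\<gamma> \<noteq> 0"
  proof
    assume "\<gamma> = 0"
    then have "A (g *v (gi *v z)) = 0" for z using A0 const unfolding \<gamma>_def by metis
    then show False using A_nonzero by (simp add: giv)
  qed
  have nu: "\<nu> = 1"
  proof -
    have "Ah (2 *s hcons 0 xq) $ None = 2 ^ (\<nu> + 1) * Ah (hcons 0 xq) $ None" unfolding Ah_scale by simp
    moreover have "q (vtl (2 *s hcons 0 xq)) = 4 * q xq"
    proof -
      have "vtl (2 *s hcons 0 xq) = 2 *s xq" by (simp add: vec_eq_iff)
      then show ?thesis by (simp add: q_def vector_scalar_commute cdot_scale_left cdot_scale_right)
    qed
    ultimately have "\<gamma> * (4 * q xq) = 2 ^ (\<nu> + 1) * (\<gamma> * q xq)"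
      unfolding AN const[of "2 *s hcons 0 xq"] const[of "hcons 0 xq"] \<gamma>_def[symmetric] by simp
    then have "(4 :: complex) = 2 ^ (\<nu> + 1)" using \<gamma> xq by simp
    then have "(of_nat 4 :: complex) = of_nat (2 ^ (\<nu> + 1))" by simp
    then have "(4 :: nat) = 2 ^ (\<nu> + 1)" unfolding of_nat_eq_iff .
    then have "(2 :: nat) ^ 2 = 2 ^ (\<nu> + 1)" by simp
    then have "2 = \<nu> + 1" by (rule power_inject_exp[THEN iffD1, rotated]) simp
    then show ?thesis by simp
  qed
  have chart: "chart_form g A x u = \<gamma> * cdot (H *v x) u" for x u
  proof -
    have "chart_form g A x u = cdot (Ah (hcons 1 x)) (hcons 0 u)" by (simp add: chart_form_def one_form_eq_cdot cAg)
    also have "\<dots> = cdot (vtl (Ah (hcons 1 x))) u" by (simp add: cdot_option)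
    also have "vtl (Ah (hcons 1 x)) = \<gamma> *s (H *v x)"
      unfolding vec_eq_iff vtl_nth AS const[of "hcons 1 x"] \<gamma>_def[symmetric] by simp
    finally show ?thesis by (simp add: cdot_scale_left)
  qed
  have quad: "dir_deriv (quad_form H) x u = 2 * cdot (H *v x) u" for x u
  proof -
    have "quad_form H x = q x" for x
      by (simp add: quad_form_def q_def cdot_def matrix_vector_mult_def sum_distrib_left mult_ac)
    then have "dir_deriv (quad_form H) x u = dir_deriv (\<lambda>x. cdot x (H *v x)) x u" by (simp add: dir_deriv_def q_def)
    also have "\<dots> = cdot (grad (\<lambda>x. cdot x (H *v x)) x) u" by (rule dir_deriv_poly_fun) simp
    also have "\<dots> = cdot (jac (\<lambda>x. x) x u) (H *v x) + cdot x (jac (\<lambda>x. H *v x) x u)"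
      by (rule grad_cdot) simp_all
    also have "\<dots> = 2 * cdot (H *v x) u" by (simp add: jac_id jac_linear sym[of x u] cdot_commute[of u])
    finally show ?thesis .
  qed
  have rank: "rank H = CARD('n)"
  proof -
    have "vec.span (rows H) = UNIV" using matrix_left_invertible_span_rows_gen[of H] G(2) by blast
    then have "vec.dim (rows H) = vec.dim (UNIV :: (complex ^ 'n) set)" by (metis vec.dim_span)
    then show ?thesis by (simp only: row_rank_def_gen vec_dim_card)
  qed
  have "chart_defined_by_d g A (quad_form H)" unfolding chart_defined_by_d_def
  proof (intro exI[of _ "\<lambda>x. \<gamma> / 2"] conjI allI)
    show "holo_on UNIV (\<lambda>x :: complex ^ 'n. \<gamma> / 2)" unfolding holo_on_def
    proof (intro ballI exI conjI allI)
      show "((\<lambda>x :: complex ^ 'n. \<gamma> / 2) has_derivative (\<lambda>_. 0)) (at w)" for w by (rule has_derivative_const)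
    qed simp
  qed (simp_all add: \<gamma> chart quad)
  moreover have "invertible g" unfolding invertible_def using gi by blast
  ultimately show ?thesis using nu Hs rank by blast
qed

end

text \<open>It remains to choose homogeneous coordinates in which the isolated singular point is the origin of a chart.\<close>

theorem mainTheorem8:
  fixes A :: "complex ^ ('n::finite option) \<Rightarrow> complex ^ ('n option)"
    and \<nu> :: nat
  assumes "CARD('n) \<ge> 3"
    and "foliation \<nu> A"
    and "L_foliation A"
    and "\<exists>p. isolated_singular_point A p"
  shows "\<nu> = 1 \<and>
    (\<exists>g :: complex ^ ('n option) ^ ('n option). invertible g \<and>
      (\<exists>Q :: complex ^ 'n ^ 'n. transpose Q = Q \<and> rank Q = CARD('n) \<and>
        chart_defined_by_d g A (quad_form Q)))"
proof -
  obtain MM p z0 where p: "poly_fun p" "p z0 \<noteq> 0" and hom: "\<exists>d. \<forall>c z. p (c *s z) = c ^ d * p z"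
    and MM: "\<forall>M\<in>MM. \<forall>c. M + mat c \<in> MM" "\<forall>M\<in>MM. \<forall>M'\<in>MM. M' ** M - M ** M' \<in> MM"
      "\<forall>M\<in>MM. \<forall>z. cdot (A z) (M *v z) = 0"
      "\<forall>z. p z \<noteq> 0 \<longrightarrow> A z \<noteq> 0 \<and> (\<forall>u. cdot (A z) u = 0 \<longrightarrow> (\<exists>M\<in>MM. u = M *v z))"
    using L_foliation_matrices[OF assms(2,3)] by blast
  obtain d where d: "\<And>c z. p (c *s z) = c ^ d * p z" using hom by blast
  obtain l where l: "l \<in> singular_set A" "l \<notin> CP_topology derived_set_of singular_set A"
    using assms(4) unfolding isolated_singular_point_def by blast
  obtain zs where zs: "A zs = 0" "zs \<noteq> 0" "l = hline zs" using l(1) unfolding singular_set_def by blast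
  have "{z. z \<noteq> 0 \<and> hline z \<in> CP} = - {0 :: complex ^ ('n option)}" unfolding CP_def by blast
  then have "openin CP_topology (CP :: (complex ^ ('n option)) set set)" unfolding openin_CP_topology by (simp add: open_Compl)
  moreover have "l \<in> CP" using zs unfolding CP_def by blast
  ultimately have "l \<in> topspace CP_topology" unfolding topspace_def by blast
  then obtain T where T: "l \<in> T" "openin CP_topology T" "\<And>y. y \<in> singular_set A \<Longrightarrow> y \<in> T \<Longrightarrow> y = l"
    using l(2) unfolding in_derived_set_of by blast
  define W where "W = {z. z \<noteq> 0 \<and> hline z \<in> T}"
  have Wo: "open W" using T(2) unfolding openin_CP_topology W_def by blast
  have zW: "zs \<in> W" using T(1) zs unfolding W_def by blast
  have iso: "\<exists>c. z = c *s zs" if z: "z \<in> W" "A z = 0" for z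
  proof -
    have "hline z \<in> singular_set A" using z unfolding W_def singular_set_def by blast
    then have "hline z = hline zs" using T(3) z(1) zs(3) unfolding W_def by blast
    moreover have "z \<in> hline z" unfolding hline_def by (rule range_eqI[of _ _ 1]) simp
    ultimately show ?thesis unfolding hline_def by blast
  qed
  obtain B C :: "complex ^ ('n option) ^ ('n option)" where BC: "B ** C = mat 1" "C ** B = mat 1" "B *v axis None 1 = zs"
    using ex_matrix_with_column[OF zs(2), of None] by blast
  have "singular_chart A \<nu> MM p z0 B C W d"
  proof
    show "\<exists>c. z = c *s (B *v axis None 1)" if "z \<in> W" "A z = 0" for z unfolding BC(3) using iso[OF that] .
  qed (use assms(1,2) p d MM BC Wo zW zs in \<open>simp_all\<close>)
  then show ?thesis by (rule singular_chart.conclusion)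
qed

end
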